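(* Let $f_0$ be a probability density on $\mathbb{R}$, let $\sigma^2=\int_{\mathbb{R}}v^2f_0(v)\,dv$, let $\tilde f_0(x)=\{f_0(x)+f_0(-x)\}/2$, $\varphi_0(\xi)=\int_{\mathbb{R}}e^{i\xi x}f_0(x)\,dx$, and let $f(\cdot,t)$ be the solution of Kac's equation with initial datum $f_0$. Assume that there exist an integer $\chi$ greater than $2$ and a number $\delta\in[0,2)$ such that: (i) $\int_{\mathbb{R}}|v|^{2\chi+\delta}f_0(v)\,dv<+\infty$; (ii) the cumulants $\kappa_{2m}$ of $\tilde f_0$ vanish for $m=2,\ldots,\chi$; (iii) $\varphi_0(\xi)=o(|\xi|^{-p})$ as $|\xi|\to+\infty$ for some strictly positive $p$. Then there exists a strictly positive constant $\overline C_{\chi,\delta}=\overline C_{\chi,\delta}(f_0;p)$ such that $$\int_{\mathbb{R}}\left|f(v,t)-\frac{1}{\sigma\sqrt{2\pi}}e^{-v^2/(2\sigma^2)}\right|dv\ \le\ \overline C_{\chi,\delta}\,e^{-(1-2\alpha_{2\chi+\delta})t}\qquad(t\ge0),$$ where $\alpha_s:=\frac1{2\pi}\int_0^{2\pi}|\sin\theta|^s\,d\theta$.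
   Context: Kac's equation is $$\frac{\partial f}{\partial t}(v,t)=\frac1{2\pi}\int_0^{2\pi}\int_{\mathbb{R}}\left[f(v\cos\theta-w\sin\theta,t)\,f(v\sin\theta+w\cos\theta,t)-f(v,t)f(w,t)\right]dw\,d\theta\qquad(v\in\mathbb{R},\,t>0),$$ with a probability density $f_0$ as initial datum. The Cauchy problem has a unique solution within the class of probability density functions on $\mathbb{R}$. The Fourier transform $\varphi(\xi,t)=\int e^{i\xi v}f(v,t)\,dv$ solves $\partial_t\varphi(\xi,t)=\frac1{2\pi}\int_0^{2\pi}\varphi(\xi\cos\theta,t)\varphi(\xi\sin\theta,t)\,d\theta-\varphi(\xi,t)$ with $\varphi(\cdot,0)=\varphi_0$, and is given by the Wild series $\varphi(\xi,t)=\sum_{n\ge1}e^{-t}(1-e^{-t})^{n-1}\hat q_n(\xi;\varphi_0)$ with $\hat q_1=\varphi_0$, $\hat q_n=\frac{1}{n-1}\sum_{k=1}^{n-1}\hat q_k\star\hat q_{n-k}$ $(n\ge2)$, where $(g_1\star g_2)(\xi)=\frac1{2\pi}\int_0^{2\pi}g_1(\xi\cos\theta)g_2(\xi\sin\theta)\,d\theta$. The $r$th cumulant of a probability distribution $Q$ on $\mathbb{R}$ (with finite $r$th absolute moment) with characteristic function $q$ is the coefficient $\kappa_r$ of $(i\xi)^r/r!$ in the Taylor expansion of $\log q(\xi)$ at $\xi=0$; the cumulants of a density are those of the distribution it determines. *)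

theory Defs
  imports "HOL-Probability.Probability" "HOL-Library.Landau_Symbols"
begin

definition prob_density_fun :: "(real \<Rightarrow> real) \<Rightarrow> bool" where
  "prob_density_fun g \<longleftrightarrow>
     (\<forall>x. 0 \<le> g x) \<and> integrable lborel g \<and> (LBINT x. g x) = 1"

abbreviation distr_of :: "(real \<Rightarrow> real) \<Rightarrow> real measure" where
  "distr_of g \<equiv> density lborel (\<lambda>x. ennreal (g x))"

text \<open>
  The integrand of the right-hand side of Kac's equation at velocity \<open>v\<close>, as a function of the
  collision angle and the velocity of the collision partner.
\<close>

definition kac_integrand :: "(real \<Rightarrow> real) \<Rightarrow> real \<Rightarrow> real \<Rightarrow> real \<Rightarrow> real" where
  "kac_integrand g v \<theta> w =
     g (v * cos \<theta> - w * sin \<theta>) * g (v * sin \<theta> + w * cos \<theta>) - g v * g w"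

definition kac_operator :: "(real \<Rightarrow> real) \<Rightarrow> real \<Rightarrow> real" where
  "kac_operator g v =
     1 / (2 * pi) * (LBINT \<theta>=0..2 * pi. (LBINT w. kac_integrand g v \<theta> w))"

text \<open>
  The next definition is the integrability needed for the double integral in Kac's equation to
  be meaningful: in Isabelle the integral of a non-integrable function is \<open>0\<close> by convention.
\<close>

definition kac_integrable :: "(real \<Rightarrow> real) \<Rightarrow> real \<Rightarrow> bool" where
  "kac_integrable g v \<longleftrightarrow>
     set_integrable (lborel \<Otimes>\<^sub>M lborel) ({0..2 * pi} \<times> UNIV)
       (\<lambda>(\<theta>, w). kac_integrand g v \<theta> w)"

text \<open>
  Solutions of the Cauchy problem for Kac's equation in the class of probability densities.
  Since a density is only determined up to null sets (and, for an unbounded initial datum, the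
  collision integral may diverge at exceptional velocities), the equation is required for almost
  every \<open>v\<close>. The exceptional null set must not depend on \<open>t\<close>: with a \<open>t\<close>-dependent one, moving
  discontinuities would be invisible to the time derivative and uniqueness would fail.
\<close>

definition kac_solution :: "(real \<Rightarrow> real) \<Rightarrow> (real \<Rightarrow> real \<Rightarrow> real) \<Rightarrow> bool" where
  "kac_solution f0 f \<longleftrightarrow>
     (\<forall>t\<ge>0. prob_density_fun (\<lambda>v. f v t)) \<and>
     (AE v in lborel.
        f v 0 = f0 v \<and> ((\<lambda>t. f v t) \<longlongrightarrow> f0 v) (at_right 0) \<and>
        (\<forall>t>0. kac_integrable (\<lambda>u. f u t) v \<and>
               ((\<lambda>s. f v s) has_real_derivative kac_operator (\<lambda>u. f u t) v) (at t)))"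

text \<open>
  The \<open>r\<close>-th cumulant is the coefficient of \<open>(\<i>\<xi>)\<^sup>r / r!\<close> in the Taylor expansion, to order \<open>r\<close>
  with Peano remainder, of the logarithm of the characteristic function at \<open>0\<close>. It is uniquely
  determined, and it exists when the \<open>r\<close>-th absolute moment is finite; \<^const>\<open>Ln\<close> is the
  principal branch, which is the relevant one as \<open>char M \<xi>\<close> is close to \<open>1\<close> near \<open>\<xi> = 0\<close>.
\<close>

definition cumulant :: "real measure \<Rightarrow> nat \<Rightarrow> real" where
  "cumulant M r = (THE c. \<exists>\<kappa> :: nat \<Rightarrow> real. \<kappa> r = c \<and>
     (\<lambda>\<xi>::real. Ln (char M \<xi>)
         - (\<Sum>k\<le>r. complex_of_real (\<kappa> k) * (\<i> * complex_of_real \<xi>) ^ k / fact k))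
       \<in> o[at 0](\<lambda>\<xi>. complex_of_real (\<xi> ^ r)))"

definition symmetrization :: "(real \<Rightarrow> real) \<Rightarrow> real \<Rightarrow> real" where
  "symmetrization g x = (g x + g (- x)) / 2"

definition kac_alpha :: "real \<Rightarrow> real" where
  "kac_alpha s = 1 / (2 * pi) * (LBINT \<theta>=0..2 * pi. \<bar>sin \<theta>\<bar> powr s)"

end

theory Submission
  imports Defs "HOL-Real_Asymp.Real_Asymp"
begin

text \<open>Integrated along the loss term, Kac's equation becomes the mild equation
  \<open>f\<^sub>t = e\<^bsup>-t\<^esup> f\<^sub>0 + \<integral> e\<^bsup>-(t-\<tau>)\<^esup> Q\<^sup>+(f\<^sub>\<tau>) d\<tau>\<close>, and the cosine transforms \<open>\<psi>\<^sub>t\<close> of its solution satisfy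
  the analogous Duhamel equation. Since the cumulants vanish, \<open>\<psi>\<^sub>0\<close> agrees with the Gaussian up to
  \<open>O(|\<xi>|\<^sup>s)\<close>, \<open>s = 2\<chi> + \<delta>\<close>, and \<open>E (|cos \<theta>|\<^sup>s + |sin \<theta>|\<^sup>s) = 2 \<alpha>\<close>, \<open>\<alpha> = \<alpha>\<^sub>s\<close>, propagates this bound with the
  factor \<open>e\<^bsup>-(1-2\<alpha>)t\<^esup>\<close>. Each application of the Duhamel operator improves the decay at infinity by
  \<open>|\<xi>|\<^bsup>-2q\<^esup>\<close>, where \<open>|\<psi>\<^sub>0| \<le> (1 + \<xi>\<^sup>2)\<^bsup>-q\<^esup>\<close>, so that after finitely many iterations the difference to the
  Gaussian and its difference quotients are square integrable with norm \<open>O(e\<^bsup>-(1-2\<alpha>)t\<^esup>)\<close>. The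
  iterate is the transform of a part of \<open>f\<^sub>t\<close> whose missing mass is of the same order, and the
  Plancherel formula turns the square integrability into the bound in \<open>L\<^sup>1\<close>.\<close>

section \<open>Collision times and angles\<close>

text \<open>The obstacle is that the datum survives in the solution as
  \<open>exp (- t) * f0\<close>: at no time need the transform decay faster than that of f0, for
  which only a small power |\<xi>|^-p is assumed, so the difference to the Gaussian need not be
  square integrable. Iterating strips off this unsmoothed part. The solution comes with no moment
  and no regularity in v at positive times; the second moment bound and the Lipschitz bound are
  therefore recovered from the Duhamel equation, and increments stand in for derivatives. A bound
  that is to propagate through a product of two factors must not have its constant squared; this is
  why the decay of \<psi>_0 is wanted with constant 1 and for all \<xi>, although the hypothesis
  speaks of large \<xi> only. Cosine transforms suffice because the odd part of a characteristic
  function cancels when the angle is averaged; accordingly the cumulants are those of the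
  symmetrized datum. Since one constant has to serve all solutions, the estimates are made for an
  abstract class of transforms.\<close>

definition angle :: "real measure" where
  "angle = density lborel (\<lambda>\<theta>. ennreal (indicator {0..2*pi} \<theta> / (2*pi)))"

text \<open>In a collision process of rate one, \<open>exp (\<tau> - t)\<close> is the probability
  of no collision between \<tau> and t: this is the law of the last collision time before t, of
  total mass 1 - e^-t.\<close>

definition clock :: "real \<Rightarrow> real measure" where
  "clock t = density lborel (\<lambda>\<tau>. ennreal (indicator {0..t} \<tau> * exp (\<tau> - t)))"

lemma sets_angle [simp, measurable_cong]: "sets angle = sets borel"
  and space_angle [simp]: "space angle = UNIV"
  by (simp_all add: angle_def)

lemma sets_clock [simp, measurable_cong]: "sets (clock t) = sets borel"
  and space_clock [simp]: "space (clock t) = UNIV"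
  by (simp_all add: clock_def)

abbreviation borel2 :: "(real \<times> real) measure" where
  "borel2 \<equiv> borel \<Otimes>\<^sub>M borel"

abbreviation collision :: "real \<Rightarrow> (real \<times> real) measure" where
  "collision t \<equiv> clock t \<Otimes>\<^sub>M angle"

abbreviation collide :: "(real \<Rightarrow> real \<Rightarrow> real) \<Rightarrow> real \<Rightarrow> real \<times> real \<Rightarrow> real" where
  "collide g \<xi> z \<equiv> g (fst z) (\<xi> * cos (snd z)) * g (fst z) (\<xi> * sin (snd z))"

lemma nn_integral_angle:
  assumes [measurable]: "f \<in> borel_measurable borel"
  shows "(\<integral>\<^sup>+\<theta>. f \<theta> \<partial>angle) = (\<integral>\<^sup>+\<theta>. f \<theta> * indicator {0..2*pi} \<theta> \<partial>lborel) * ennreal (1 / (2*pi))"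
proof -
  have "(\<integral>\<^sup>+\<theta>. f \<theta> \<partial>angle) = (\<integral>\<^sup>+\<theta>. ennreal (indicator {0..2*pi} \<theta> / (2*pi)) * f \<theta> \<partial>lborel)"
    unfolding angle_def by (subst nn_integral_density) auto
  also have "\<dots> = (\<integral>\<^sup>+\<theta>. (f \<theta> * indicator {0..2*pi} \<theta>) * ennreal (1 / (2*pi)) \<partial>lborel)"
    by (intro nn_integral_cong) (auto split: split_indicator simp: mult.commute)
  also have "\<dots> = (\<integral>\<^sup>+\<theta>. f \<theta> * indicator {0..2*pi} \<theta> \<partial>lborel) * ennreal (1 / (2*pi))"
    by (rule nn_integral_multc) simp
  finally show ?thesis .
qed

lemma integral_angle:
  fixes f :: "real \<Rightarrow> real"
  assumes [measurable]: "f \<in> borel_measurable borel"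
  shows "(\<integral>\<theta>. f \<theta> \<partial>angle) = 1 / (2*pi) * (LBINT \<theta>:{0..2*pi}. f \<theta>)"
proof -
  have "(\<integral>\<theta>. f \<theta> \<partial>angle) = (\<integral>\<theta>. (1 / (2*pi)) *\<^sub>R (indicator {0..2*pi} \<theta> *\<^sub>R f \<theta>) \<partial>lborel)"
    unfolding angle_def by (subst integral_density) (auto intro!: Bochner_Integration.integral_cong)
  then show ?thesis by (simp add: set_lebesgue_integral_def)
qed

lemma nn_integral_clock:
  assumes [measurable]: "f \<in> borel_measurable borel"
  shows "(\<integral>\<^sup>+\<tau>. f \<tau> \<partial>clock t) = (\<integral>\<^sup>+\<tau>. f \<tau> * ennreal (exp (\<tau> - t)) * indicator {0..t} \<tau> \<partial>lborel)"
  unfolding clock_def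
  by (subst nn_integral_density)
     (auto intro!: nn_integral_cong split: split_indicator simp: ennreal_mult'' mult_ac)

lemma AE_clock: "AE \<tau> in clock t. 0 \<le> \<tau> \<and> \<tau> \<le> t"
  unfolding clock_def by (subst AE_density) (auto split: split_indicator)

lemma prob_space_angle: "prob_space angle"
proof
  have "emeasure angle (space angle) = (\<integral>\<^sup>+\<theta>. 1 \<partial>angle)" by simp
  also have "\<dots> = 1"
    by (subst nn_integral_angle) (auto simp: ennreal_mult'[symmetric])
  finally show "emeasure angle (space angle) = 1" .
qed

interpretation angle: prob_space angle by (rule prob_space_angle)

text \<open>The subtracted e^-t is what the initial term of the Duhamel equation puts back, see
  \<open>add_contribution\<close>.\<close>

lemma nn_integral_clock_exp:
  assumes "r < 1" "t \<ge> 0"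
  shows "(\<integral>\<^sup>+\<tau>. ennreal (exp (- r * \<tau>)) \<partial>clock t) = ennreal ((exp (-r*t) - exp (-t)) / (1 - r))"
proof -
  have "(\<integral>\<^sup>+\<tau>. ennreal (exp (- r * \<tau>)) \<partial>clock t)
      = (\<integral>\<^sup>+\<tau>. ennreal (exp ((1-r)*\<tau> - t)) * indicator {0..t} \<tau> \<partial>lborel)"
    by (subst nn_integral_clock)
       (auto intro!: nn_integral_cong simp: ennreal_mult[symmetric] exp_add[symmetric] algebra_simps split: split_indicator)
  also have "\<dots> = ennreal (exp ((1-r)*t - t) / (1-r) - exp ((1-r)*0 - t) / (1-r))"
    using assms
    by (intro nn_integral_FTC_Icc) (auto intro!: derivative_eq_intros)
  also have "\<dots> = ennreal ((exp (-r*t) - exp (-t)) / (1 - r))"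
    by (simp add: algebra_simps diff_divide_distrib)
  finally show ?thesis .
qed

lemma finite_measure_clock: "finite_measure (clock t)"
proof (cases "t \<ge> 0")
  case True
  have "emeasure (clock t) (space (clock t)) = (\<integral>\<^sup>+\<tau>. ennreal (exp (- 0 * \<tau>)) \<partial>clock t)" by simp
  also have "\<dots> < \<infinity>" by (subst nn_integral_clock_exp[OF _ True]) auto
  finally show ?thesis by (intro finite_measureI) auto
next
  case False
  have "emeasure (clock t) (space (clock t)) = (\<integral>\<^sup>+\<tau>. 1 \<partial>clock t)" by simp
  also have "\<dots> = 0" using False by (subst nn_integral_clock) auto
  finally show ?thesis by (intro finite_measureI) auto
qed

interpretation clock: finite_measure "clock t" for t by (rule finite_measure_clock)

lemma integral_clock_exp:
  assumes "r < 1" "t \<ge> 0"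
  shows "(\<integral>\<tau>. exp (- r * \<tau>) \<partial>clock t) = (exp (-r*t) - exp (-t)) / (1 - r)"
    and "integrable (clock t) (\<lambda>\<tau>. exp (- r * \<tau>))"
proof -
  have "r * t \<le> 1 * t" using assms by (intro mult_right_mono) auto
  then have nn: "0 \<le> (exp (-r*t) - exp (-t)) / (1 - r)"
    using assms by (intro divide_nonneg_nonneg) auto
  show "integrable (clock t) (\<lambda>\<tau>. exp (- r * \<tau>))"
    by (rule integrableI_nonneg) (simp_all only: nn_integral_clock_exp[OF assms], auto)
  show "(\<integral>\<tau>. exp (- r * \<tau>) \<partial>clock t) = (exp (-r*t) - exp (-t)) / (1 - r)"
    by (subst integral_eq_nn_integral) (auto simp only: nn_integral_clock_exp[OF assms] enn2real_ennreal[OF nn], auto)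
qed

lemma measure_clock: "t \<ge> 0 \<Longrightarrow> measure (clock t) UNIV = 1 - exp (-t)"
  using integral_clock_exp(1)[of 0 t] by simp

text \<open>The factor \<open>exp (\<tau> - t)\<close> is simply bounded by 1: this integral only
  feeds the remainder c \<tau>^n of the Gronwall iteration.\<close>

lemma clock_power:
  assumes "t \<ge> 0"
  shows "(\<integral>\<tau>. \<tau> ^ n \<partial>clock t) \<le> t ^ Suc n / Suc n"
    and "integrable (clock t) (\<lambda>\<tau>. \<tau> ^ n)"
proof -
  have bd: "AE \<tau> in clock t. norm (\<tau>^n) \<le> t ^ n"
    using AE_clock[of t] by eventually_elim (auto simp: power_mono power_abs[symmetric])
  show int: "integrable (clock t) (\<lambda>\<tau>. \<tau> ^ n)"
    by (rule clock.integrable_const_bound[OF bd]) simp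
  have "ennreal (\<integral>\<tau>. \<tau> ^ n \<partial>clock t) = (\<integral>\<^sup>+\<tau>. ennreal (\<tau>^n) \<partial>clock t)"
    using AE_clock[of t] by (intro nn_integral_eq_integral[symmetric] int) (auto elim!: eventually_mono)
  also have "\<dots> = (\<integral>\<^sup>+\<tau>. ennreal (\<tau>^n) * ennreal (exp (\<tau> - t)) * indicator {0..t} \<tau> \<partial>lborel)"
    by (subst nn_integral_clock) auto
  also have "\<dots> \<le> (\<integral>\<^sup>+\<tau>. ennreal (\<tau>^n) * indicator {0..t} \<tau> \<partial>lborel)"
    by (intro nn_integral_mono) (auto split: split_indicator simp: ennreal_mult[symmetric] intro!: ennreal_leI mult_left_le)
  also have "\<dots> = ennreal (t ^ Suc n / Suc n - 0 ^ Suc n / Suc n)"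
    using assms by (intro nn_integral_FTC_Icc)
       (auto intro!: derivative_eq_intros simp del: power_Suc of_nat_Suc)
  finally show "(\<integral>\<tau>. \<tau> ^ n \<partial>clock t) \<le> t ^ Suc n / Suc n"
    using assms by (subst (asm) ennreal_le_iff) auto
qed

section \<open>Invariance of the angle under a quarter turn\<close>

lemma nn_integral_angle_quarter_turn:
  assumes [measurable]: "f \<in> borel_measurable borel2"
  shows "(\<integral>\<^sup>+\<theta>. f (- sin \<theta>, cos \<theta>) \<partial>angle) = (\<integral>\<^sup>+\<theta>. f (cos \<theta>, sin \<theta>) \<partial>angle)"
proof -
  define g where "g = (\<lambda>x::real. f (cos x, sin x))"
  have [measurable]: "g \<in> borel_measurable borel" unfolding g_def by measurable
  have g1: "f (- sin x, cos x) = g (pi/2 + 1 * x)" for x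
    by (simp add: g_def sin_add cos_add)
  have g2: "g (2*pi + 1 * x) = g x" for x by (simp add: g_def sin_add cos_add)
  have "(\<integral>\<^sup>+x. f (- sin x, cos x) * indicator {0..2*pi} x \<partial>lborel)
      = (\<integral>\<^sup>+x. g (pi/2 + 1 * x) * indicator {pi/2..5*pi/2} (pi/2 + 1 * x) \<partial>lborel)"
    by (intro nn_integral_cong) (auto simp: g1 split: split_indicator)
  also have "\<dots> = (\<integral>\<^sup>+x. g x * indicator {pi/2..5*pi/2} x \<partial>lborel)"
    by (subst (2) nn_integral_real_affine[where c=1 and t="pi/2"]) auto
  \<comment> \<open>The period shifted by \<pi>/2 is cut at 2\<pi>, and the overhang is moved back
    by periodicity.\<close>
  also have "\<dots> = (\<integral>\<^sup>+x. g x * indicator {pi/2..<2*pi} x + g x * indicator {2*pi..5*pi/2} x \<partial>lborel)"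
    by (intro nn_integral_cong) (auto split: split_indicator)
  also have "\<dots> = (\<integral>\<^sup>+x. g x * indicator {pi/2..<2*pi} x \<partial>lborel) + (\<integral>\<^sup>+x. g x * indicator {2*pi..5*pi/2} x \<partial>lborel)"
    by (rule nn_integral_add) auto
  also have "(\<integral>\<^sup>+x. g x * indicator {2*pi..5*pi/2} x \<partial>lborel)
    = (\<integral>\<^sup>+x. g (2*pi + 1*x) * indicator {2*pi..5*pi/2} (2*pi + 1*x) \<partial>lborel)"
    by (subst nn_integral_real_affine[where c=1 and t="2*pi"]) auto
  also have "\<dots> = (\<integral>\<^sup>+x. g x * indicator {0..pi/2} x \<partial>lborel)"
    unfolding g2 by (intro nn_integral_cong) (auto split: split_indicator)
  also have "(\<integral>\<^sup>+x. g x * indicator {pi/2..<2*pi} x \<partial>lborel) + (\<integral>\<^sup>+x. g x * indicator {0..pi/2} x \<partial>lborel)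
     = (\<integral>\<^sup>+x. g x * indicator {pi/2..<2*pi} x + g x * indicator {0..pi/2} x \<partial>lborel)"
    by (rule nn_integral_add[symmetric]) auto
  also have "\<dots> = (\<integral>\<^sup>+x. g x * indicator {0..2*pi} x \<partial>lborel)"
  proof (intro nn_integral_cong_AE)
    show "AE x in lborel. g x * indicator {pi/2..<2*pi} x + g x * indicator {0..pi/2} x = g x * indicator {0..2*pi} x"
      using AE_lborel_singleton[of "pi/2"] AE_lborel_singleton[of "2*pi"]
      by eventually_elim (auto split: split_indicator)
  qed
  finally show ?thesis by (subst (1 2) nn_integral_angle) (auto simp: g_def)
qed

lemma distr_angle_quarter_turn:
  "distr angle borel2 (\<lambda>\<theta>. (- sin \<theta>, cos \<theta>)) = distr angle borel2 (\<lambda>\<theta>. (cos \<theta>, sin \<theta>))"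
proof (rule measure_eqI)
  fix A :: "(real \<times> real) set" assume "A \<in> sets (distr angle borel2 (\<lambda>\<theta>. (- sin \<theta>, cos \<theta>)))"
  then have A[measurable]: "A \<in> sets borel2" by simp
  show "emeasure (distr angle borel2 (\<lambda>\<theta>. (- sin \<theta>, cos \<theta>))) A
      = emeasure (distr angle borel2 (\<lambda>\<theta>. (cos \<theta>, sin \<theta>))) A"
    using nn_integral_angle_quarter_turn[of "indicator A"]
    by (simp add: nn_integral_distr flip: nn_integral_indicator)
qed simp

lemma integral_angle_quarter_turn:
  fixes f :: "real \<times> real \<Rightarrow> real"
  assumes [measurable]: "f \<in> borel_measurable borel2"
  shows "(\<integral>\<theta>. f (- sin \<theta>, cos \<theta>) \<partial>angle) = (\<integral>\<theta>. f (cos \<theta>, sin \<theta>) \<partial>angle)"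
    and "integrable angle (\<lambda>\<theta>. f (- sin \<theta>, cos \<theta>)) \<longleftrightarrow> integrable angle (\<lambda>\<theta>. f (cos \<theta>, sin \<theta>))"
  using arg_cong[OF distr_angle_quarter_turn, of "\<lambda>M. integral\<^sup>L M f"]
    arg_cong[OF distr_angle_quarter_turn, of "\<lambda>M. integrable M f"]
  by (simp_all add: integral_distr integrable_distr_eq)

text \<open>The quarter turn sends (cos, sin) to (- sin, cos) and so changes the sign of the
  integrand. This is why products of two sine transforms drop out of the collision term.\<close>

lemma integral_angle_sin_sin:
  fixes f :: "real \<Rightarrow> real"
  assumes [measurable]: "f \<in> borel_measurable borel" and "\<And>x. f (- x) = - f x"
  shows "(\<integral>\<theta>. f (\<xi> * cos \<theta>) * f (\<xi> * sin \<theta>) \<partial>angle) = 0"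
  using integral_angle_quarter_turn(1)[of "\<lambda>z. f (\<xi> * fst z) * f (\<xi> * snd z)"]
  by (simp add: assms(2) mult.commute)

text \<open>Call the two integrals A and B. The quarter turn applied to the first product gives A =
  - B, applied to the second it gives A = B.\<close>

lemma integral_angle_sin_cos:
  fixes f g :: "real \<Rightarrow> real"
  assumes [measurable]: "f \<in> borel_measurable borel" "g \<in> borel_measurable borel"
    and "\<And>x. f (- x) = - f x" "\<And>x. g (- x) = g x"
  shows "(\<integral>\<theta>. f (\<xi> * cos \<theta>) * g (\<xi> * sin \<theta>) \<partial>angle) = 0"
    and "(\<integral>\<theta>. g (\<xi> * cos \<theta>) * f (\<xi> * sin \<theta>) \<partial>angle) = 0"
  using integral_angle_quarter_turn(1)[of "\<lambda>z. f (\<xi> * fst z) * g (\<xi> * snd z)"]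
    integral_angle_quarter_turn(1)[of "\<lambda>z. g (\<xi> * fst z) * f (\<xi> * snd z)"]
  by (simp_all add: assms(3,4) mult.commute)

section \<open>Moments of the sine and cosine of the angle\<close>

definition alpha :: "real \<Rightarrow> real" where "alpha s = (\<integral>\<theta>. \<bar>cos \<theta>\<bar> powr s \<partial>angle)"

lemma integral_angle_sin_cos_powr:
  "(\<integral>\<theta>. \<bar>sin \<theta>\<bar> powr s \<partial>angle) = alpha s"
  "integrable angle (\<lambda>\<theta>. \<bar>sin \<theta>\<bar> powr s) \<longleftrightarrow> integrable angle (\<lambda>\<theta>. \<bar>cos \<theta>\<bar> powr s)"
  using integral_angle_quarter_turn[of "\<lambda>z. \<bar>fst z\<bar> powr s"] by (simp_all add: alpha_def)

lemma kac_alpha_eq: "kac_alpha s = alpha s"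
proof -
  have "kac_alpha s = 1 / (2 * pi) * (LBINT \<theta>:{0..2*pi}. \<bar>sin \<theta>\<bar> powr s)"
    unfolding kac_alpha_def zero_ereal_def by (subst interval_integral_Icc) auto
  also have "\<dots> = (\<integral>\<theta>. \<bar>sin \<theta>\<bar> powr s \<partial>angle)" by (subst integral_angle) auto
  finally show ?thesis by (simp add: integral_angle_sin_cos_powr)
qed

lemma integrable_angle_cos_powr: "s \<ge> 0 \<Longrightarrow> integrable angle (\<lambda>\<theta>. \<bar>cos \<theta>\<bar> powr s)"
  by (rule angle.integrable_const_bound[where B=1]) (auto intro!: powr_le_one_le powr_le1)

lemma AE_angle: "AE \<theta> in angle. sin \<theta> \<noteq> 0 \<and> cos \<theta> \<noteq> 0"
proof -
  have *: "sin \<theta> \<noteq> 0 \<and> cos \<theta> \<noteq> 0" if "0 < \<theta>" "\<theta> < 2*pi" "\<theta> \<noteq> pi" "\<theta> \<noteq> pi/2" "\<theta> \<noteq> 3*pi/2" for \<theta> :: real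
  proof -
    have "sin \<theta> \<noteq> 0"
    proof (cases "\<theta> < pi")
      case True then show ?thesis using sin_gt_zero[of \<theta>] that by auto
    next
      case False then show ?thesis using sin_gt_zero[of "\<theta> - pi"] that by (auto simp: sin_diff)
    qed
    moreover have "cos \<theta> \<noteq> 0"
    proof -
      consider "\<theta> < pi/2" | "pi/2 < \<theta>" "\<theta> < 3*pi/2" | "\<theta> > 3*pi/2"
        using \<open>\<theta> \<noteq> pi/2\<close> \<open>\<theta> \<noteq> 3*pi/2\<close> by (meson linorder_neqE_linordered_idom)
      then show ?thesis
      proof cases
        case 1 then show ?thesis using cos_gt_zero_pi[of \<theta>] that by auto
      next
        case 2 then show ?thesis using cos_gt_zero_pi[of "\<theta> - pi"] that by (auto simp: cos_diff)
      next
        case 3 then show ?thesis using cos_gt_zero_pi[of "\<theta> - 2*pi"] that by (auto simp: cos_diff)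
      qed
    qed
    ultimately show ?thesis by simp
  qed
  have "AE \<theta> in lborel. 0 < ennreal (indicator {0..2*pi} \<theta> / (2*pi)) \<longrightarrow> sin \<theta> \<noteq> 0 \<and> cos \<theta> \<noteq> 0"
    using AE_lborel_singleton[of 0] AE_lborel_singleton[of "2*pi"] AE_lborel_singleton[of pi]
      AE_lborel_singleton[of "pi/2"] AE_lborel_singleton[of "3*pi/2"]
    by eventually_elim (use * in \<open>auto split: split_indicator simp: less_le\<close>)
  then show ?thesis unfolding angle_def by (subst AE_density) auto
qed

lemma alpha_pos: "s \<ge> 0 \<Longrightarrow> 0 < alpha s"
proof -
  assume s: "s \<ge> 0"
  have "(\<integral>\<theta>. 0 \<partial>angle) < alpha s" unfolding alpha_def
    using s AE_angle angle.emeasure_space_1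
    by (intro angle.integral_less_AE_space integrable_angle_cos_powr) (auto elim: eventually_mono)
  then show ?thesis by simp
qed

text \<open>Used for s and s + 1, where the gap makes the denominator of the constant
  \<open>A\<close> positive.\<close>

lemma alpha_strict_antimono: "0 \<le> s \<Longrightarrow> s < s' \<Longrightarrow> alpha s' < alpha s"
proof -
  assume s: "0 \<le> s" "s < s'"
  have *: "\<bar>cos \<theta>\<bar> powr s' < \<bar>cos \<theta>\<bar> powr s" if "sin \<theta> \<noteq> 0 \<and> cos \<theta> \<noteq> 0" for \<theta>::real
  proof -
    have "(cos \<theta>)\<^sup>2 < 1" using that sin_cos_squared_add[of \<theta>] zero_less_power2[of "sin \<theta>"] by linarith
    then have "\<bar>cos \<theta>\<bar> < 1" by (simp add: abs_square_less_1)
    then show ?thesis using that s by (intro powr_less_mono') auto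
  qed
  show ?thesis unfolding alpha_def
    using s eventually_mono[OF AE_angle *] angle.emeasure_space_1
    by (intro angle.integral_less_AE_space integrable_angle_cos_powr) auto
qed

text \<open>A weak form of Jordan's inequality. The slope 1/2 = cos (\<pi>/3) bounds the derivative
  up to \<pi>/3; beyond, sin (\<pi>/3) already exceeds \<pi>/4.\<close>

lemma sin_ge_lin: "0 \<le> x \<Longrightarrow> x \<le> pi/2 \<Longrightarrow> sin x \<ge> x / 2" for x :: real
proof -
  assume x: "0 \<le> x" "x \<le> pi/2"
  show ?thesis
  proof (cases "x \<le> pi/3")
    case True
    have "0 \<le> x \<Longrightarrow> x \<le> pi/3 \<Longrightarrow> sin 0 - 0/2 \<le> sin x - x/2" for x :: real
    proof (rule DERIV_nonneg_imp_nondecreasing[of 0 x])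
      fix y assume "0 \<le> x" "x \<le> pi/3" "0 \<le> y" "y \<le> x"
      then have "cos y \<ge> cos (pi/3)" by (intro cos_monotone_0_pi_le) auto
      then show "\<exists>z. ((\<lambda>x. sin x - x / 2) has_real_derivative z) (at y) \<and> 0 \<le> z"
        by (intro exI[of _ "cos y - 1/2"]) (auto intro!: derivative_eq_intros simp: cos_60)
    qed auto
    from this[of x] x True show ?thesis by simp
  next
    case False
    have "sin (pi/3) \<le> sin x" using False x by (intro sin_monotone_2pi_le) auto
    moreover have "sqrt 3 \<ge> 17/10" by (rule real_le_rsqrt) (simp add: power2_eq_square)
    moreover have "x / 2 \<le> 16/20" using x pi_less_4 pi_approx by simp
    ultimately show ?thesis unfolding sin_60 by linarith
  qed
qed

text \<open>Near each zero of the sine the integrand is dominated by \<open>|\<theta> - k\<pi>|\<^bsup>-a\<^esup>\<close> with \<open>a < 1\<close>.\<close>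

lemma integrable_angle_sin_powr_neg:
  assumes a: "0 < a" "a < 1"
  shows "integrable angle (\<lambda>\<theta>. \<bar>sin \<theta>\<bar> powr (-a))"
proof -
  define h where "h = (\<lambda>x::real. x powr (-a) * indicator {0..2*pi} x)"
  have "((\<lambda>x. x powr (-a)) has_integral ((2*pi) powr (-a+1) / (-a+1))) {0..2*pi}"
    using a by (intro has_integral_powr_from_0) auto
  then have "(\<integral>\<^sup>+x. ennreal (x powr (-a)) * indicator {0..2*pi} x \<partial>lborel) = ennreal ((2*pi) powr (-a+1) / (-a+1))"
    by (intro nn_integral_has_integral_lebesgue') auto
  also have "(\<lambda>x. ennreal (x powr (-a)) * indicator {0..2*pi} x) = (\<lambda>x. ennreal (h x))"
    by (auto simp: h_def fun_eq_iff split: split_indicator)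
  finally have "integrable lborel h"
    by (intro integrableI_nonneg) (auto simp: h_def)
  then have i: "integrable lborel (\<lambda>x. h (t + c * x))" if "c \<noteq> 0" for t c
    using that by (subst lborel_integrable_real_affine_iff) auto
  \<comment> \<open>One copy of the majorant for each way of folding x into the first quadrant
    without changing |sin x|.\<close>
  define S where "S = (\<lambda>x. 2 powr a * (h (0 + 1*x) + h (pi + (-1)*x) + h ((-pi) + 1*x) + h (2*pi + (-1)*x)))"
  have "integrable lborel (\<lambda>x. 1/(2*pi) * S x)"
    unfolding S_def by (intro integrable_mult_right Bochner_Integration.integrable_add i) auto
  then have "integrable lborel (\<lambda>\<theta>. (indicator {0..2*pi} \<theta> / (2*pi)) *\<^sub>R \<bar>sin \<theta>\<bar> powr (-a))"
  proof (rule Bochner_Integration.integrable_bound)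
    have hn: "h y \<ge> 0" for y by (simp add: h_def)
    have "indicator {0..2*pi} x * \<bar>sin x\<bar> powr (-a) \<le> S x" for x
    proof -
      have key: "\<bar>sin x\<bar> powr (-a) \<le> S x"
        if y: "0 \<le> y" "y \<le> pi/2" "\<bar>sin x\<bar> = sin y" and xy: "y = x \<or> y = pi - x \<or> y = x - pi \<or> y = 2*pi - x" for y
      proof -
        have "\<bar>sin x\<bar> powr (-a) \<le> 2 powr a * h y"
        proof (cases "y = 0")
          case False
          then have "(sin y) powr (-a) \<le> (y/2) powr (-a)"
            using sin_ge_lin[of y] y a by (intro powr_mono2') auto
          also have "\<dots> = 2 powr a * h y" using y False
            by (auto simp: h_def powr_divide powr_minus field_simps)
          finally show ?thesis using y by simp
        qed (use y in \<open>auto simp: hn\<close>)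
        also have "\<dots> \<le> S x" unfolding S_def
          using xy hn[of x] hn[of "pi-x"] hn[of "x-pi"] hn[of "2*pi-x"] by (intro mult_left_mono) auto
        finally show ?thesis .
      qed
      consider "x \<notin> {0..2*pi}" | "0 \<le> x" "x \<le> pi/2" | "pi/2 \<le> x" "x \<le> pi" | "pi \<le> x" "x \<le> 3*pi/2" | "3*pi/2 \<le> x" "x \<le> 2*pi"
        by force
      then show ?thesis
      proof cases
        case 1 then show ?thesis using hn by (auto simp: S_def intro!: add_nonneg_nonneg)
      next
        case 2 then show ?thesis using key[of x] sin_ge_zero[of x] by simp
      next
        case 3 then show ?thesis using key[of "pi - x"] sin_ge_zero[of x] by simp
      next
        case 4 then show ?thesis using key[of "x - pi"] sin_ge_zero[of "x - pi"] by (simp add: sin_diff)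
      next
        case 5 then show ?thesis using key[of "2*pi - x"] sin_ge_zero[of "2*pi - x"] by (simp add: sin_diff)
      qed
    qed
    moreover have "S x \<ge> 0" for x using hn by (simp add: S_def add_nonneg_nonneg)
    ultimately show "AE x in lborel. norm ((indicator {0..2*pi} x / (2*pi)) *\<^sub>R \<bar>sin x\<bar> powr (-a)) \<le> norm (1/(2*pi) * S x)"
      by (intro AE_I2) (auto simp: abs_mult divide_simps)
  qed simp
  then show ?thesis unfolding angle_def by (subst integrable_density) auto
qed

section \<open>Estimates for one Duhamel step and their iteration\<close>

interpretation collision: pair_sigma_finite "clock t" angle for t
  by (intro pair_sigma_finite.intro clock.sigma_finite_measure_axioms angle.sigma_finite_measure_axioms)

interpretation collision: finite_measure "collision t" for t
  by (intro finite_measure_pair_measure finite_measure_clock angle.finite_measure_axioms)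

lemma measure_collision: "t \<ge> 0 \<Longrightarrow> measure (collision t) UNIV = 1 - exp (- t)"
proof -
  assume "t \<ge> 0"
  have "emeasure (collision t) (UNIV \<times> UNIV) = emeasure (clock t) UNIV * emeasure angle UNIV"
    by (intro angle.emeasure_pair_measure_Times) auto
  then show ?thesis using measure_clock[OF \<open>t \<ge> 0\<close>] angle.emeasure_space_1
    by (simp add: measure_def)
qed

lemma AE_collision:
  "AE z in collision t. 0 \<le> fst z \<and> fst z \<le> t \<and> sin (snd z) \<noteq> 0 \<and> cos (snd z) \<noteq> 0"
proof (rule collision.AE_pair_measure)
  show "AE x in clock t. AE y in angle. 0 \<le> fst (x,y) \<and> fst (x,y) \<le> t \<and> sin (snd (x,y)) \<noteq> 0 \<and> cos (snd (x,y)) \<noteq> 0"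
    using AE_clock[of t]
  proof eventually_elim
    case (elim x)
    show ?case using AE_angle by eventually_elim (use elim in auto)
  qed
qed measurable

text \<open>The hypothesis on H says that averaging over the angle multiplies the bound by at most 1
  - r, which cancels the 1 / (1 - r) of \<open>integral_clock_exp\<close>; hence the rate e^-rt is
  reproduced with the same B. The term c \<tau>^n is the error carried along by
  \<open>comparison\<close>. With r = 0 the lemma propagates bounds that do not depend on
  time.\<close>

lemma collision_bound:
  fixes y :: "real \<times> real \<Rightarrow> real"
  assumes y[measurable]: "y \<in> borel_measurable borel2"
    and t: "t \<ge> 0" and r: "r < 1" and H: "integrable angle H" and HB: "(\<integral>\<theta>. H \<theta> \<partial>angle) \<le> (1 - r) * B"
    and c: "c \<ge> 0"
    and bd: "\<And>\<tau> \<theta>. 0 \<le> \<tau> \<Longrightarrow> \<tau> \<le> t \<Longrightarrow> sin \<theta> \<noteq> 0 \<Longrightarrow> cos \<theta> \<noteq> 0 \<Longrightarrow> \<bar>y (\<tau>, \<theta>)\<bar> \<le> exp (- r * \<tau>) * H \<theta> + c * \<tau> ^ n"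
  shows "\<bar>\<integral>z. y z \<partial>collision t\<bar> \<le> B * (exp (- r * t) - exp (- t)) + c * t ^ Suc n / Suc n"
proof -
  define k where "k = (\<lambda>z::real\<times>real. exp (- r * fst z) * H (snd z) + c * fst z ^ n)"
  have Hm[measurable]: "H \<in> borel_measurable borel" using H by (auto dest: borel_measurable_integrable)
  have ke: "integrable (clock t) (\<lambda>\<tau>. exp (- r * \<tau>))" by (rule integral_clock_exp[OF r t])
  have kp: "integrable (clock t) (\<lambda>\<tau>. \<tau>^n)" by (rule clock_power[OF t])
  have i1: "integrable (collision t) (\<lambda>z. exp (- r * fst z) * H (snd z))"
  proof (rule collision.Fubini_integrable)
    show "integrable (clock t) (\<lambda>x. \<integral>y. norm (exp (- r * fst (x,y)) * H (snd (x,y))) \<partial>angle)"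
      using ke by (simp add: abs_mult)
  qed (use H in auto)
  have i2: "integrable (collision t) (\<lambda>z. c * fst z ^ n)"
  proof (rule collision.Fubini_integrable)
    show "integrable (clock t) (\<lambda>x. \<integral>y. norm (c * fst (x,y::real) ^ n) \<partial>angle)"
      using integrable_norm[OF kp] by (simp add: abs_mult angle.prob_space[simplified])
  qed auto
  have ik: "integrable (collision t) k" unfolding k_def using i1 i2 by simp
  have ae: "AE z in collision t. \<bar>y z\<bar> \<le> k z"
    using AE_collision by eventually_elim (use bd in \<open>auto simp: k_def\<close>)
  have iy: "integrable (collision t) y"
    by (rule Bochner_Integration.integrable_bound[OF ik]) (use ae in \<open>auto elim: eventually_mono\<close>)
  have "\<bar>\<integral>z. y z \<partial>collision t\<bar> \<le> (\<integral>z. \<bar>y z\<bar> \<partial>collision t)"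
    by (rule integral_abs_bound)
  also have "\<dots> \<le> (\<integral>z. k z \<partial>collision t)"
    by (rule integral_mono_AE[OF _ ik ae]) (use iy in auto)
  also have "\<dots> = (\<integral>\<tau>. (\<integral>\<theta>. k (\<tau>, \<theta>) \<partial>angle) \<partial>clock t)"
    by (rule collision.integral_fst'[OF ik, symmetric])
  also have "\<dots> = (\<integral>\<tau>. exp (- r * \<tau>) * (\<integral>\<theta>. H \<theta> \<partial>angle) + c * \<tau> ^ n \<partial>clock t)"
    using H by (simp add: k_def angle.prob_space[simplified])
  also have "\<dots> = (exp (- r * t) - exp (- t)) / (1 - r) * (\<integral>\<theta>. H \<theta> \<partial>angle) + c * (\<integral>\<tau>. \<tau>^n \<partial>clock t)"
    using ke kp by (simp add: integral_clock_exp(1)[OF r t, simplified])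
  also have "\<dots> \<le> (exp (- r * t) - exp (- t)) / (1 - r) * ((1 - r) * B) + c * (t ^ Suc n / Suc n)"
  proof (intro add_mono mult_left_mono HB clock_power t c)
    have "r * t \<le> 1 * t" using t r by (intro mult_right_mono) auto
    then show "0 \<le> (exp (-r*t) - exp (-t)) / (1 - r)" using r by (intro divide_nonneg_nonneg) auto
  qed
  also have "\<dots> = B * (exp (- r * t) - exp (- t)) + c * t ^ Suc n / Suc n"
    using r by (simp del: power_Suc of_nat_Suc)
  finally show ?thesis .
qed

text \<open>A Gronwall argument without a priori finiteness of the weighted norm: iterating the
  integral inequality leaves the remainder \<open>K (2t)\<^sup>n / n!\<close>.\<close>

lemma comparison:
  fixes Z Y :: "real \<Rightarrow> 'p \<Rightarrow> real"
  assumes base: "\<And>t p. t \<ge> 0 \<Longrightarrow> Z t p \<le> Y t p + K" and K: "K \<ge> 0"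
    and step: "\<And>c n t p. c \<ge> 0 \<Longrightarrow> (\<And>\<tau> p. \<tau> \<ge> 0 \<Longrightarrow> Z \<tau> p \<le> Y \<tau> p + c * \<tau> ^ n) \<Longrightarrow> t \<ge> 0 \<Longrightarrow>
        Z t p \<le> Y t p + 2 * c * t ^ Suc n / Suc n"
    and t: "t \<ge> 0"
  shows "Z t p \<le> Y t p"
proof -
  have *: "\<forall>t\<ge>0. \<forall>p. Z t p \<le> Y t p + K * 2 ^ n / fact n * t ^ n" for n
  proof (induction n)
    case (Suc n)
    show ?case
    proof (intro allI impI)
      fix t :: real and p assume "t \<ge> 0"
      have "Z t p \<le> Y t p + 2 * (K * 2 ^ n / fact n) * t ^ Suc n / Suc n"
        using Suc K \<open>t \<ge> 0\<close> by (intro step) auto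
      then show "Z t p \<le> Y t p + K * 2 ^ Suc n / fact (Suc n) * t ^ Suc n"
        by (simp add: field_simps)
    qed
  qed (use base in simp)
  have "(\<lambda>n. inverse (fact n) * (2*t) ^ n) \<longlonglongrightarrow> 0"
    by (rule summable_LIMSEQ_zero[OF summable_exp])
  then have "(\<lambda>n. Y t p + K * (inverse (fact n) * (2*t) ^ n)) \<longlonglongrightarrow> Y t p + K * 0"
    by (intro tendsto_intros)
  moreover have "Z t p \<le> Y t p + K * (inverse (fact n) * (2*t) ^ n)" for n
    using * t by (auto simp: field_simps power_mult_distrib)
  ultimately show ?thesis by (auto intro: LIMSEQ_le_const)
qed

section \<open>Weights\<close>

text \<open>Behaves like |x|^2e at infinity and like 1 near 0. Exponents count squares: a gain of q
  in the exponent is a decay |x|^-2q.\<close>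

definition W :: "real \<Rightarrow> real \<Rightarrow> real" where "W e x = (1 + x\<^sup>2) powr e"

lemma W_nonneg [simp]: "W e x \<ge> 0" by (simp add: W_def)

lemma W_measurable [measurable]: "W e \<in> borel_measurable borel"
  unfolding W_def by measurable

lemma W_mono: "e \<le> e' \<Longrightarrow> W e x \<le> W e' x"
  unfolding W_def by (rule powr_mono) auto

lemma W_add: "W e x * W e' x = W (e + e') x"
  unfolding W_def by (simp add: powr_add)

lemma W_le_1: "e \<le> 0 \<Longrightarrow> W e x \<le> 1"
  using W_mono[of e 0 x] by (simp add: W_def add_nonneg_eq_0_iff)

lemma W_scale_nonneg: "e \<ge> 0 \<Longrightarrow> \<bar>c\<bar> \<le> 1 \<Longrightarrow> W e (x * c) \<le> W e x"
  unfolding W_def by (intro powr_mono2) (auto simp: power_mult_distrib abs_square_le_1 intro!: mult_left_le)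

lemma W_scale_half:
  assumes "c\<^sup>2 \<ge> 1/2" "\<bar>c\<bar> \<le> 1" shows "W e (x * c) \<le> 2 powr \<bar>e\<bar> * W e x"
proof (cases "e \<ge> 0")
  case True
  have "W e (x * c) \<le> 1 * W e x" using W_scale_nonneg[OF True assms(2)] by simp
  also have "\<dots> \<le> 2 powr \<bar>e\<bar> * W e x" by (intro mult_right_mono) (auto simp: ge_one_powr_ge_zero)
  finally show ?thesis .
next
  case False
  have "x\<^sup>2 * (1/2) \<le> x\<^sup>2 * c\<^sup>2" using assms by (intro mult_left_mono) auto
  then have "W e (x * c) \<le> ((1 + x\<^sup>2) / 2) powr e"
    unfolding W_def using False by (intro powr_mono2') (auto simp: power_mult_distrib intro!: add_pos_nonneg)
  also have "\<dots> = 2 powr \<bar>e\<bar> * W e x"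
    using False by (simp add: W_def powr_divide powr_minus field_simps)
  finally show ?thesis .
qed

lemma W_scale_neg:
  assumes "c \<noteq> 0" "\<bar>c\<bar> \<le> 1" "e \<le> 0" shows "W e (x * c) \<le> \<bar>c\<bar> powr (2 * e) * W e x"
proof -
  have "c\<^sup>2 * (1 + x\<^sup>2) \<le> 1 + (x * c)\<^sup>2"
    using assms by (simp add: algebra_simps power_mult_distrib abs_square_le_1)
  then have "W e (x * c) \<le> (c\<^sup>2 * (1 + x\<^sup>2)) powr e"
    unfolding W_def using assms by (intro powr_mono2') (auto simp: add_nonneg_eq_0_iff intro!: mult_pos_pos add_pos_nonneg)
  also have "\<dots> = \<bar>c\<bar> powr (2 * e) * W e x"
    using assms by (simp add: W_def powr_mult flip: powr_powr)
  finally show ?thesis .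
qed

lemma W_shift:
  assumes "\<bar>\<eta>\<bar> \<le> 1" "e \<le> 0" shows "W e (x + \<eta>) \<le> 3 powr (- e) * W e x"
proof -
  \<comment> \<open>Obtained by completing the square in 3 (1 + (x + \<eta>)^2) - (1 + x^2); what
    remains is at least 3/2 (1 - \<eta>^2).\<close>
  have "0 \<le> 2 * (x + 3/2 * \<eta>)\<^sup>2 + 3/2 * (1 - \<eta>\<^sup>2)" using assms by (simp add: abs_square_le_1)
  also have "\<dots> \<le> 3 * (1 + (x + \<eta>)\<^sup>2) - (1 + x\<^sup>2)"
    by (simp add: power2_eq_square field_simps)
  finally have "(1 + x\<^sup>2) / 3 \<le> 1 + (x + \<eta>)\<^sup>2" by simp
  then have "W e (x + \<eta>) \<le> ((1 + x\<^sup>2) / 3) powr e"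
    unfolding W_def using assms by (intro powr_mono2') (auto intro!: add_pos_nonneg)
  also have "\<dots> = 3 powr (- e) * W e x" by (simp add: W_def powr_divide powr_minus field_simps)
  finally show ?thesis .
qed

text \<open>One of c^2, s^2 is at least 1/2, so one factor sees a frequency comparable to \<xi>. If
  it is the first, the second still yields W (- q) at the price |s|^-2q, which is integrable over
  the angle for q \<le> 1/4. If it is the second, its weight at \<xi> absorbs the first factor, for
  negative a because of a + b \<ge> q.\<close>

lemma W_cos_sin:
  assumes "0 < q" "b \<ge> q" "a + b \<ge> q" and cs: "c\<^sup>2 + s\<^sup>2 = 1" "s \<noteq> 0"
  shows "W a (\<xi> * c) * W (- b) (\<xi> * s) \<le> 2 powr (\<bar>a\<bar> + b) * W (a - q) \<xi> * (1 + \<bar>s\<bar> powr (- (2*q)))"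
proof -
  have c1: "\<bar>c\<bar> \<le> 1" and s1: "\<bar>s\<bar> \<le> 1" using cs(1) zero_le_power2[of c] zero_le_power2[of s]
    by (simp_all only: abs_square_le_1[symmetric])
  consider "c\<^sup>2 \<ge> 1/2" | "s\<^sup>2 \<ge> 1/2" using cs(1) by linarith
  then show ?thesis
  proof cases
    case 1
    have "W (- b) (\<xi> * s) \<le> W (- q) (\<xi> * s)" using assms by (intro W_mono) auto
    also have "\<dots> \<le> \<bar>s\<bar> powr (- (2*q)) * W (- q) \<xi>"
      using W_scale_neg[of s "-q" \<xi>] s1 assms by auto
    finally have "W a (\<xi> * c) * W (- b) (\<xi> * s) \<le> (2 powr \<bar>a\<bar> * W a \<xi>) * (\<bar>s\<bar> powr (- (2*q)) * W (- q) \<xi>)"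
      using W_scale_half[OF 1 c1] by (intro mult_mono) auto
    also have "\<dots> = 2 powr \<bar>a\<bar> * (W (a - q) \<xi> * \<bar>s\<bar> powr (- (2*q)))"
      by (simp add: W_add[symmetric, of a "-q", simplified])
    also have "\<dots> \<le> 2 powr (\<bar>a\<bar> + b) * (W (a - q) \<xi> * (1 + \<bar>s\<bar> powr (- (2*q))))"
      using assms by (intro mult_mono powr_mono) auto
    finally show ?thesis by (simp add: mult.assoc)
  next
    case 2
    have "W (-b) (\<xi> * s) \<le> 2 powr b * W (- b) \<xi>" using W_scale_half[OF 2 s1, of "-b" \<xi>] assms by simp
    moreover have "W a (\<xi> * c) * W (- b) \<xi> \<le> W (a - q) \<xi>"
    proof (cases "a \<ge> 0")
      case True
      have "W a (\<xi> * c) * W (- b) \<xi> \<le> W a \<xi> * W (-q) \<xi>"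
        using assms by (intro mult_mono W_scale_nonneg True c1 W_mono) auto
      then show ?thesis by (simp add: W_add)
    next
      case False
      have "W a (\<xi> * c) * W (- b) \<xi> \<le> 1 * W (a - q) \<xi>"
        using assms False by (intro mult_mono W_le_1 W_mono) auto
      then show ?thesis by simp
    qed
    ultimately have "W a (\<xi> * c) * W (- b) (\<xi> * s) \<le> W a (\<xi> * c) * (2 powr b * W (- b) \<xi>)"
      by (intro mult_left_mono) auto
    also have "\<dots> = 2 powr b * (W a (\<xi> * c) * W (- b) \<xi>)" by simp
    also have "\<dots> \<le> 2 powr b * W (a - q) \<xi>"
      using \<open>W a (\<xi> * c) * W (- b) \<xi> \<le> W (a - q) \<xi>\<close> by (intro mult_left_mono) auto
    also have "\<dots> \<le> 2 powr (\<bar>a\<bar> + b) * W (a - q) \<xi> * 1"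
      by (simp add: powr_add ge_one_powr_ge_zero mult_le_cancel_right1 mult_right_mono)
    also have "\<dots> \<le> 2 powr (\<bar>a\<bar> + b) * W (a - q) \<xi> * (1 + \<bar>s\<bar> powr (- (2*q)))"
      by (intro mult_left_mono) auto
    finally show ?thesis .
  qed
qed

text \<open>The factor with the larger of |c|, |s| keeps W (- b), the other one contributes the gain
  q; hence one singular summand for each case.\<close>

lemma W_cos_sin_same:
  assumes "0 < q" "b \<ge> q" and cs: "c\<^sup>2 + s\<^sup>2 = 1" "s \<noteq> 0" "c \<noteq> 0"
  shows "W (- b) (\<xi> * c) * W (- b) (\<xi> * s) \<le> 2 powr b * W (- b - q) \<xi> * (\<bar>s\<bar> powr (- (2*q)) + \<bar>c\<bar> powr (- (2*q)))"
proof -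
  have *: "W (- b) (\<xi> * c) * W (- b) (\<xi> * s) \<le> 2 powr b * W (- b - q) \<xi> * \<bar>s\<bar> powr (- (2*q))"
    if "c\<^sup>2 \<ge> 1/2" "c\<^sup>2 + s\<^sup>2 = 1" "s \<noteq> 0" for c s :: real
  proof -
    have c1: "\<bar>c\<bar> \<le> 1" and s1: "\<bar>s\<bar> \<le> 1" using that(2) zero_le_power2[of c] zero_le_power2[of s]
      by (simp_all only: abs_square_le_1[symmetric])
    have "W (- b) (\<xi> * s) \<le> W (- q) (\<xi> * s)" using assms by (intro W_mono) auto
    also have "\<dots> \<le> \<bar>s\<bar> powr (- (2*q)) * W (- q) \<xi>"
      using W_scale_neg[of s "-q" \<xi>] s1 assms that by auto
    finally have "W (-b) (\<xi> * c) * W (- b) (\<xi> * s) \<le> (2 powr b * W (-b) \<xi>) * (\<bar>s\<bar> powr (- (2*q)) * W (- q) \<xi>)"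
      using W_scale_half[OF that(1) c1, of "-b" \<xi>] assms by (intro mult_mono) auto
    then show ?thesis by (simp add: W_add[symmetric, of "-b" "-q", simplified] mult_ac)
  qed
  consider "c\<^sup>2 \<ge> 1/2" | "s\<^sup>2 \<ge> 1/2" using cs(1) by linarith
  then show ?thesis
  proof cases
    case 1
    show ?thesis using *[OF 1 cs(1,2)]
      by (rule order_trans) (auto intro!: mult_left_mono)
  next
    case 2
    have "W (- b) (\<xi> * s) * W (- b) (\<xi> * c) \<le> 2 powr b * W (- b - q) \<xi> * \<bar>c\<bar> powr (- (2*q))"
      using * 2 cs by (simp add: add.commute)
    also have "\<dots> \<le> 2 powr b * W (- b - q) \<xi> * (\<bar>s\<bar> powr (- (2*q)) + \<bar>c\<bar> powr (- (2*q)))"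
      by (auto intro!: mult_left_mono)
    finally show ?thesis by (simp add: mult.commute)
  qed
qed

text \<open>For negative a, scaling out c costs |c|^2a, which is integrable over the angle only for
  2a > -1. Exponents below -3/8 are therefore raised to -3/8, where the cost is |c|^(-3/4).\<close>

lemma W_scale_floor:
  assumes "c \<noteq> 0" "\<bar>c\<bar> \<le> 1"
  shows "W a (\<xi> * c) \<le> (1 + \<bar>c\<bar> powr (-3/4)) * W (max a (-3/8)) \<xi>"
proof (cases "a \<ge> 0")
  case True
  have "W a (\<xi> * c) \<le> 1 * W a \<xi>" using W_scale_nonneg[OF True assms(2)] by simp
  also have "\<dots> \<le> (1 + \<bar>c\<bar> powr (-3/4)) * W a \<xi>" by (intro mult_right_mono) auto
  finally show ?thesis using True by (simp add: max_def)
next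
  case False
  define a' where "a' = max a (-3/8)"
  have "W a (\<xi> * c) \<le> W a' (\<xi> * c)" by (intro W_mono) (auto simp: a'_def)
  also have "\<dots> \<le> \<bar>c\<bar> powr (2 * a') * W a' \<xi>" using False assms by (intro W_scale_neg) (auto simp: a'_def)
  also have "\<dots> \<le> (1 + \<bar>c\<bar> powr (-3/4)) * W a' \<xi>"
  proof (intro mult_right_mono)
    have "\<bar>c\<bar> powr (2 * a') \<le> \<bar>c\<bar> powr (-3/4)" using assms by (intro powr_mono') (auto simp: a'_def)
    then show "\<bar>c\<bar> powr (2 * a') \<le> 1 + \<bar>c\<bar> powr (-3/4)" by simp
  qed simp
  finally show ?thesis by (simp add: a'_def)
qed

section \<open>The Duhamel operator in Fourier space\<close>

lemma measurable_duhamel_kernel [measurable]: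
  fixes g :: "real \<Rightarrow> real \<Rightarrow> real"
  assumes [measurable]: "(\<lambda>z. g (fst z) (snd z)) \<in> borel_measurable borel2"
  shows "(\<lambda>z. collide g \<xi> z) \<in> borel_measurable borel2"
proof -
  have "(\<lambda>z. g (fst z) (\<xi> * cos (snd z))) \<in> borel_measurable borel2"
    using measurable_compose[OF _ assms, of "\<lambda>z. (fst z, \<xi> * cos (snd z))" borel2] by simp
  moreover have "(\<lambda>z. g (fst z) (\<xi> * sin (snd z))) \<in> borel_measurable borel2"
    using measurable_compose[OF _ assms, of "\<lambda>z. (fst z, \<xi> * sin (snd z))" borel2] by simp
  ultimately show ?thesis by simp
qed

text \<open>The integral term of the mild equation after Fourier transformation. The initial term
  e^-t \<psi>_0 is kept apart, since the iteration below is to get rid of it.\<close>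

definition duhamel :: "(real \<Rightarrow> real \<Rightarrow> real) \<Rightarrow> real \<Rightarrow> real \<Rightarrow> real" where
  "duhamel g t \<xi> = (\<integral>z. collide g \<xi> z \<partial>collision t)"

text \<open>Moves the dependence on t from the measure into the integrand, so that measurability of
  parameter integrals applies jointly in t and \<xi>.\<close>

lemma collision_eq_density:
  "collision t = density (lborel \<Otimes>\<^sub>M angle) (\<lambda>z. ennreal (indicator {0..t} (fst z) * exp (fst z - t)))"
proof -
  have "clock t \<Otimes>\<^sub>M density angle (\<lambda>_. 1)
    = density (lborel \<Otimes>\<^sub>M angle) (\<lambda>(x, y). ennreal (indicator {0..t} x * exp (x - t)) * 1)"
    unfolding clock_def
    by (rule pair_measure_density) (auto simp: density_1 intro: angle.sigma_finite_measure_axioms)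
  then show ?thesis by (simp add: density_1 split_def)
qed

lemma measurable_duhamel [measurable]:
  fixes g :: "real \<Rightarrow> real \<Rightarrow> real"
  assumes m[measurable]: "(\<lambda>z. g (fst z) (snd z)) \<in> borel_measurable borel2"
  shows "(\<lambda>z. duhamel g (fst z) (snd z)) \<in> borel_measurable borel2"
proof -
  interpret L: pair_sigma_finite lborel angle
    by (intro pair_sigma_finite.intro lborel.sigma_finite_measure_axioms angle.sigma_finite_measure_axioms)
  have sf: "sigma_finite_measure (lborel \<Otimes>\<^sub>M angle)" by unfold_locales
  have m1: "(\<lambda>w. g (fst (snd w)) (snd (fst w) * cos (snd (snd w)))) \<in> borel_measurable (borel2 \<Otimes>\<^sub>M borel2)"
    using measurable_compose[OF _ m, of "\<lambda>w. (fst (snd w), snd (fst w) * cos (snd (snd w)))" "borel2 \<Otimes>\<^sub>M borel2"] by simp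
  have m2: "(\<lambda>w. g (fst (snd w)) (snd (fst w) * sin (snd (snd w)))) \<in> borel_measurable (borel2 \<Otimes>\<^sub>M borel2)"
    using measurable_compose[OF _ m, of "\<lambda>w. (fst (snd w), snd (fst w) * sin (snd (snd w)))" "borel2 \<Otimes>\<^sub>M borel2"] by simp
  have "(\<lambda>z. duhamel g (fst z) (snd z)) = (\<lambda>p. \<integral>z. (if 0 \<le> fst z \<and> fst z \<le> fst p then exp (fst z - fst p) else 0) *
      (collide g (snd p) z) \<partial>(lborel \<Otimes>\<^sub>M angle))"
    unfolding duhamel_def collision_eq_density
    by (rule ext, subst integral_density)
       (auto intro!: Bochner_Integration.integral_cong measurable_duhamel_kernel m split: split_indicator)
  also have "\<dots> \<in> borel_measurable borel2"
  proof (rule sigma_finite_measure.borel_measurable_lebesgue_integral[OF sf])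
    have ss: "sets (borel2 \<Otimes>\<^sub>M (lborel \<Otimes>\<^sub>M angle)) = sets (borel2 \<Otimes>\<^sub>M borel2)"
      by (intro sets_pair_measure_cong) auto
    have "(\<lambda>w. (if 0 \<le> fst (snd w) \<and> fst (snd w) \<le> fst (fst w) then exp (fst (snd w) - fst (fst w)) else 0) *
      (g (fst (snd w)) (snd (fst w) * cos (snd (snd w))) * g (fst (snd w)) (snd (fst w) * sin (snd (snd w)))))
       \<in> borel_measurable (borel2 \<Otimes>\<^sub>M borel2)"
      using m1 m2 by measurable
    then show "(\<lambda>(p, z). (if 0 \<le> fst z \<and> fst z \<le> fst p then exp (fst z - fst p) else 0) *
      (collide g (snd p) z)) \<in> borel_measurable (borel2 \<Otimes>\<^sub>M (lborel \<Otimes>\<^sub>M angle))"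
      unfolding split_def by (subst measurable_cong_sets[OF ss refl])
  qed
  finally show ?thesis .
qed

lemma integrable_collision_bounded:
  fixes y :: "real \<times> real \<Rightarrow> real"
  assumes "y \<in> borel_measurable borel2" "\<And>z. \<bar>y z\<bar> \<le> K"
  shows "integrable (collision t) y"
  using assms by (intro collision.integrable_const_bound[where B=K]) (auto cong: measurable_cong_sets)

lemma abs_duhamel_le_1:
  assumes "\<And>t \<xi>. \<bar>g t \<xi>\<bar> \<le> 1"
    and m: "(\<lambda>z. g (fst z) (snd z)) \<in> borel_measurable borel2"
  shows "\<bar>duhamel g t \<xi>\<bar> \<le> 1"
proof (cases "t \<ge> 0")
  case True
  have "\<bar>duhamel g t \<xi>\<bar> \<le> 1 * (exp (- 0 * t) - exp (- t)) + 0 * t ^ Suc 0 / Suc 0"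
    unfolding duhamel_def
  proof (rule collision_bound[where H="\<lambda>_. 1"])
    show "\<bar>collide g \<xi> (\<tau>, \<theta>)\<bar> \<le> exp (- 0 * \<tau>) * 1 + 0 * \<tau> ^ 0" for \<tau> \<theta>
      using assms(1) by (simp add: abs_mult mult_le_one)
  qed (use True m in \<open>auto simp: angle.prob_space[simplified]\<close>)
  then show ?thesis by simp (smt (verit) exp_ge_zero)
next
  case False
  have "AE z in collision t. False" using AE_collision[of t] False by (auto elim: eventually_mono)
  then have "duhamel g t \<xi> = 0" unfolding duhamel_def by (intro integral_eq_zero_AE) (auto elim: eventually_mono)
  then show ?thesis by simp
qed

section \<open>The class of transforms to be estimated, and the Gaussian\<close>

locale kac_fourier =
  fixes q s \<sigma> D :: real
  assumes q_pos: "0 < q" and q_le: "q \<le> 1/4" and s_ge: "1 \<le> s" and sigma_pos: "0 < \<sigma>" and D_nonneg: "0 \<le> D"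
begin

text \<open>The exponent of the theorem; 2 \<alpha>_s = 1 - r is the mean of |cos|^s + |sin|^s and
  thus the contraction factor demanded by \<open>collision_bound\<close>.\<close>

definition r :: real where "r = 1 - 2 * alpha s"

definition M :: "real \<Rightarrow> real" where "M \<xi> = exp (- (\<sigma>\<^sup>2 * \<xi>\<^sup>2 / 2))"

definition L :: real where "L = 1 + \<sigma>\<^sup>2"

text \<open>Collects what the estimates use of the cosine transforms of a solution, so that their
  constants depend on q, s, \<sigma>, D only and serve all solutions with the same datum. The
  increment inequality replaces a bound on the derivative; it holds for the transform of every
  probability density, with or without moments. The last clause is a Lipschitz form of the closeness
  O(|\<xi>|^s) to the Gaussian.\<close>

definition admissible :: "(real \<Rightarrow> real \<Rightarrow> real) \<Rightarrow> bool" where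
  "admissible \<psi> \<longleftrightarrow>
     (\<lambda>z. \<psi> (fst z) (snd z)) \<in> borel_measurable borel2 \<and> (\<forall>t \<xi>. \<bar>\<psi> t \<xi>\<bar> \<le> 1) \<and>
     (\<forall>t\<ge>0. \<forall>\<xi>. \<psi> t \<xi> = exp (- t) * \<psi> 0 \<xi> + duhamel \<psi> t \<xi>) \<and>
     (\<forall>t\<ge>0. \<forall>x y. x \<noteq> y \<longrightarrow> \<bar>\<psi> t x - \<psi> t y\<bar> \<le> \<bar>x - y\<bar> + (1 - \<psi> t (x - y)) / (2 * \<bar>x - y\<bar>)) \<and>
     \<psi> 0 0 = 1 \<and> (\<forall>\<xi>. \<bar>\<psi> 0 \<xi>\<bar> \<le> W (- q) \<xi>) \<and> (\<forall>\<xi>. 1 - \<psi> 0 \<xi> \<le> \<sigma>\<^sup>2 * \<xi>\<^sup>2 / 2) \<and>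
     (\<forall>x y m. \<bar>x\<bar> \<le> m \<longrightarrow> \<bar>y\<bar> \<le> m \<longrightarrow> \<bar>(\<psi> 0 x - M x) - (\<psi> 0 y - M y)\<bar> \<le> D * \<bar>x - y\<bar> * m powr (s - 1))"

lemma admissibleD:
  assumes "admissible \<psi>"
  shows admissible_measurable: "(\<lambda>z. \<psi> (fst z) (snd z)) \<in> borel_measurable borel2"
    and admissible_le_1: "\<bar>\<psi> t \<xi>\<bar> \<le> 1"
    and admissible_eq: "t \<ge> 0 \<Longrightarrow> \<psi> t \<xi> = exp (- t) * \<psi> 0 \<xi> + duhamel \<psi> t \<xi>"
    and admissible_incr: "t \<ge> 0 \<Longrightarrow> x \<noteq> y \<Longrightarrow> \<bar>\<psi> t x - \<psi> t y\<bar> \<le> \<bar>x - y\<bar> + (1 - \<psi> t (x - y)) / (2 * \<bar>x - y\<bar>)"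
    and admissible_0: "\<psi> 0 0 = 1"
    and admissible_decay: "\<bar>\<psi> 0 \<xi>\<bar> \<le> W (- q) \<xi>"
    and admissible_quadratic: "1 - \<psi> 0 \<xi> \<le> \<sigma>\<^sup>2 * \<xi>\<^sup>2 / 2"
    and admissible_initial: "\<bar>x\<bar> \<le> m \<Longrightarrow> \<bar>y\<bar> \<le> m \<Longrightarrow> \<bar>(\<psi> 0 x - M x) - (\<psi> 0 y - M y)\<bar> \<le> D * \<bar>x - y\<bar> * m powr (s - 1)"
  using assms unfolding admissible_def by blast+

lemma alpha_r: "2 * alpha s = 1 - r" and r_less: "r < 1"
  using alpha_pos[of s] s_ge by (auto simp: r_def)

lemma M_measurable [measurable]: "M \<in> borel_measurable borel" unfolding M_def by measurable

lemma M_pos: "0 < M x" and M_le_1: "M x \<le> 1" by (auto simp: M_def)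

text \<open>The Gaussian is a fixed point of the collision product, by cos^2 + sin^2 = 1.
  Subtracting it under the Duhamel integral therefore leaves a difference of products.\<close>

lemma M_mult: "M (\<xi> * cos \<theta>) * M (\<xi> * sin \<theta>) = M \<xi>"
proof -
  have "\<sigma>\<^sup>2 * (\<xi> * cos \<theta>)\<^sup>2 / 2 + \<sigma>\<^sup>2 * (\<xi> * sin \<theta>)\<^sup>2 / 2 = \<sigma>\<^sup>2 * \<xi>\<^sup>2 / 2 * ((cos \<theta>)\<^sup>2 + (sin \<theta>)\<^sup>2)"
    by (simp only: distrib_left power_mult_distrib) simp
  also have "\<dots> = \<sigma>\<^sup>2 * \<xi>\<^sup>2 / 2" by simp
  finally show ?thesis unfolding M_def exp_add[symmetric] by (simp add: algebra_simps)
qed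

lemma M_0: "M 0 = 1" by (simp add: M_def)

lemma M_lip: "\<bar>M x - M y\<bar> \<le> L * \<bar>x - y\<bar>"
proof -
  have d: "\<bar>- (\<sigma>\<^sup>2 * z) * M z\<bar> \<le> L" for z
  proof -
    have "(\<sigma> * \<bar>z\<bar>) * exp (- ((\<sigma> * \<bar>z\<bar>)\<^sup>2 / 2)) \<le> 1"
    proof -
      have "2 * (\<sigma> * \<bar>z\<bar>) \<le> 1 + (\<sigma> * \<bar>z\<bar>)\<^sup>2" using zero_le_power2[of "\<sigma> * \<bar>z\<bar> - 1"] by (simp add: power2_diff)
      then have "\<sigma> * \<bar>z\<bar> \<le> 1 + (\<sigma> * \<bar>z\<bar>)\<^sup>2 / 2" by simp
      also have "\<dots> \<le> exp ((\<sigma> * \<bar>z\<bar>)\<^sup>2 / 2)" by (rule exp_ge_add_one_self)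
      finally show ?thesis by (simp add: exp_minus field_simps)
    qed
    then have "\<sigma> * ((\<sigma> * \<bar>z\<bar>) * exp (- ((\<sigma> * \<bar>z\<bar>)\<^sup>2 / 2))) \<le> \<sigma> * 1" using sigma_pos by (intro mult_left_mono) auto
    moreover have "2 * \<sigma> \<le> 1 + \<sigma>\<^sup>2" using zero_le_power2[of "\<sigma> - 1"] by (simp add: power2_diff)
    then have "\<sigma> \<le> L" using sigma_pos unfolding L_def by linarith
    ultimately have "\<sigma> * ((\<sigma> * \<bar>z\<bar>) * exp (- ((\<sigma> * \<bar>z\<bar>)\<^sup>2 / 2))) \<le> L" by linarith
    then show ?thesis using sigma_pos
      by (simp add: M_def abs_mult power_mult_distrib mult.assoc power2_eq_square[of \<sigma>] del: mult_le_cancel_left_pos)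
  qed
  have "norm (M x - M y) \<le> L * norm (x - y)"
  proof (rule field_differentiable_bound[where S=UNIV and f'="\<lambda>z. - (\<sigma>\<^sup>2 * z) * M z"])
    show "(M has_real_derivative - (\<sigma>\<^sup>2 * z) * M z) (at z within UNIV)" for z
      unfolding M_def by (auto intro!: derivative_eq_intros)
  qed (use d in auto)
  then show ?thesis by simp
qed

lemma M_decay: "\<exists>C\<ge>0. \<forall>\<xi>. M \<xi> \<le> C * W (- b) \<xi>" if "b > 0"
proof (intro exI conjI allI)
  \<comment> \<open>Chosen such that \<open>ln y \<le> y - 1\<close> at y = k (1 + \<xi>^2),
    multiplied by b, produces the Gaussian exponent \<sigma>^2 \<xi>^2 / 2.\<close>
  define k where "k = \<sigma>\<^sup>2 / (2 * b)"
  have k: "k > 0" "b * k = \<sigma>\<^sup>2 / 2" using that sigma_pos by (auto simp: k_def)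
  fix \<xi> :: real
  define X where "X = 1 + \<xi>\<^sup>2"
  have X: "X > 0" by (auto simp: X_def intro: add_pos_nonneg)
  have "ln (k * X) \<le> k * X - 1" using k X by (intro ln_le_minus_one) auto
  then have "ln X \<le> k * X - 1 - ln k" using k X by (simp add: ln_mult)
  then have "b * ln X \<le> b * (k * X - 1 - ln k)" using that by (intro mult_left_mono) auto
  also have "\<dots> = \<sigma>\<^sup>2 / 2 * X - b * (1 + ln k)" using k(2) by (simp add: algebra_simps)
  finally have "- (\<sigma>\<^sup>2 * \<xi>\<^sup>2 / 2) \<le> (\<sigma>\<^sup>2 / 2 - b * (1 + ln k)) + (- b * ln X)" by (simp add: X_def algebra_simps)
  then have "M \<xi> \<le> exp ((\<sigma>\<^sup>2 / 2 - b * (1 + ln k)) + (- b * ln X))" by (simp add: M_def)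
  also have "\<dots> = exp (\<sigma>\<^sup>2 / 2 - b * (1 + ln k)) * W (- b) \<xi>"
    using X by (simp only: exp_add) (simp add: W_def powr_def X_def[symmetric])
  finally show "M \<xi> \<le> exp (\<sigma>\<^sup>2 / 2 - b * (1 + ln k)) * W (- b) \<xi>" .
qed simp

lemma duhamel_diff_M:
  assumes m: "(\<lambda>z. g (fst z) (snd z)) \<in> borel_measurable borel2"
    and b: "\<And>t \<xi>. \<bar>g t \<xi>\<bar> \<le> 1" and t: "t \<ge> 0"
  shows "duhamel g t \<xi> - (1 - exp (- t)) * M \<xi> =
    (\<integral>z. collide g \<xi> z - M (\<xi> * cos (snd z)) * M (\<xi> * sin (snd z)) \<partial>collision t)"
proof -
  have "integrable (collision t) (\<lambda>z. collide g \<xi> z)"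
    using b by (intro integrable_collision_bounded[where K=1] measurable_duhamel_kernel m) (auto simp: abs_mult mult_le_one)
  then show ?thesis using measure_collision[OF t] by (simp add: M_mult duhamel_def space_pair_measure mult.commute)
qed

lemma duhamel_diff:
  assumes m: "(\<lambda>z. g (fst z) (snd z)) \<in> borel_measurable borel2"
    and b: "\<And>t \<xi>. \<bar>g t \<xi>\<bar> \<le> 1" and t: "t \<ge> 0"
  shows "duhamel g t x - duhamel g t y =
    (\<integral>z. collide g x z - collide g y z \<partial>collision t)"
proof -
  have "integrable (collision t) (\<lambda>z. collide g \<xi> z)" for \<xi>
    using b by (intro integrable_collision_bounded[where K=1] measurable_duhamel_kernel m) (auto simp: abs_mult mult_le_one)
  then show ?thesis by (simp add: duhamel_def)
qed

end

text \<open>The error R enters once through each factor; this is the factor 2 in the step of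
  \<open>comparison\<close>.\<close>

lemma prod_le_comparison:
  fixes x y :: real
  assumes "x \<le> 1" "0 \<le> y" "y \<le> 1" "x \<le> a + R" "y \<le> b + R" "0 \<le> a" "a \<le> 1" "0 \<le> R"
  shows "x * y \<le> a * b + 2 * R"
proof -
  have "x * y \<le> (a + R) * y" using assms by (intro mult_right_mono) auto
  also have "\<dots> = a * y + R * y" by (simp add: algebra_simps)
  also have "\<dots> \<le> a * (b + R) + R * 1" using assms by (intro add_mono mult_left_mono) auto
  also have "\<dots> \<le> a * b + 2 * R" using mult_right_mono[of a 1 R] assms by (simp add: algebra_simps)
  finally show ?thesis .
qed

text \<open>With R = e^-rt and e = e^-t, the initial term restores exactly what is missing in B (R -
  e), so the bound propagates with unchanged constant.\<close>

lemma add_contribution: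
  fixes z :: real
  assumes "i \<le> B * (R - e) + c" "z \<le> e * a + i" "a \<le> B" "0 \<le> e" shows "z \<le> R * B + c"
  using mult_left_mono[OF assms(3,4)] assms(1,2) by (simp add: algebra_simps)

section \<open>Bounds that propagate in time\<close>

context kac_fourier
begin

text \<open>The weight is submultiplicative along a collision, because 1 + \<xi>^2 \<le> (1 +
  \<xi>^2 cos^2) (1 + \<xi>^2 sin^2). The constant 1 is essential to this argument: a larger one
  would be squared in the product.\<close>

lemma char_decay:
  assumes g: "admissible \<psi>" and "t \<ge> 0" shows "\<bar>\<psi> t \<xi>\<bar> \<le> W (- q) \<xi>"
proof (rule comparison[where K=1 and Z="\<lambda>t \<xi>. \<bar>\<psi> t \<xi>\<bar>" and Y="\<lambda>t. W (- q)"])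
  note [measurable] = admissible_measurable[OF g]
  fix c t \<xi> :: real and n :: nat
  assume c: "c \<ge> 0" and t: "t \<ge> 0" and H: "\<And>\<tau> p. \<tau> \<ge> 0 \<Longrightarrow> \<bar>\<psi> \<tau> p\<bar> \<le> W (- q) p + c * \<tau> ^ n"
  have "\<bar>duhamel \<psi> t \<xi>\<bar> \<le> W (- q) \<xi> * (exp (- 0 * t) - exp (- t)) + (2 * c) * t ^ Suc n / Suc n"
    unfolding duhamel_def
  proof (rule collision_bound[where H="\<lambda>_. W (- q) \<xi>"])
    fix \<tau> \<theta> :: real assume \<tau>: "0 \<le> \<tau>"
    have "\<bar>\<psi> \<tau> (\<xi> * cos \<theta>)\<bar> * \<bar>\<psi> \<tau> (\<xi> * sin \<theta>)\<bar> \<le> W (- q) (\<xi> * cos \<theta>) * W (- q) (\<xi> * sin \<theta>) + 2 * (c * \<tau>^n)"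
      using H[OF \<tau>] c \<tau> q_pos by (intro prod_le_comparison admissible_le_1[OF g] W_le_1) auto
    also have "W (- q) (\<xi> * cos \<theta>) * W (- q) (\<xi> * sin \<theta>) \<le> W (- q) \<xi>"
    proof -
      have "1 + \<xi>\<^sup>2 = 1 + \<xi>\<^sup>2 * (cos \<theta>)\<^sup>2 + \<xi>\<^sup>2 * (sin \<theta>)\<^sup>2"
        by (simp add: distrib_left[symmetric] flip: add.assoc)
      also have "\<dots> \<le> (1 + (\<xi> * cos \<theta>)\<^sup>2) * (1 + (\<xi> * sin \<theta>)\<^sup>2)"
        by (simp add: power_mult_distrib algebra_simps)
      finally have "((1 + (\<xi> * cos \<theta>)\<^sup>2) * (1 + (\<xi> * sin \<theta>)\<^sup>2)) powr (- q) \<le> (1 + \<xi>\<^sup>2) powr (- q)"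
        using q_pos by (intro powr_mono2') (auto intro: add_pos_nonneg)
      then show ?thesis by (simp add: W_def powr_mult)
    qed
    finally show "\<bar>collide \<psi> \<xi> (\<tau>, \<theta>)\<bar>
        \<le> exp (- 0 * \<tau>) * W (- q) \<xi> + (2 * c) * \<tau> ^ n"
      by (simp add: abs_mult)
  qed (use t c in \<open>auto simp: angle.prob_space[simplified] intro!: measurable_duhamel_kernel\<close>)
  moreover have "\<bar>\<psi> t \<xi>\<bar> \<le> exp (- t) * \<bar>\<psi> 0 \<xi>\<bar> + \<bar>duhamel \<psi> t \<xi>\<bar>"
    unfolding admissible_eq[OF g t, of \<xi>] by (simp add: abs_mult order_trans[OF abs_triangle_ineq])
  ultimately have "\<bar>\<psi> t \<xi>\<bar> \<le> exp (- 0 * t) * W (- q) \<xi> + (2 * c) * t ^ Suc n / Suc n"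
    by (rule add_contribution[OF _ _ admissible_decay[OF g] exp_ge_zero])
  then show "\<bar>\<psi> t \<xi>\<bar> \<le> W (- q) \<xi> + 2 * c * t ^ Suc n / Suc n" by simp
next
  fix t \<xi> show "\<bar>\<psi> t \<xi>\<bar> \<le> W (- q) \<xi> + 1"
    using admissible_le_1[OF g, of t \<xi>] W_nonneg[of "-q" \<xi>] by linarith
qed (use assms in auto)

text \<open>Conservation of energy in the form of an inequality, without assuming that the energy is
  finite at positive times. The defects 1 - \<psi> are subadditive under products, as (1 - x) (1 -
  y) \<ge> 0, and the squares of the two frequencies add up to \<xi>^2.\<close>

lemma char_quadratic:
  assumes g: "admissible \<psi>" and "t \<ge> 0" shows "1 - \<psi> t \<xi> \<le> \<sigma>\<^sup>2 * \<xi>\<^sup>2 / 2"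
proof (rule comparison[where K=2 and Z="\<lambda>t \<xi>. 1 - \<psi> t \<xi>" and Y="\<lambda>t \<xi>. \<sigma>\<^sup>2 * \<xi>\<^sup>2 / 2"])
  note [measurable] = admissible_measurable[OF g]
  fix c t \<xi> :: real and n :: nat
  assume c: "c \<ge> 0" and t: "t \<ge> 0" and H: "\<And>\<tau> p. \<tau> \<ge> 0 \<Longrightarrow> 1 - \<psi> \<tau> p \<le> \<sigma>\<^sup>2 * p\<^sup>2 / 2 + c * \<tau> ^ n"
  have "\<bar>\<integral>z. 1 - collide \<psi> \<xi> z \<partial>collision t\<bar>
      \<le> (\<sigma>\<^sup>2 * \<xi>\<^sup>2 / 2) * (exp (- 0 * t) - exp (- t)) + (2 * c) * t ^ Suc n / Suc n"
  proof (rule collision_bound[where H="\<lambda>_. \<sigma>\<^sup>2 * \<xi>\<^sup>2 / 2"])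
    fix \<tau> \<theta> :: real assume \<tau>: "0 \<le> \<tau>"
    define x y where "x = \<psi> \<tau> (\<xi> * cos \<theta>)" and "y = \<psi> \<tau> (\<xi> * sin \<theta>)"
    have xy: "\<bar>x\<bar> \<le> 1" "\<bar>y\<bar> \<le> 1" unfolding x_def y_def by (rule admissible_le_1[OF g])+
    then have "\<bar>x * y\<bar> \<le> 1" by (simp add: abs_mult mult_le_one)
    then have "\<bar>1 - x * y\<bar> = 1 - x * y" by auto
    also have "\<dots> \<le> (1 - x) + (1 - y)"
      using mult_nonneg_nonneg[of "1 - x" "1 - y"] xy by (simp add: algebra_simps)
    also have "\<dots> \<le> \<sigma>\<^sup>2 * (\<xi> * cos \<theta>)\<^sup>2 / 2 + c * \<tau>^n + (\<sigma>\<^sup>2 * (\<xi> * sin \<theta>)\<^sup>2 / 2 + c * \<tau>^n)"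
      unfolding x_def y_def by (intro add_mono H \<tau>)
    also have "\<dots> = \<sigma>\<^sup>2 * \<xi>\<^sup>2 / 2 * ((cos \<theta>)\<^sup>2 + (sin \<theta>)\<^sup>2) + (2 * c) * \<tau>^n"
      by (simp only: power_mult_distrib sin_squared_eq) (simp add: field_simps)
    finally show "\<bar>1 - collide \<psi> \<xi> (\<tau>, \<theta>)\<bar>
        \<le> exp (- 0 * \<tau>) * (\<sigma>\<^sup>2 * \<xi>\<^sup>2 / 2) + (2 * c) * \<tau> ^ n"
      by (simp add: x_def y_def)
  qed (use t c in \<open>auto simp: angle.prob_space[simplified] intro!: borel_measurable_diff measurable_duhamel_kernel\<close>)
  then have "(\<integral>z. 1 - collide \<psi> \<xi> z \<partial>collision t)
      \<le> (\<sigma>\<^sup>2 * \<xi>\<^sup>2 / 2) * (exp (- 0 * t) - exp (- t)) + (2 * c) * t ^ Suc n / Suc n" by linarith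
  also have "(\<integral>z. 1 - collide \<psi> \<xi> z \<partial>collision t)
     = 1 - exp (- t) - duhamel \<psi> t \<xi>"
  proof -
    have "integrable (collision t) (\<lambda>z. collide \<psi> \<xi> z)"
      using admissible_le_1[OF g] by (intro integrable_collision_bounded[where K=1] measurable_duhamel_kernel) (auto simp: abs_mult mult_le_one)
    then show ?thesis using measure_collision[OF t] by (simp add: duhamel_def space_pair_measure)
  qed
  finally have "1 - \<psi> t \<xi> \<le> exp (- 0 * t) * (\<sigma>\<^sup>2 * \<xi>\<^sup>2 / 2) + (2 * c) * t ^ Suc n / Suc n"
  proof (rule add_contribution[OF _ _ admissible_quadratic[OF g, of \<xi>] exp_ge_zero])
    show "1 - \<psi> t \<xi> \<le> exp (- t) * (1 - \<psi> 0 \<xi>) + (1 - exp (- t) - duhamel \<psi> t \<xi>)"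
      unfolding admissible_eq[OF g t, of \<xi>] by (simp add: algebra_simps)
  qed
  then show "1 - \<psi> t \<xi> \<le> \<sigma>\<^sup>2 * \<xi>\<^sup>2 / 2 + 2 * c * t ^ Suc n / Suc n" by simp
next
  fix t \<xi>
  have "1 - \<psi> t \<xi> \<le> 2" using admissible_le_1[OF g, of t \<xi>] by linarith
  moreover have "0 \<le> \<sigma>\<^sup>2 * \<xi>\<^sup>2 / 2" by simp
  ultimately show "1 - \<psi> t \<xi> \<le> \<sigma>\<^sup>2 * \<xi>\<^sup>2 / 2 + 2" by linarith
qed (use assms in auto)

text \<open>In the increment inequality the quotient becomes linear in |x - y| once the defect at x
  - y is bounded quadratically.\<close>

lemma char_lip:
  assumes g: "admissible \<psi>" and t: "t \<ge> 0" shows "\<bar>\<psi> t x - \<psi> t y\<bar> \<le> L * \<bar>x - y\<bar>"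
proof (cases "x = y")
  case False
  have "\<bar>\<psi> t x - \<psi> t y\<bar> \<le> \<bar>x - y\<bar> + (1 - \<psi> t (x - y)) / (2 * \<bar>x - y\<bar>)"
    by (rule admissible_incr[OF g t False])
  also have "\<dots> \<le> \<bar>x - y\<bar> + (\<sigma>\<^sup>2 * (x - y)\<^sup>2 / 2) / (2 * \<bar>x - y\<bar>)"
    using char_quadratic[OF g t, of "x - y"] False by (intro add_left_mono divide_right_mono) auto
  also have "(\<sigma>\<^sup>2 * (x - y)\<^sup>2 / 2) / (2 * \<bar>x - y\<bar>) = \<sigma>\<^sup>2 / 4 * \<bar>x - y\<bar>"
    using False power2_eq_square[of "\<bar>x - y\<bar>"] by (simp add: field_simps)
  also have "\<bar>x - y\<bar> + \<sigma>\<^sup>2 / 4 * \<bar>x - y\<bar> \<le> L * \<bar>x - y\<bar>"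
    by (simp add: L_def algebra_simps)
  finally show ?thesis .
qed simp

lemma integrable_cos_powr: "0 \<le> a \<Longrightarrow> integrable angle (\<lambda>\<theta>. \<bar>cos \<theta>\<bar> powr a)"
  and integrable_sin_powr: "0 \<le> a \<Longrightarrow> integrable angle (\<lambda>\<theta>. \<bar>sin \<theta>\<bar> powr a)"
  using integrable_angle_cos_powr integral_angle_sin_cos_powr(2) by auto

lemma initial_diff:
  assumes g: "admissible \<psi>" shows "\<bar>\<psi> 0 \<xi> - M \<xi>\<bar> \<le> D * \<bar>\<xi>\<bar> powr s"
proof -
  have "\<bar>\<psi> 0 \<xi> - M \<xi>\<bar> \<le> D * \<bar>\<xi>\<bar> * \<bar>\<xi>\<bar> powr (s - 1)"
    using admissible_initial[OF g, of \<xi> "\<bar>\<xi>\<bar>" 0] admissible_0[OF g] M_0 by simp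
  also have "\<dots> = D * \<bar>\<xi>\<bar> powr s"
    by (cases "\<xi> = 0") (auto simp: powr_diff)
  finally show ?thesis .
qed

text \<open>The weight |\<xi>|^s is homogeneous, so a collision multiplies it by |cos|^s + |sin|^s,
  whose mean is 1 - r. The second factor of each product is bounded by 1, which keeps the inequality
  linear.\<close>

lemma char_diff:
  assumes g: "admissible \<psi>" and "t \<ge> 0" shows "\<bar>\<psi> t \<xi> - M \<xi>\<bar> \<le> exp (- r * t) * (D * \<bar>\<xi>\<bar> powr s)"
proof (rule comparison[where K=2 and Z="\<lambda>t \<xi>. \<bar>\<psi> t \<xi> - M \<xi>\<bar>" and Y="\<lambda>t \<xi>. exp (- r * t) * (D * \<bar>\<xi>\<bar> powr s)"])
  note [measurable] = admissible_measurable[OF g]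
  fix c t \<xi> :: real and n :: nat
  assume c: "c \<ge> 0" and t: "t \<ge> 0" and H: "\<And>\<tau> p. \<tau> \<ge> 0 \<Longrightarrow> \<bar>\<psi> \<tau> p - M p\<bar> \<le> exp (- r * \<tau>) * (D * \<bar>p\<bar> powr s) + c * \<tau> ^ n"
  have "\<bar>duhamel \<psi> t \<xi> - (1 - exp (- t)) * M \<xi>\<bar> \<le> (D * \<bar>\<xi>\<bar> powr s) * (exp (- r * t) - exp (- t)) + (2 * c) * t ^ Suc n / Suc n"
    unfolding duhamel_diff_M[OF admissible_measurable[OF g] admissible_le_1[OF g] t]
  proof (rule collision_bound[where H="\<lambda>\<theta>. D * \<bar>\<xi>\<bar> powr s * (\<bar>cos \<theta>\<bar> powr s + \<bar>sin \<theta>\<bar> powr s)"])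
    fix \<tau> \<theta> :: real assume \<tau>: "0 \<le> \<tau>"
    define x y where "x = \<psi> \<tau> (\<xi> * cos \<theta>)" and "y = \<psi> \<tau> (\<xi> * sin \<theta>)"
    define a b where "a = M (\<xi> * cos \<theta>)" and "b = M (\<xi> * sin \<theta>)"
    have xy: "\<bar>y\<bar> \<le> 1" "\<bar>a\<bar> \<le> 1" unfolding a_def y_def using admissible_le_1[OF g] M_le_1 M_pos[THEN less_imp_le] by auto
    have "x * y - a * b = (x - a) * y + a * (y - b)" by (simp add: algebra_simps)
    then have "\<bar>x * y - a * b\<bar> \<le> \<bar>x - a\<bar> * \<bar>y\<bar> + \<bar>a\<bar> * \<bar>y - b\<bar>"
      using abs_triangle_ineq[of "(x - a) * y" "a * (y - b)"] by (simp add: abs_mult)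
    also have "\<dots> \<le> \<bar>x - a\<bar> * 1 + 1 * \<bar>y - b\<bar>"
      using xy by (intro add_mono mult_left_mono mult_right_mono) auto
    also have "\<dots> \<le> (exp (- r * \<tau>) * (D * \<bar>\<xi> * cos \<theta>\<bar> powr s) + c * \<tau>^n) + (exp (- r * \<tau>) * (D * \<bar>\<xi> * sin \<theta>\<bar> powr s) + c * \<tau>^n)"
      unfolding x_def y_def a_def b_def using H[OF \<tau>, of "\<xi> * cos \<theta>"] H[OF \<tau>, of "\<xi> * sin \<theta>"]
      unfolding mult_1_left mult_1_right by (rule add_mono)
    also have "\<dots> = exp (- r * \<tau>) * (D * \<bar>\<xi>\<bar> powr s * (\<bar>cos \<theta>\<bar> powr s + \<bar>sin \<theta>\<bar> powr s)) + (2 * c) * \<tau> ^ n"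
      by (simp add: abs_mult powr_mult algebra_simps)
    finally show "\<bar>collide \<psi> \<xi> (\<tau>, \<theta>)
       - M (\<xi> * cos (snd (\<tau>, \<theta>))) * M (\<xi> * sin (snd (\<tau>, \<theta>)))\<bar>
        \<le> exp (- r * \<tau>) * (D * \<bar>\<xi>\<bar> powr s * (\<bar>cos \<theta>\<bar> powr s + \<bar>sin \<theta>\<bar> powr s)) + (2 * c) * \<tau> ^ n"
      by (simp add: x_def y_def a_def b_def)
  next
    show "(\<integral>\<theta>. D * \<bar>\<xi>\<bar> powr s * (\<bar>cos \<theta>\<bar> powr s + \<bar>sin \<theta>\<bar> powr s) \<partial>angle) \<le> (1 - r) * (D * \<bar>\<xi>\<bar> powr s)"
      using s_ge integrable_cos_powr[of s] integrable_sin_powr[of s]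
      by (simp add: integral_angle_sin_cos_powr alpha_def[symmetric] alpha_r[symmetric])
  qed (use t c r_less s_ge integrable_cos_powr[of s] integrable_sin_powr[of s] in \<open>auto intro!: borel_measurable_diff measurable_duhamel_kernel\<close>)
  moreover have "\<psi> t \<xi> - M \<xi> = exp (- t) * (\<psi> 0 \<xi> - M \<xi>) + (duhamel \<psi> t \<xi> - (1 - exp (- t)) * M \<xi>)"
    unfolding admissible_eq[OF g t, of \<xi>] by (simp add: algebra_simps)
  then have "\<bar>\<psi> t \<xi> - M \<xi>\<bar> \<le> exp (- t) * \<bar>\<psi> 0 \<xi> - M \<xi>\<bar> + \<bar>duhamel \<psi> t \<xi> - (1 - exp (- t)) * M \<xi>\<bar>"
    using abs_triangle_ineq[of "exp (- t) * (\<psi> 0 \<xi> - M \<xi>)" "duhamel \<psi> t \<xi> - (1 - exp (- t)) * M \<xi>"]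
    by (simp only: abs_mult abs_exp_cancel)
  ultimately show "\<bar>\<psi> t \<xi> - M \<xi>\<bar> \<le> exp (- r * t) * (D * \<bar>\<xi>\<bar> powr s) + 2 * c * t ^ Suc n / Suc n"
    by (rule add_contribution[OF _ _ initial_diff[OF g] exp_ge_zero])
next
  fix t \<xi>
  have "\<bar>\<psi> t \<xi> - M \<xi>\<bar> \<le> 2" using admissible_le_1[OF g, of t \<xi>] M_pos[of \<xi>] M_le_1[of \<xi>] by linarith
  moreover have "0 \<le> exp (- r * t) * (D * \<bar>\<xi>\<bar> powr s)" using D_nonneg by simp
  ultimately show "\<bar>\<psi> t \<xi> - M \<xi>\<bar> \<le> exp (- r * t) * (D * \<bar>\<xi>\<bar> powr s) + 2" by linarith
qed (use assms in auto)

text \<open>\<open>A\<close> is the fixed point \<open>A_eq\<close> of the estimate below; it exists because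
  \<open>alpha (s + 1) < alpha s\<close>.\<close>

definition A :: real where "A = alpha s * L * D / (alpha s - alpha (s + 1))"

lemma A_nonneg: "A \<ge> 0" and A_eq: "2 * A * alpha (s + 1) + 2 * L * D * alpha s = (1 - r) * A"
proof -
  have *: "alpha (s + 1) < alpha s" using s_ge by (intro alpha_strict_antimono) auto
  show "A \<ge> 0" unfolding A_def using * alpha_pos[of s] s_ge D_nonneg
    by (intro divide_nonneg_nonneg mult_nonneg_nonneg) (auto simp: L_def)
  have "A * (alpha s - alpha (s + 1)) = alpha s * L * D" unfolding A_def using * by simp
  then show "2 * A * alpha (s + 1) + 2 * L * D * alpha s = (1 - r) * A"
    unfolding alpha_r[symmetric] by (simp add: algebra_simps)
qed

text \<open>The difference of two products contains cross terms: u = \<psi> - M at one point times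
  an increment of \<psi> or M. By \<open>char_diff\<close> and the Lipschitz bounds they are of
  order m^s |x - y|, where m is the maximum of |x| and |y|, one power of m above the initial bound.
  The summand with \<open>A\<close> absorbs them: under a collision it shrinks by 2 \<alpha>_(s+1) <
  1 - r, and the room left is exactly filled by the cross terms.\<close>

lemma char_diff_lip:
  assumes g: "admissible \<psi>" and "t \<ge> 0"
  shows "\<bar>(\<psi> t x - M x) - (\<psi> t y - M y)\<bar> \<le> exp (- r * t) * (\<bar>x - y\<bar> *
    (D * max \<bar>x\<bar> \<bar>y\<bar> powr (s - 1) + A * max \<bar>x\<bar> \<bar>y\<bar> powr s))"
proof -
  define m where "m = (\<lambda>p::real\<times>real. max \<bar>fst p\<bar> \<bar>snd p\<bar>)"
  define u where "u = (\<lambda>\<tau> x. \<psi> \<tau> x - M x)"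
  define Y where "Y = (\<lambda>p. \<bar>fst p - snd p\<bar> * (D * m p powr (s - 1) + A * m p powr s))"
  have Y0: "Y p \<ge> 0" for p using D_nonneg A_nonneg by (simp add: Y_def)
  have "\<bar>u t (fst (x,y)) - u t (snd (x,y))\<bar> \<le> exp (- r * t) * Y (x,y)"
  proof (rule comparison[where K=4 and Z="\<lambda>t p. \<bar>u t (fst p) - u t (snd p)\<bar>" and Y="\<lambda>t p. exp (- r * t) * Y p"])
    note [measurable] = admissible_measurable[OF g]
    fix c t :: real and n :: nat and p :: "real \<times> real"
    assume c: "c \<ge> 0" and t: "t \<ge> 0" and H': "\<And>\<tau> p. \<tau> \<ge> 0 \<Longrightarrow> \<bar>u \<tau> (fst p) - u \<tau> (snd p)\<bar> \<le> exp (- r * \<tau>) * Y p + c * \<tau> ^ n"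
    obtain x y where p: "p = (x, y)" by (cases p)
    have H: "\<bar>u \<tau> x - u \<tau> y\<bar> \<le> exp (- r * \<tau>) * Y (x, y) + c * \<tau> ^ n" if "\<tau> \<ge> 0" for \<tau> x y
      using H'[OF that, of "(x,y)"] by simp
    define G where "G = (\<lambda>\<xi> z. collide \<psi> \<xi> z - M (\<xi> * cos (snd z)) * M (\<xi> * sin (snd z)))"
    have Gm[measurable]: "G \<xi> \<in> borel_measurable borel2" for \<xi>
      unfolding G_def by (intro borel_measurable_diff measurable_duhamel_kernel admissible_measurable[OF g]) measurable
    have Gi: "integrable (collision t) (G \<xi>)" for \<xi>
    proof (rule integrable_collision_bounded[where K=2, OF Gm])
      fix z
      have "\<bar>collide \<psi> \<xi> z\<bar> \<le> 1"
        using admissible_le_1[OF g] by (simp add: abs_mult mult_le_one)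
      then show "\<bar>G \<xi> z\<bar> \<le> 2" using M_pos[of \<xi>] M_le_1[of \<xi>] unfolding G_def M_mult by linarith
    qed
    define mm where "mm = m (x, y)"
    define d where "d = \<bar>x - y\<bar>"
    have mm: "\<bar>x\<bar> \<le> mm" "\<bar>y\<bar> \<le> mm" "mm \<ge> 0" by (auto simp: mm_def m_def)
    \<comment> \<open>Homogeneity: the increment |x - y| contributes one power of |k| to each
      summand.\<close>
    have Yscale: "Y (x * k, y * k) = d * (D * mm powr (s - 1) * \<bar>k\<bar> powr s + A * mm powr s * \<bar>k\<bar> powr (s + 1))" for k
    proof (cases "k = 0")
      case False
      have "m (x * k, y * k) = mm * \<bar>k\<bar>"
        by (auto simp: m_def mm_def abs_mult max_mult_distrib_right)
      moreover have "\<bar>x * k - y * k\<bar> = d * \<bar>k\<bar>" by (simp add: d_def abs_mult[symmetric] algebra_simps)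
      ultimately show ?thesis using mm False
        by (simp add: Y_def powr_mult powr_add powr_diff field_simps)
    qed (simp add: Y_def)
    \<comment> \<open>The first two lines come from the increments of u (\<open>T1\<close> and
      \<open>T3\<close>), the last one from the cross terms (\<open>T2\<close> and
      \<open>T4\<close>).\<close>
    define h where "h = (\<lambda>\<theta>. (D * mm powr (s - 1) * \<bar>cos \<theta>\<bar> powr s + A * mm powr s * \<bar>cos \<theta>\<bar> powr (s + 1))
        + (D * mm powr (s - 1) * \<bar>sin \<theta>\<bar> powr s + A * mm powr s * \<bar>sin \<theta>\<bar> powr (s + 1))
        + (L * D * mm powr s * \<bar>cos \<theta>\<bar> powr s + L * D * mm powr s * \<bar>sin \<theta>\<bar> powr s))"
    note ii = integrable_cos_powr[of s] integrable_sin_powr[of s] integrable_cos_powr[of "s+1"] integrable_sin_powr[of "s+1"]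
    have hi: "integrable angle h" unfolding h_def using ii s_ge by auto
    have "(\<integral>\<theta>. h \<theta> \<partial>angle) = 2 * alpha s * D * mm powr (s - 1) + (2 * A * alpha (s + 1) + 2 * L * D * alpha s) * mm powr s"
      unfolding h_def using ii s_ge
      by (simp add: integral_angle_sin_cos_powr alpha_def[symmetric] algebra_simps)
    also have "\<dots> = (1 - r) * (D * mm powr (s - 1) + A * mm powr s)"
      unfolding A_eq alpha_r by (simp add: algebra_simps)
    finally have "(\<integral>\<theta>. d * h \<theta> \<partial>angle) = d * ((1 - r) * (D * mm powr (s - 1) + A * mm powr s))"
      by simp
    then have hI: "(\<integral>\<theta>. d * h \<theta> \<partial>angle) = (1 - r) * Y (x, y)"
      by (simp add: Y_def mm_def d_def)
    have "\<bar>\<integral>z. G x z - G y z \<partial>collision t\<bar> \<le> Y (x, y) * (exp (- r * t) - exp (- t)) + (2 * c) * t ^ Suc n / Suc n"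
    proof (rule collision_bound[where H="\<lambda>\<theta>. d * h \<theta>"])
      fix \<tau> \<theta> :: real assume \<tau>: "0 \<le> \<tau>"
      define C S where "C = cos \<theta>" and "S = sin \<theta>"
      have CS: "\<bar>C\<bar> \<le> 1" "\<bar>S\<bar> \<le> 1" by (auto simp: C_def S_def)
      \<comment> \<open>Arranged such that each summand contains either an increment of u next to a
        factor bounded by 1, or u itself next to an increment of a Lipschitz function.\<close>
      have eq: "G x (\<tau>, \<theta>) - G y (\<tau>, \<theta>) = (u \<tau> (x*C) - u \<tau> (y*C)) * \<psi> \<tau> (x*S) + u \<tau> (y*C) * (\<psi> \<tau> (x*S) - \<psi> \<tau> (y*S))
         + (M (x*C) * (u \<tau> (x*S) - u \<tau> (y*S)) + u \<tau> (y*S) * (M (x*C) - M (y*C)))"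
        by (simp add: G_def u_def C_def S_def algebra_simps)
      have T1: "\<bar>(u \<tau> (x*C) - u \<tau> (y*C)) * \<psi> \<tau> (x*S)\<bar> \<le> exp (- r * \<tau>) * Y (x*C, y*C) + c * \<tau>^n"
        unfolding abs_mult using H[OF \<tau>, of "x*C" "y*C"] admissible_le_1[OF g, of \<tau> "x*S"]
        by (intro order_trans[OF mult_left_le]) auto
      have T3: "\<bar>M (x*C) * (u \<tau> (x*S) - u \<tau> (y*S))\<bar> \<le> exp (- r * \<tau>) * Y (x*S, y*S) + c * \<tau>^n"
        unfolding abs_mult using H[OF \<tau>, of "x*S" "y*S"] M_pos[of "x*C"] M_le_1[of "x*C"]
        by (intro order_trans[OF mult_left_le_one_le]) auto
      have us: "\<bar>u \<tau> (y*k)\<bar> \<le> exp (- r * \<tau>) * (D * (mm powr s * \<bar>k\<bar> powr s))" for k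
      proof -
        have "\<bar>u \<tau> (y*k)\<bar> \<le> exp (- r * \<tau>) * (D * \<bar>y*k\<bar> powr s)" unfolding u_def by (rule char_diff[OF g \<tau>])
        also have "\<bar>y*k\<bar> powr s \<le> mm powr s * \<bar>k\<bar> powr s"
          using mm s_ge by (auto simp: abs_mult powr_mult intro!: mult_right_mono powr_mono2)
        finally show ?thesis using D_nonneg by (simp add: mult_left_mono)
      qed
      have lk: "L * \<bar>x*k - y*k\<bar> \<le> L * d" if "\<bar>k\<bar> \<le> 1" for k
        using that by (auto simp: d_def L_def left_diff_distrib[symmetric] abs_mult intro!: mult_left_mono mult_left_le)
      have T2: "\<bar>u \<tau> (y*C) * (\<psi> \<tau> (x*S) - \<psi> \<tau> (y*S))\<bar> \<le> exp (- r * \<tau>) * (D * (mm powr s * \<bar>C\<bar> powr s)) * (L * d)"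
        unfolding abs_mult using char_lip[OF g \<tau>, of "x*S" "y*S"] lk[OF CS(2)] D_nonneg
        by (intro mult_mono us) auto
      have T4: "\<bar>u \<tau> (y*S) * (M (x*C) - M (y*C))\<bar> \<le> exp (- r * \<tau>) * (D * (mm powr s * \<bar>S\<bar> powr s)) * (L * d)"
        unfolding abs_mult using M_lip[of "x*C" "y*C"] lk[OF CS(1)] D_nonneg
        by (intro mult_mono us) auto
      have "\<bar>G x (\<tau>, \<theta>) - G y (\<tau>, \<theta>)\<bar> \<le> (exp (- r * \<tau>) * Y (x*C, y*C) + c * \<tau>^n) + exp (- r * \<tau>) * (D * (mm powr s * \<bar>C\<bar> powr s)) * (L * d)
         + ((exp (- r * \<tau>) * Y (x*S, y*S) + c * \<tau>^n) + exp (- r * \<tau>) * (D * (mm powr s * \<bar>S\<bar> powr s)) * (L * d))"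
        unfolding eq by (intro order_trans[OF abs_triangle_ineq] add_mono T1 T2 T3 T4)
      also have "\<dots> = exp (- r * \<tau>) * (d * h \<theta>) + (2 * c) * \<tau> ^ n"
        unfolding Yscale h_def C_def S_def by (simp add: algebra_simps)
      finally show "\<bar>G x (\<tau>, \<theta>) - G y (\<tau>, \<theta>)\<bar> \<le> exp (- r * \<tau>) * (d * h \<theta>) + (2 * c) * \<tau> ^ n" .
    qed (use t c r_less hi hI in auto)
    moreover have "u t \<xi> = exp (- t) * u 0 \<xi> + (\<integral>z. G \<xi> z \<partial>collision t)" for \<xi>
      unfolding G_def duhamel_diff_M[OF admissible_measurable[OF g] admissible_le_1[OF g] t, symmetric] u_def
      by (subst admissible_eq[OF g t, of \<xi>]) (simp add: algebra_simps)
    then have "u t x - u t y = exp (- t) * (u 0 x - u 0 y) + (\<integral>z. G x z - G y z \<partial>collision t)"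
      using Gi by (simp add: algebra_simps)
    then have "\<bar>u t x - u t y\<bar> \<le> exp (- t) * \<bar>u 0 x - u 0 y\<bar> + \<bar>\<integral>z. G x z - G y z \<partial>collision t\<bar>"
      by (simp only: abs_mult[of "exp (- t)", simplified, symmetric] abs_triangle_ineq)
    moreover have "\<bar>u 0 x - u 0 y\<bar> \<le> Y (x, y)"
    proof -
      have "\<bar>u 0 x - u 0 y\<bar> \<le> D * \<bar>x - y\<bar> * mm powr (s - 1)"
        unfolding u_def by (rule admissible_initial[OF g mm(1,2)])
      also have "\<dots> \<le> Y (x, y)"
        using A_nonneg D_nonneg by (simp add: Y_def mm_def algebra_simps)
      finally show ?thesis .
    qed
    ultimately show "\<bar>u t (fst p) - u t (snd p)\<bar> \<le> exp (- r * t) * Y p + 2 * c * t ^ Suc n / Suc n"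
      unfolding p fst_conv snd_conv by (rule add_contribution[OF _ _ _ exp_ge_zero])
  next
    fix t :: real and p :: "real \<times> real"
    have "\<bar>u t (fst p) - u t (snd p)\<bar> \<le> 4"
      using admissible_le_1[OF g, of t "fst p"] M_pos[of "fst p"] M_le_1[of "fst p"]
        admissible_le_1[OF g, of t "snd p"] M_pos[of "snd p"] M_le_1[of "snd p"] unfolding u_def by linarith
    then show "\<bar>u t (fst p) - u t (snd p)\<bar> \<le> exp (- r * t) * Y p + 4"
      using mult_nonneg_nonneg[OF exp_ge_zero Y0[of p], of "- r * t"] by linarith
  qed (use assms in auto)
  then show ?thesis by (simp add: u_def Y_def m_def)
qed

end

text \<open>For a single step the angle average of H need not match the rate: any integrable H is
  allowed, at the price of a new constant.\<close>

lemma collision_bound_exp: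
  fixes y :: "real \<times> real \<Rightarrow> real"
  assumes "y \<in> borel_measurable borel2" "t \<ge> 0" "r < 1" "integrable angle H" "\<And>\<theta>. H \<theta> \<ge> 0"
    and bd: "\<And>\<tau> \<theta>. 0 \<le> \<tau> \<Longrightarrow> \<tau> \<le> t \<Longrightarrow> sin \<theta> \<noteq> 0 \<Longrightarrow> cos \<theta> \<noteq> 0 \<Longrightarrow> \<bar>y (\<tau>, \<theta>)\<bar> \<le> exp (- r * \<tau>) * H \<theta>"
  shows "\<bar>\<integral>z. y z \<partial>collision t\<bar> \<le> exp (- r * t) * ((\<integral>\<theta>. H \<theta> \<partial>angle) / (1 - r))"
proof -
  define E where "E = (\<integral>\<theta>. H \<theta> \<partial>angle) / (1 - r)"
  have E: "0 \<le> E" unfolding E_def using assms by (intro divide_nonneg_nonneg integral_nonneg_AE) auto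
  have "\<bar>\<integral>z. y z \<partial>collision t\<bar> \<le> E * (exp (- r * t) - exp (- t)) + 0 * t ^ Suc 0 / Suc 0"
    by (rule collision_bound) (use assms in \<open>auto simp: E_def\<close>)
  moreover have "E * (exp (- r * t) - exp (- t)) \<le> E * exp (- r * t)"
    using E by (intro mult_left_mono) auto
  ultimately have "\<bar>\<integral>z. y z \<partial>collision t\<bar> \<le> E * exp (- r * t)" by linarith
  then show ?thesis by (simp add: E_def mult.commute)
qed

section \<open>Decay gained by iterating the Duhamel operator\<close>

context kac_fourier
begin

text \<open>The initial term is omitted at every step, so for d > 0 this is no longer \<psi> but the
  transform of the part \<open>G d\<close> of the solution introduced below.\<close>

primrec iter :: "(real \<Rightarrow> real \<Rightarrow> real) \<Rightarrow> nat \<Rightarrow> real \<Rightarrow> real \<Rightarrow> real" where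
  "iter \<psi> 0 = \<psi>"
| "iter \<psi> (Suc d) = duhamel (iter \<psi> d)"

lemma iter_measurable:
  assumes g: "admissible \<psi>"
  shows "(\<lambda>z. iter \<psi> d (fst z) (snd z)) \<in> borel_measurable borel2"
  by (induction d) (auto intro: measurable_duhamel admissible_measurable[OF g])

lemma iter_le_1: "admissible \<psi> \<Longrightarrow> \<bar>iter \<psi> d t \<xi>\<bar> \<le> 1"
proof (induction d arbitrary: t \<xi>)
  case (Suc d)
  then show ?case using abs_duhamel_le_1[of "iter \<psi> d" t \<xi>] iter_measurable[of \<psi> d] by simp
qed (simp add: admissible_le_1)

lemma integrable_sin_powr_neg: "0 < a \<Longrightarrow> a < 1 \<Longrightarrow> integrable angle (\<lambda>\<theta>. \<bar>sin \<theta>\<bar> powr (- a))"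
  and integrable_cos_powr_neg: "0 < a \<Longrightarrow> a < 1 \<Longrightarrow> integrable angle (\<lambda>\<theta>. \<bar>cos \<theta>\<bar> powr (- a))"
  using integrable_angle_sin_powr_neg[of a] integral_angle_sin_cos_powr(2)[of "-a"] by auto

lemmas integrable_weights = integrable_sin_powr_neg[of "2*q"] integrable_cos_powr_neg[of "2*q"]
  integrable_sin_powr_neg[of "3/4"] integrable_cos_powr_neg[of "3/4"]

text \<open>Each product gains q at the cost of |sin|^-2q + |cos|^-2q, integrable as 2q \<le> 1/2.
  Here constants may grow with d, because only one fixed d is used in the end; they do not depend on
  t or \<psi>.\<close>

lemma iter_decay:
  "\<exists>C\<ge>0. \<forall>\<psi>. admissible \<psi> \<longrightarrow> (\<forall>t\<ge>0. \<forall>\<xi>. \<bar>iter \<psi> d t \<xi>\<bar> \<le> C * W (- (q * Suc d)) \<xi>)"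
proof (induction d)
  case 0
  show ?case using char_decay by (intro exI[of _ 1]) auto
next
  case (Suc d)
  then obtain C where C: "C \<ge> 0" "\<And>\<psi> t \<xi>. admissible \<psi> \<Longrightarrow> t \<ge> 0 \<Longrightarrow> \<bar>iter \<psi> d t \<xi>\<bar> \<le> C * W (- (q * Suc d)) \<xi>"
    by blast
  define b where "b = q * Suc d"
  have b: "b \<ge> q" using q_pos by (simp add: b_def mult_le_cancel_left1)
  define k where "k = (\<lambda>\<theta>::real. \<bar>sin \<theta>\<bar> powr (- (2*q)) + \<bar>cos \<theta>\<bar> powr (- (2*q)))"
  have ki: "integrable angle k" unfolding k_def using integrable_weights(1,2) q_pos q_le by auto
  define K where "K = C * C * 2 powr b"
  have K: "K \<ge> 0" using C by (simp add: K_def)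
  show ?case
  proof (intro exI[of _ "K * (\<integral>\<theta>. k \<theta> \<partial>angle)"] conjI allI impI)
    show "K * (\<integral>\<theta>. k \<theta> \<partial>angle) \<ge> 0" using K by (intro mult_nonneg_nonneg integral_nonneg_AE) (auto simp: k_def)
    fix \<psi> :: "real \<Rightarrow> real \<Rightarrow> real" and t \<xi> :: real assume g: "admissible \<psi>" and t: "t \<ge> 0"
    have "\<bar>duhamel (iter \<psi> d) t \<xi>\<bar> \<le> exp (- 0 * t) * ((\<integral>\<theta>. K * W (- b - q) \<xi> * k \<theta> \<partial>angle) / (1 - 0))"
      unfolding duhamel_def
    proof (rule collision_bound_exp)
      fix \<tau> \<theta> :: real assume h: "0 \<le> \<tau>" "sin \<theta> \<noteq> 0" "cos \<theta> \<noteq> 0"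
      have "\<bar>iter \<psi> d \<tau> (\<xi> * cos \<theta>) * iter \<psi> d \<tau> (\<xi> * sin \<theta>)\<bar> \<le> (C * W (- b) (\<xi> * cos \<theta>)) * (C * W (- b) (\<xi> * sin \<theta>))"
        unfolding abs_mult b_def using C(1) by (intro mult_mono C(2) g h) auto
      also have "\<dots> = C * C * (W (- b) (\<xi> * cos \<theta>) * W (- b) (\<xi> * sin \<theta>))" by simp
      also have "\<dots> \<le> C * C * (2 powr b * W (- b - q) \<xi> * k \<theta>)"
        unfolding k_def using h q_pos b C by (intro mult_left_mono W_cos_sin_same) auto
      finally show "\<bar>collide (iter \<psi> d) \<xi> (\<tau>, \<theta>)\<bar>
        \<le> exp (- 0 * \<tau>) * (K * W (- b - q) \<xi> * k \<theta>)" by (simp add: K_def mult_ac)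
    qed (use t ki K in \<open>auto intro!: measurable_duhamel_kernel iter_measurable g simp: k_def\<close>)
    then show "\<bar>iter \<psi> (Suc d) t \<xi>\<bar> \<le> K * (\<integral>\<theta>. k \<theta> \<partial>angle) * W (- (q * real (Suc (Suc d)))) \<xi>"
      by (simp add: b_def algebra_simps)
  qed
qed

text \<open>A product of two functions bounded by 1 at most doubles the Lipschitz constant. No decay
  is obtained for the increments, which costs one extra iteration in
  \<open>iter_diff_lip\<close>.\<close>

lemma iter_lip:
  "\<exists>C\<ge>0. \<forall>\<psi>. admissible \<psi> \<longrightarrow> (\<forall>t\<ge>0. \<forall>x y. \<bar>iter \<psi> d t x - iter \<psi> d t y\<bar> \<le> C * \<bar>x - y\<bar>)"
proof (induction d)
  case 0
  show ?case using char_lip by (intro exI[of _ L]) (auto simp: L_def)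
next
  case (Suc d)
  then obtain C where C: "C \<ge> 0" "\<And>\<psi> t x y. admissible \<psi> \<Longrightarrow> t \<ge> 0 \<Longrightarrow> \<bar>iter \<psi> d t x - iter \<psi> d t y\<bar> \<le> C * \<bar>x - y\<bar>"
    by blast
  show ?case
  proof (intro exI[of _ "2 * C"] conjI allI impI)
    show "2 * C \<ge> 0" using C by simp
    fix \<psi> :: "real \<Rightarrow> real \<Rightarrow> real" and t x y :: real assume g: "admissible \<psi>" and t: "t \<ge> 0"
    have "\<bar>duhamel (iter \<psi> d) t x - duhamel (iter \<psi> d) t y\<bar> \<le> exp (- 0 * t) * ((\<integral>\<theta>. 2 * C * \<bar>x - y\<bar> \<partial>angle) / (1 - 0))"
      unfolding duhamel_diff[OF iter_measurable[OF g] iter_le_1[OF g] t]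
    proof (rule collision_bound_exp)
      fix \<tau> \<theta> :: real assume h: "0 \<le> \<tau>"
      define f where "f = iter \<psi> d \<tau>"
      have f1: "\<bar>f z\<bar> \<le> 1" for z unfolding f_def by (rule iter_le_1[OF g])
      have lip: "\<bar>f (x * k) - f (y * k)\<bar> \<le> C * \<bar>x - y\<bar>" if "\<bar>k\<bar> \<le> 1" for k
      proof -
        have "\<bar>f (x * k) - f (y * k)\<bar> \<le> C * \<bar>x * k - y * k\<bar>" unfolding f_def by (rule C(2)[OF g h])
        also have "\<dots> \<le> C * \<bar>x - y\<bar>"
          using that C(1) by (auto simp: left_diff_distrib[symmetric] abs_mult intro!: mult_left_mono mult_left_le)
        finally show ?thesis .
      qed
      have "f (x * cos \<theta>) * f (x * sin \<theta>) - f (y * cos \<theta>) * f (y * sin \<theta>)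
        = (f (x * cos \<theta>) - f (y * cos \<theta>)) * f (x * sin \<theta>) + f (y * cos \<theta>) * (f (x * sin \<theta>) - f (y * sin \<theta>))"
        by (simp add: algebra_simps)
      also have "\<bar>\<dots>\<bar> \<le> \<bar>f (x * cos \<theta>) - f (y * cos \<theta>)\<bar> * \<bar>f (x * sin \<theta>)\<bar> + \<bar>f (y * cos \<theta>)\<bar> * \<bar>f (x * sin \<theta>) - f (y * sin \<theta>)\<bar>"
        unfolding abs_mult[symmetric] by (rule abs_triangle_ineq)
      also have "\<dots> \<le> (C * \<bar>x - y\<bar>) * 1 + 1 * (C * \<bar>x - y\<bar>)"
        using C(1) by (intro add_mono mult_mono f1 lip) auto
      finally show "\<bar>collide (iter \<psi> d) x (\<tau>, \<theta>) -
         collide (iter \<psi> d) y (\<tau>, \<theta>)\<bar>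
        \<le> exp (- 0 * \<tau>) * (2 * C * \<bar>x - y\<bar>)" by (simp add: f_def)
    qed (use t C(1) in \<open>auto intro!: borel_measurable_diff measurable_duhamel_kernel iter_measurable g\<close>)
    then show "\<bar>iter \<psi> (Suc d) t x - iter \<psi> (Suc d) t y\<bar> \<le> 2 * C * \<bar>x - y\<bar>"
      by (simp add: angle.prob_space[simplified])
  qed
qed

lemma exp_le_rate: "t \<ge> 0 \<Longrightarrow> exp (- t) \<le> exp (- r * t)"
  using mult_right_mono[of r 1 t] r_less by simp

text \<open>Mean value theorem on the unit neighbourhood of x, where the weight changes at most by a
  constant (\<open>W_shift\<close>). The Gaussian offers any exponent; -3/8 is the one wanted in
  \<open>iter_diff_lip\<close>.\<close>

lemma M_diff_decay: "\<exists>C\<ge>0. \<forall>x \<eta>. \<bar>\<eta>\<bar> \<le> 1 \<longrightarrow> \<bar>M (x + \<eta>) - M x\<bar> \<le> \<bar>\<eta>\<bar> * (C * W (-3/8) x)"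
proof -
  obtain C where C: "C \<ge> 0" "\<And>\<xi>. M \<xi> \<le> C * W (- 1) \<xi>" using M_decay[of 1] by auto
  define K where "K = \<sigma>\<^sup>2 * C * 3 powr (3/8)"
  show ?thesis
  proof (intro exI[of _ K] conjI allI impI)
    show "K \<ge> 0" using C by (simp add: K_def)
    fix x \<eta> :: real assume e: "\<bar>\<eta>\<bar> \<le> 1"
    have "norm (M (x + \<eta>) - M x) \<le> (K * W (-3/8) x) * norm (x + \<eta> - x)"
    proof (rule field_differentiable_bound[where S="{x-1..x+1}" and f'="\<lambda>z. - (\<sigma>\<^sup>2 * z) * M z"])
      show "(M has_real_derivative - (\<sigma>\<^sup>2 * z) * M z) (at z within {x-1..x+1})" for z
        unfolding M_def by (auto intro!: derivative_eq_intros)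
      fix z assume z: "z \<in> {x-1..x+1}"
      have "\<bar>z\<bar> = (z\<^sup>2) powr (1/2)" by (simp add: powr_half_sqrt)
      also have "\<dots> \<le> W (1/2) z" unfolding W_def by (intro powr_mono2) auto
      finally have "\<bar>z\<bar> * M z \<le> W (1/2) z * (C * W (-1) z)" using C M_pos[of z] by (intro mult_mono) auto
      also have "\<dots> = C * W (-1/2) z" using W_add[of "1/2" z "-1"] by simp
      also have "\<dots> \<le> C * W (-3/8) (x + (z - x))" using C by (intro mult_left_mono) (auto intro: W_mono)
      also have "\<dots> \<le> C * (3 powr (- (- 3/8)) * W (-3/8) x)" using z C by (intro mult_left_mono W_shift) auto
      finally have "\<bar>z\<bar> * M z \<le> C * (3 powr (3/8) * W (-3/8) x)" by simp
      then have "\<sigma>\<^sup>2 * (\<bar>z\<bar> * M z) \<le> \<sigma>\<^sup>2 * (C * (3 powr (3/8) * W (-3/8) x))" by (rule mult_left_mono) simp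
      then show "norm (- (\<sigma>\<^sup>2 * z) * M z) \<le> K * W (-3/8) x"
        using M_pos[of z] by (simp add: abs_mult K_def mult_ac)
    qed (use e in auto)
    then show "\<bar>M (x + \<eta>) - M x\<bar> \<le> \<bar>\<eta>\<bar> * (K * W (-3/8) x)" by (simp add: mult.commute)
  qed
qed

text \<open>The start is |\<xi>|^s \<le> W (s/2). Each step lowers the exponent by q, because the
  products consist of one difference and one factor that decays by \<open>iter_decay\<close>.
  Omitting the initial term leaves e^-t M uncompensated, which is admissible since e^-t \<le>
  e^-rt.\<close>

lemma iter_diff:
  "\<exists>C\<ge>0. \<forall>\<psi>. admissible \<psi> \<longrightarrow> (\<forall>t\<ge>0. \<forall>\<xi>. \<bar>iter \<psi> d t \<xi> - M \<xi>\<bar> \<le> exp (- r * t) * (C * W (s/2 - q * d) \<xi>))"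
proof (induction d)
  case 0
  show ?case
  proof (intro exI[of _ D] conjI allI impI D_nonneg)
    fix \<psi> :: "real \<Rightarrow> real \<Rightarrow> real" and t \<xi> :: real assume g: "admissible \<psi>" and t: "t \<ge> 0"
    have "\<bar>\<xi>\<bar> powr s = (\<bar>\<xi>\<bar> powr 2) powr (s/2)" by (simp only: powr_powr) simp
    also have "\<dots> = (\<xi>\<^sup>2) powr (s/2)" by simp
    also have "\<dots> \<le> W (s/2) \<xi>" unfolding W_def using s_ge by (intro powr_mono2) auto
    finally have "exp (- r * t) * (D * \<bar>\<xi>\<bar> powr s) \<le> exp (- r * t) * (D * W (s/2) \<xi>)"
      using D_nonneg by (intro mult_left_mono) auto
    from order_trans[OF char_diff[OF g t] this]
    show "\<bar>iter \<psi> 0 t \<xi> - M \<xi>\<bar> \<le> exp (- r * t) * (D * W (s/2 - q * real 0) \<xi>)" by simp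
  qed
next
  case (Suc d)
  then obtain C1 where C1: "C1 \<ge> 0" "\<And>\<psi> t \<xi>. admissible \<psi> \<Longrightarrow> t \<ge> 0 \<Longrightarrow> \<bar>iter \<psi> d t \<xi> - M \<xi>\<bar> \<le> exp (- r * t) * (C1 * W (s/2 - q * d) \<xi>)"
    by blast
  obtain C2 where C2: "C2 \<ge> 0" "\<And>\<psi> t \<xi>. admissible \<psi> \<Longrightarrow> t \<ge> 0 \<Longrightarrow> \<bar>iter \<psi> d t \<xi>\<bar> \<le> C2 * W (- (q * Suc d)) \<xi>"
    using iter_decay[of d] by blast
  define b where "b = q * Suc d"
  define a where "a = s/2 - q * d"
  have b: "b \<ge> q" "b > 0" using q_pos by (simp_all add: b_def mult_le_cancel_left1)
  \<comment> \<open>In fact a + b = s/2 + q: the decay of the iterate makes up for the growth still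
    allowed to the difference.\<close>
  have ab: "a + b \<ge> q" using s_ge by (simp add: a_def b_def algebra_simps)
  obtain C3 where C3: "C3 \<ge> 0" "\<And>\<xi>. M \<xi> \<le> C3 * W (- b) \<xi>" using M_decay[OF b(2)] by auto
  define k where "k = (\<lambda>\<theta>::real. C2 * (1 + \<bar>sin \<theta>\<bar> powr (- (2*q))) + C3 * (1 + \<bar>cos \<theta>\<bar> powr (- (2*q))))"
  have ki: "integrable angle k" unfolding k_def using integrable_weights(1,2) q_pos q_le by auto
  have k0: "k \<theta> \<ge> 0" for \<theta> using C2 C3 by (simp add: k_def)
  define K where "K = C1 * 2 powr (\<bar>a\<bar> + b)"
  have K: "K \<ge> 0" using C1 by (simp add: K_def)
  define I where "I = (\<integral>\<theta>. k \<theta> \<partial>angle) / (1 - r)"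
  have I: "I \<ge> 0" unfolding I_def using r_less k0 by (intro divide_nonneg_nonneg integral_nonneg_AE) auto
  show ?case
  proof (intro exI[of _ "C3 + K * I"] conjI allI impI)
    show "C3 + K * I \<ge> 0" using K I C3 by simp
    fix \<psi> :: "real \<Rightarrow> real \<Rightarrow> real" and t \<xi> :: real assume g: "admissible \<psi>" and t: "t \<ge> 0"
    have "\<bar>duhamel (iter \<psi> d) t \<xi> - (1 - exp (- t)) * M \<xi>\<bar> \<le> exp (- r * t) * ((\<integral>\<theta>. K * W (a - q) \<xi> * k \<theta> \<partial>angle) / (1 - r))"
      unfolding duhamel_diff_M[OF iter_measurable[OF g] iter_le_1[OF g] t]
    proof (rule collision_bound_exp)
      fix \<tau> \<theta> :: real assume h: "0 \<le> \<tau>" "sin \<theta> \<noteq> 0" "cos \<theta> \<noteq> 0"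
      define x y where "x = iter \<psi> d \<tau> (\<xi> * cos \<theta>)" and "y = iter \<psi> d \<tau> (\<xi> * sin \<theta>)"
      define m n where "m = M (\<xi> * cos \<theta>)" and "n = M (\<xi> * sin \<theta>)"
      have "x * y - m * n = (x - m) * y + m * (y - n)" by (simp add: algebra_simps)
      then have "\<bar>x * y - m * n\<bar> \<le> \<bar>x - m\<bar> * \<bar>y\<bar> + \<bar>m\<bar> * \<bar>y - n\<bar>"
        using abs_triangle_ineq[of "(x - m) * y" "m * (y - n)"] by (simp add: abs_mult)
      also have "\<dots> \<le> (exp (- r * \<tau>) * (C1 * W a (\<xi> * cos \<theta>))) * (C2 * W (-b) (\<xi> * sin \<theta>))
          + (C3 * W (-b) (\<xi> * cos \<theta>)) * (exp (- r * \<tau>) * (C1 * W a (\<xi> * sin \<theta>)))"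
        unfolding x_def y_def m_def n_def a_def using C1(1) C2(1) C3 M_pos[THEN less_imp_le]
        by (intro add_mono mult_mono C1(2) C2(2)[of \<psi>, folded b_def] g h) auto
      also have "\<dots> = exp (- r * \<tau>) * C1 * (C2 * (W a (\<xi> * cos \<theta>) * W (-b) (\<xi> * sin \<theta>)) + C3 * (W a (\<xi> * sin \<theta>) * W (-b) (\<xi> * cos \<theta>)))"
        by (simp add: algebra_simps)
      also have "\<dots> \<le> exp (- r * \<tau>) * C1 * (C2 * (2 powr (\<bar>a\<bar> + b) * W (a - q) \<xi> * (1 + \<bar>sin \<theta>\<bar> powr (- (2*q))))
          + C3 * (2 powr (\<bar>a\<bar> + b) * W (a - q) \<xi> * (1 + \<bar>cos \<theta>\<bar> powr (- (2*q)))))"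
        using h q_pos b ab C1(1) C2(1) C3(1) by (intro mult_left_mono add_mono W_cos_sin) auto
      also have "\<dots> = exp (- r * \<tau>) * (K * W (a - q) \<xi> * k \<theta>)"
        by (simp add: K_def k_def algebra_simps)
      finally show "\<bar>collide (iter \<psi> d) \<xi> (\<tau>, \<theta>)
          - M (\<xi> * cos (snd (\<tau>, \<theta>))) * M (\<xi> * sin (snd (\<tau>, \<theta>)))\<bar>
        \<le> exp (- r * \<tau>) * (K * W (a - q) \<xi> * k \<theta>)" by (simp add: x_def y_def m_def n_def)
    qed (use t ki K k0 r_less in \<open>auto intro!: borel_measurable_diff measurable_duhamel_kernel iter_measurable g\<close>)
    then have "\<bar>duhamel (iter \<psi> d) t \<xi> - (1 - exp (- t)) * M \<xi>\<bar> \<le> exp (- r * t) * (K * I * W (a - q) \<xi>)"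
      by (simp add: I_def mult_ac)
    moreover have "exp (- t) * M \<xi> \<le> exp (- r * t) * (C3 * W (a - q) \<xi>)"
    proof (intro mult_mono exp_le_rate t)
      have "M \<xi> \<le> C3 * W (- b) \<xi>" by (rule C3)
      also have "\<dots> \<le> C3 * W (a - q) \<xi>" using ab C3 by (intro mult_left_mono W_mono) auto
      finally show "M \<xi> \<le> C3 * W (a - q) \<xi>" .
    qed (use M_pos[of \<xi>] in auto)
    moreover have "0 \<le> exp (- t) * M \<xi>" using M_pos[of \<xi>] by simp
    ultimately have "\<bar>iter \<psi> (Suc d) t \<xi> - M \<xi>\<bar> \<le> exp (- r * t) * (C3 * W (a - q) \<xi>) + exp (- r * t) * (K * I * W (a - q) \<xi>)"
      by (simp add: algebra_simps)
    also have "\<dots> = exp (- r * t) * ((C3 + K * I) * W (s/2 - q * real (Suc d)) \<xi>)"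
      by (simp add: a_def algebra_simps)
    finally show "\<bar>iter \<psi> (Suc d) t \<xi> - M \<xi>\<bar> \<le> exp (- r * t) * ((C3 + K * I) * W (s/2 - q * real (Suc d)) \<xi>)" .
  qed
qed

text \<open>Two kinds of terms arise. An increment of the difference times a decaying factor gains q
  as before. The difference times an increment of the iterate has only the Lipschitz bound at its
  disposal, which brings no decay, so the exponent lags one step behind \<open>iter_diff\<close>;
  this is the additional q. For these terms the weight must be carried over from \<xi> cos \<theta>
  or \<xi> sin \<theta> to \<xi> by \<open>W_scale_floor\<close>, which imposes the floor
  -3/8.\<close>

lemma iter_diff_lip:
  "\<exists>C\<ge>0. \<forall>\<psi>. admissible \<psi> \<longrightarrow> (\<forall>t\<ge>0. \<forall>\<xi> \<eta>. \<bar>\<eta>\<bar> \<le> 1 \<longrightarrow>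
     \<bar>(iter \<psi> d t (\<xi> + \<eta>) - M (\<xi> + \<eta>)) - (iter \<psi> d t \<xi> - M \<xi>)\<bar> \<le> exp (- r * t) * (\<bar>\<eta>\<bar> * (C * W (max (s/2 + q - q * d) (-3/8)) \<xi>)))"
proof (induction d)
  case 0
  define K where "K = (D + A) * 2 powr (s/2)"
  show ?case
  proof (intro exI[of _ K] conjI allI impI)
    show "K \<ge> 0" using D_nonneg A_nonneg by (simp add: K_def)
    fix \<psi> :: "real \<Rightarrow> real \<Rightarrow> real" and t \<xi> \<eta> :: real assume g: "admissible \<psi>" and t: "t \<ge> 0" and e: "\<bar>\<eta>\<bar> \<le> 1"
    define m where "m = max \<bar>\<xi> + \<eta>\<bar> \<bar>\<xi>\<bar>"
    have m: "0 \<le> m" "m \<le> \<bar>\<xi>\<bar> + 1" using e by (auto simp: m_def)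
    have "(\<bar>\<xi>\<bar> + 1) powr s = ((\<bar>\<xi>\<bar> + 1)\<^sup>2) powr (s/2)" by (simp add: powr_powr flip: powr_numeral)
    also have "\<dots> \<le> (2 * (1 + \<xi>\<^sup>2)) powr (s/2)"
      using s_ge zero_le_power2[of "\<bar>\<xi>\<bar> - 1"] by (intro powr_mono2) (auto simp: power2_diff power2_sum)
    also have "\<dots> = 2 powr (s/2) * W (s/2) \<xi>" by (subst powr_mult) (auto simp: W_def)
    finally have w: "(\<bar>\<xi>\<bar> + 1) powr s \<le> 2 powr (s/2) * W (s/2) \<xi>" .
    have "m powr (s - 1) \<le> (\<bar>\<xi>\<bar> + 1) powr (s - 1)" using m s_ge by (intro powr_mono2) auto
    also have "\<dots> \<le> (\<bar>\<xi>\<bar> + 1) powr s" by (intro powr_mono) auto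
    finally have m1: "m powr (s - 1) \<le> 2 powr (s/2) * W (s/2) \<xi>" using w by simp
    have "m powr s \<le> (\<bar>\<xi>\<bar> + 1) powr s" using m s_ge by (intro powr_mono2) auto
    then have m2: "m powr s \<le> 2 powr (s/2) * W (s/2) \<xi>" using w by simp
    have "\<bar>(\<psi> t (\<xi> + \<eta>) - M (\<xi> + \<eta>)) - (\<psi> t \<xi> - M \<xi>)\<bar> \<le> exp (- r * t) * (\<bar>\<xi> + \<eta> - \<xi>\<bar> * (D * m powr (s - 1) + A * m powr s))"
      unfolding m_def by (rule char_diff_lip[OF g t])
    also have "\<dots> \<le> exp (- r * t) * (\<bar>\<eta>\<bar> * (D * (2 powr (s/2) * W (s/2) \<xi>) + A * (2 powr (s/2) * W (s/2) \<xi>)))"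
      using D_nonneg A_nonneg m1 m2 by (intro mult_left_mono add_mono) (auto simp: add_nonneg_nonneg intro!: mult_left_mono add_mono)
    also have "\<dots> = exp (- r * t) * (\<bar>\<eta>\<bar> * (K * W (s/2) \<xi>))" by (simp add: K_def algebra_simps)
    also have "\<dots> \<le> exp (- r * t) * (\<bar>\<eta>\<bar> * (K * W (max (s/2 + q - q * real 0) (-3/8)) \<xi>))"
    proof -
      have "s/2 \<le> max (s/2 + q - q * real 0) (-3/8)" using q_pos by (intro max.coboundedI1) simp
      then show ?thesis using D_nonneg A_nonneg by (intro mult_left_mono W_mono) (auto simp: K_def)
    qed
    finally show "\<bar>(iter \<psi> 0 t (\<xi> + \<eta>) - M (\<xi> + \<eta>)) - (iter \<psi> 0 t \<xi> - M \<xi>)\<bar> \<le> exp (- r * t) * (\<bar>\<eta>\<bar> * (K * W (max (s/2 + q - q * real 0) (-3/8)) \<xi>))"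
      by simp
  qed
next
  case (Suc d)
  define a where "a = s/2 - q * d"
  define b where "b = q * Suc d"
  define e where "e = max (s/2 + q - q * d) (-3/8)"
  define e' where "e' = max a (-3/8)"
  have e'_eq: "max (s/2 + q - q * real (Suc d)) (-3/8) = e'" by (simp add: e'_def a_def algebra_simps)
  have b: "b \<ge> q" "b > 0" using q_pos by (simp_all add: b_def mult_le_cancel_left1)
  have eb: "e + b \<ge> q"
  proof -
    have "q \<le> s/2 + q - q * d + b" using s_ge q_pos by (simp add: b_def algebra_simps)
    then show ?thesis unfolding e_def by linarith
  qed
  have ee: "e - q \<le> e'" using q_pos unfolding e_def e'_def a_def by linarith
  obtain C1 where C1: "C1 \<ge> 0" "\<And>\<psi> t \<xi> \<eta>. admissible \<psi> \<Longrightarrow> t \<ge> 0 \<Longrightarrow> \<bar>\<eta>\<bar> \<le> 1 \<Longrightarrow>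
     \<bar>(iter \<psi> d t (\<xi> + \<eta>) - M (\<xi> + \<eta>)) - (iter \<psi> d t \<xi> - M \<xi>)\<bar> \<le> exp (- r * t) * (\<bar>\<eta>\<bar> * (C1 * W e \<xi>))"
    using Suc unfolding e_def[symmetric] by blast
  obtain C2 where C2: "C2 \<ge> 0" "\<And>\<psi> t \<xi>. admissible \<psi> \<Longrightarrow> t \<ge> 0 \<Longrightarrow> \<bar>iter \<psi> d t \<xi>\<bar> \<le> C2 * W (- b) \<xi>"
    using iter_decay[of d] unfolding b_def[symmetric] by blast
  obtain C3 where C3: "C3 \<ge> 0" "\<And>\<psi> t \<xi>. admissible \<psi> \<Longrightarrow> t \<ge> 0 \<Longrightarrow> \<bar>iter \<psi> d t \<xi> - M \<xi>\<bar> \<le> exp (- r * t) * (C3 * W a \<xi>)"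
    using iter_diff[of d] unfolding a_def[symmetric] by blast
  obtain C4 where C4: "C4 \<ge> 0" "\<And>\<psi> t x y. admissible \<psi> \<Longrightarrow> t \<ge> 0 \<Longrightarrow> \<bar>iter \<psi> d t x - iter \<psi> d t y\<bar> \<le> C4 * \<bar>x - y\<bar>"
    using iter_lip[of d] by blast
  obtain C5 where C5: "C5 \<ge> 0" "\<And>\<xi>. M \<xi> \<le> C5 * W (- b) \<xi>" using M_decay[OF b(2)] by auto
  obtain C6 where C6: "C6 \<ge> 0" "\<And>\<xi> \<eta>. \<bar>\<eta>\<bar> \<le> 1 \<Longrightarrow> \<bar>M (\<xi> + \<eta>) - M \<xi>\<bar> \<le> \<bar>\<eta>\<bar> * (C6 * W (-3/8) \<xi>)"
    using M_diff_decay by blast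
  \<comment> \<open>The factors stem from the induction hypothesis, the shift of the decaying
    factor, and \<open>W_cos_sin\<close>.\<close>
  define K where "K = C1 * 3 powr b * 2 powr (\<bar>e\<bar> + b)"
  have L0: "L \<ge> 0" by (simp add: L_def)
  have K: "K \<ge> 0" using C1 by (simp add: K_def)
  define k where "k = (\<lambda>\<theta>::real. K * C2 * (1 + \<bar>sin \<theta>\<bar> powr (- (2*q))) + C3 * C4 * (1 + \<bar>cos \<theta>\<bar> powr (-3/4))
     + (K * C5 * (1 + \<bar>cos \<theta>\<bar> powr (- (2*q))) + C3 * L * (1 + \<bar>sin \<theta>\<bar> powr (-3/4))))"
  have ki: "integrable angle k" unfolding k_def using integrable_weights q_pos q_le by auto
  have k0: "k \<theta> \<ge> 0" for \<theta> using K C2 C3 C4 C5 L0 by (simp add: k_def)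
  define I where "I = (\<integral>\<theta>. k \<theta> \<partial>angle) / (1 - r)"
  have I: "I \<ge> 0" unfolding I_def using r_less k0 by (intro divide_nonneg_nonneg integral_nonneg_AE) auto
  show ?case unfolding e'_eq
  proof (intro exI[of _ "C6 + I"] conjI allI impI)
    show "C6 + I \<ge> 0" using I C6 by simp
    fix \<psi> :: "real \<Rightarrow> real \<Rightarrow> real" and t \<xi> \<eta> :: real assume g: "admissible \<psi>" and t: "t \<ge> 0" and h1: "\<bar>\<eta>\<bar> \<le> 1"
    define G where "G = (\<lambda>\<xi> z. collide (iter \<psi> d) \<xi> z - M (\<xi> * cos (snd z)) * M (\<xi> * sin (snd z)))"
    have Gm[measurable]: "G \<xi> \<in> borel_measurable borel2" for \<xi>
      unfolding G_def by (intro borel_measurable_diff measurable_duhamel_kernel iter_measurable[OF g]) measurable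
    have Gi: "integrable (collision t) (G \<xi>)" for \<xi>
    proof (rule integrable_collision_bounded[where K=2, OF Gm])
      fix z
      have "\<bar>collide (iter \<psi> d) \<xi> z\<bar> \<le> 1"
        using iter_le_1[OF g] by (simp add: abs_mult mult_le_one)
      then show "\<bar>G \<xi> z\<bar> \<le> 2" using M_pos[of \<xi>] M_le_1[of \<xi>] unfolding G_def M_mult by linarith
    qed
    have "\<bar>\<integral>z. G (\<xi> + \<eta>) z - G \<xi> z \<partial>collision t\<bar> \<le> exp (- r * t) * ((\<integral>\<theta>. \<bar>\<eta>\<bar> * W e' \<xi> * k \<theta> \<partial>angle) / (1 - r))"
    proof (rule collision_bound_exp)
      fix \<tau> \<theta> :: real assume \<tau>: "0 \<le> \<tau>" and nz: "sin \<theta> \<noteq> 0" "cos \<theta> \<noteq> 0"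
      define C S where "C = cos \<theta>" and "S = sin \<theta>"
      have CS: "\<bar>C\<bar> \<le> 1" "\<bar>S\<bar> \<le> 1" "C \<noteq> 0" "S \<noteq> 0" "C\<^sup>2 + S\<^sup>2 = 1" "S\<^sup>2 + C\<^sup>2 = 1" using nz by (auto simp: C_def S_def)
      define f where "f = iter \<psi> d \<tau>"
      define u where "u = (\<lambda>x. f x - M x)"
      have eq: "G (\<xi> + \<eta>) (\<tau>, \<theta>) - G \<xi> (\<tau>, \<theta>) = (u (\<xi>*C + \<eta>*C) - u (\<xi>*C)) * f (\<xi>*S + \<eta>*S) + u (\<xi>*C) * (f (\<xi>*S + \<eta>*S) - f (\<xi>*S))
         + (M (\<xi>*C + \<eta>*C) * (u (\<xi>*S + \<eta>*S) - u (\<xi>*S)) + u (\<xi>*S) * (M (\<xi>*C + \<eta>*C) - M (\<xi>*C)))"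
        by (simp add: G_def u_def f_def C_def S_def algebra_simps)
      have small: "\<bar>\<eta> * z\<bar> \<le> 1" and small': "\<bar>\<eta> * z\<bar> \<le> \<bar>\<eta>\<bar>" if "\<bar>z\<bar> \<le> 1" for z
        using that h1 by (auto simp: abs_mult mult_le_one mult_left_le)
      have dec: "\<bar>h (\<xi>*z + \<eta>*z)\<bar> \<le> c * (3 powr b * W (- b) (\<xi>*z))"
        if "\<bar>z\<bar> \<le> 1" and hb: "\<And>x. \<bar>h x\<bar> \<le> c * W (- b) x" "c \<ge> 0" for h :: "real \<Rightarrow> real" and z c
      proof -
        have "\<bar>h (\<xi>*z + \<eta>*z)\<bar> \<le> c * W (- b) (\<xi>*z + \<eta>*z)" by (rule hb)
        also have "\<dots> \<le> c * (3 powr (- (- b)) * W (- b) (\<xi>*z))"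
          using small[OF that(1)] b hb(2) by (intro mult_left_mono W_shift) auto
        finally show ?thesis by simp
      qed
      have du: "\<bar>u (\<xi>*z + \<eta>*z) - u (\<xi>*z)\<bar> \<le> exp (- r * \<tau>) * (\<bar>\<eta>\<bar> * (C1 * W e (\<xi>*z)))" if "\<bar>z\<bar> \<le> 1" for z
      proof -
        have "\<bar>u (\<xi>*z + \<eta>*z) - u (\<xi>*z)\<bar> \<le> exp (- r * \<tau>) * (\<bar>\<eta>*z\<bar> * (C1 * W e (\<xi>*z)))"
          unfolding u_def f_def by (rule C1(2)[OF g \<tau> small[OF that]])
        also have "\<dots> \<le> exp (- r * \<tau>) * (\<bar>\<eta>\<bar> * (C1 * W e (\<xi>*z)))"
          using small'[OF that] C1(1) by (intro mult_left_mono mult_right_mono) auto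
        finally show ?thesis .
      qed
      \<comment> \<open>Stated for a general h because it serves twice, for the iterate and for M; z
        and w are the cosine and the sine in either order. The same holds for
        \<open>T2\<close>.\<close>
      have T1: "\<bar>(u (\<xi>*z + \<eta>*z) - u (\<xi>*z)) * h (\<xi>*w + \<eta>*w)\<bar> \<le> exp (- r * \<tau>) * (\<bar>\<eta>\<bar> * W e' \<xi> * (K * c * (1 + \<bar>w\<bar> powr (- (2*q)))))"
        if z: "\<bar>z\<bar> \<le> 1" "\<bar>w\<bar> \<le> 1" "w \<noteq> 0" "z\<^sup>2 + w\<^sup>2 = 1" and hb: "\<And>x. \<bar>h x\<bar> \<le> c * W (- b) x" "c \<ge> 0" for z w h c
      proof -
        have "\<bar>(u (\<xi>*z + \<eta>*z) - u (\<xi>*z)) * h (\<xi>*w + \<eta>*w)\<bar>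
          \<le> (exp (- r * \<tau>) * (\<bar>\<eta>\<bar> * (C1 * W e (\<xi>*z)))) * (c * (3 powr b * W (- b) (\<xi>*w)))"
          unfolding abs_mult[of _ "h _"] using C1(1) by (intro mult_mono du z dec hb) auto
        also have "\<dots> = exp (- r * \<tau>) * (\<bar>\<eta>\<bar> * (C1 * c * 3 powr b * (W e (\<xi>*z) * W (- b) (\<xi>*w))))"
          by simp
        also have "\<dots> \<le> exp (- r * \<tau>) * (\<bar>\<eta>\<bar> * (C1 * c * 3 powr b * (2 powr (\<bar>e\<bar> + b) * W (e - q) \<xi> * (1 + \<bar>w\<bar> powr (- (2*q))))))"
          using C1(1) hb(2) q_pos b eb z by (intro mult_left_mono W_cos_sin) auto
        also have "\<dots> \<le> exp (- r * \<tau>) * (\<bar>\<eta>\<bar> * (C1 * c * 3 powr b * (2 powr (\<bar>e\<bar> + b) * W e' \<xi> * (1 + \<bar>w\<bar> powr (- (2*q))))))"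
          using C1(1) hb(2) ee by (intro mult_left_mono mult_right_mono W_mono) auto
        finally show ?thesis by (simp add: K_def mult_ac)
      qed
      have T2: "\<bar>u (\<xi>*z) * (h (\<xi>*w + \<eta>*w) - h (\<xi>*w))\<bar> \<le> exp (- r * \<tau>) * (\<bar>\<eta>\<bar> * W e' \<xi> * (C3 * c * (1 + \<bar>z\<bar> powr (-3/4))))"
        if z: "\<bar>z\<bar> \<le> 1" "\<bar>w\<bar> \<le> 1" "z \<noteq> 0" and hb: "\<And>x y. \<bar>h x - h y\<bar> \<le> c * \<bar>x - y\<bar>" "c \<ge> 0" for z w h c
      proof -
        have "\<bar>u (\<xi>*z)\<bar> \<le> exp (- r * \<tau>) * (C3 * W a (\<xi>*z))" unfolding u_def f_def by (rule C3(2)[OF g \<tau>])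
        also have "\<dots> \<le> exp (- r * \<tau>) * (C3 * ((1 + \<bar>z\<bar> powr (-3/4)) * W e' \<xi>))"
          unfolding e'_def using C3(1) z by (intro mult_left_mono W_scale_floor) auto
        finally have u1: "\<bar>u (\<xi>*z)\<bar> \<le> exp (- r * \<tau>) * (C3 * ((1 + \<bar>z\<bar> powr (-3/4)) * W e' \<xi>))" .
        have "\<bar>h (\<xi>*w + \<eta>*w) - h (\<xi>*w)\<bar> \<le> c * \<bar>\<xi>*w + \<eta>*w - \<xi>*w\<bar>" by (rule hb)
        also have "\<dots> \<le> c * \<bar>\<eta>\<bar>" using small'[OF z(2)] hb(2) by (intro mult_left_mono) auto
        finally have "\<bar>u (\<xi>*z) * (h (\<xi>*w + \<eta>*w) - h (\<xi>*w))\<bar> \<le> (exp (- r * \<tau>) * (C3 * ((1 + \<bar>z\<bar> powr (-3/4)) * W e' \<xi>))) * (c * \<bar>\<eta>\<bar>)"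
          unfolding abs_mult using C3(1) by (intro mult_mono u1) auto
        then show ?thesis by (simp add: mult_ac)
      qed
      have "\<bar>G (\<xi> + \<eta>) (\<tau>, \<theta>) - G \<xi> (\<tau>, \<theta>)\<bar>
          \<le> exp (- r * \<tau>) * (\<bar>\<eta>\<bar> * W e' \<xi> * (K * C2 * (1 + \<bar>S\<bar> powr (- (2*q)))))
          + exp (- r * \<tau>) * (\<bar>\<eta>\<bar> * W e' \<xi> * (C3 * C4 * (1 + \<bar>C\<bar> powr (-3/4))))
          + (exp (- r * \<tau>) * (\<bar>\<eta>\<bar> * W e' \<xi> * (K * C5 * (1 + \<bar>C\<bar> powr (- (2*q)))))
          + exp (- r * \<tau>) * (\<bar>\<eta>\<bar> * W e' \<xi> * (C3 * L * (1 + \<bar>S\<bar> powr (-3/4)))))"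
        unfolding eq
      proof (intro order_trans[OF abs_triangle_ineq] add_mono)
        show "\<bar>(u (\<xi>*C + \<eta>*C) - u (\<xi>*C)) * f (\<xi>*S + \<eta>*S)\<bar> \<le> exp (- r * \<tau>) * (\<bar>\<eta>\<bar> * W e' \<xi> * (K * C2 * (1 + \<bar>S\<bar> powr (- (2*q)))))"
          using CS C2(1) C2(2)[OF g \<tau>] by (intro T1) (auto simp: f_def)
        show "\<bar>u (\<xi>*C) * (f (\<xi>*S + \<eta>*S) - f (\<xi>*S))\<bar> \<le> exp (- r * \<tau>) * (\<bar>\<eta>\<bar> * W e' \<xi> * (C3 * C4 * (1 + \<bar>C\<bar> powr (-3/4))))"
          using CS C4(1) C4(2)[OF g \<tau>] by (intro T2) (auto simp: f_def)
        show "\<bar>M (\<xi>*C + \<eta>*C) * (u (\<xi>*S + \<eta>*S) - u (\<xi>*S))\<bar> \<le> exp (- r * \<tau>) * (\<bar>\<eta>\<bar> * W e' \<xi> * (K * C5 * (1 + \<bar>C\<bar> powr (- (2*q)))))"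
          using T1[of S C M C5] CS C5 M_pos[THEN less_imp_le] by (simp add: mult.commute)
        show "\<bar>u (\<xi>*S) * (M (\<xi>*C + \<eta>*C) - M (\<xi>*C))\<bar> \<le> exp (- r * \<tau>) * (\<bar>\<eta>\<bar> * W e' \<xi> * (C3 * L * (1 + \<bar>S\<bar> powr (-3/4))))"
          using CS L0 M_lip by (intro T2) auto
      qed
      also have "\<dots> = exp (- r * \<tau>) * (\<bar>\<eta>\<bar> * W e' \<xi> * k \<theta>)"
        unfolding k_def C_def S_def by (simp only: distrib_left)
      finally show "\<bar>G (\<xi> + \<eta>) (\<tau>, \<theta>) - G \<xi> (\<tau>, \<theta>)\<bar> \<le> exp (- r * \<tau>) * (\<bar>\<eta>\<bar> * W e' \<xi> * k \<theta>)" .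
    qed (use t ki k0 r_less in auto)
    then have i: "\<bar>\<integral>z. G (\<xi> + \<eta>) z - G \<xi> z \<partial>collision t\<bar> \<le> exp (- r * t) * (\<bar>\<eta>\<bar> * (I * W e' \<xi>))"
      by (simp add: I_def mult_ac)
    have dM: "exp (- t) * \<bar>M (\<xi> + \<eta>) - M \<xi>\<bar> \<le> exp (- r * t) * (\<bar>\<eta>\<bar> * (C6 * W e' \<xi>))"
    proof (intro mult_mono exp_le_rate t)
      have "\<bar>M (\<xi> + \<eta>) - M \<xi>\<bar> \<le> \<bar>\<eta>\<bar> * (C6 * W (-3/8) \<xi>)" by (rule C6(2)[OF h1])
      also have "\<dots> \<le> \<bar>\<eta>\<bar> * (C6 * W e' \<xi>)" using C6(1) by (intro mult_left_mono W_mono) (auto simp: e'_def)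
      finally show "\<bar>M (\<xi> + \<eta>) - M \<xi>\<bar> \<le> \<bar>\<eta>\<bar> * (C6 * W e' \<xi>)" .
    qed auto
    have "duhamel (iter \<psi> d) t x - M x = (\<integral>z. G x z \<partial>collision t) - exp (- t) * M x" for x
      unfolding G_def duhamel_diff_M[OF iter_measurable[OF g] iter_le_1[OF g] t, symmetric] by (simp add: algebra_simps)
    then have "(iter \<psi> (Suc d) t (\<xi> + \<eta>) - M (\<xi> + \<eta>)) - (iter \<psi> (Suc d) t \<xi> - M \<xi>)
       = (\<integral>z. G (\<xi> + \<eta>) z - G \<xi> z \<partial>collision t) - exp (- t) * (M (\<xi> + \<eta>) - M \<xi>)"
      by (simp only: iter.simps Bochner_Integration.integral_diff[OF Gi Gi]) (simp add: right_diff_distrib)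
    also have "\<bar>\<dots>\<bar> \<le> \<bar>\<integral>z. G (\<xi> + \<eta>) z - G \<xi> z \<partial>collision t\<bar> + exp (- t) * \<bar>M (\<xi> + \<eta>) - M \<xi>\<bar>"
      by (rule order_trans[OF abs_triangle_ineq4]) (simp add: abs_mult)
    also have "\<dots> \<le> exp (- r * t) * (\<bar>\<eta>\<bar> * (I * W e' \<xi>)) + exp (- r * t) * (\<bar>\<eta>\<bar> * (C6 * W e' \<xi>))"
      by (intro add_mono i dM)
    also have "\<dots> = exp (- r * t) * (\<bar>\<eta>\<bar> * ((C6 + I) * W e' \<xi>))" by (simp add: algebra_simps)
    finally show "\<bar>(iter \<psi> (Suc d) t (\<xi> + \<eta>) - M (\<xi> + \<eta>)) - (iter \<psi> (Suc d) t \<xi> - M \<xi>)\<bar>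
      \<le> exp (- r * t) * (\<bar>\<eta>\<bar> * ((C6 + I) * W e' \<xi>))" .
  qed
qed

theorem iter_approx:
  "\<exists>d\<ge>1. \<exists>C\<ge>0. \<forall>\<psi>. admissible \<psi> \<longrightarrow> (\<forall>t\<ge>0. \<forall>\<xi>.
     \<bar>iter \<psi> d t \<xi> - M \<xi>\<bar> \<le> exp (- r * t) * C * W (-1) \<xi> \<and>
     (\<forall>\<eta>. \<bar>\<eta>\<bar> \<le> 1 \<longrightarrow> \<bar>(iter \<psi> d t (\<xi> + \<eta>) - M (\<xi> + \<eta>)) - (iter \<psi> d t \<xi> - M \<xi>)\<bar> \<le> \<bar>\<eta>\<bar> * (exp (- r * t) * C * W (-3/8) \<xi>)))"
proof -
  \<comment> \<open>This d brings the exponent of \<open>iter_diff\<close> below -1 and that of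
    \<open>iter_diff_lip\<close> down to its floor -3/8.\<close>
  obtain d :: nat where d: "(s/2 + q + 1) / q < d" using reals_Archimedean2 by blast
  then have dq: "s/2 + q + 1 < q * d" using q_pos by (simp add: field_simps)
  then have d1: "d \<ge> 1" using s_ge q_pos by (cases d) auto
  obtain C1 where C1: "C1 \<ge> 0" "\<And>\<psi> t \<xi>. admissible \<psi> \<Longrightarrow> t \<ge> 0 \<Longrightarrow> \<bar>iter \<psi> d t \<xi> - M \<xi>\<bar> \<le> exp (- r * t) * (C1 * W (s/2 - q * d) \<xi>)"
    using iter_diff[of d] by blast
  obtain C2 where C2: "C2 \<ge> 0" "\<And>\<psi> t \<xi> \<eta>. admissible \<psi> \<Longrightarrow> t \<ge> 0 \<Longrightarrow> \<bar>\<eta>\<bar> \<le> 1 \<Longrightarrow>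
     \<bar>(iter \<psi> d t (\<xi> + \<eta>) - M (\<xi> + \<eta>)) - (iter \<psi> d t \<xi> - M \<xi>)\<bar> \<le> exp (- r * t) * (\<bar>\<eta>\<bar> * (C2 * W (max (s/2 + q - q * d) (-3/8)) \<xi>))"
    using iter_diff_lip[of d] by blast
  have mx: "max (s/2 + q - q * d) (-3/8) = -3/8" using dq by simp
  show ?thesis
  proof (rule exI[of _ d], intro conjI d1, rule exI[of _ "C1 + C2"], intro conjI allI impI)
    show "C1 + C2 \<ge> 0" using C1 C2 by simp
    fix \<psi> :: "real \<Rightarrow> real \<Rightarrow> real" and t \<xi> :: real assume g: "admissible \<psi>" and t: "t \<ge> 0"
    have "C1 * W (s/2 - q * d) \<xi> \<le> (C1 + C2) * W (-1) \<xi>"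
      using C1 C2 dq q_pos by (intro mult_mono W_mono) auto
    then have "exp (- r * t) * (C1 * W (s/2 - q * d) \<xi>) \<le> exp (- r * t) * ((C1 + C2) * W (-1) \<xi>)"
      by (rule mult_left_mono) simp
    then show "\<bar>iter \<psi> d t \<xi> - M \<xi>\<bar> \<le> exp (- r * t) * (C1 + C2) * W (-1) \<xi>"
      unfolding mult.assoc by (rule order_trans[OF C1(2)[OF g t]])
    fix \<eta> :: real assume h: "\<bar>\<eta>\<bar> \<le> 1"
    have "exp (- r * t) * (\<bar>\<eta>\<bar> * (C2 * W (-3/8) \<xi>)) \<le> exp (- r * t) * (\<bar>\<eta>\<bar> * ((C1 + C2) * W (-3/8) \<xi>))"
      using C1 by (intro mult_left_mono mult_right_mono) auto
    then show "\<bar>(iter \<psi> d t (\<xi> + \<eta>) - M (\<xi> + \<eta>)) - (iter \<psi> d t \<xi> - M \<xi>)\<bar> \<le> \<bar>\<eta>\<bar> * (exp (- r * t) * (C1 + C2) * W (-3/8) \<xi>)"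
      using C2(2)[OF g t h, of \<xi>] unfolding mx by (simp add: mult_ac)
  qed
qed

end

section \<open>Fourier inversion\<close>

text \<open>\<open>ennreal\<close> cuts off negative values, so the two densities are the positive
  and the negative part of g. They define measures that agree on half-open intervals, an
  intersection-stable generator, and hence coincide; but the two parts of a number agree only if it
  is 0.\<close>

lemma AE_eq_0_if_Ioc_integrals_0:
  fixes g :: "real \<Rightarrow> real"
  assumes [measurable]: "g \<in> borel_measurable borel"
    and int: "\<And>a b. set_integrable lborel {a<..b} g"
    and zero: "\<And>a b. a \<le> b \<Longrightarrow> (LBINT x:{a<..b}. g x) = 0"
  shows "AE x in lborel. g x = 0"
proof -
  let ?P = "density lborel (\<lambda>x. ennreal (g x))" and ?N = "density lborel (\<lambda>x. ennreal (- g x))"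
  have fin: "emeasure (density lborel (\<lambda>x. ennreal (h x))) {a<..b} = ennreal (\<integral>x. max 0 (indicator {a<..b} x * h x) \<partial>lborel)"
    if h: "set_integrable lborel {a<..b} h" "h \<in> borel_measurable borel" for h :: "real \<Rightarrow> real" and a b
  proof -
    note [measurable] = h(2)
    have "emeasure (density lborel (\<lambda>x. ennreal (h x))) {a<..b} = (\<integral>\<^sup>+x. ennreal (max 0 (indicator {a<..b} x * h x)) \<partial>lborel)"
      by (subst emeasure_density) (auto intro!: nn_integral_cong simp: ennreal_max_0 split: split_indicator)
    also have "\<dots> = ennreal (\<integral>x. max 0 (indicator {a<..b} x * h x) \<partial>lborel)"
      using h(1) by (intro nn_integral_eq_integral integrable_max) (auto simp: set_integrable_def)
    finally show ?thesis .
  qed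
  have neg: "set_integrable lborel {a<..b} (\<lambda>x. - g x)" for a b
    using int[of a b] by (simp add: set_integrable_def)
  have eq: "emeasure ?P {a<..b} = emeasure ?N {a<..b}" for a b
  proof (cases "a \<le> b")
    case True
    have "(\<integral>x. max 0 (indicator {a<..b} x * g x) \<partial>lborel) - (\<integral>x. max 0 (indicator {a<..b} x * (- g x)) \<partial>lborel)
      = (\<integral>x. max 0 (indicator {a<..b} x * g x) - max 0 (indicator {a<..b} x * (- g x)) \<partial>lborel)"
      using int[of a b] neg[of a b] by (intro Bochner_Integration.integral_diff[symmetric] integrable_max) (auto simp: set_integrable_def)
    also have "\<dots> = (LBINT x:{a<..b}. g x)" unfolding set_lebesgue_integral_def
      by (intro Bochner_Integration.integral_cong) (auto split: split_indicator)
    finally show ?thesis using zero[OF True] fin[OF int[of a b]] fin[OF neg[of a b]] by simp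
  qed simp
  have "?P = ?N"
  proof (rule measure_eqI_generator_eq[where E="range (\<lambda>(a, b). {a<..b::real})" and \<Omega>=UNIV and A="\<lambda>i. {- real i<..real i}"])
    show "Int_stable (range (\<lambda>(a, b). {a<..b::real}))"
      by (auto simp: Int_stable_def)
    show "emeasure ?P X = emeasure ?N X" if "X \<in> range (\<lambda>(a, b). {a<..b::real})" for X using eq that by auto
    show "(\<Union>i. {- real i<..real i}) = UNIV"
    proof (rule UNIV_eq_I[symmetric])
      fix x :: real
      obtain n :: nat where "\<bar>x\<bar> < n" using reals_Archimedean2 by blast
      then show "x \<in> (\<Union>i. {- real i<..real i})" by (auto intro!: exI[of _ n])
    qed
    show "emeasure ?P {- real i<..real i} \<noteq> \<infinity>" for i using int by (subst fin) auto
  qed (auto simp: borel_sigma_sets_Ioc)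
  then have "AE x in lborel. ennreal (g x) = ennreal (- g x)"
    by (subst (asm) sigma_finite_measure.density_unique_iff[OF sigma_finite_lborel]) auto
  then show ?thesis
  proof eventually_elim
    case (elim x)
    then show ?case by (cases "g x \<ge> 0") (auto simp: ennreal_neg ennreal_eq_0_iff)
  qed
qed

lemma integrable_W:
  assumes "e < - 1/2" shows "integrable lborel (W e)"
proof -
  define p where "p = (\<lambda>x::real. indicator {1..} x * x powr (2*e))"
  have "((\<lambda>x::real. x powr (2*e)) has_integral (-(1 powr (2*e+1)) / (2*e+1))) {1..}"
    using assms by (intro has_integral_powr_to_inf) auto
  then have "(\<integral>\<^sup>+x. ennreal (x powr (2*e)) * indicator {1..} x \<partial>lborel) = ennreal (-(1 powr (2*e+1)) / (2*e+1))"
    by (intro nn_integral_has_integral_lebesgue') auto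
  also have "(\<lambda>x. ennreal (x powr (2*e)) * indicator {1..} x) = (\<lambda>x. ennreal (p x))"
    by (auto simp: p_def fun_eq_iff split: split_indicator)
  finally have p: "integrable lborel p"
    by (intro integrableI_nonneg) (auto simp: p_def)
  have "integrable lborel (\<lambda>x. indicator {-1..1} x + p (0 + 1*x) + p (0 + (-1)*x))"
    using p by (intro Bochner_Integration.integrable_add, simp) (subst lborel_integrable_real_affine_iff; simp)+
  then show ?thesis
  proof (rule Bochner_Integration.integrable_bound)
    show "AE x in lborel. norm (W e x) \<le> norm (indicator {-1..1} x + p (0 + 1*x) + p (0 + (-1)*x) :: real)"
    proof (rule AE_I2)
      fix x :: real
      have big: "W e y \<le> \<bar>y\<bar> powr (2*e)" if "\<bar>y\<bar> \<ge> 1" for y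
      proof -
        have "W e y \<le> (y\<^sup>2) powr e" unfolding W_def using assms that by (intro powr_mono2') auto
        also have "y\<^sup>2 = \<bar>y\<bar> powr 2" by simp
        also have "\<dots> powr e = \<bar>y\<bar> powr (2*e)" by (rule powr_powr)
        finally show ?thesis .
      qed
      consider "\<bar>x\<bar> \<le> 1" | "x > 1" | "x < -1" by linarith
      then have "W e x \<le> indicator {-1..1} x + p (0 + 1*x) + p (0 + (-1)*x)"
      proof cases
        case 1 then show ?thesis using W_le_1[of e x] assms by (auto simp: p_def indicator_def)
      qed (use big[of x] in \<open>auto simp: p_def\<close>)
      then show "norm (W e x) \<le> norm (indicator {-1..1} x + p (0 + 1*x) + p (0 + (-1)*x) :: real)" by simp
    qed
  qed simp
qed

section \<open>Inversion of the transform of a difference of two densities\<close>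

lemma integrable_mult_iexp:
  fixes f :: "real \<Rightarrow> complex"
  assumes "integrable lborel f" shows "integrable lborel (\<lambda>x. f x * iexp (c * x))" "integrable lborel (\<lambda>x. iexp (c * x) * f x)"
proof -
  have [measurable]: "f \<in> borel_measurable borel" using assms by (auto dest: borel_measurable_integrable)
  show "integrable lborel (\<lambda>x. f x * iexp (c * x))"
    by (rule Bochner_Integration.integrable_bound[OF assms]) (auto simp: norm_mult)
  then show "integrable lborel (\<lambda>x. iexp (c * x) * f x)" by (simp add: mult.commute)
qed

lemma prob_density_real_distribution:
  assumes "prob_density_fun F" shows "real_distribution (distr_of F)"
proof -
  have F: "\<And>x. 0 \<le> F x" "integrable lborel F" "(LBINT x. F x) = 1" using assms by (auto simp: prob_density_fun_def)
  then have [measurable]: "F \<in> borel_measurable borel" by (auto dest: borel_measurable_integrable)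
  have "(\<integral>\<^sup>+x. ennreal (F x) \<partial>lborel) = 1" using F by (simp add: nn_integral_eq_integral)
  then have "prob_space (distr_of F)" by (intro prob_spaceI) (simp add: emeasure_density)
  then show ?thesis by (simp add: real_distribution_def real_distribution_axioms_def)
qed

lemma char_density:
  assumes "prob_density_fun F"
  shows "char (distr_of F) \<xi> = (\<integral>x. of_real (F x) * iexp (\<xi> * x) \<partial>lborel)"
proof -
  have F: "\<And>x. 0 \<le> F x" "F \<in> borel_measurable borel" using assms by (auto simp: prob_density_fun_def dest: borel_measurable_integrable)
  then show ?thesis unfolding char_def
    by (subst integral_density) (auto simp: scaleR_conv_of_real)
qed

text \<open>The factor in Levy's inversion formula: the transform, at frequency -t, of the indicator
  of the interval from a to b. At t = 0 division by zero yields 0 instead of b - a, on a null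
  set.\<close>

definition kernel :: "real \<Rightarrow> real \<Rightarrow> real \<Rightarrow> complex" where
  "kernel a b t = (iexp (-(t * a)) - iexp (-(t * b))) / (\<i> * t)"

lemma kernel_measurable [measurable]: "kernel a b \<in> borel_measurable borel" unfolding kernel_def by measurable

lemma norm_kernel_le: "a \<le> b \<Longrightarrow> cmod (kernel a b t) \<le> b - a"
proof (cases "t = 0")
  case False
  assume "a \<le> b"
  then have "cmod ((iexp ((-t) * b) - iexp ((-t) * a)) / (\<i> * complex_of_real (-t))) \<le> b - a"
    using False by (intro Levy_Inversion_aux2) auto
  also have "(iexp ((-t) * b) - iexp ((-t) * a)) / (\<i> * complex_of_real (-t)) = kernel a b t"
    using False by (simp add: kernel_def field_simps)
  finally show ?thesis .
qed (simp add: kernel_def)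

lemma kernel_eq_integral:
  assumes "a \<le> b" "t \<noteq> 0" shows "kernel a b t = (CLBINT x:{a<..b}. iexp (-(t * x)))"
proof -
  have "(CLBINT x=a..b. iexp (-(t * x))) = (\<i> / t * iexp (- (t * b))) - (\<i> / t * iexp (- (t * a)))"
    using assms by (intro interval_integral_FTC_finite[where F="\<lambda>x. \<i> / t * iexp (- (t * x))"])
      (auto intro!: derivative_eq_intros continuous_intros simp: has_vector_derivative_complex_iff Re_exp Im_exp)
  also have "\<dots> = kernel a b t" using assms by (simp add: kernel_def field_simps)
  finally show ?thesis using assms by (simp add: interval_integral_Ioc)
qed

text \<open>The two characteristic functions need not be integrable, only their difference is. The
  truncated inversion integrals are therefore subtracted before the limit, which is then taken by
  dominated convergence with majorant (b - a) |w|.\<close>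

lemma Levy_integrable:
  fixes w :: "real \<Rightarrow> complex"
  assumes F: "prob_density_fun F" and N: "prob_density_fun N"
    and w: "\<And>\<xi>. w \<xi> = char (distr_of F) \<xi> - char (distr_of N) \<xi>"
    and wi: "integrable lborel w" and ab: "a \<le> b"
  shows "complex_of_real (LBINT x:{a<..b}. F x - N x) = 1 / (2*pi) * (\<integral>\<xi>. kernel a b \<xi> * w \<xi> \<partial>lborel)"
proof -
  \<comment> \<open>Levy's formula asks that the end points of the interval are not atoms.\<close>
  have meas: "measure (distr_of G) {c} = 0" if G: "prob_density_fun G" for G c
  proof -
    have [measurable]: "G \<in> borel_measurable borel" using G by (auto simp: prob_density_fun_def dest: borel_measurable_integrable)
    have "emeasure (distr_of G) {c} = (\<integral>\<^sup>+x. ennreal (G x) * indicator {c} x \<partial>lborel)" by (subst emeasure_density) auto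
    also have "\<dots> = 0" using AE_lborel_singleton[of c] by (subst nn_integral_0_iff_AE) (auto elim!: eventually_mono)
    finally show ?thesis by (simp add: measure_def)
  qed
  have Ioc: "measure (distr_of G) {a<..b} = (LBINT x:{a<..b}. G x)" if G: "prob_density_fun G" for G
  proof -
    have [measurable]: "G \<in> borel_measurable borel" and G': "\<And>x. 0 \<le> G x" "integrable lborel G"
      using G by (auto simp: prob_density_fun_def dest: borel_measurable_integrable)
    have "emeasure (distr_of G) {a<..b} = (\<integral>\<^sup>+x. ennreal (indicator {a<..b} x * G x) \<partial>lborel)"
      by (subst emeasure_density) (auto intro!: nn_integral_cong split: split_indicator)
    also have "\<dots> = ennreal (\<integral>x. indicator {a<..b} x * G x \<partial>lborel)"
      using G' integrable_mult_indicator[of "{a<..b}" lborel G] by (intro nn_integral_eq_integral) auto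
    finally show ?thesis using G' by (simp add: measure_def set_lebesgue_integral_def integral_nonneg_AE)
  qed
  have "set_integrable lborel {a<..b} F" "set_integrable lborel {a<..b} N"
    using F N by (auto simp: prob_density_fun_def set_integrable_def simp del: real_scaleR_def intro!: integrable_mult_indicator)
  then have lhs: "(LBINT x:{a<..b}. F x - N x) = measure (distr_of F) {a<..b} - measure (distr_of N) {a<..b}"
    using Ioc[OF F] Ioc[OF N] by simp
  interpret F: real_distribution "distr_of F" by (rule prob_density_real_distribution[OF F])
  interpret N: real_distribution "distr_of N" by (rule prob_density_real_distribution[OF N])
  have bint: "set_integrable lborel {-real T..real T} (\<lambda>t. kernel a b t * char (distr_of G) t)"
    if G: "real_distribution (distr_of G)" for T :: nat and G
  proof -
    interpret G: real_distribution "distr_of G" by (rule G)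
    show ?thesis unfolding set_integrable_def
    proof (rule integrableI_bounded_set_indicator[where B="b - a"])
      show "AE x in lborel. x \<in> {- real T..real T} \<longrightarrow> norm (kernel a b x * char (distr_of G) x) \<le> b - a"
        using mult_mono[OF norm_kernel_le[OF ab] G.cmod_char_le_1] ab by (auto simp: norm_mult)
    qed (auto intro: kernel_measurable G.char_measurable)
  qed
  have "(\<lambda>T. 1 / (2 * pi) * (CLBINT t=-real T..real T. kernel a b t * char (distr_of F) t) - 1 / (2 * pi) * (CLBINT t=-real T..real T. kernel a b t * char (distr_of N) t))
     \<longlonglongrightarrow> of_real (measure (distr_of F) {a<..b}) - of_real (measure (distr_of N) {a<..b})"
    unfolding kernel_def using F.Levy_Inversion[OF ab meas[OF F] meas[OF F]] N.Levy_Inversion[OF ab meas[OF N] meas[OF N]]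
    by (intro tendsto_diff) simp_all
  also have "(\<lambda>T. 1 / (2 * pi) * (CLBINT t=-real T..real T. kernel a b t * char (distr_of F) t) - 1 / (2 * pi) * (CLBINT t=-real T..real T. kernel a b t * char (distr_of N) t))
    = (\<lambda>T::nat. 1 / (2 * pi) * (\<integral>t. indicator {-real T..real T} t *\<^sub>R (kernel a b t * w t) \<partial>lborel))"
  proof (rule ext)
    fix T :: nat
    have "(CLBINT t=-real T..real T. kernel a b t * char (distr_of F) t) - (CLBINT t=-real T..real T. kernel a b t * char (distr_of N) t)
      = (CLBINT t:{-real T..real T}. kernel a b t * char (distr_of F) t) - (CLBINT t:{-real T..real T}. kernel a b t * char (distr_of N) t)"
      by (simp add: interval_integral_Icc)
    also have "\<dots> = (CLBINT t:{-real T..real T}. kernel a b t * char (distr_of F) t - kernel a b t * char (distr_of N) t)"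
      by (intro set_integral_diff(2)[symmetric] bint F.real_distribution_axioms N.real_distribution_axioms)
    also have "\<dots> = (\<integral>t. indicator {-real T..real T} t *\<^sub>R (kernel a b t * w t) \<partial>lborel)"
      unfolding set_lebesgue_integral_def w by (simp add: right_diff_distrib)
    finally show "1 / (2 * pi) * (CLBINT t=-real T..real T. kernel a b t * char (distr_of F) t) - 1 / (2 * pi) * (CLBINT t=-real T..real T. kernel a b t * char (distr_of N) t)
     = 1 / (2 * pi) * (\<integral>t. indicator {-real T..real T} t *\<^sub>R (kernel a b t * w t) \<partial>lborel)"
      unfolding right_diff_distrib[symmetric] by simp
  qed
  finally have lim1: "(\<lambda>T::nat. 1 / (2 * pi) * (\<integral>t. indicator {-real T..real T} t *\<^sub>R (kernel a b t * w t) \<partial>lborel))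
    \<longlonglongrightarrow> complex_of_real (LBINT x:{a<..b}. F x - N x)" unfolding lhs by simp
  have [measurable]: "w \<in> borel_measurable borel" using wi by (auto dest: borel_measurable_integrable)
  have "(\<lambda>T::nat. (\<integral>t. indicator {-real T..real T} t *\<^sub>R (kernel a b t * w t) \<partial>lborel)) \<longlonglongrightarrow> (\<integral>\<xi>. kernel a b \<xi> * w \<xi> \<partial>lborel)"
  proof (rule integral_dominated_convergence[where w="\<lambda>x. (b - a) * norm (w x)"])
    show "integrable lborel (\<lambda>x. (b - a) * norm (w x))" using wi by simp
    show "AE x in lborel. (\<lambda>T. indicator {- real T..real T} x *\<^sub>R (kernel a b x * w x)) \<longlonglongrightarrow> kernel a b x * w x"
    proof (rule AE_I2)
      fix x :: real
      obtain n :: nat where n: "\<bar>x\<bar> < n" using reals_Archimedean2 by blast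
      have "\<forall>\<^sub>F T in sequentially. indicator {- real T..real T} x *\<^sub>R (kernel a b x * w x) = kernel a b x * w x"
        using eventually_ge_at_top[of n] by eventually_elim (use n in \<open>auto simp: indicator_def\<close>)
      then show "(\<lambda>T. indicator {- real T..real T} x *\<^sub>R (kernel a b x * w x)) \<longlonglongrightarrow> kernel a b x * w x"
        by (rule tendsto_eventually)
    qed
    show "AE x in lborel. norm (indicator {- real T..real T} x *\<^sub>R (kernel a b x * w x)) \<le> (b - a) * norm (w x)" for T
      using norm_kernel_le[OF ab] ab by (auto simp: norm_mult indicator_def intro!: mult_right_mono)
  qed measurable
  then have "(\<lambda>T::nat. 1 / (2*pi) * (\<integral>t. indicator {-real T..real T} t *\<^sub>R (kernel a b t * w t) \<partial>lborel)) \<longlonglongrightarrow> 1 / (2*pi) * (\<integral>\<xi>. kernel a b \<xi> * w \<xi> \<partial>lborel)"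
    by (intro tendsto_mult tendsto_const)
  from LIMSEQ_unique[OF lim1 this] show ?thesis .
qed

definition inv_fourier :: "(real \<Rightarrow> complex) \<Rightarrow> real \<Rightarrow> complex" where
  "inv_fourier w x = 1 / (2*pi) * (\<integral>\<xi>. iexp (-(\<xi> * x)) * w \<xi> \<partial>lborel)"

lemma inv_fourier_measurable [measurable]:
  assumes [measurable]: "w \<in> borel_measurable borel"
  shows "inv_fourier w \<in> borel_measurable borel"
  unfolding inv_fourier_def by measurable

lemma norm_inv_fourier_le: "cmod (inv_fourier w x) \<le> 1 / (2*pi) * (\<integral>\<xi>. cmod (w \<xi>) \<partial>lborel)"
proof -
  have "cmod (\<integral>\<xi>. iexp (-(\<xi> * x)) * w \<xi> \<partial>lborel) \<le> (\<integral>\<xi>. cmod (iexp (-(\<xi> * x)) * w \<xi>) \<partial>lborel)"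
    by (rule integral_norm_bound)
  then show ?thesis by (simp add: inv_fourier_def norm_mult norm_divide divide_right_mono)
qed

text \<open>Both sides have the same integral over every interval: by Fubini the inverse transform
  integrates to the expression with \<open>kernel\<close>, which \<open>Levy_integrable\<close>
  identifies. Real and imaginary part are compared separately, since the vanishing criterion is for
  real functions.\<close>

theorem fourier_inversion:
  fixes w :: "real \<Rightarrow> complex"
  assumes F: "prob_density_fun F" and N: "prob_density_fun N"
    and w: "\<And>\<xi>. w \<xi> = char (distr_of F) \<xi> - char (distr_of N) \<xi>"
    and wi: "integrable lborel w"
  shows "AE x in lborel. complex_of_real (F x - N x) = inv_fourier w x"
proof -
  have [measurable]: "w \<in> borel_measurable borel" using wi by (auto dest: borel_measurable_integrable)
  have Fm[measurable]: "F \<in> borel_measurable borel" "N \<in> borel_measurable borel" and Fi: "integrable lborel F" "integrable lborel N"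
    using F N by (auto simp: prob_density_fun_def dest: borel_measurable_integrable)
  have si: "set_integrable lborel {a<..b} (inv_fourier w)" for a b
    unfolding set_integrable_def
  proof (rule integrableI_bounded_set_indicator[where B="1 / (2*pi) * (\<integral>\<xi>. cmod (w \<xi>) \<partial>lborel)"])
    show "emeasure lborel {a<..b} < \<infinity>"
      by (rule le_less_trans[OF emeasure_mono[of _ "{a..b}"]]) (auto simp: emeasure_lborel_Icc_eq)
    show "AE x in lborel. x \<in> {a<..b} \<longrightarrow> norm (inv_fourier w x) \<le> 1 / (2*pi) * (\<integral>\<xi>. cmod (w \<xi>) \<partial>lborel)"
      by (intro AE_I2 impI norm_inv_fourier_le)
  qed auto
  have eq: "(CLBINT x:{a<..b}. inv_fourier w x) = complex_of_real (LBINT x:{a<..b}. F x - N x)" if ab: "a \<le> b" for a b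
  proof -
    have "(CLBINT x:{a<..b}. inv_fourier w x) = 1/(2*pi) * (\<integral>x. (\<integral>\<xi>. indicator {a<..b} x *\<^sub>R (iexp (-(\<xi> * x)) * w \<xi>) \<partial>lborel) \<partial>lborel)"
      unfolding set_lebesgue_integral_def inv_fourier_def
      by (subst integral_mult_right_zero[symmetric]) (simp add: mult.left_commute scaleR_conv_of_real)
    also have "(\<integral>x. (\<integral>\<xi>. indicator {a<..b} x *\<^sub>R (iexp (-(\<xi> * x)) * w \<xi>) \<partial>lborel) \<partial>lborel)
       = (\<integral>\<xi>. (\<integral>x. indicator {a<..b} x *\<^sub>R (iexp (-(\<xi> * x)) * w \<xi>) \<partial>lborel) \<partial>lborel)"
    proof (rule lborel_pair.Fubini_integral[symmetric])
      have "integrable (lborel \<Otimes>\<^sub>M lborel) (\<lambda>z. indicator {a<..b} (fst z) *\<^sub>R (iexp (-(snd z * fst z)) * w (snd z)))"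
      proof (rule lborel_pair.Fubini_integrable)
        have eq: "(\<lambda>x. \<integral>y. norm (indicator {a<..b} (fst (x, y)) *\<^sub>R (iexp (- (snd (x, y) * fst (x, y))) * w (snd (x, y)))) \<partial>lborel)
           = (\<lambda>x. indicator {a<..b} x *\<^sub>R (\<integral>y. norm (w y) \<partial>lborel))"
          by (rule ext) (simp add: norm_mult indicator_def)
        show "integrable lborel (\<lambda>x. \<integral>y. norm (indicator {a<..b} (fst (x, y)) *\<^sub>R (iexp (- (snd (x, y) * fst (x, y))) * w (snd (x, y)))) \<partial>lborel)"
          unfolding eq using ab by (intro integrable_scaleR_left integrable_real_indicator) auto
        show "AE x in lborel. integrable lborel (\<lambda>y. indicator {a<..b} (fst (x, y)) *\<^sub>R (iexp (- (snd (x, y) * fst (x, y))) * w (snd (x, y))))"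
        proof (rule AE_I2)
          fix x :: real
          show "integrable lborel (\<lambda>y. indicator {a<..b} (fst (x, y)) *\<^sub>R (iexp (- (snd (x, y) * fst (x, y))) * w (snd (x, y))))"
            using integrable_mult_iexp(2)[OF wi, of "-x"] by (simp add: mult.commute)
        qed
      qed measurable
      then show "integrable (lborel \<Otimes>\<^sub>M lborel) (\<lambda>(x, \<xi>). indicator {a<..b} x *\<^sub>R (iexp (-(\<xi> * x)) * w \<xi>))"
        by (simp add: split_def)
    qed
    also have "\<dots> = (\<integral>\<xi>. kernel a b \<xi> * w \<xi> \<partial>lborel)"
    proof (rule integral_cong_AE)
      show "AE \<xi> in lborel. (\<integral>x. indicator {a<..b} x *\<^sub>R (iexp (-(\<xi> * x)) * w \<xi>) \<partial>lborel) = kernel a b \<xi> * w \<xi>"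
        using AE_lborel_singleton[of 0]
      proof eventually_elim
        case (elim \<xi>)
        show ?case unfolding kernel_eq_integral[OF ab elim] set_lebesgue_integral_def
          by (subst integral_mult_left_zero[symmetric]) simp
      qed
    qed measurable
    finally show ?thesis unfolding Levy_integrable[OF F N w wi ab] .
  qed
  have Re0: "AE x in lborel. (F x - N x) - Re (inv_fourier w x) = 0"
  proof (rule AE_eq_0_if_Ioc_integrals_0)
    have i1: "set_integrable lborel {a<..b} (\<lambda>x. F x - N x)" for a b
      unfolding set_integrable_def using Fi
      by (intro integrable_mult_indicator Bochner_Integration.integrable_diff) auto
    have i2: "set_integrable lborel {a<..b} (\<lambda>x. Re (inv_fourier w x))" for a b
      using integrable_Re[OF si[unfolded set_integrable_def]] by (simp add: set_integrable_def)
    show "set_integrable lborel {a<..b} (\<lambda>x. (F x - N x) - Re (inv_fourier w x))" for a b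
      by (intro set_integral_diff i1 i2)
    have "(LBINT x:{a<..b}. Re (inv_fourier w x)) = Re (CLBINT x:{a<..b}. inv_fourier w x)" for a b
      using integral_Re[OF si[unfolded set_integrable_def]] by (simp add: set_lebesgue_integral_def)
    then show "(LBINT x:{a<..b}. (F x - N x) - Re (inv_fourier w x)) = 0" if "a \<le> b" for a b
      using eq[OF that] by (subst set_integral_diff(2)[OF i1 i2]) simp
  qed measurable
  have Im0: "AE x in lborel. Im (inv_fourier w x) = 0"
  proof (rule AE_eq_0_if_Ioc_integrals_0)
    show "set_integrable lborel {a<..b} (\<lambda>x. Im (inv_fourier w x))" for a b
      using integrable_Im[OF si[unfolded set_integrable_def]] by (simp add: set_integrable_def)
    have "(LBINT x:{a<..b}. Im (inv_fourier w x)) = Im (CLBINT x:{a<..b}. inv_fourier w x)" for a b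
      using integral_Im[OF si[unfolded set_integrable_def]] by (simp add: set_lebesgue_integral_def)
    then show "(LBINT x:{a<..b}. Im (inv_fourier w x)) = 0" if "a \<le> b" for a b
      using eq[OF that] by simp
  qed measurable
  show ?thesis using Re0 Im0 by eventually_elim (simp add: complex_eq_iff)
qed

text \<open>As w is integrable, k is almost everywhere bounded by
  \<open>norm_inv_fourier_le\<close>, so an integrable k is also square integrable, and the identity
  is one exchange of integrals.\<close>

theorem plancherel:
  fixes k w :: "real \<Rightarrow> complex"
  assumes k: "integrable lborel k" and w: "integrable lborel w"
    and fw: "\<And>\<xi>. w \<xi> = (\<integral>x. k x * iexp (\<xi> * x) \<partial>lborel)"
    and inv: "AE x in lborel. k x = inv_fourier w x"
  shows "(\<integral>x. (cmod (k x))\<^sup>2 \<partial>lborel) = 1 / (2*pi) * (\<integral>\<xi>. (cmod (w \<xi>))\<^sup>2 \<partial>lborel)"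
    and "integrable lborel (\<lambda>x. (cmod (k x))\<^sup>2)"
proof -
  have [measurable]: "cnj \<in> borel_measurable borel"
    by (intro borel_measurable_continuous_onI continuous_intros)
  have [measurable]: "k \<in> borel_measurable borel" "w \<in> borel_measurable borel"
    using k w by (auto dest: borel_measurable_integrable)
  have "integrable lborel (\<lambda>x. k x * cnj (k x))"
  proof (rule Bochner_Integration.integrable_bound[OF integrable_mult_right[OF integrable_norm[OF k], of "1 / (2*pi) * (\<integral>\<xi>. cmod (w \<xi>) \<partial>lborel)"]])
    show "AE x in lborel. norm (k x * cnj (k x)) \<le> norm (1 / (2*pi) * (\<integral>\<xi>. cmod (w \<xi>) \<partial>lborel) * norm (k x))"
      using inv
    proof eventually_elim
      case (elim x)
      have "cmod (k x) \<le> 1 / (2*pi) * (\<integral>\<xi>. cmod (w \<xi>) \<partial>lborel)" unfolding elim by (rule norm_inv_fourier_le)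
      then have "cmod (k x) * cmod (k x) \<le> 1 / (2*pi) * (\<integral>\<xi>. cmod (w \<xi>) \<partial>lborel) * cmod (k x)" by (rule mult_right_mono) simp
      also have "\<dots> \<le> norm \<dots>" by simp
      finally show ?case by (simp add: norm_mult)
    qed
  qed measurable
  then have ki: "integrable lborel (\<lambda>x. complex_of_real ((cmod (k x))\<^sup>2))" by (simp only: complex_norm_square)
  then show "integrable lborel (\<lambda>x. (cmod (k x))\<^sup>2)" using integrable_Re[OF ki] by simp
  have pint: "integrable (lborel \<Otimes>\<^sub>M lborel) (\<lambda>(x, \<xi>). k x * (iexp (\<xi> * x) * cnj (w \<xi>)))"
  proof -
    have "integrable (lborel \<Otimes>\<^sub>M lborel) (\<lambda>z. k (fst z) * (iexp (snd z * fst z) * cnj (w (snd z))))"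
    proof (rule lborel_pair.Fubini_integrable)
      have "(\<lambda>x. \<integral>y. norm (k (fst (x,y)) * (iexp (snd (x,y) * fst (x,y)) * cnj (w (snd (x,y))))) \<partial>lborel)
          = (\<lambda>x. norm (k x) * (\<integral>y. norm (w y) \<partial>lborel))"
        by (rule ext) (simp add: norm_mult)
      then show "integrable lborel (\<lambda>x. \<integral>y. norm (k (fst (x,y)) * (iexp (snd (x,y) * fst (x,y)) * cnj (w (snd (x,y))))) \<partial>lborel)"
        using k by simp
      have "integrable lborel (\<lambda>y. iexp (x * y) * cnj (w y))" for x
        using w by (intro integrable_mult_iexp) simp
      then show "AE x in lborel. integrable lborel (\<lambda>y. k (fst (x,y)) * (iexp (snd (x,y) * fst (x,y)) * cnj (w (snd (x,y)))))"
        by (auto simp: mult.commute)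
    qed measurable
    then show ?thesis by (simp add: split_def)
  qed
  have "(\<integral>x. complex_of_real ((cmod (k x))\<^sup>2) \<partial>lborel) = (\<integral>x. k x * cnj (inv_fourier w x) \<partial>lborel)"
  proof (rule integral_cong_AE)
    show "AE x in lborel. complex_of_real ((cmod (k x))\<^sup>2) = k x * cnj (inv_fourier w x)"
      using inv by eventually_elim (simp only: complex_norm_square)
  qed measurable
  also have "\<dots> = 1/(2*pi) * (\<integral>x. (\<integral>\<xi>. k x * (iexp (\<xi> * x) * cnj (w \<xi>)) \<partial>lborel) \<partial>lborel)"
  proof -
    have "cnj (\<integral>\<xi>. iexp (-(\<xi> * x)) * w \<xi> \<partial>lborel) = (\<integral>\<xi>. iexp (\<xi> * x) * cnj (w \<xi>) \<partial>lborel)" for x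
      by (subst integral_bounded_linear'[OF bounded_linear_cnj bounded_linear_cnj, symmetric]) (simp_all add: exp_cnj)
    then show ?thesis
      by (subst integral_mult_right_zero[symmetric]) (simp add: inv_fourier_def mult.left_commute)
  qed
  also have "(\<integral>x. (\<integral>\<xi>. k x * (iexp (\<xi> * x) * cnj (w \<xi>)) \<partial>lborel) \<partial>lborel) = (\<integral>\<xi>. (\<integral>x. k x * (iexp (\<xi> * x) * cnj (w \<xi>)) \<partial>lborel) \<partial>lborel)"
    by (rule lborel_pair.Fubini_integral[symmetric, OF pint])
  also have "\<dots> = (\<integral>\<xi>. complex_of_real ((cmod (w \<xi>))\<^sup>2) \<partial>lborel)"
  proof (rule Bochner_Integration.integral_cong[OF refl])
    fix \<xi>
    have "(\<integral>x. k x * (iexp (\<xi> * x) * cnj (w \<xi>)) \<partial>lborel) = (\<integral>x. k x * iexp (\<xi> * x) \<partial>lborel) * cnj (w \<xi>)"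
      by (subst integral_mult_left_zero[symmetric]) (simp add: mult.assoc)
    then show "(\<integral>x. k x * (iexp (\<xi> * x) * cnj (w \<xi>)) \<partial>lborel) = complex_of_real ((cmod (w \<xi>))\<^sup>2)"
      unfolding fw[symmetric] by (simp only: complex_norm_square)
  qed
  finally have "complex_of_real (\<integral>x. (cmod (k x))\<^sup>2 \<partial>lborel) = complex_of_real (1 / (2*pi) * (\<integral>\<xi>. (cmod (w \<xi>))\<^sup>2 \<partial>lborel))"
    by (simp only: integral_complex_of_real of_real_mult)
  then show "(\<integral>x. (cmod (k x))\<^sup>2 \<partial>lborel) = 1 / (2*pi) * (\<integral>\<xi>. (cmod (w \<xi>))\<^sup>2 \<partial>lborel)"
    by (simp only: of_real_eq_iff)
qed

lemma norm_iexp_minus_1: "(cmod (iexp y - 1))\<^sup>2 = 2 - 2 * cos y"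
proof -
  have "(cmod (iexp y - 1))\<^sup>2 = (cos y - 1)\<^sup>2 + (sin y)\<^sup>2"
    by (simp add: cmod_power2 Re_exp Im_exp)
  also have "\<dots> = 2 - 2 * cos y"
    by (simp only: power2_diff sin_squared_eq) simp
  finally show ?thesis .
qed

text \<open>The exponent \<open>-3/8\<close> is chosen because the square \<open>W (-3/4)\<close> of the weight is integrable.\<close>

definition char_close :: "(real \<Rightarrow> real) \<Rightarrow> (real \<Rightarrow> real) \<Rightarrow> real \<Rightarrow> bool" where
  "char_close F N E \<longleftrightarrow> (\<forall>\<xi>. cmod (char (distr_of F) \<xi> - char (distr_of N) \<xi>) \<le> E * W (-1) \<xi>) \<and>
     (\<forall>\<xi> \<eta>. \<bar>\<eta>\<bar> \<le> 1 \<longrightarrow> cmod ((char (distr_of F) (\<xi> + \<eta>) - char (distr_of N) (\<xi> + \<eta>)) - (char (distr_of F) \<xi> - char (distr_of N) \<xi>))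
         \<le> \<bar>\<eta>\<bar> * (E * W (-3/8) \<xi>))"

text \<open>Weighted Plancherel estimate: the difference quotients of the Fourier transform control
  \<open>x (F(x) - N(x))\<close> in \<open>L\<^sup>2\<close> without differentiating it.\<close>

theorem L1_bound:
  obtains K where "K > 0" and "\<And>F N E. prob_density_fun F \<Longrightarrow> prob_density_fun N \<Longrightarrow> E > 0 \<Longrightarrow>
     char_close F N E \<Longrightarrow> (LBINT x. \<bar>F x - N x\<bar>) \<le> K * E"
proof -
  define J where "J = (\<integral>x. W (-3/4) x \<partial>lborel)"
  have Wi: "integrable lborel (W (-3/4))" by (rule integrable_W) simp
  have J0: "J \<ge> 0" unfolding J_def by (intro integral_nonneg_AE) auto
  show ?thesis
  proof (rule that[of "J + 1"])
    show "J + 1 > 0" using J0 by simp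
    fix F N :: "real \<Rightarrow> real" and E :: real
    assume F: "prob_density_fun F" and N: "prob_density_fun N" and E: "E > 0"
      and close: "char_close F N E"
    define w where "w = (\<lambda>\<xi>. char (distr_of F) \<xi> - char (distr_of N) \<xi>)"
    have b1: "cmod (w \<xi>) \<le> E * W (-1) \<xi>" for \<xi>
      using close by (simp add: char_close_def w_def)
    have b2: "cmod (w (\<xi> + \<eta>) - w \<xi>) \<le> \<bar>\<eta>\<bar> * (E * W (-3/8) \<xi>)" if "\<bar>\<eta>\<bar> \<le> 1" for \<xi> \<eta>
      using close that by (simp add: char_close_def w_def)
    have [measurable]: "F \<in> borel_measurable borel" "N \<in> borel_measurable borel" and Fi: "integrable lborel F" "integrable lborel N"
      using F N by (auto simp: prob_density_fun_def dest: borel_measurable_integrable)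
    interpret Fd: real_distribution "distr_of F" by (rule prob_density_real_distribution[OF F])
    interpret Nd: real_distribution "distr_of N" by (rule prob_density_real_distribution[OF N])
    have wm[measurable]: "w \<in> borel_measurable borel" unfolding w_def by measurable
    have W1: "W (-1) x \<le> W (-3/4) x" for x by (intro W_mono) simp
    have wi: "integrable lborel w"
    proof (rule Bochner_Integration.integrable_bound[OF integrable_mult_right[OF Wi, of E]])
      have "cmod (w x) \<le> norm (E * W (-3/4) x)" for x
        using order_trans[OF b1 mult_left_mono[OF W1, of E]] E by simp
      then show "AE x in lborel. cmod (w x) \<le> norm (E * W (-3/4) x)" by simp
    qed simp
    define h where "h = (\<lambda>x. F x - N x)"
    have [measurable]: "h \<in> borel_measurable borel" unfolding h_def by measurable
    have hi: "integrable lborel h" unfolding h_def using Fi by simp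
    then have hci: "integrable lborel (\<lambda>x. complex_of_real (h x))" by simp
    have wh: "w \<xi> = (\<integral>x. complex_of_real (h x) * iexp (\<xi> * x) \<partial>lborel)" for \<xi>
    proof -
      have "integrable lborel (\<lambda>x. complex_of_real (F x) * iexp (\<xi> * x))" "integrable lborel (\<lambda>x. complex_of_real (N x) * iexp (\<xi> * x))"
        by (rule integrable_mult_iexp(1), use Fi in simp)+
      then show ?thesis unfolding w_def h_def char_density[OF F] char_density[OF N] by (simp add: left_diff_distrib)
    qed
    have hinv: "AE x in lborel. complex_of_real (h x) = inv_fourier w x"
      unfolding h_def by (rule fourier_inversion[OF F N _ wi]) (simp add: w_def)
    have p0: "(\<integral>x. (h x)\<^sup>2 \<partial>lborel) = 1 / (2*pi) * (\<integral>\<xi>. (cmod (w \<xi>))\<^sup>2 \<partial>lborel)"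
      and p0i: "integrable lborel (\<lambda>x. (h x)\<^sup>2)"
      using plancherel[OF hci wi wh hinv] by simp_all
    have nn0: "(\<integral>\<^sup>+x. ennreal ((h x)\<^sup>2) \<partial>lborel) \<le> ennreal (E\<^sup>2 * J / (2*pi))"
    proof -
      have W2: "E\<^sup>2 * W (-2) x \<le> E\<^sup>2 * W (-3/4) x" for x by (intro mult_left_mono W_mono) auto
      have le: "(cmod (w x))\<^sup>2 \<le> E\<^sup>2 * W (-3/4) x" for x
      proof -
        have "(cmod (w x))\<^sup>2 \<le> (E * W (-1) x)\<^sup>2" by (intro power_mono b1) simp
        also have "\<dots> = E\<^sup>2 * (W (-1) x * W (-1) x)" by (simp add: power2_eq_square)
        also have "\<dots> = E\<^sup>2 * W (-2) x" by (simp add: W_add)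
        finally show ?thesis using W2[of x] by linarith
      qed
      have "(\<integral>\<xi>. (cmod (w \<xi>))\<^sup>2 \<partial>lborel) \<le> (\<integral>\<xi>. E\<^sup>2 * W (-3/4) \<xi> \<partial>lborel)"
        by (rule integral_mono_AE') (use le Wi in auto)
      then have "(\<integral>x. (h x)\<^sup>2 \<partial>lborel) \<le> E\<^sup>2 * J / (2*pi)"
        unfolding p0 J_def by (simp add: divide_right_mono)
      then show ?thesis using p0i by (subst nn_integral_eq_integral) (auto intro: ennreal_leI)
    qed
    \<comment> \<open>Multiplying h by e^(i\<eta>x) - 1 turns the transform w into its increment v,
      which is of order \<eta> E; the squared modulus of the multiplier is 2 - 2 cos (\<eta>
      x).\<close>
    have nn1: "(\<integral>\<^sup>+x. ennreal ((h x)\<^sup>2 * ((2 - 2 * cos (\<eta> * x)) / \<eta>\<^sup>2)) \<partial>lborel) \<le> ennreal (E\<^sup>2 * J / (2*pi))"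
      if \<eta>: "0 < \<eta>" "\<eta> \<le> 1" for \<eta>
    proof -
      define k where "k = (\<lambda>x. complex_of_real (h x) * (iexp (\<eta> * x) - 1))"
      define v where "v = (\<lambda>\<xi>. w (\<xi> + \<eta>) - w \<xi>)"
      have [measurable]: "k \<in> borel_measurable borel" "v \<in> borel_measurable borel" unfolding k_def v_def by measurable
      have wsi: "integrable lborel (\<lambda>\<xi>. w (\<xi> + \<eta>))"
        using lborel_integrable_real_affine[OF wi, of 1 \<eta>] by (simp add: add.commute)
      have vi: "integrable lborel v" unfolding v_def using wsi wi by simp
      have ki: "integrable lborel k" unfolding k_def right_diff_distrib using integrable_mult_iexp(1)[OF hci] hci by simp
      have vk: "v \<xi> = (\<integral>x. k x * iexp (\<xi> * x) \<partial>lborel)" for \<xi>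
      proof -
        have "(\<integral>x. k x * iexp (\<xi> * x) \<partial>lborel) = (\<integral>x. complex_of_real (h x) * iexp ((\<xi> + \<eta>) * x) - complex_of_real (h x) * iexp (\<xi> * x) \<partial>lborel)"
          by (intro Bochner_Integration.integral_cong refl) (simp add: k_def algebra_simps exp_add)
        also have "\<dots> = v \<xi>" unfolding v_def wh by (intro Bochner_Integration.integral_diff integrable_mult_iexp hci)
        finally show ?thesis by simp
      qed
      have "inv_fourier v x = inv_fourier w x * (iexp (\<eta> * x) - 1)" for x
      proof -
        have "(\<integral>\<xi>. iexp (-(\<xi> * x)) * w (\<xi> + \<eta>) \<partial>lborel) = (\<integral>\<xi>. iexp (\<eta> * x) * (iexp (-(\<xi> * x)) * w \<xi>) \<partial>lborel)"
          by (subst (2) lborel_integral_real_affine[where c=1 and t=\<eta>])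
             (auto intro!: Bochner_Integration.integral_cong simp: algebra_simps exp_add exp_diff exp_minus)
        also have "\<dots> = iexp (\<eta> * x) * (\<integral>\<xi>. iexp (-(\<xi> * x)) * w \<xi> \<partial>lborel)" by simp
        finally have 1: "(\<integral>\<xi>. iexp (-(\<xi> * x)) * w (\<xi> + \<eta>) \<partial>lborel) = iexp (\<eta> * x) * (\<integral>\<xi>. iexp (-(\<xi> * x)) * w \<xi> \<partial>lborel)" .
        have i: "integrable lborel (\<lambda>\<xi>. iexp (-(\<xi> * x)) * w \<xi>)" "integrable lborel (\<lambda>\<xi>. iexp (-(\<xi> * x)) * w (\<xi> + \<eta>))"
          using integrable_mult_iexp(2)[OF wi, of "-x"] integrable_mult_iexp(2)[OF wsi, of "-x"] by (simp_all add: mult.commute)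
        have "(\<integral>\<xi>. iexp (-(\<xi> * x)) * v \<xi> \<partial>lborel) = (\<integral>\<xi>. iexp (-(\<xi> * x)) * w (\<xi> + \<eta>) \<partial>lborel) - (\<integral>\<xi>. iexp (-(\<xi> * x)) * w \<xi> \<partial>lborel)"
          unfolding v_def right_diff_distrib by (rule Bochner_Integration.integral_diff[OF i(2,1)])
        then show ?thesis unfolding inv_fourier_def 1 by (simp add: algebra_simps)
      qed
      then have kinv: "AE x in lborel. k x = inv_fourier v x"
        using hinv by (auto elim!: eventually_mono simp: k_def)
      have k2: "(cmod (k x))\<^sup>2 = (h x)\<^sup>2 * (2 - 2 * cos (\<eta> * x))" for x
        using norm_iexp_minus_1[of "\<eta> * x"] by (simp add: k_def norm_mult power_mult_distrib)
      have le: "(cmod (v x))\<^sup>2 \<le> (\<eta> * E)\<^sup>2 * W (-3/4) x" for x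
      proof -
        have "(cmod (v x))\<^sup>2 \<le> (\<eta> * (E * W (-3/8) x))\<^sup>2"
          using b2[of \<eta> x] \<eta> by (intro power_mono) (auto simp: v_def)
        also have "\<dots> = (\<eta> * E)\<^sup>2 * (W (-3/8) x * W (-3/8) x)" by (simp add: power2_eq_square)
        also have "\<dots> = (\<eta> * E)\<^sup>2 * W (-3/4) x" by (simp add: W_add)
        finally show ?thesis .
      qed
      have "(\<integral>\<xi>. (cmod (v \<xi>))\<^sup>2 \<partial>lborel) \<le> (\<integral>\<xi>. (\<eta> * E)\<^sup>2 * W (-3/4) \<xi> \<partial>lborel)"
        by (rule integral_mono_AE') (use le Wi in auto)
      then have "(\<integral>x. (cmod (k x))\<^sup>2 \<partial>lborel) \<le> (\<eta> * E)\<^sup>2 * J / (2*pi)"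
        unfolding plancherel(1)[OF ki vi vk kinv] J_def by (simp add: divide_right_mono)
      then have "(\<integral>x. (h x)\<^sup>2 * ((2 - 2 * cos (\<eta> * x)) / \<eta>\<^sup>2) \<partial>lborel) \<le> E\<^sup>2 * J / (2*pi)"
        using \<eta> unfolding k2 by (simp add: field_simps power_mult_distrib)
      moreover have "integrable lborel (\<lambda>x. (h x)\<^sup>2 * ((2 - 2 * cos (\<eta> * x)) / \<eta>\<^sup>2))"
        using plancherel(2)[OF ki vi vk kinv] unfolding k2 by simp
      ultimately show ?thesis by (subst nn_integral_eq_integral) (auto intro: ennreal_leI)
    qed
    have cosl: "(\<lambda>n. (2 - 2 * cos (1 / real (Suc n) * x)) / (1 / real (Suc n))\<^sup>2) \<longlonglongrightarrow> x\<^sup>2" for x :: real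
    proof -
      have "((\<lambda>\<eta>::real. (2 - 2 * cos (\<eta> * x)) / \<eta>\<^sup>2) \<longlongrightarrow> x * x) (at_right 0)"
        by real_asymp
      moreover have "filterlim (\<lambda>n. 1 / real (Suc n)) (at_right 0) sequentially" by real_asymp
      ultimately show ?thesis unfolding power2_eq_square[of x] by (rule filterlim_compose)
    qed
    \<comment> \<open>Fatou's lemma along \<eta> = 1/(n+1), where the quotient tends to x^2. It also
      yields the finiteness of the weighted norm.\<close>
    have nn2: "(\<integral>\<^sup>+x. ennreal ((h x)\<^sup>2 * x\<^sup>2) \<partial>lborel) \<le> ennreal (E\<^sup>2 * J / (2*pi))"
    proof -
      define u where "u = (\<lambda>n x. ennreal ((h x)\<^sup>2 * ((2 - 2 * cos (1 / real (Suc n) * x)) / (1 / real (Suc n))\<^sup>2)))"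
      have "(\<integral>\<^sup>+x. ennreal ((h x)\<^sup>2 * x\<^sup>2) \<partial>lborel) = (\<integral>\<^sup>+x. liminf (\<lambda>n. u n x) \<partial>lborel)"
      proof (rule nn_integral_cong)
        fix x :: real
        have "(\<lambda>n. u n x) \<longlonglongrightarrow> ennreal ((h x)\<^sup>2 * x\<^sup>2)"
          unfolding u_def by (intro tendsto_ennrealI tendsto_mult tendsto_const cosl)
        then show "ennreal ((h x)\<^sup>2 * x\<^sup>2) = liminf (\<lambda>n. u n x)"
          by (simp add: lim_imp_Liminf)
      qed
      also have "\<dots> \<le> liminf (\<lambda>n. \<integral>\<^sup>+x. u n x \<partial>lborel)"
        by (rule nn_integral_liminf) (simp add: u_def)
      also have "\<dots> \<le> liminf (\<lambda>n. ennreal (E\<^sup>2 * J / (2*pi)))"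
        unfolding u_def by (intro Liminf_mono always_eventually allI nn1) auto
      also have "\<dots> = ennreal (E\<^sup>2 * J / (2*pi))" by (simp add: Liminf_const)
      finally show ?thesis .
    qed
    \<comment> \<open>Young's inequality with y = 1 + x^2 and scale E: the integrals of the squares
      are of order E^2 and get divided by E, so all three summands integrate to multiples of
      E.\<close>
    have pw: "\<bar>h x\<bar> \<le> (h x)\<^sup>2 / (2*E) + ((h x)\<^sup>2 * x\<^sup>2) / (2*E) + E/2 * W (-3/4) x" for x
    proof -
      define y where "y = 1 + x\<^sup>2"
      have y: "y > 0" by (auto simp: y_def intro: add_pos_nonneg)
      have "0 \<le> (y * \<bar>h x\<bar> - E)\<^sup>2" by simp
      then have "2 * y * E * \<bar>h x\<bar> \<le> y\<^sup>2 * (h x)\<^sup>2 + E\<^sup>2" by (simp add: power2_diff power_mult_distrib algebra_simps)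
      then have "\<bar>h x\<bar> \<le> (y\<^sup>2 * (h x)\<^sup>2 + E\<^sup>2) / (2 * y * E)" using y E by (simp add: field_simps)
      also have "\<dots> = y * (h x)\<^sup>2 / (2*E) + E / 2 * (1 / y)" using y E by (simp add: field_simps power2_eq_square)
      also have "1 / y = W (-1) x" using y by (simp add: W_def y_def[symmetric] powr_minus divide_inverse)
      also have "E / 2 * W (-1) x \<le> E / 2 * W (-3/4) x" using E W1 by (intro mult_left_mono) auto
      finally show ?thesis by (simp add: y_def algebra_simps add_divide_distrib)
    qed
    have "ennreal (LBINT x. \<bar>h x\<bar>) = (\<integral>\<^sup>+x. ennreal \<bar>h x\<bar> \<partial>lborel)"
      using hi by (intro nn_integral_eq_integral[symmetric]) auto
    also have "\<dots> \<le> (\<integral>\<^sup>+x. ennreal (1 / (2*E)) * ennreal ((h x)\<^sup>2) + ennreal (1 / (2*E)) * ennreal ((h x)\<^sup>2 * x\<^sup>2) + ennreal (E/2 * W (-3/4) x) \<partial>lborel)"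
      using pw E by (intro nn_integral_mono) (simp add: ennreal_mult[symmetric] ennreal_plus[symmetric] del: ennreal_plus)
    also have "\<dots> = ennreal (1 / (2*E)) * (\<integral>\<^sup>+x. ennreal ((h x)\<^sup>2) \<partial>lborel) + ennreal (1 / (2*E)) * (\<integral>\<^sup>+x. ennreal ((h x)\<^sup>2 * x\<^sup>2) \<partial>lborel)
        + (\<integral>\<^sup>+x. ennreal (E/2 * W (-3/4) x) \<partial>lborel)"
      by (simp add: nn_integral_add nn_integral_cmult)
    also have "(\<integral>\<^sup>+x. ennreal (E/2 * W (-3/4) x) \<partial>lborel) = ennreal (E/2 * J)"
      using Wi E by (subst nn_integral_eq_integral) (auto simp: J_def)
    also have "ennreal (1 / (2*E)) * (\<integral>\<^sup>+x. ennreal ((h x)\<^sup>2) \<partial>lborel) + ennreal (1 / (2*E)) * (\<integral>\<^sup>+x. ennreal ((h x)\<^sup>2 * x\<^sup>2) \<partial>lborel) + ennreal (E/2 * J)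
       \<le> ennreal (1 / (2*E)) * ennreal (E\<^sup>2 * J / (2*pi)) + ennreal (1 / (2*E)) * ennreal (E\<^sup>2 * J / (2*pi)) + ennreal (E/2 * J)"
      by (intro add_mono mult_left_mono nn0 nn2) auto
    also have "\<dots> = ennreal (E * J / (2*pi) + E/2 * J)"
      using E J0 by (simp add: ennreal_mult[symmetric] ennreal_plus[symmetric] field_simps power2_eq_square del: ennreal_plus)
    finally have "(LBINT x. \<bar>h x\<bar>) \<le> E * J / (2*pi) + E/2 * J"
      using E J0 by (subst (asm) ennreal_le_iff) auto
    also have "\<dots> \<le> (J + 1) * E"
    proof -
      have "E * J / (2*pi) \<le> E * J / 2" using E J0 pi_ge_two by (intro divide_left_mono) auto
      then show ?thesis using E by (simp add: algebra_simps)
    qed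
    finally show "(LBINT x. \<bar>F x - N x\<bar>) \<le> (J + 1) * E" by (simp add: h_def)
  qed
qed

section \<open>Cosine transforms of densities\<close>

definition cos_transform :: "(real \<Rightarrow> real) \<Rightarrow> real \<Rightarrow> real" where
  "cos_transform f \<xi> = (\<integral>v. cos (\<xi> * v) * f v \<partial>lborel)"

lemma integrable_bounded_mult:
  fixes k f :: "real \<Rightarrow> real"
  assumes "integrable lborel f" and [measurable]: "k \<in> borel_measurable borel" and "\<And>x. \<bar>k x\<bar> \<le> B"
  shows "integrable lborel (\<lambda>x. k x * f x)"
proof -
  have [measurable]: "f \<in> borel_measurable borel" using assms(1) by (auto dest: borel_measurable_integrable)
  show ?thesis
  proof (rule Bochner_Integration.integrable_bound[OF integrable_mult_right[OF integrable_norm[OF assms(1)], of B]])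
    have "norm (k x * f x) \<le> norm (B * norm (f x))" for x
    proof -
      have "\<bar>k x\<bar> * \<bar>f x\<bar> \<le> B * \<bar>f x\<bar>" using assms(3) by (intro mult_right_mono) auto
      also have "\<dots> \<le> \<bar>B * \<bar>f x\<bar>\<bar>" by (rule abs_ge_self)
      finally show ?thesis by (simp add: abs_mult)
    qed
    then show "AE x in lborel. norm (k x * f x) \<le> norm (B * norm (f x))" by simp
  qed simp
qed

lemma integrable_cos_mult: "integrable lborel f \<Longrightarrow> integrable lborel (\<lambda>v. cos (\<xi> * v) * f v)" for f :: "real \<Rightarrow> real"
  by (rule integrable_bounded_mult[where B=1]) auto

lemma integrable_sin_mult: "integrable lborel f \<Longrightarrow> integrable lborel (\<lambda>v. sin (\<xi> * v) * f v)" for f :: "real \<Rightarrow> real"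
  by (rule integrable_bounded_mult[where B=1]) auto

lemma Re_char_density: "prob_density_fun F \<Longrightarrow> Re (char (distr_of F) \<xi>) = cos_transform F \<xi>"
proof -
  assume F: "prob_density_fun F"
  then have "integrable lborel (\<lambda>x. complex_of_real (F x) * iexp (\<xi> * x))"
    by (intro integrable_mult_iexp(1)) (simp add: prob_density_fun_def)
  then have "Re (char (distr_of F) \<xi>) = (\<integral>x. Re (complex_of_real (F x) * iexp (\<xi> * x)) \<partial>lborel)"
    unfolding char_density[OF F] by (rule integral_Re[symmetric])
  also have "\<dots> = cos_transform F \<xi>" unfolding cos_transform_def
    by (intro Bochner_Integration.integral_cong refl) (simp add: Re_exp mult.commute)
  finally show ?thesis .
qed

lemma Im_char_density: "prob_density_fun F \<Longrightarrow> Im (char (distr_of F) \<xi>) = (\<integral>v. sin (\<xi> * v) * F v \<partial>lborel)"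
proof -
  assume F: "prob_density_fun F"
  then have "integrable lborel (\<lambda>x. complex_of_real (F x) * iexp (\<xi> * x))"
    by (intro integrable_mult_iexp(1)) (simp add: prob_density_fun_def)
  then have "Im (char (distr_of F) \<xi>) = (\<integral>x. Im (complex_of_real (F x) * iexp (\<xi> * x)) \<partial>lborel)"
    unfolding char_density[OF F] by (rule integral_Im[symmetric])
  also have "\<dots> = (\<integral>v. sin (\<xi> * v) * F v \<partial>lborel)"
    by (intro Bochner_Integration.integral_cong refl) (simp add: Im_exp mult.commute)
  finally show ?thesis .
qed

lemma lborel_integral_reflect: "(\<integral>v. f (- v) \<partial>lborel) = (\<integral>v. f v \<partial>lborel)" for f :: "real \<Rightarrow> real"
  using lborel_integral_real_affine[of "-1" f 0] by simp

lemma integrable_lborel_reflect: "integrable lborel (\<lambda>v. f (- v)) \<longleftrightarrow> integrable lborel f" for f :: "real \<Rightarrow> real"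
  using lborel_integrable_real_affine_iff[of "-1" f 0] by simp

lemma prob_density_symmetrization:
  assumes "prob_density_fun f" shows "prob_density_fun (symmetrization f)"
proof -
  have "symmetrization f = (\<lambda>x. (f x + f (- x)) / 2)" by (simp add: symmetrization_def fun_eq_iff)
  then show ?thesis using assms integrable_lborel_reflect[of f] lborel_integral_reflect[of f]
    by (simp add: prob_density_fun_def)
qed

text \<open>Reflection cancels the sine part and preserves the cosine part. So the cosine transform
  of the datum is the characteristic function to which the cumulant hypothesis refers.\<close>

lemma char_symmetrization:
  assumes f: "prob_density_fun f"
  shows "char (distr_of (symmetrization f)) \<xi> = complex_of_real (cos_transform f \<xi>)"
proof -
  note s = prob_density_symmetrization[OF f]
  have i: "integrable lborel f" "integrable lborel (\<lambda>v. f (- v))"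
    using f integrable_lborel_reflect[of f] by (auto simp: prob_density_fun_def)
  have "(\<integral>v. cos (\<xi> * v) * f (- v) \<partial>lborel) = cos_transform f \<xi>"
    using lborel_integral_reflect[of "\<lambda>v. cos (\<xi> * v) * f v"] by (simp add: cos_transform_def)
  then have "cos_transform (symmetrization f) \<xi> = cos_transform f \<xi>"
    using integrable_cos_mult[OF i(1), of \<xi>] integrable_cos_mult[OF i(2), of \<xi>]
    by (simp add: cos_transform_def symmetrization_def distrib_left)
  moreover have "(\<integral>v. sin (\<xi> * v) * f (- v) \<partial>lborel) = - (\<integral>v. sin (\<xi> * v) * f v \<partial>lborel)"
    using lborel_integral_reflect[of "\<lambda>v. sin (\<xi> * v) * f v"] by simp
  then have "(\<integral>v. sin (\<xi> * v) * symmetrization f v \<partial>lborel) = 0"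
    using integrable_sin_mult[OF i(1), of \<xi>] integrable_sin_mult[OF i(2), of \<xi>]
    by (simp add: symmetrization_def distrib_left)
  ultimately show ?thesis
    by (simp add: complex_eq_iff Re_char_density[OF s] Im_char_density[OF s])
qed

lemma cos_transform_0: "prob_density_fun f \<Longrightarrow> cos_transform f 0 = 1"
  by (simp add: cos_transform_def prob_density_fun_def)

lemma abs_cos_transform_le_1:
  assumes f: "prob_density_fun f" shows "\<bar>cos_transform f \<xi>\<bar> \<le> 1"
proof -
  have "\<bar>cos_transform f \<xi>\<bar> \<le> (\<integral>v. \<bar>cos (\<xi> * v) * f v\<bar> \<partial>lborel)"
    unfolding cos_transform_def by (rule integral_abs_bound)
  also have "\<dots> \<le> (\<integral>v. f v \<partial>lborel)"
    using f by (intro integral_mono_AE') (auto simp: prob_density_fun_def abs_mult intro!: mult_left_le_one_le)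
  finally show ?thesis using f by (simp add: prob_density_fun_def)
qed

text \<open>Integrates \<open>(1 \<plusminus> cos \<xi>v)\<^sup>2 \<ge> 0\<close>.\<close>

lemma cos_transform_double:
  assumes f: "prob_density_fun f"
  shows "4 * \<bar>cos_transform f \<xi>\<bar> \<le> 3 + cos_transform f (2 * \<xi>)"
proof -
  have fi: "integrable lborel f" "(\<integral>v. f v \<partial>lborel) = 1" "\<And>v. 0 \<le> f v" using f by (auto simp: prob_density_fun_def)
  have *: "0 \<le> (1 + k * cos_transform f \<xi>) - (1 - cos_transform f (2 * \<xi>)) / 4" if k: "k\<^sup>2 = 1" for k
  proof -
    have "0 \<le> (\<integral>v. (1 + k * cos (\<xi> * v) - (1 - cos (2 * \<xi> * v)) / 4) * f v \<partial>lborel)"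
    proof (intro integral_nonneg_AE AE_I2 mult_nonneg_nonneg fi)
      fix v
      have "cos (2 * \<xi> * v) = 2 * (cos (\<xi> * v))\<^sup>2 - 1" using cos_double_cos[of "\<xi> * v"] by (simp add: mult.assoc)
      then have "1 + k * cos (\<xi> * v) - (1 - cos (2 * \<xi> * v)) / 4 = 1/2 * (1 + k * cos (\<xi> * v))\<^sup>2"
        by (simp only: power2_sum power_mult_distrib k) (simp add: field_simps)
      then show "0 \<le> 1 + k * cos (\<xi> * v) - (1 - cos (2 * \<xi> * v)) / 4" by (simp only:) simp
    qed
    also have "\<dots> = (\<integral>v. (f v + k * (cos (\<xi> * v) * f v)) - (f v - cos (2 * \<xi> * v) * f v) / 4 \<partial>lborel)"
      by (intro Bochner_Integration.integral_cong refl) (simp add: algebra_simps diff_divide_distrib)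
    also have "\<dots> = (1 + k * cos_transform f \<xi>) - (1 - cos_transform f (2 * \<xi>)) / 4"
      unfolding cos_transform_def using fi integrable_cos_mult[OF fi(1)] by simp
    finally show ?thesis .
  qed
  have "4 * cos_transform f \<xi> \<le> 3 + cos_transform f (2 * \<xi>)" "- (4 * cos_transform f \<xi>) \<le> 3 + cos_transform f (2 * \<xi>)"
    using *[of 1] *[of "-1"] by simp_all
  then show ?thesis by linarith
qed

text \<open>Iterates the doubling inequality: a defect of the transform at the frequency 2^k \<xi>
  forces 4^-k of it at \<xi>.\<close>

lemma cos_transform_double_iterate:
  assumes f: "prob_density_fun f"
  shows "\<bar>cos_transform f \<xi>\<bar> \<le> 1 - (1 - cos_transform f (2 ^ Suc k * \<xi>)) / 4 ^ Suc k"
proof (induction k arbitrary: \<xi>)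
  case 0 then show ?case using cos_transform_double[OF f, of \<xi>] by (simp add: field_simps)
next
  case (Suc k)
  define X where "X = (1 - cos_transform f (2 ^ Suc k * (2 * \<xi>))) / 4 ^ Suc k"
  have "\<bar>cos_transform f (2 * \<xi>)\<bar> \<le> 1 - X" unfolding X_def by (rule Suc)
  then have "4 * \<bar>cos_transform f \<xi>\<bar> \<le> 4 - X" using cos_transform_double[OF f, of \<xi>] by linarith
  then have "\<bar>cos_transform f \<xi>\<bar> \<le> 1 - X / 4" by simp
  then show ?case by (simp add: X_def mult.assoc mult.left_commute)
qed

text \<open>Provides the constant 1 on which \<open>char_decay\<close> rests. Far out this follows
  from the assumed decay. Elsewhere the modulus must be bounded away from 1 quantitatively: doubling
  \<xi> until it reaches the region where the transform is at most 1/2 gives 1 - c \<xi>^2, which is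
  sharp enough also near 0.\<close>

lemma cos_transform_decay:
  assumes f: "prob_density_fun f" and p: "p > 0"
    and o: "(\<lambda>\<xi>. char (distr_of f) \<xi>) \<in> o[at_infinity](\<lambda>\<xi>. complex_of_real (\<bar>\<xi>\<bar> powr (- p)))"
  shows "\<exists>q>0. q \<le> 1/4 \<and> (\<forall>\<xi>. \<bar>cos_transform f \<xi>\<bar> \<le> W (- q) \<xi>)"
proof -
  have "eventually (\<lambda>\<xi>. norm (char (distr_of f) \<xi>) \<le> 1 * norm (complex_of_real (\<bar>\<xi>\<bar> powr (- p)))) at_infinity"
    by (rule landau_o.smallD[OF o]) simp
  then obtain b where b: "\<And>\<xi>. \<bar>\<xi>\<bar> \<ge> b \<Longrightarrow> norm (char (distr_of f) \<xi>) \<le> \<bar>\<xi>\<bar> powr (- p)"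
    by (auto simp: eventually_at_infinity)
  \<comment> \<open>Beyond A the assumed decay is in force and makes the transform at most 1/2; A
    \<ge> 2 serves the comparison of 1 + \<xi>^2 with |\<xi>|^3.\<close>
  define A where "A = max (max b 2) (2 powr (1/p))"
  have A: "A \<ge> 2" "A \<ge> b" "A \<ge> 2 powr (1/p)" by (auto simp: A_def)
  have big: "\<bar>cos_transform f \<xi>\<bar> \<le> \<bar>\<xi>\<bar> powr (- p)" if "\<bar>\<xi>\<bar> \<ge> A" for \<xi>
  proof -
    have "\<bar>cos_transform f \<xi>\<bar> \<le> norm (char (distr_of f) \<xi>)"
      unfolding Re_char_density[OF f, symmetric] by (rule abs_Re_le_cmod)
    also have "\<dots> \<le> \<bar>\<xi>\<bar> powr (- p)" using that A by (intro b) simp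
    finally show ?thesis .
  qed
  have half: "\<bar>cos_transform f \<xi>\<bar> \<le> 1/2" if "\<bar>\<xi>\<bar> \<ge> A" for \<xi>
  proof -
    have "\<bar>\<xi>\<bar> powr (- p) \<le> (2 powr (1/p)) powr (- p)" using that A p by (intro powr_mono2') auto
    also have "\<dots> = 1/2" using p by (simp add: powr_powr powr_minus)
    finally show ?thesis using big[OF that] by simp
  qed
  \<comment> \<open>For the least k with 2^k |\<xi>| \<ge> A one has 4^k \<xi>^2 \<le> 4 A^2, so the
    defect (1/2) / 4^k is at least \<xi>^2 / (8 A^2).\<close>
  define c where "c = 1 / (8 * A\<^sup>2)"
  have c: "c > 0" using A by (simp add: c_def)
  have small: "\<bar>cos_transform f \<xi>\<bar> \<le> 1 - c * \<xi>\<^sup>2" if x: "\<bar>\<xi>\<bar> < A" for \<xi>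
  proof (cases "\<xi> = 0")
    case False
    then obtain n where n: "A / \<bar>\<xi>\<bar> < 2 ^ n" using real_arch_pow[of 2 "A / \<bar>\<xi>\<bar>"] by auto
    define k where "k = (LEAST n. A / \<bar>\<xi>\<bar> \<le> 2 ^ n)"
    have k: "A / \<bar>\<xi>\<bar> \<le> 2 ^ k" unfolding k_def by (rule LeastI[of _ n]) (use n in simp)
    have "k \<noteq> 0" using k x False A by (auto simp: field_simps intro!: Nat.gr0I)
    then obtain l where l: "k = Suc l" by (cases k) auto
    have "\<not> A / \<bar>\<xi>\<bar> \<le> 2 ^ l" using not_less_Least[of l "\<lambda>n. A / \<bar>\<xi>\<bar> \<le> 2 ^ n"] l by (simp add: k_def)
    then have l2: "2 ^ l * \<bar>\<xi>\<bar> < A" using False by (simp add: field_simps)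
    have k2: "A \<le> 2 ^ k * \<bar>\<xi>\<bar>" using k False by (simp add: field_simps)
    have "(4::real) ^ l = (2 ^ l)\<^sup>2" by (simp add: power2_eq_square power_mult_distrib[symmetric])
    then have "4 ^ k * \<xi>\<^sup>2 = 4 * (2 ^ l * \<bar>\<xi>\<bar>)\<^sup>2"
      unfolding l by (simp add: power_mult_distrib)
    also have "\<dots> \<le> 4 * A\<^sup>2" using l2 by (intro mult_left_mono power_mono) auto
    finally have "c * \<xi>\<^sup>2 \<le> (1/2) / 4 ^ k" using A by (simp add: c_def field_simps)
    also have "\<dots> \<le> (1 - cos_transform f (2 ^ k * \<xi>)) / 4 ^ k"
    proof (intro divide_right_mono)
      have "\<bar>cos_transform f (2 ^ k * \<xi>)\<bar> \<le> 1/2" using k2 by (intro half) (simp add: abs_mult)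
      then show "1/2 \<le> 1 - cos_transform f (2 ^ k * \<xi>)" by linarith
    qed simp
    finally show ?thesis using cos_transform_double_iterate[OF f, of \<xi> l] unfolding l by linarith
  qed (use cos_transform_0[OF f] in simp)
  \<comment> \<open>Below A, q \<le> c is used through q ln (1 + \<xi>^2) \<le> c \<xi>^2; above A,
    3q \<le> p through 1 + \<xi>^2 \<le> |\<xi>|^3. The bound 1/4 makes the powers -2q of sine and
    cosine integrable.\<close>
  define q where "q = min (min c (p/3)) (1/4)"
  have q: "q > 0" "q \<le> c" "3 * q \<le> p" "q \<le> 1/4" using c p by (auto simp: q_def)
  show ?thesis
  proof (intro exI[of _ q] conjI allI q(1,4))
    fix \<xi> :: real
    show "\<bar>cos_transform f \<xi>\<bar> \<le> W (- q) \<xi>"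
    proof (cases "\<bar>\<xi>\<bar> < A")
      case True
      have y: "0 < 1 + \<xi>\<^sup>2" by (simp add: add_pos_nonneg)
      have "\<bar>cos_transform f \<xi>\<bar> \<le> 1 + (- (c * \<xi>\<^sup>2))" using small[OF True] by simp
      also have "\<dots> \<le> exp (- (c * \<xi>\<^sup>2))" by (rule exp_ge_add_one_self)
      also have "\<dots> \<le> exp (- q * ln (1 + \<xi>\<^sup>2))"
      proof -
        have "q * ln (1 + \<xi>\<^sup>2) \<le> c * \<xi>\<^sup>2"
          using q c ln_add_one_self_le_self[of "\<xi>\<^sup>2"] by (intro mult_mono) auto
        then show ?thesis by simp
      qed
      also have "\<dots> = W (- q) \<xi>" using y by (simp add: W_def powr_def)
      finally show ?thesis .
    next
      case False
      then have x: "\<bar>\<xi>\<bar> \<ge> 2" using A by simp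
      have "1 + \<xi>\<^sup>2 \<le> \<bar>\<xi>\<bar> ^ 3"
      proof -
        have "2 * \<bar>\<xi>\<bar>\<^sup>2 \<le> \<bar>\<xi>\<bar> * \<bar>\<xi>\<bar>\<^sup>2" using x by (intro mult_right_mono) auto
        moreover have "1 \<le> \<bar>\<xi>\<bar>\<^sup>2" using x by (intro one_le_power) simp
        ultimately show ?thesis by (simp add: power3_eq_cube power2_eq_square)
      qed
      also have "\<bar>\<xi>\<bar> ^ 3 = \<bar>\<xi>\<bar> powr 3" using x by simp
      finally have "(\<bar>\<xi>\<bar> powr 3) powr (- q) \<le> W (- q) \<xi>" unfolding W_def using q by (intro powr_mono2') (auto intro: add_pos_nonneg)
      moreover have "\<bar>\<xi>\<bar> powr (- p) \<le> \<bar>\<xi>\<bar> powr (3 * (- q))" using x q by (intro powr_mono) auto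
      moreover have "(\<bar>\<xi>\<bar> powr 3) powr (- q) = \<bar>\<xi>\<bar> powr (3 * (- q))" by (rule powr_powr)
      ultimately show ?thesis using big[of \<xi>] False by linarith
    qed
  qed
qed

section \<open>Taylor expansions of the cosine and of cosine transforms\<close>

lemma cos_coeff_Re: "cos_coeff k = Re (\<i> ^ k) / fact k"
proof (cases "even k")
  case True
  then obtain j where j: "k = 2 * j" by (elim evenE)
  have "\<i> ^ k = complex_of_real ((-1) ^ j)" by (simp add: j power_mult)
  then have "Re (\<i> ^ k) = (-1) ^ j" by (simp only: Re_complex_of_real)
  then show ?thesis by (simp add: cos_coeff_def j)
next
  case False
  then obtain j where k: "k = 2 * j + 1" by (elim oddE)
  have "\<i> ^ k = complex_of_real ((-1) ^ j) * \<i>" by (simp add: k power_mult)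
  then have "Re (\<i> ^ k) = 0" by (simp only: Re_complex_of_real times_complex.sel) simp
  then show ?thesis using False by (simp add: cos_coeff_def)
qed

definition cos_poly :: "nat \<Rightarrow> real \<Rightarrow> real" where
  "cos_poly n z = (\<Sum>k\<le>n. cos_coeff k * z ^ k)"

lemma cos_poly_Re: "cos z - cos_poly n z = Re (iexp z - (\<Sum>k\<le>n. (\<i> * complex_of_real z) ^ k / fact k))"
proof -
  have "Re ((\<i> * complex_of_real z) ^ k / fact k) = cos_coeff k * z ^ k" for k
  proof -
    have "(\<i> * complex_of_real z) ^ k / fact k = \<i> ^ k * complex_of_real (z ^ k / fact k)"
      by (simp add: power_mult_distrib)
    also have "Re \<dots> = Re (\<i> ^ k) * (z ^ k / fact k)" by (simp only: times_complex.sel Re_complex_of_real Im_complex_of_real)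
    finally show ?thesis by (simp add: cos_coeff_Re)
  qed
  then show ?thesis by (simp add: cos_poly_def Re_exp)
qed

lemma cos_poly_bound1: "\<bar>cos z - cos_poly n z\<bar> \<le> \<bar>z\<bar> ^ Suc n"
proof -
  have "\<bar>cos z - cos_poly n z\<bar> \<le> \<bar>z\<bar> ^ Suc n / fact (Suc n)"
    unfolding cos_poly_Re by (rule order_trans[OF abs_Re_le_cmod iexp_approx1])
  also have "\<dots> \<le> \<bar>z\<bar> ^ Suc n / 1" by (intro divide_left_mono) (auto simp: fact_ge_1 simp del: fact_Suc)
  finally show ?thesis by simp
qed

lemma cos_poly_bound2: "\<bar>cos z - cos_poly n z\<bar> \<le> 2 * \<bar>z\<bar> ^ n"
proof -
  have "\<bar>cos z - cos_poly n z\<bar> \<le> 2 * \<bar>z\<bar> ^ n / fact n"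
    unfolding cos_poly_Re by (rule order_trans[OF abs_Re_le_cmod iexp_approx2])
  also have "\<dots> \<le> 2 * \<bar>z\<bar> ^ n / 1" by (intro divide_left_mono) (auto simp: fact_ge_1)
  finally show ?thesis by simp
qed

lemma integrable_lower_moment:
  fixes h :: "real \<Rightarrow> real"
  assumes h: "integrable lborel h" and hs: "integrable lborel (\<lambda>v. \<bar>v\<bar> powr s * h v)" and k: "real k \<le> s"
  shows "integrable lborel (\<lambda>v. v ^ k * h v)"
proof -
  have [measurable]: "h \<in> borel_measurable borel" using h by (auto dest: borel_measurable_integrable)
  have "integrable lborel (\<lambda>v. \<bar>h v\<bar> + \<bar>\<bar>v\<bar> powr s * h v\<bar>)" using integrable_abs[OF h] integrable_abs[OF hs] by simp
  then show ?thesis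
  proof (rule Bochner_Integration.integrable_bound)
    have "\<bar>v ^ k * h v\<bar> \<le> \<bar>h v\<bar> + \<bar>\<bar>v\<bar> powr s * h v\<bar>" for v
    proof -
      have "\<bar>v\<bar> ^ k \<le> 1 + \<bar>v\<bar> powr s"
      proof (cases "\<bar>v\<bar> \<le> 1")
        case True
        then have "\<bar>v\<bar> ^ k \<le> 1" by (intro power_le_one) auto
        moreover have "0 \<le> \<bar>v\<bar> powr s" by (rule powr_ge_zero)
        ultimately show ?thesis by linarith
      next
        case False
        then have "\<bar>v\<bar> ^ k = \<bar>v\<bar> powr real k" by (simp add: powr_realpow)
        also have "\<dots> \<le> \<bar>v\<bar> powr s" using False k by (intro powr_mono) auto
        finally show ?thesis by simp
      qed
      then have "\<bar>v\<bar> ^ k * \<bar>h v\<bar> \<le> (1 + \<bar>v\<bar> powr s) * \<bar>h v\<bar>" by (rule mult_right_mono) simp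
      then show ?thesis by (simp add: abs_mult power_abs algebra_simps)
    qed
    then show "AE v in lborel. norm (v ^ k * h v) \<le> norm (\<bar>h v\<bar> + \<bar>\<bar>v\<bar> powr s * h v\<bar>)" by auto
  qed simp
qed

lemma cos_transform_minus_poly:
  assumes h: "integrable lborel h" and hn: "\<And>k. k \<le> n \<Longrightarrow> integrable lborel (\<lambda>v. v ^ k * h v)"
  shows "cos_transform h \<xi> - (\<Sum>k\<le>n. cos_coeff k * (\<integral>v. v ^ k * h v \<partial>lborel) * \<xi> ^ k) = (\<integral>v. (cos (\<xi> * v) - cos_poly n (\<xi> * v)) * h v \<partial>lborel)"
    and "integrable lborel (\<lambda>v. (cos (\<xi> * v) - cos_poly n (\<xi> * v)) * h v)"
proof -
  have "(\<integral>v. cos_poly n (\<xi> * v) * h v \<partial>lborel) = (\<integral>v. (\<Sum>k\<le>n. (cos_coeff k * \<xi> ^ k) * (v ^ k * h v)) \<partial>lborel)"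
    by (intro Bochner_Integration.integral_cong refl) (simp add: cos_poly_def sum_distrib_left power_mult_distrib mult_ac)
  also have "\<dots> = (\<Sum>k\<le>n. (cos_coeff k * \<xi> ^ k) * (\<integral>v. v ^ k * h v \<partial>lborel))"
    by (subst Bochner_Integration.integral_sum) (auto intro!: integrable_mult_right hn)
  finally have *: "(\<integral>v. cos_poly n (\<xi> * v) * h v \<partial>lborel) = (\<Sum>k\<le>n. cos_coeff k * (\<integral>v. v ^ k * h v \<partial>lborel) * \<xi> ^ k)"
    by (simp add: mult_ac)
  have "integrable lborel (\<lambda>v. \<Sum>k\<le>n. (cos_coeff k * \<xi> ^ k) * (v ^ k * h v))"
    by (intro Bochner_Integration.integrable_sum integrable_mult_right hn) simp
  then have "integrable lborel (\<lambda>v. cos_poly n (\<xi> * v) * h v)"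
    by (simp add: cos_poly_def sum_distrib_left power_mult_distrib mult_ac)
  note i = integrable_cos_mult[OF h, of \<xi>] this
  show "integrable lborel (\<lambda>v. (cos (\<xi> * v) - cos_poly n (\<xi> * v)) * h v)"
    using i by (simp add: left_diff_distrib)
  show "cos_transform h \<xi> - (\<Sum>k\<le>n. cos_coeff k * (\<integral>v. v ^ k * h v \<partial>lborel) * \<xi> ^ k) = (\<integral>v. (cos (\<xi> * v) - cos_poly n (\<xi> * v)) * h v \<partial>lborel)"
    unfolding *[symmetric] cos_transform_def using i by (simp add: left_diff_distrib)
qed

text \<open>Dominated convergence with two different remainder bounds:
  \<open>cos_poly_bound2\<close> dominates by the n-th absolute moment, while
  \<open>cos_poly_bound1\<close>, of one order more, gives convergence at each v.\<close>

lemma cos_transform_Taylor: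
  assumes h: "integrable lborel h" and hn: "\<And>k. k \<le> n \<Longrightarrow> integrable lborel (\<lambda>v. v ^ k * h v)"
  shows "((\<lambda>\<xi>. (cos_transform h \<xi> - (\<Sum>k\<le>n. cos_coeff k * (\<integral>v. v ^ k * h v \<partial>lborel) * \<xi> ^ k)) / \<xi> ^ n) \<longlongrightarrow> 0) (at 0)"
proof -
  have [measurable]: "h \<in> borel_measurable borel" using h by (auto dest: borel_measurable_integrable)
  have cm[measurable]: "cos_poly n \<in> borel_measurable borel" unfolding cos_poly_def by measurable
  have eq: "cos_transform h \<xi> - (\<Sum>k\<le>n. cos_coeff k * (\<integral>v. v ^ k * h v \<partial>lborel) * \<xi> ^ k) = (\<integral>v. (cos (\<xi> * v) - cos_poly n (\<xi> * v)) * h v \<partial>lborel)" for \<xi>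
    by (rule cos_transform_minus_poly(1)[OF h]) (rule hn)
  show ?thesis unfolding eq tendsto_at_iff_sequentially
  proof (intro allI impI)
    fix X :: "nat \<Rightarrow> real" assume X0: "\<forall>i. X i \<in> UNIV - {0}" and X: "X \<longlonglongrightarrow> 0"
    have "(\<lambda>i. \<integral>v. (cos (X i * v) - cos_poly n (X i * v)) * h v / X i ^ n \<partial>lborel) \<longlonglongrightarrow> integral\<^sup>L (lborel :: real measure) (\<lambda>v. 0)"
    proof (rule integral_dominated_convergence[where w="\<lambda>v. 2 * \<bar>v ^ n * h v\<bar>"])
      show "integrable lborel (\<lambda>v. 2 * \<bar>v ^ n * h v\<bar>)" using integrable_abs[OF hn[of n]] by simp
      show "AE v in lborel. norm ((cos (X i * v) - cos_poly n (X i * v)) * h v / X i ^ n) \<le> 2 * \<bar>v ^ n * h v\<bar>" for i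
      proof (rule AE_I2)
        fix v
        have "\<bar>cos (X i * v) - cos_poly n (X i * v)\<bar> * \<bar>h v\<bar> / \<bar>X i\<bar> ^ n \<le> 2 * \<bar>X i * v\<bar> ^ n * \<bar>h v\<bar> / \<bar>X i\<bar> ^ n"
          by (intro divide_right_mono mult_right_mono cos_poly_bound2) auto
        also have "\<dots> = 2 * \<bar>v ^ n * h v\<bar>" using X0 by (simp add: abs_mult power_mult_distrib power_abs)
        finally show "norm ((cos (X i * v) - cos_poly n (X i * v)) * h v / X i ^ n) \<le> 2 * \<bar>v ^ n * h v\<bar>"
          by (simp add: abs_mult power_abs)
      qed
      show "AE v in lborel. (\<lambda>i. (cos (X i * v) - cos_poly n (X i * v)) * h v / X i ^ n) \<longlonglongrightarrow> 0"
      proof (rule AE_I2)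
        fix v
        have "(\<lambda>i. \<bar>X i\<bar> * (\<bar>v\<bar> ^ Suc n * \<bar>h v\<bar>)) \<longlonglongrightarrow> \<bar>0\<bar> * (\<bar>v\<bar> ^ Suc n * \<bar>h v\<bar>)"
          by (intro tendsto_intros X)
        then have l: "(\<lambda>i. \<bar>X i\<bar> * (\<bar>v\<bar> ^ Suc n * \<bar>h v\<bar>)) \<longlonglongrightarrow> 0" by simp
        show "(\<lambda>i. (cos (X i * v) - cos_poly n (X i * v)) * h v / X i ^ n) \<longlonglongrightarrow> 0"
        proof (rule Lim_null_comparison[OF _ l], intro always_eventually allI)
          fix i
          have "\<bar>cos (X i * v) - cos_poly n (X i * v)\<bar> * \<bar>h v\<bar> / \<bar>X i\<bar> ^ n \<le> \<bar>X i * v\<bar> ^ Suc n * \<bar>h v\<bar> / \<bar>X i\<bar> ^ n"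
            by (intro divide_right_mono mult_right_mono cos_poly_bound1) auto
          also have "\<dots> = \<bar>X i\<bar> * (\<bar>v\<bar> ^ Suc n * \<bar>h v\<bar>)" using X0 by (simp add: abs_mult power_mult_distrib)
          finally show "norm ((cos (X i * v) - cos_poly n (X i * v)) * h v / X i ^ n) \<le> \<bar>X i\<bar> * (\<bar>v\<bar> ^ Suc n * \<bar>h v\<bar>)"
            by (simp add: abs_mult power_abs)
        qed
      qed
    qed measurable
    then show "((\<lambda>\<xi>. (\<integral>v. (cos (\<xi> * v) - cos_poly n (\<xi> * v)) * h v \<partial>lborel) / \<xi> ^ n) \<circ> X) \<longlonglongrightarrow> 0"
      by (simp add: o_def)
  qed
qed

text \<open>Once the lower coefficients are known to vanish, dividing by \<xi>^k and letting \<xi>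
  tend to 0 isolates the coefficient of order k.\<close>

lemma poly_smallo_zero:
  fixes a :: "nat \<Rightarrow> complex"
  assumes "(\<lambda>\<xi>::real. \<Sum>k\<le>n. a k * of_real \<xi> ^ k) \<in> o[at 0](\<lambda>\<xi>. of_real (\<xi> ^ n))" and "k \<le> n"
  shows "a k = 0"
  using assms(2)
proof (induction k rule: less_induct)
  case (less k)
  have t: "((\<lambda>\<xi>::real. (\<Sum>j\<le>n. a j * of_real \<xi> ^ j) / of_real (\<xi> ^ n)) \<longlongrightarrow> 0) (at 0)"
    by (rule smalloD_tendsto[OF assms(1)])
  have "((\<lambda>\<xi>::real. (\<Sum>j\<le>n. a j * of_real \<xi> ^ j) / of_real (\<xi> ^ n) * of_real \<xi> ^ (n - k)) \<longlongrightarrow> 0 * of_real 0 ^ (n - k)) (at 0)"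
    by (intro tendsto_intros t)
  then have "((\<lambda>\<xi>::real. (\<Sum>j\<le>n. a j * of_real \<xi> ^ j) / of_real (\<xi> ^ n) * of_real \<xi> ^ (n - k)) \<longlongrightarrow> 0) (at 0)"
    by simp
  moreover have "eventually (\<lambda>\<xi>::real. (\<Sum>j\<le>n. a j * of_real \<xi> ^ j) / of_real (\<xi> ^ n) * of_real \<xi> ^ (n - k) = (\<Sum>j\<in>{k..n}. a j * of_real \<xi> ^ (j - k))) (at 0)"
    unfolding eventually_at_filter
  proof (intro always_eventually allI impI)
    fix \<xi> :: real assume x: "\<xi> \<noteq> 0"
    have "(\<Sum>j\<le>n. a j * of_real \<xi> ^ j) = (\<Sum>j\<in>{k..n}. a j * of_real \<xi> ^ j)"
      using less by (intro sum.mono_neutral_right) auto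
    also have "\<dots> = (\<Sum>j\<in>{k..n}. a j * of_real \<xi> ^ (j - k)) * of_real \<xi> ^ k"
      unfolding sum_distrib_right by (intro sum.cong refl) (simp add: mult.assoc flip: power_add)
    finally have s: "(\<Sum>j\<le>n. a j * of_real \<xi> ^ j) = (\<Sum>j\<in>{k..n}. a j * of_real \<xi> ^ (j - k)) * of_real \<xi> ^ k" .
    have "(of_real (\<xi> ^ n) :: complex) = of_real \<xi> ^ k * of_real \<xi> ^ (n - k)"
      using less.prems by (simp flip: power_add)
    then show "(\<Sum>j\<le>n. a j * of_real \<xi> ^ j) / of_real (\<xi> ^ n) * of_real \<xi> ^ (n - k) = (\<Sum>j\<in>{k..n}. a j * of_real \<xi> ^ (j - k))"
      unfolding s using x by simp
  qed
  ultimately have l1: "((\<lambda>\<xi>::real. \<Sum>j\<in>{k..n}. a j * of_real \<xi> ^ (j - k)) \<longlongrightarrow> 0) (at 0)"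
    by (rule Lim_transform_eventually)
  have l2: "((\<lambda>\<xi>::real. \<Sum>j\<in>{k..n}. a j * of_real \<xi> ^ (j - k)) \<longlongrightarrow> (\<Sum>j\<in>{k..n}. a j * of_real 0 ^ (j - k))) (at 0)"
    by (intro tendsto_intros)
  have "(\<Sum>j\<in>{k..n}. a j * of_real 0 ^ (j - k)) = a k"
  proof -
    have "(\<Sum>j\<in>{k..n}. a j * of_real 0 ^ (j - k)) = (\<Sum>j\<in>{k..n}. if j = k then a k else 0)"
      by (intro sum.cong refl) (auto simp: power_0_left)
    then show ?thesis using less.prems by simp
  qed
  with tendsto_unique[OF _ l2 l1] show "a k = 0" by simp
qed

text \<open>Makes the definite description usable: two expansions of the same logarithm differ by a
  polynomial of degree at most r that is o(\<xi>^r), so they coincide.\<close>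

lemma cumulant_eqI:
  fixes \<kappa> :: "nat \<Rightarrow> real"
  assumes "(\<lambda>\<xi>::real. Ln (char M \<xi>) - (\<Sum>k\<le>r. complex_of_real (\<kappa> k) * (\<i> * complex_of_real \<xi>) ^ k / fact k))
       \<in> o[at 0](\<lambda>\<xi>. complex_of_real (\<xi> ^ r))" (is "?R \<kappa>")
  shows "cumulant M r = \<kappa> r"
  unfolding cumulant_def
proof (rule the_equality)
  show "\<exists>\<kappa>'::nat \<Rightarrow> real. \<kappa>' r = \<kappa> r \<and> ?R \<kappa>'" using assms by blast
  fix c assume "\<exists>\<kappa>'::nat \<Rightarrow> real. \<kappa>' r = c \<and> ?R \<kappa>'"
  then obtain \<kappa>' :: "nat \<Rightarrow> real" where k': "\<kappa>' r = c" "?R \<kappa>'" by blast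
  have "(\<lambda>\<xi>::real. (Ln (char M \<xi>) - (\<Sum>k\<le>r. complex_of_real (\<kappa> k) * (\<i> * complex_of_real \<xi>) ^ k / fact k))
     - (Ln (char M \<xi>) - (\<Sum>k\<le>r. complex_of_real (\<kappa>' k) * (\<i> * complex_of_real \<xi>) ^ k / fact k))) \<in> o[at 0](\<lambda>\<xi>. complex_of_real (\<xi> ^ r))"
    by (rule sum_in_smallo(2)[OF assms k'(2)])
  also have "(\<lambda>\<xi>::real. (Ln (char M \<xi>) - (\<Sum>k\<le>r. complex_of_real (\<kappa> k) * (\<i> * complex_of_real \<xi>) ^ k / fact k))
     - (Ln (char M \<xi>) - (\<Sum>k\<le>r. complex_of_real (\<kappa>' k) * (\<i> * complex_of_real \<xi>) ^ k / fact k)))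
    = (\<lambda>\<xi>::real. \<Sum>k\<le>r. (complex_of_real (\<kappa>' k - \<kappa> k) * \<i> ^ k / fact k) * of_real \<xi> ^ k)"
    by (rule ext) (simp add: sum_subtractf[symmetric] power_mult_distrib field_simps)
  finally have "complex_of_real (\<kappa>' r - \<kappa> r) * \<i> ^ r / fact r = 0"
    by (rule poly_smallo_zero) simp
  then show "c = \<kappa> r" using k' by simp
qed

text \<open>The derivative of a Taylor remainder of the cosine is minus one of the sine; it is
  written as an imaginary part to make the remainder bounds for the exponential available.\<close>

lemma cos_minus_poly_deriv:
  "((\<lambda>z. cos z - cos_poly (Suc n) z) has_real_derivative - Im (iexp z - (\<Sum>k\<le>n. (\<i> * complex_of_real z) ^ k / fact k))) (at z within A)"
proof -
  have im: "Im ((\<i> * complex_of_real z) ^ k / fact k) = Im (\<i> ^ k) * (z ^ k / fact k)" for k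
  proof -
    have "(\<i> * complex_of_real z) ^ k / fact k = \<i> ^ k * complex_of_real (z ^ k / fact k)"
      by (simp add: power_mult_distrib)
    also have "Im \<dots> = Im (\<i> ^ k) * (z ^ k / fact k)" by (simp only: times_complex.sel Re_complex_of_real Im_complex_of_real)
    finally show ?thesis .
  qed
  have cc: "cos_coeff (Suc k) * real (Suc k) = - (Im (\<i> ^ k) / fact k)" for k
    by (simp add: cos_coeff_Re field_simps del: of_nat_Suc)
  have "((\<lambda>z. cos z - (\<Sum>k\<le>Suc n. cos_coeff k * z ^ k)) has_real_derivative - sin z - (\<Sum>k\<le>Suc n. cos_coeff k * (real k * z ^ (k - 1)))) (at z within A)"
  proof (intro DERIV_diff)
    show "((\<lambda>z. \<Sum>k\<le>N. cos_coeff k * z ^ k) has_real_derivative (\<Sum>k\<le>N. cos_coeff k * (real k * z ^ (k - 1)))) (at z within A)" for N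
      by (auto intro!: derivative_eq_intros sum.cong)
  qed (auto intro: DERIV_subset[OF DERIV_cos])
  also have "(\<Sum>k\<le>Suc n. cos_coeff k * (real k * z ^ (k - 1))) = (\<Sum>k\<le>n. cos_coeff (Suc k) * real (Suc k) * z ^ k)"
    by (subst sum.atMost_Suc_shift) (simp add: mult.assoc)
  also have "\<dots> = - (\<Sum>k\<le>n. Im (\<i> ^ k) * (z ^ k / fact k))"
    unfolding cc sum_negf[symmetric] by (intro sum.cong) auto
  finally show ?thesis by (simp add: cos_poly_def Im_exp im)
qed

text \<open>The term of order 2n is real and can be added without changing the imaginary part, which
  gives order 2n + 1 for |z| \<le> 1; for |z| > 1 the order 2n - 1 is used. The exponent a lies
  between the two.\<close>

lemma cos_minus_poly_deriv_bound:
  assumes "1 \<le> n" "2 * real n - 1 \<le> a" "a \<le> 2 * real n + 1"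
  shows "\<bar>Im (iexp z - (\<Sum>k\<le>2*n-1. (\<i> * complex_of_real z) ^ k / fact k))\<bar> \<le> 2 * \<bar>z\<bar> powr a"
proof (cases "\<bar>z\<bar> \<le> 1")
  case True
  have s: "{..2*n} = insert (2*n) {..2*n-1}" using assms(1) by auto
  have "(\<i> * complex_of_real z) ^ (2*n) / fact (2*n) = complex_of_real ((- (z\<^sup>2)) ^ n / fact (2*n))"
    by (simp add: power_mult_distrib power_mult)
  then have "Im ((\<i> * complex_of_real z) ^ (2*n) / fact (2*n)) = 0" by (simp only: Im_complex_of_real)
  then have "Im (iexp z - (\<Sum>k\<le>2*n-1. (\<i> * complex_of_real z) ^ k / fact k)) = Im (iexp z - (\<Sum>k\<le>2*n. (\<i> * complex_of_real z) ^ k / fact k))"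
    unfolding s using assms(1) by (subst sum.insert) auto
  then have "\<bar>Im (iexp z - (\<Sum>k\<le>2*n-1. (\<i> * complex_of_real z) ^ k / fact k))\<bar> \<le> \<bar>z\<bar> ^ Suc (2*n) / fact (Suc (2*n))"
    by (simp only:) (rule order_trans[OF abs_Im_le_cmod iexp_approx1])
  also have "\<dots> \<le> \<bar>z\<bar> ^ Suc (2*n) / 1" by (intro divide_left_mono) (auto simp: fact_ge_1 simp del: fact_Suc)
  also have "\<dots> \<le> 2 * \<bar>z\<bar> powr a"
  proof (cases "z = 0")
    case False
    have "\<bar>z\<bar> ^ Suc (2*n) = \<bar>z\<bar> powr real (Suc (2*n))" using False by (subst powr_realpow) auto
    also have "\<dots> \<le> \<bar>z\<bar> powr a" using assms True False by (intro powr_mono') auto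
    also have "\<dots> \<le> 2 * \<bar>z\<bar> powr a" by simp
    finally show ?thesis by simp
  qed simp
  finally show ?thesis .
next
  case False
  have "\<bar>Im (iexp z - (\<Sum>k\<le>2*n-1. (\<i> * complex_of_real z) ^ k / fact k))\<bar> \<le> 2 * \<bar>z\<bar> ^ (2*n-1) / fact (2*n-1)"
    by (rule order_trans[OF abs_Im_le_cmod iexp_approx2])
  also have "\<dots> \<le> 2 * \<bar>z\<bar> ^ (2*n-1) / 1" by (intro divide_left_mono) (auto simp: fact_ge_1)
  also have "\<dots> \<le> 2 * \<bar>z\<bar> powr a"
  proof -
    have "\<bar>z\<bar> ^ (2*n-1) = \<bar>z\<bar> powr real (2*n-1)" using False by (subst powr_realpow) auto
    also have "\<dots> \<le> \<bar>z\<bar> powr a" using assms False by (intro powr_mono) (auto simp: of_nat_diff)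
    finally show ?thesis by simp
  qed
  finally show ?thesis .
qed

lemma cos_minus_poly_lip:
  assumes "1 \<le> n" "2 * real n - 1 \<le> a" "a \<le> 2 * real n + 1" and xy: "\<bar>x\<bar> \<le> m" "\<bar>y\<bar> \<le> m"
  shows "\<bar>(cos x - cos_poly (2*n) x) - (cos y - cos_poly (2*n) y)\<bar> \<le> 2 * m powr a * \<bar>x - y\<bar>"
proof -
  have n: "2 * n = Suc (2*n-1)" using assms(1) by simp
  have "norm ((cos x - cos_poly (Suc (2*n-1)) x) - (cos y - cos_poly (Suc (2*n-1)) y)) \<le> 2 * m powr a * norm (x - y)"
  proof (rule field_differentiable_bound[where S="{-m..m}"])
    show "((\<lambda>z. cos z - cos_poly (Suc (2*n-1)) z) has_real_derivative - Im (iexp z - (\<Sum>k\<le>2*n-1. (\<i> * complex_of_real z) ^ k / fact k))) (at z within {-m..m})" for z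
      by (rule cos_minus_poly_deriv)
    fix z assume "z \<in> {-m..m}"
    then have "\<bar>z\<bar> powr a \<le> m powr a" using assms by (intro powr_mono2) auto
    then show "norm (- Im (iexp z - (\<Sum>k\<le>2*n-1. (\<i> * complex_of_real z) ^ k / fact k))) \<le> 2 * m powr a"
      using cos_minus_poly_deriv_bound[OF assms(1-3), of z] by simp
  qed (use xy in auto)
  then show ?thesis using n by simp
qed

section \<open>Transforms of the centred Gaussian\<close>

lemma prob_density_normal: "0 < \<sigma> \<Longrightarrow> prob_density_fun (normal_density 0 \<sigma>)"
  by (simp add: prob_density_fun_def)

lemma cos_transform_normal:
  assumes "0 < \<sigma>" shows "cos_transform (normal_density 0 \<sigma>) \<xi> = exp (- (\<sigma>\<^sup>2 * \<xi>\<^sup>2 / 2))"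
proof -
  have "cos_transform (normal_density 0 \<sigma>) \<xi> = \<sigma> * (\<integral>u. cos (\<xi> * (\<sigma> * u)) * normal_density 0 \<sigma> (\<sigma> * u) \<partial>lborel)"
    unfolding cos_transform_def using assms by (subst lborel_integral_real_affine[where c=\<sigma> and t=0]) auto
  also have "\<dots> = (\<integral>u. \<sigma> * (cos (\<xi> * (\<sigma> * u)) * normal_density 0 \<sigma> (\<sigma> * u)) \<partial>lborel)" by simp
  also have "\<dots> = cos_transform std_normal_density (\<sigma> * \<xi>)"
    unfolding cos_transform_def
    using assms by (intro Bochner_Integration.integral_cong refl) (simp add: normal_density_def real_sqrt_mult power_mult_distrib mult_ac)
  also have "\<dots> = Re (char (distr_of std_normal_density) (\<sigma> * \<xi>))"
    by (rule Re_char_density[OF prob_density_normal, symmetric]) simp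
  also have "\<dots> = exp (- ((\<sigma> * \<xi>)\<^sup>2 / 2))" by (simp add: char_std_normal_distribution Re_complex_of_real del: of_real_exp)
  finally show ?thesis by (simp add: power_mult_distrib)
qed

lemma char_normal:
  assumes "0 < \<sigma>" shows "char (distr_of (normal_density 0 \<sigma>)) \<xi> = complex_of_real (exp (- (\<sigma>\<^sup>2 * \<xi>\<^sup>2 / 2)))"
proof -
  note N = prob_density_normal[OF assms]
  have "(\<integral>v. sin (\<xi> * v) * normal_density 0 \<sigma> v \<partial>lborel) = 0"
    using lborel_integral_reflect[of "\<lambda>v. sin (\<xi> * v) * normal_density 0 \<sigma> v"] by (simp add: normal_density_def)
  then show ?thesis
    by (simp add: complex_eq_iff Re_char_density[OF N] Im_char_density[OF N] cos_transform_normal[OF assms] del: of_real_exp)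
qed

section \<open>The initial datum\<close>

locale kac_initial =
  fixes f0 :: "real \<Rightarrow> real" and \<sigma> \<delta> :: real and chi :: nat
  assumes f0: "prob_density_fun f0"
    and sigma_def: "\<sigma> = sqrt (LBINT v. v\<^sup>2 * f0 v)"
    and chi: "chi > 2" and delta: "0 \<le> \<delta>" "\<delta> < 2"
    and moment: "integrable lborel (\<lambda>v. \<bar>v\<bar> powr (2 * real chi + \<delta>) * f0 v)"
    and cumulants: "\<forall>m\<in>{2..chi}. cumulant (distr_of (symmetrization f0)) (2 * m) = 0"
begin

definition s :: real where "s = 2 * real chi + \<delta>"
definition h :: "real \<Rightarrow> real" where "h v = f0 v - normal_density 0 \<sigma> v"
text \<open>Only even moments are recorded, since the Taylor polynomials of the cosine contain no
  others.\<close>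

definition d :: "nat \<Rightarrow> real" where "d j = (\<integral>v. v ^ (2 * j) * h v \<partial>lborel)"

lemma f0_integrable: "integrable lborel f0" and f0_nonneg: "0 \<le> f0 v" and f0_integral: "(\<integral>v. f0 v \<partial>lborel) = 1"
  using f0 by (auto simp: prob_density_fun_def)

lemma f0_measurable [measurable]: "f0 \<in> borel_measurable borel"
  using f0_integrable by (auto dest: borel_measurable_integrable)

lemma f0_moment: "real k \<le> s \<Longrightarrow> integrable lborel (\<lambda>v. v ^ k * f0 v)"
  by (rule integrable_lower_moment[OF f0_integrable moment]) (simp add: s_def)

lemma second_moment_pos: "0 < (LBINT v. v\<^sup>2 * f0 v)"
proof -
  have i: "integrable lborel (\<lambda>v. v\<^sup>2 * f0 v)" using chi delta by (intro f0_moment) (simp add: s_def)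
  have "(LBINT v. v\<^sup>2 * f0 v) \<noteq> 0"
  proof
    assume "(LBINT v. v\<^sup>2 * f0 v) = 0"
    then have "AE v in lborel. v\<^sup>2 * f0 v = 0"
      using integral_nonneg_eq_0_iff_AE[OF i] f0_nonneg by simp
    then have "AE v in lborel. f0 v = 0" using AE_lborel_singleton[of 0] by eventually_elim auto
    then have "(\<integral>v. f0 v \<partial>lborel) = 0" by (rule integral_eq_zero_AE)
    then show False using f0_integral by simp
  qed
  moreover have "0 \<le> (LBINT v. v\<^sup>2 * f0 v)" using f0_nonneg by (intro integral_nonneg_AE) auto
  ultimately show ?thesis by simp
qed

lemma sigma_pos: "0 < \<sigma>" and sigma_sq: "\<sigma>\<^sup>2 = (LBINT v. v\<^sup>2 * f0 v)"
  using second_moment_pos by (simp_all add: sigma_def)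

lemma normal_abs_moment: "integrable lborel (\<lambda>v. \<bar>v\<bar> powr s * normal_density 0 \<sigma> v)"
proof -
  have "integrable lborel (\<lambda>v. normal_density 0 \<sigma> v + normal_density 0 \<sigma> v * \<bar>v - 0\<bar> ^ (2*chi+2))"
    using sigma_pos by (intro Bochner_Integration.integrable_add integrable_normal_moment_abs integrable_normal_density)
  then show ?thesis
  proof (rule Bochner_Integration.integrable_bound)
    have "norm (\<bar>v\<bar> powr s * normal_density 0 \<sigma> v) \<le> norm (normal_density 0 \<sigma> v + normal_density 0 \<sigma> v * \<bar>v - 0\<bar> ^ (2*chi+2))" for v
    proof -
      have "\<bar>v\<bar> powr s \<le> 1 + \<bar>v\<bar> ^ (2*chi+2)"
      proof (cases "\<bar>v\<bar> \<le> 1")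
        case True
        have "\<bar>v\<bar> powr s \<le> 1" using True delta by (intro powr_le1) (auto simp: s_def)
        then show ?thesis by (simp add: add_increasing2)
      next
        case False
        then have "\<bar>v\<bar> powr s \<le> \<bar>v\<bar> powr real (2*chi+2)" using delta by (intro powr_mono) (auto simp: s_def)
        also have "\<dots> = \<bar>v\<bar> ^ (2*chi+2)" using False by (subst powr_realpow) auto
        finally show ?thesis by simp
      qed
      then have "\<bar>v\<bar> powr s * normal_density 0 \<sigma> v \<le> (1 + \<bar>v\<bar> ^ (2*chi+2)) * normal_density 0 \<sigma> v"
        by (rule mult_right_mono) simp
      then show ?thesis by (simp add: algebra_simps)
    qed
    then show "AE v in lborel. norm (\<bar>v\<bar> powr s * normal_density 0 \<sigma> v) \<le> norm (normal_density 0 \<sigma> v + normal_density 0 \<sigma> v * \<bar>v - 0\<bar> ^ (2*chi+2))"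
      by simp
  qed simp
qed

lemma h_integrable: "integrable lborel h" and h_abs_moment: "integrable lborel (\<lambda>v. \<bar>v\<bar> powr s * h v)"
proof -
  show "integrable lborel h" unfolding h_def using f0_integrable sigma_pos by (intro Bochner_Integration.integrable_diff) auto
  show "integrable lborel (\<lambda>v. \<bar>v\<bar> powr s * h v)"
    unfolding h_def right_diff_distrib using moment normal_abs_moment by (intro Bochner_Integration.integrable_diff) (auto simp: s_def)
qed

lemma h_moment: "real k \<le> s \<Longrightarrow> integrable lborel (\<lambda>v. v ^ k * h v)"
  by (rule integrable_lower_moment[OF h_integrable h_abs_moment])

lemma cos_transform_h: "cos_transform h \<xi> = cos_transform f0 \<xi> - exp (- (\<sigma>\<^sup>2 * \<xi>\<^sup>2 / 2))"
  using integrable_cos_mult[OF f0_integrable, of \<xi>] integrable_cos_mult[of "normal_density 0 \<sigma>" \<xi>] sigma_pos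
  unfolding cos_transform_normal[OF sigma_pos, symmetric] by (simp add: cos_transform_def h_def right_diff_distrib)

lemma d_0: "d 0 = 0" and d_1: "d 1 = 0"
proof -
  show "d 0 = 0" unfolding d_def h_def using f0_integrable f0_integral sigma_pos by simp
  have "integrable lborel (\<lambda>v. v\<^sup>2 * f0 v)" using chi delta by (intro f0_moment) (simp add: s_def)
  moreover have "integrable lborel (\<lambda>v. v\<^sup>2 * normal_density 0 \<sigma> v)"
    using integrable_normal_moment[OF sigma_pos, of 0 2] by (simp add: mult.commute)
  moreover have "(\<integral>v. v\<^sup>2 * normal_density 0 \<sigma> v \<partial>lborel) = \<sigma>\<^sup>2"
    using integral_normal_moment_even[OF sigma_pos, of 0 1] by (simp add: mult.commute)
  ultimately show "d 1 = 0" unfolding d_def h_def by (simp add: right_diff_distrib sigma_sq)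
qed

lemma Taylor_sum:
  assumes "\<And>j. j < n \<Longrightarrow> d j = 0"
  shows "(\<Sum>k\<le>2*n. cos_coeff k * (\<integral>v. v ^ k * h v \<partial>lborel) * \<xi> ^ k) = (-1) ^ n / fact (2*n) * d n * \<xi> ^ (2*n)"
proof -
  have "(\<Sum>k\<le>2*n. cos_coeff k * (\<integral>v. v ^ k * h v \<partial>lborel) * \<xi> ^ k) = (\<Sum>k\<le>2*n. if k = 2*n then (-1) ^ n / fact (2*n) * d n * \<xi> ^ (2*n) else 0)"
  proof (rule sum.cong[OF refl])
    fix k assume k: "k \<in> {..2*n}"
    show "cos_coeff k * (\<integral>v. v ^ k * h v \<partial>lborel) * \<xi> ^ k = (if k = 2*n then (-1) ^ n / fact (2*n) * d n * \<xi> ^ (2*n) else 0)"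
    proof (cases "even k")
      case True
      then obtain j where j: "k = 2 * j" by (elim evenE)
      have "(\<integral>v. v ^ k * h v \<partial>lborel) = d j" by (simp add: d_def j)
      then show ?thesis using k assms[of j] j by (auto simp: cos_coeff_def)
    next
      case False
      then show ?thesis by (auto simp: cos_coeff_def)
    qed
  qed
  then show ?thesis by simp
qed

text \<open>If the even moments of f0 and of the Gaussian agree below order 2n, the cosine transform
  of f0 is g (1 + R) with R close to c \<xi>^2n, so its logarithm is - \<sigma>^2 \<xi>^2 / 2 + c
  \<xi>^2n up to smaller order. Hence the first moment difference that could be nonzero is the
  cumulant of order 2n, and that is 0.\<close>

lemma d_step:
  assumes n: "2 \<le> n" "n \<le> chi" and dj: "\<And>j. j < n \<Longrightarrow> d j = 0"
  shows "d n = 0"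
proof -
  define c where "c = (-1) ^ n / fact (2*n) * d n"
  define g where "g = (\<lambda>\<xi>. exp (- (\<sigma>\<^sup>2 * \<xi>\<^sup>2 / 2)))"
  define E where "E = cos_transform h"
  define R where "R = (\<lambda>\<xi>. E \<xi> / g \<xi>)"
  have le: "real k \<le> s" if "k \<le> 2*n" for k using that n(2) delta by (simp add: s_def)
  have T: "(\<Sum>k\<le>2*n. cos_coeff k * (\<integral>v. v ^ k * h v \<partial>lborel) * \<xi> ^ k) = c * \<xi> ^ (2*n)" for \<xi>
    unfolding c_def by (rule Taylor_sum) (rule dj)
  have "((\<lambda>\<xi>. (E \<xi> - (\<Sum>k\<le>2*n. cos_coeff k * (\<integral>v. v ^ k * h v \<partial>lborel) * \<xi> ^ k)) / \<xi> ^ (2*n)) \<longlongrightarrow> 0) (at 0)"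
    unfolding E_def by (rule cos_transform_Taylor[OF h_integrable]) (intro h_moment le)
  then have "((\<lambda>\<xi>. (E \<xi> - c * \<xi> ^ (2*n)) / \<xi> ^ (2*n)) \<longlongrightarrow> 0) (at 0)" unfolding T .
  then have "((\<lambda>\<xi>. (E \<xi> - c * \<xi> ^ (2*n)) / \<xi> ^ (2*n) + c) \<longlongrightarrow> 0 + c) (at 0)" by (intro tendsto_intros)
  moreover have "eventually (\<lambda>\<xi>. (E \<xi> - c * \<xi> ^ (2*n)) / \<xi> ^ (2*n) + c = E \<xi> / \<xi> ^ (2*n)) (at (0::real))"
    unfolding eventually_at_filter by (intro always_eventually) (auto simp: field_simps)
  ultimately have E: "((\<lambda>\<xi>. E \<xi> / \<xi> ^ (2*n)) \<longlongrightarrow> c) (at 0)" by (simp add: Lim_transform_eventually)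
  have g: "(g \<longlongrightarrow> 1) (at 0)" unfolding g_def by (auto intro!: tendsto_eq_intros)
  have gp: "g \<xi> > 0" for \<xi> by (simp add: g_def)
  have "((\<lambda>\<xi>. E \<xi> / \<xi> ^ (2*n) / g \<xi>) \<longlongrightarrow> c / 1) (at 0)" by (intro tendsto_intros E g) simp
  then have R: "((\<lambda>\<xi>. R \<xi> / \<xi> ^ (2*n)) \<longlongrightarrow> c) (at 0)" by (simp add: R_def mult.commute)
  have "((\<lambda>\<xi>. R \<xi> / \<xi> ^ (2*n) * \<xi> ^ (2*n)) \<longlongrightarrow> c * 0 ^ (2*n)) (at 0)" by (intro tendsto_intros R)
  then have "((\<lambda>\<xi>. R \<xi> / \<xi> ^ (2*n) * \<xi> ^ (2*n)) \<longlongrightarrow> 0) (at 0)"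
    by (rule tendsto_eq_rhs) (use n in simp)
  moreover have "eventually (\<lambda>\<xi>. R \<xi> / \<xi> ^ (2*n) * \<xi> ^ (2*n) = R \<xi>) (at (0::real))"
    unfolding eventually_at_filter by (intro always_eventually) auto
  ultimately have R0: "(R \<longlongrightarrow> 0) (at 0)" by (rule Lim_transform_eventually)
  have small: "eventually (\<lambda>\<xi>. \<bar>R \<xi>\<bar> \<le> 1/2) (at 0)"
    using R0[THEN tendstoD, of "1/2"] by (auto elim!: eventually_mono)
  \<comment> \<open>The error of the logarithm is at most 2 R^2, and R^2 / \<xi>^2n is the
    convergent R / \<xi>^2n times R, which tends to 0.\<close>
  have ln_diff: "((\<lambda>\<xi>. (ln (1 + R \<xi>) - R \<xi>) / \<xi> ^ (2*n)) \<longlongrightarrow> 0) (at 0)"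
  proof (rule Lim_null_comparison)
    have "((\<lambda>\<xi>. 2 * \<bar>R \<xi> / \<xi> ^ (2*n)\<bar> * \<bar>R \<xi>\<bar>) \<longlongrightarrow> 2 * \<bar>c\<bar> * \<bar>0\<bar>) (at 0)" by (intro tendsto_intros R R0)
    then show "((\<lambda>\<xi>. 2 * \<bar>R \<xi> / \<xi> ^ (2*n)\<bar> * \<bar>R \<xi>\<bar>) \<longlongrightarrow> 0) (at 0)" by simp
    show "eventually (\<lambda>\<xi>. norm ((ln (1 + R \<xi>) - R \<xi>) / \<xi> ^ (2*n)) \<le> 2 * \<bar>R \<xi> / \<xi> ^ (2*n)\<bar> * \<bar>R \<xi>\<bar>) (at 0)"
      using small
    proof eventually_elim
      case (elim \<xi>)
      have "\<bar>ln (1 + R \<xi>) - R \<xi>\<bar> / \<bar>\<xi> ^ (2*n)\<bar> \<le> 2 * (R \<xi>)\<^sup>2 / \<bar>\<xi> ^ (2*n)\<bar>"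
        using abs_ln_one_plus_x_minus_x_bound[OF elim] by (intro divide_right_mono) auto
      also have "2 * (R \<xi>)\<^sup>2 = 2 * (\<bar>R \<xi>\<bar> * \<bar>R \<xi>\<bar>)" by (simp add: power2_eq_square abs_mult[symmetric])
      finally show ?case by (simp add: abs_divide)
    qed
  qed
  have "((\<lambda>\<xi>. (ln (1 + R \<xi>) - R \<xi>) / \<xi> ^ (2*n) + R \<xi> / \<xi> ^ (2*n) - c) \<longlongrightarrow> 0 + c - c) (at 0)"
    by (intro tendsto_intros ln_diff R)
  then have "((\<lambda>\<xi>. complex_of_real ((ln (1 + R \<xi>) - R \<xi>) / \<xi> ^ (2*n) + R \<xi> / \<xi> ^ (2*n) - c)) \<longlongrightarrow> complex_of_real (0 + c - c)) (at 0)"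
    by (rule tendsto_of_real)
  then have lim: "((\<lambda>\<xi>. complex_of_real ((ln (1 + R \<xi>) - R \<xi>) / \<xi> ^ (2*n) + R \<xi> / \<xi> ^ (2*n) - c)) \<longlongrightarrow> 0) (at 0)" by simp
  \<comment> \<open>Read off from the expansion of the logarithm: c \<xi>^2n is d n (i \<xi>)^2n /
    (2n)!. As n \<ge> 2, the two nonzero entries do not collide.\<close>
  define \<kappa> where "\<kappa> = (\<lambda>k::nat. if k = 2 then \<sigma>\<^sup>2 else if k = 2*n then d n else 0)"
  have ksum: "(\<Sum>k\<le>2*n. complex_of_real (\<kappa> k) * (\<i> * complex_of_real \<xi>) ^ k / fact k) = complex_of_real (- (\<sigma>\<^sup>2 * \<xi>\<^sup>2 / 2) + c * \<xi> ^ (2*n))" for \<xi>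
  proof -
    have "(\<Sum>k\<le>2*n. complex_of_real (\<kappa> k) * (\<i> * complex_of_real \<xi>) ^ k / fact k) = (\<Sum>k\<in>{2, 2*n}. complex_of_real (\<kappa> k) * (\<i> * complex_of_real \<xi>) ^ k / fact k)"
      using n by (intro sum.mono_neutral_right) (auto simp: \<kappa>_def)
    also have "\<dots> = complex_of_real (\<sigma>\<^sup>2) * (\<i> * complex_of_real \<xi>) ^ 2 / fact 2 + complex_of_real (d n) * (\<i> * complex_of_real \<xi>) ^ (2*n) / fact (2*n)"
      using n by (simp add: \<kappa>_def)
    also have "\<dots> = complex_of_real (- (\<sigma>\<^sup>2 * \<xi>\<^sup>2 / 2) + c * \<xi> ^ (2*n))"
      by (simp add: c_def power_mult_distrib power_mult fact_2 power_minus[of "(complex_of_real \<xi>)\<^sup>2"])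
    finally show ?thesis .
  qed
  have "cumulant (distr_of (symmetrization f0)) (2*n) = \<kappa> (2*n)"
  proof (rule cumulant_eqI, rule smalloI_tendsto)
    show "eventually (\<lambda>\<xi>. complex_of_real (\<xi> ^ (2*n)) \<noteq> 0) (at (0::real))"
      unfolding eventually_at_filter by (intro always_eventually) auto
    show "((\<lambda>\<xi>. (Ln (char (distr_of (symmetrization f0)) \<xi>) - (\<Sum>k\<le>2*n. complex_of_real (\<kappa> k) * (\<i> * complex_of_real \<xi>) ^ k / fact k)) / complex_of_real (\<xi> ^ (2*n))) \<longlongrightarrow> 0) (at 0)"
    proof (rule Lim_transform_eventually[OF lim])
      have nz: "eventually (\<lambda>\<xi>::real. \<xi> \<noteq> 0) (at 0)" unfolding eventually_at_filter by simp
      show "eventually (\<lambda>\<xi>. complex_of_real ((ln (1 + R \<xi>) - R \<xi>) / \<xi> ^ (2*n) + R \<xi> / \<xi> ^ (2*n) - c) =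
         (Ln (char (distr_of (symmetrization f0)) \<xi>) - (\<Sum>k\<le>2*n. complex_of_real (\<kappa> k) * (\<i> * complex_of_real \<xi>) ^ k / fact k)) / complex_of_real (\<xi> ^ (2*n))) (at 0)"
        using small nz
      proof eventually_elim
        case (elim \<xi>)
        have "cos_transform f0 \<xi> = g \<xi> * (1 + R \<xi>)"
          using gp[of \<xi>] cos_transform_h[of \<xi>] by (simp add: R_def E_def g_def field_simps)
        moreover have p: "1 + R \<xi> > 0" using elim by linarith
        ultimately have "ln (cos_transform f0 \<xi>) = - (\<sigma>\<^sup>2 * \<xi>\<^sup>2 / 2) + ln (1 + R \<xi>)" and "cos_transform f0 \<xi> > 0"
          using gp[of \<xi>] by (simp_all add: ln_mult g_def)
        then have "Ln (char (distr_of (symmetrization f0)) \<xi>) = complex_of_real (- (\<sigma>\<^sup>2 * \<xi>\<^sup>2 / 2) + ln (1 + R \<xi>))"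
          unfolding char_symmetrization[OF f0] by (simp add: Ln_of_real)
        then have "(Ln (char (distr_of (symmetrization f0)) \<xi>) - (\<Sum>k\<le>2*n. complex_of_real (\<kappa> k) * (\<i> * complex_of_real \<xi>) ^ k / fact k)) / complex_of_real (\<xi> ^ (2*n))
          = complex_of_real ((ln (1 + R \<xi>) - c * \<xi> ^ (2*n)) / \<xi> ^ (2*n))"
          unfolding ksum by simp
        also have "(ln (1 + R \<xi>) - c * \<xi> ^ (2*n)) / \<xi> ^ (2*n) = (ln (1 + R \<xi>) - R \<xi>) / \<xi> ^ (2*n) + R \<xi> / \<xi> ^ (2*n) - c"
          using elim(2) by (simp add: field_simps)
        finally show ?case by simp
      qed
    qed
  qed
  moreover have "cumulant (distr_of (symmetrization f0)) (2*n) = 0" using cumulants n by auto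
  ultimately show "d n = 0" using n by (simp add: \<kappa>_def split: if_splits)
qed

lemma d_zero: "n \<le> chi \<Longrightarrow> d n = 0"
proof (induction n rule: less_induct)
  case (less n)
  consider "n = 0" | "n = 1" | "2 \<le> n" by linarith
  then show ?case
  proof cases
    case 3
    show ?thesis by (rule d_step[OF 3 less.prems less.IH]) (use less.prems in auto)
  next
    case 2 show ?thesis unfolding 2 by (rule d_1)
  next
    case 1 show ?thesis unfolding 1 by (rule d_0)
  qed
qed

text \<open>As the even moments of h vanish up to order 2 chi, the Taylor polynomial can be
  subtracted from the cosine under the integral. On [-m, m] scaled by v the remainder is Lipschitz
  by \<open>cos_minus_poly_lip\<close> with exponent s - 1, and the factor |v| of the increment
  completes it to the moment of order s.\<close>

theorem initial_lip:
  "\<exists>D\<ge>0. \<forall>x y m. \<bar>x\<bar> \<le> m \<longrightarrow> \<bar>y\<bar> \<le> m \<longrightarrow>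
     \<bar>(cos_transform f0 x - exp (- (\<sigma>\<^sup>2 * x\<^sup>2 / 2))) - (cos_transform f0 y - exp (- (\<sigma>\<^sup>2 * y\<^sup>2 / 2)))\<bar> \<le> D * \<bar>x - y\<bar> * m powr (s - 1)"
proof (intro exI[of _ "2 * (\<integral>v. \<bar>\<bar>v\<bar> powr s * h v\<bar> \<partial>lborel)"] conjI allI impI)
  show "0 \<le> 2 * (\<integral>v. \<bar>\<bar>v\<bar> powr s * h v\<bar> \<partial>lborel)" by simp
  fix x y m :: real assume xy: "\<bar>x\<bar> \<le> m" "\<bar>y\<bar> \<le> m"
  define C where "C = (\<lambda>z. cos z - cos_poly (2*chi) z)"
  have le: "real k \<le> s" if "k \<le> 2*chi" for k using that delta by (simp add: s_def)
  have T: "(\<Sum>k\<le>2*chi. cos_coeff k * (\<integral>v. v ^ k * h v \<partial>lborel) * \<xi> ^ k) = 0" for \<xi>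
    by (subst Taylor_sum) (simp_all add: d_zero)
  have i: "integrable lborel (\<lambda>v. C (\<xi> * v) * h v)" for \<xi>
    unfolding C_def by (rule cos_transform_minus_poly(2)[OF h_integrable]) (intro h_moment le)
  have "cos_transform h \<xi> - (\<Sum>k\<le>2*chi. cos_coeff k * (\<integral>v. v ^ k * h v \<partial>lborel) * \<xi> ^ k) = (\<integral>v. C (\<xi> * v) * h v \<partial>lborel)" for \<xi>
    unfolding C_def by (rule cos_transform_minus_poly(1)[OF h_integrable]) (intro h_moment le)
  then have eq: "cos_transform h \<xi> = (\<integral>v. C (\<xi> * v) * h v \<partial>lborel)" for \<xi> unfolding T by simp
  have bd: "\<bar>C (x * v) - C (y * v)\<bar> \<le> 2 * \<bar>x - y\<bar> * m powr (s - 1) * \<bar>v\<bar> powr s" for v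
  proof -
    have "\<bar>C (x * v) - C (y * v)\<bar> \<le> 2 * (m * \<bar>v\<bar>) powr (s - 1) * \<bar>x * v - y * v\<bar>"
      unfolding C_def using chi delta xy by (intro cos_minus_poly_lip) (auto simp: s_def abs_mult intro!: mult_right_mono)
    also have "\<bar>x * v - y * v\<bar> = \<bar>x - y\<bar> * \<bar>v\<bar>" by (simp add: abs_mult[symmetric] algebra_simps)
    also have "(m * \<bar>v\<bar>) powr (s - 1) = m powr (s - 1) * \<bar>v\<bar> powr (s - 1)" using xy by (intro powr_mult)
    also have "2 * (m powr (s - 1) * \<bar>v\<bar> powr (s - 1)) * (\<bar>x - y\<bar> * \<bar>v\<bar>) = 2 * \<bar>x - y\<bar> * m powr (s - 1) * \<bar>v\<bar> powr s"
      by (cases "v = 0") (auto simp: powr_diff)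
    finally show ?thesis .
  qed
  have "\<bar>cos_transform h x - cos_transform h y\<bar> = \<bar>\<integral>v. (C (x * v) - C (y * v)) * h v \<partial>lborel\<bar>"
    unfolding eq left_diff_distrib using i by simp
  also have "\<dots> \<le> (\<integral>v. \<bar>(C (x * v) - C (y * v)) * h v\<bar> \<partial>lborel)" by (rule integral_abs_bound)
  also have "\<dots> \<le> (\<integral>v. 2 * \<bar>x - y\<bar> * m powr (s - 1) * \<bar>\<bar>v\<bar> powr s * h v\<bar> \<partial>lborel)"
  proof (rule integral_mono_AE')
    show "integrable lborel (\<lambda>v. 2 * \<bar>x - y\<bar> * m powr (s - 1) * \<bar>\<bar>v\<bar> powr s * h v\<bar>)"
      using h_abs_moment by (intro integrable_mult_right integrable_abs)
    show "AE v in lborel. \<bar>(C (x * v) - C (y * v)) * h v\<bar> \<le> 2 * \<bar>x - y\<bar> * m powr (s - 1) * \<bar>\<bar>v\<bar> powr s * h v\<bar>"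
      using mult_right_mono[OF bd abs_ge_zero] by (auto simp: abs_mult mult.assoc)
  qed auto
  also have "\<dots> = 2 * (\<integral>v. \<bar>\<bar>v\<bar> powr s * h v\<bar> \<partial>lborel) * \<bar>x - y\<bar> * m powr (s - 1)" by simp
  finally show "\<bar>(cos_transform f0 x - exp (- (\<sigma>\<^sup>2 * x\<^sup>2 / 2))) - (cos_transform f0 y - exp (- (\<sigma>\<^sup>2 * y\<^sup>2 / 2)))\<bar> \<le> 2 * (\<integral>v. \<bar>\<bar>v\<bar> powr s * h v\<bar> \<partial>lborel) * \<bar>x - y\<bar> * m powr (s - 1)"
    unfolding cos_transform_h .
qed

lemma initial_quadratic: "1 - cos_transform f0 \<xi> \<le> \<sigma>\<^sup>2 * \<xi>\<^sup>2 / 2"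
proof -
  have i: "integrable lborel (\<lambda>v. v\<^sup>2 * f0 v)" using chi delta by (intro f0_moment) (simp add: s_def)
  have "1 - cos_transform f0 \<xi> = (\<integral>v. f0 v - cos (\<xi> * v) * f0 v \<partial>lborel)"
    unfolding cos_transform_def using f0_integrable f0_integral integrable_cos_mult[OF f0_integrable, of \<xi>] by simp
  also have "\<dots> \<le> (\<integral>v. \<xi>\<^sup>2 / 2 * (v\<^sup>2 * f0 v) \<partial>lborel)"
  proof (rule integral_mono)
    fix v
    have "1 - cos (\<xi> * v) \<le> (\<xi> * v)\<^sup>2 / 2"
    proof -
      have "1 - cos (\<xi> * v) = 2 * (sin (\<xi> * v / 2))\<^sup>2"
        using cos_double_sin[of "\<xi> * v / 2"] by simp
      also have "(sin (\<xi> * v / 2))\<^sup>2 \<le> (\<xi> * v / 2)\<^sup>2"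
        using abs_sin_x_le_abs_x[of "\<xi> * v / 2"] by (simp only: abs_le_square_iff)
      finally show ?thesis by (simp add: power_divide)
    qed
    then have "(1 - cos (\<xi> * v)) * f0 v \<le> (\<xi> * v)\<^sup>2 / 2 * f0 v" by (rule mult_right_mono[OF _ f0_nonneg])
    then show "f0 v - cos (\<xi> * v) * f0 v \<le> \<xi>\<^sup>2 / 2 * (v\<^sup>2 * f0 v)" by (simp add: algebra_simps power_mult_distrib)
  qed (use i f0_integrable integrable_cos_mult[OF f0_integrable, of \<xi>] in auto)
  also have "\<dots> = \<sigma>\<^sup>2 * \<xi>\<^sup>2 / 2" by (simp add: sigma_sq mult.commute)
  finally show ?thesis .
qed

end

section \<open>The mild equation\<close>

text \<open>Values in the extended nonnegative reals keep the collision integral meaningful at every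
  velocity, even where it diverges, and make Tonelli's theorem applicable throughout.\<close>

definition gain :: "(real \<Rightarrow> ennreal) \<Rightarrow> real \<Rightarrow> ennreal" where
  "gain H v = (\<integral>\<^sup>+\<theta>. (\<integral>\<^sup>+w. H (v * cos \<theta> - w * sin \<theta>) * H (v * sin \<theta> + w * cos \<theta>) \<partial>lborel) \<partial>angle)"

definition mild :: "(real \<Rightarrow> real \<Rightarrow> ennreal) \<Rightarrow> real \<Rightarrow> real \<Rightarrow> ennreal" where
  "mild G t v = (\<integral>\<^sup>+\<tau>. gain (G \<tau>) v \<partial>clock t)"

lemma measurable_gain:
  fixes G :: "real \<Rightarrow> real \<Rightarrow> ennreal"
  assumes m: "(\<lambda>z. G (fst z) (snd z)) \<in> borel_measurable borel2"
  shows "(\<lambda>z. gain (G (fst z)) (snd z)) \<in> borel_measurable borel2"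
proof -
  let ?B = "borel :: real measure"
  let ?M = "(borel2 \<Otimes>\<^sub>M ?B) \<Otimes>\<^sub>M ?B"
  have 1: "(\<lambda>p. G (fst (fst (fst p))) (snd (fst (fst p)) * cos (snd (fst p)) - snd p * sin (snd (fst p)))) \<in> borel_measurable ?M"
    using measurable_compose[OF _ m, of "\<lambda>p. (fst (fst (fst p)), snd (fst (fst p)) * cos (snd (fst p)) - snd p * sin (snd (fst p)))" ?M] by simp
  have 2: "(\<lambda>p. G (fst (fst (fst p))) (snd (fst (fst p)) * sin (snd (fst p)) + snd p * cos (snd (fst p)))) \<in> borel_measurable ?M"
    using measurable_compose[OF _ m, of "\<lambda>p. (fst (fst (fst p)), snd (fst (fst p)) * sin (snd (fst p)) + snd p * cos (snd (fst p)))" ?M] by simp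
  have 3: "(\<lambda>p. G (fst (fst (fst p))) (snd (fst (fst p)) * cos (snd (fst p)) - snd p * sin (snd (fst p))) *
      G (fst (fst (fst p))) (snd (fst (fst p)) * sin (snd (fst p)) + snd p * cos (snd (fst p)))) \<in> borel_measurable ?M"
    using 1 2 by (rule borel_measurable_times_ennreal)
  have s1: "sets ((borel2 \<Otimes>\<^sub>M ?B) \<Otimes>\<^sub>M lborel) = sets ?M" by (intro sets_pair_measure_cong) auto
  have 4: "(\<lambda>p. \<integral>\<^sup>+w. G (fst (fst p)) (snd (fst p) * cos (snd p) - w * sin (snd p)) * G (fst (fst p)) (snd (fst p) * sin (snd p) + w * cos (snd p)) \<partial>lborel)
    \<in> borel_measurable (borel2 \<Otimes>\<^sub>M ?B)"
    by (rule lborel.borel_measurable_nn_integral) (use 3 in \<open>simp add: split_def measurable_cong_sets[OF s1 refl]\<close>)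
  have s2: "sets (borel2 \<Otimes>\<^sub>M angle) = sets (borel2 \<Otimes>\<^sub>M ?B)" by (intro sets_pair_measure_cong) auto
  show ?thesis unfolding gain_def
    by (rule angle.borel_measurable_nn_integral) (use 4 in \<open>simp add: split_def measurable_cong_sets[OF s2 refl]\<close>)
qed

lemma measurable_mild:
  fixes G :: "real \<Rightarrow> real \<Rightarrow> ennreal"
  assumes m: "(\<lambda>z. G (fst z) (snd z)) \<in> borel_measurable borel2"
  shows "(\<lambda>z. mild G (fst z) (snd z)) \<in> borel_measurable borel2"
proof -
  let ?B = "borel :: real measure"
  note g = measurable_gain[OF m]
  have gv: "(\<lambda>\<tau>. gain (G \<tau>) v) \<in> borel_measurable borel" for v
    using measurable_compose[OF _ g, of "\<lambda>\<tau>. (\<tau>, v)" borel] by simp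
  have "(\<lambda>z. mild G (fst z) (snd z)) = (\<lambda>z. \<integral>\<^sup>+\<tau>. gain (G \<tau>) (snd z) * ennreal (exp (\<tau> - fst z)) * (if 0 \<le> \<tau> \<and> \<tau> \<le> fst z then 1 else 0) \<partial>lborel)"
    unfolding mild_def by (rule ext, subst nn_integral_clock[OF gv]) (auto intro!: nn_integral_cong split: split_indicator)
  also have "\<dots> \<in> borel_measurable borel2"
  proof (rule lborel.borel_measurable_nn_integral)
    have 1: "(\<lambda>p. gain (G (snd p)) (snd (fst p))) \<in> borel_measurable (borel2 \<Otimes>\<^sub>M ?B)"
      using measurable_compose[OF _ g, of "\<lambda>p. (snd p, snd (fst p))" "borel2 \<Otimes>\<^sub>M ?B"] by simp
    have "(\<lambda>p. gain (G (snd p)) (snd (fst p)) * ennreal (exp (snd p - fst (fst p))) * (if 0 \<le> snd p \<and> snd p \<le> fst (fst p) then 1 else 0)) \<in> borel_measurable (borel2 \<Otimes>\<^sub>M ?B)"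
      using 1 by measurable
    moreover have ss: "sets (borel2 \<Otimes>\<^sub>M lborel) = sets (borel2 \<Otimes>\<^sub>M ?B)" by (intro sets_pair_measure_cong) auto
    ultimately show "(\<lambda>(z, \<tau>). gain (G \<tau>) (snd z) * ennreal (exp (\<tau> - fst z)) * (if 0 \<le> \<tau> \<and> \<tau> \<le> fst z then 1 else 0)) \<in> borel_measurable (borel2 \<Otimes>\<^sub>M lborel)"
      unfolding split_def by (subst measurable_cong_sets[OF ss refl])
  qed
  finally show ?thesis .
qed

lemma AE_real_affine:
  assumes "AE x in lborel. P x" "c \<noteq> (0::real)" shows "AE x in lborel. P (t + c * x)"
proof -
  obtain N where N: "\<And>x. x \<in> space lborel - N \<Longrightarrow> P x" "N \<in> null_sets lborel" using AE_E3[OF assms(1)] by metis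
  have [measurable]: "N \<in> sets borel" using N(2) by auto
  have "AE x in lborel. x \<notin> N" using N(2) by (rule AE_not_in)
  then have "AE x in lborel. t + c * x \<notin> N" using assms(2) by (intro AE_borel_affine) auto
  then show ?thesis using N(1) by (auto elim: eventually_mono)
qed

text \<open>When sin \<theta> and cos \<theta> are nonzero, both arguments are nonconstant affine
  functions of w, under which null sets pull back to null sets. So even the value at a single v
  depends only on the almost everywhere class of the density.\<close>

lemma gain_mono_AE:
  assumes "AE v in lborel. H v \<le> H' v" shows "gain H v \<le> gain H' v"
  unfolding gain_def
proof (rule nn_integral_mono_AE)
  show "AE \<theta> in angle. (\<integral>\<^sup>+w. H (v * cos \<theta> - w * sin \<theta>) * H (v * sin \<theta> + w * cos \<theta>) \<partial>lborel)
    \<le> (\<integral>\<^sup>+w. H' (v * cos \<theta> - w * sin \<theta>) * H' (v * sin \<theta> + w * cos \<theta>) \<partial>lborel)"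
    using AE_angle
  proof eventually_elim
    case (elim \<theta>)
    have "AE w in lborel. H (v * cos \<theta> + (- sin \<theta>) * w) \<le> H' (v * cos \<theta> + (- sin \<theta>) * w)"
      "AE w in lborel. H (v * sin \<theta> + cos \<theta> * w) \<le> H' (v * sin \<theta> + cos \<theta> * w)"
      using elim by (intro AE_real_affine[OF assms]; simp)+
    then have "AE w in lborel. H (v * cos \<theta> - w * sin \<theta>) * H (v * sin \<theta> + w * cos \<theta>) \<le> H' (v * cos \<theta> - w * sin \<theta>) * H' (v * sin \<theta> + w * cos \<theta>)"
      by eventually_elim (auto simp: mult.commute intro: mult_mono)
    then show ?case by (rule nn_integral_mono_AE)
  qed
qed

lemma gain_cong_AE: "AE v in lborel. H v = H' v \<Longrightarrow> gain H v = gain H' v"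
  by (intro antisym gain_mono_AE) (auto elim: eventually_mono)

lemma mild_mono_AE:
  assumes "\<And>\<tau>. \<tau> \<ge> 0 \<Longrightarrow> AE v in lborel. G \<tau> v \<le> G' \<tau> v" shows "mild G t v \<le> mild G' t v"
  unfolding mild_def
  using AE_clock[of t] by (intro nn_integral_mono_AE) (auto elim!: eventually_mono intro: gain_mono_AE assms)

text \<open>The rotation is decomposed into two one-dimensional substitutions: y = v s + w c for
  fixed v, with factor 1/|c|, then x = (v - y s) / c for fixed y, with factor |c|.\<close>

lemma nn_integral_rotation:
  fixes c s :: real
  assumes [measurable]: "k \<in> borel_measurable borel" "H \<in> borel_measurable borel"
    and c: "c \<noteq> 0" and cs: "c\<^sup>2 + s\<^sup>2 = 1"
  shows "(\<integral>\<^sup>+v. k v * (\<integral>\<^sup>+w. H (v * c - w * s) * H (v * s + w * c) \<partial>lborel) \<partial>lborel)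
    = (\<integral>\<^sup>+x. (\<integral>\<^sup>+y. k (x * c + y * s) * (H x * H y) \<partial>lborel) \<partial>lborel)"
proof -
  have in1: "k v * (\<integral>\<^sup>+w. H (v * c - w * s) * H (v * s + w * c) \<partial>lborel) = (\<integral>\<^sup>+y. ennreal \<bar>1/c\<bar> * (k v * (H ((v - y * s) / c) * H y)) \<partial>lborel)" for v
  proof -
    have "(\<integral>\<^sup>+w. H (v * c - w * s) * H (v * s + w * c) \<partial>lborel) =
      \<bar>1/c\<bar> * (\<integral>\<^sup>+y. H (v * c - (- v * s / c + 1/c * y) * s) * H (v * s + (- v * s / c + 1/c * y) * c) \<partial>lborel)"
      using c by (intro nn_integral_real_affine) auto
    also have "(\<lambda>y. H (v * c - (- v * s / c + 1/c * y) * s) * H (v * s + (- v * s / c + 1/c * y) * c)) = (\<lambda>y. H ((v - y * s) / c) * H y)"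
    proof (rule ext)
      fix y
      have "v * c - (- v * s / c + 1/c * y) * s = (v * (c\<^sup>2 + s\<^sup>2) - y * s) / c"
        using c by (simp add: field_simps power2_eq_square)
      also have "\<dots> = (v - y * s) / c" by (simp add: cs)
      finally have "v * c - (- v * s / c + 1/c * y) * s = (v - y * s) / c" .
      moreover have "v * s + (- v * s / c + 1/c * y) * c = y" using c by (simp add: field_simps)
      ultimately show "H (v * c - (- v * s / c + 1/c * y) * s) * H (v * s + (- v * s / c + 1/c * y) * c) = H ((v - y * s) / c) * H y"
        by simp
    qed
    finally show ?thesis by (simp add: nn_integral_cmult mult.left_commute)
  qed
  have "(\<integral>\<^sup>+v. k v * (\<integral>\<^sup>+w. H (v * c - w * s) * H (v * s + w * c) \<partial>lborel) \<partial>lborel)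
    = (\<integral>\<^sup>+v. (\<integral>\<^sup>+y. ennreal \<bar>1/c\<bar> * (k v * (H ((v - y * s) / c) * H y)) \<partial>lborel) \<partial>lborel)"
    unfolding in1 ..
  also have "\<dots> = (\<integral>\<^sup>+y. (\<integral>\<^sup>+v. ennreal \<bar>1/c\<bar> * (k v * (H ((v - y * s) / c) * H y)) \<partial>lborel) \<partial>lborel)"
    by (rule lborel_pair.Fubini') measurable
  also have "\<dots> = (\<integral>\<^sup>+y. (\<integral>\<^sup>+x. k (x * c + y * s) * (H x * H y) \<partial>lborel) \<partial>lborel)"
  proof (rule nn_integral_cong)
    fix y
    have "(\<integral>\<^sup>+v. ennreal \<bar>1/c\<bar> * (k v * (H ((v - y * s) / c) * H y)) \<partial>lborel) =
      \<bar>c\<bar> * (\<integral>\<^sup>+x. ennreal \<bar>1/c\<bar> * (k (y * s + c * x) * (H ((y * s + c * x - y * s) / c) * H y)) \<partial>lborel)"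
      using c by (intro nn_integral_real_affine) auto
    also have "\<dots> = (\<integral>\<^sup>+x. (ennreal \<bar>c\<bar> * ennreal \<bar>1/c\<bar>) * (k (y * s + c * x) * (H ((y * s + c * x - y * s) / c) * H y)) \<partial>lborel)"
      by (simp add: nn_integral_cmult[symmetric] mult.assoc)
    also have "ennreal \<bar>c\<bar> * ennreal \<bar>1/c\<bar> = 1" using c by (simp add: ennreal_mult[symmetric] abs_mult[symmetric] del: abs_divide)
    finally show "(\<integral>\<^sup>+v. ennreal \<bar>1/c\<bar> * (k v * (H ((v - y * s) / c) * H y)) \<partial>lborel) = (\<integral>\<^sup>+x. k (x * c + y * s) * (H x * H y) \<partial>lborel)"
      using c by (simp add: add.commute mult.commute)
  qed
  also have "\<dots> = (\<integral>\<^sup>+x. (\<integral>\<^sup>+y. k (x * c + y * s) * (H x * H y) \<partial>lborel) \<partial>lborel)"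
    by (rule lborel_pair.Fubini') measurable
  finally show ?thesis .
qed

interpretation angle_lborel: pair_sigma_finite lborel angle
  by (intro pair_sigma_finite.intro lborel.sigma_finite_measure_axioms angle.sigma_finite_measure_axioms)

interpretation clock_lborel: pair_sigma_finite lborel "clock t" for t
  by (intro pair_sigma_finite.intro lborel.sigma_finite_measure_axioms clock.sigma_finite_measure_axioms)

text \<open>Tonelli and a rotation of the \<open>(v, w)\<close> plane.\<close>

lemma nn_integral_gain:
  assumes k[measurable]: "k \<in> borel_measurable borel" and H[measurable]: "H \<in> borel_measurable borel"
  shows "(\<integral>\<^sup>+v. k v * gain H v \<partial>lborel) = (\<integral>\<^sup>+\<theta>. (\<integral>\<^sup>+x. (\<integral>\<^sup>+y. k (x * cos \<theta> + y * sin \<theta>) * (H x * H y) \<partial>lborel) \<partial>lborel) \<partial>angle)"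
proof -
  have m: "(\<lambda>p. \<integral>\<^sup>+w. H (fst p * cos (snd p) - w * sin (snd p)) * H (fst p * sin (snd p) + w * cos (snd p)) \<partial>lborel) \<in> borel_measurable borel2"
    by (rule lborel.borel_measurable_nn_integral) (simp add: split_def)
  have m': "(\<lambda>\<theta>. \<integral>\<^sup>+w. H (v * cos \<theta> - w * sin \<theta>) * H (v * sin \<theta> + w * cos \<theta>) \<partial>lborel) \<in> borel_measurable borel" for v
    using measurable_compose[OF _ m, of "\<lambda>\<theta>. (v, \<theta>)" borel] by simp
  have "(\<integral>\<^sup>+v. k v * gain H v \<partial>lborel) = (\<integral>\<^sup>+v. (\<integral>\<^sup>+\<theta>. k v * (\<integral>\<^sup>+w. H (v * cos \<theta> - w * sin \<theta>) * H (v * sin \<theta> + w * cos \<theta>) \<partial>lborel) \<partial>angle) \<partial>lborel)"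
    unfolding gain_def by (intro nn_integral_cong nn_integral_cmult[symmetric]) (use m' in \<open>simp cong: measurable_cong_sets\<close>)
  also have "\<dots> = (\<integral>\<^sup>+\<theta>. (\<integral>\<^sup>+v. k v * (\<integral>\<^sup>+w. H (v * cos \<theta> - w * sin \<theta>) * H (v * sin \<theta> + w * cos \<theta>) \<partial>lborel) \<partial>lborel) \<partial>angle)"
  proof (rule angle_lborel.Fubini'[symmetric])
    have "(\<lambda>p. k (fst p) * (\<integral>\<^sup>+w. H (fst p * cos (snd p) - w * sin (snd p)) * H (fst p * sin (snd p) + w * cos (snd p)) \<partial>lborel)) \<in> borel_measurable borel2"
      using m by measurable
    moreover have ss: "sets (lborel \<Otimes>\<^sub>M angle) = sets borel2" by (intro sets_pair_measure_cong) auto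
    ultimately show "(\<lambda>(v, \<theta>). k v * (\<integral>\<^sup>+w. H (v * cos \<theta> - w * sin \<theta>) * H (v * sin \<theta> + w * cos \<theta>) \<partial>lborel)) \<in> borel_measurable (lborel \<Otimes>\<^sub>M angle)"
      unfolding split_def by (subst measurable_cong_sets[OF ss refl])
  qed
  also have "\<dots> = (\<integral>\<^sup>+\<theta>. (\<integral>\<^sup>+x. (\<integral>\<^sup>+y. k (x * cos \<theta> + y * sin \<theta>) * (H x * H y) \<partial>lborel) \<partial>lborel) \<partial>angle)"
    by (intro nn_integral_cong_AE eventually_mono[OF AE_angle] nn_integral_rotation) auto
  finally show ?thesis .
qed

lemma nn_integral_mild:
  fixes G :: "real \<Rightarrow> real \<Rightarrow> ennreal"
  assumes k[measurable]: "k \<in> borel_measurable borel"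
    and m: "(\<lambda>z. G (fst z) (snd z)) \<in> borel_measurable borel2"
  shows "(\<integral>\<^sup>+v. k v * mild G t v \<partial>lborel)
    = (\<integral>\<^sup>+\<tau>. (\<integral>\<^sup>+\<theta>. (\<integral>\<^sup>+x. (\<integral>\<^sup>+y. k (x * cos \<theta> + y * sin \<theta>) * (G \<tau> x * G \<tau> y) \<partial>lborel) \<partial>lborel) \<partial>angle) \<partial>clock t)"
proof -
  note g = measurable_gain[OF m]
  have gv: "(\<lambda>\<tau>. gain (G \<tau>) v) \<in> borel_measurable borel" for v
    using measurable_compose[OF _ g, of "\<lambda>\<tau>. (\<tau>, v)" borel] by simp
  have Gm: "G \<tau> \<in> borel_measurable borel" for \<tau>
    using measurable_compose[OF _ m, of "\<lambda>v. (\<tau>, v)" borel] by simp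
  have "(\<integral>\<^sup>+v. k v * mild G t v \<partial>lborel) = (\<integral>\<^sup>+v. (\<integral>\<^sup>+\<tau>. k v * gain (G \<tau>) v \<partial>clock t) \<partial>lborel)"
    unfolding mild_def by (intro nn_integral_cong nn_integral_cmult[symmetric]) (use gv in \<open>simp cong: measurable_cong_sets\<close>)
  also have "\<dots> = (\<integral>\<^sup>+\<tau>. (\<integral>\<^sup>+v. k v * gain (G \<tau>) v \<partial>lborel) \<partial>clock t)"
  proof (rule clock_lborel.Fubini'[symmetric])
    have "(\<lambda>p. gain (G (snd p)) (fst p)) \<in> borel_measurable borel2"
      using measurable_compose[OF _ g, of "\<lambda>p. (snd p, fst p)" borel2] by simp
    then have "(\<lambda>p. k (fst p) * gain (G (snd p)) (fst p)) \<in> borel_measurable borel2"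
      by measurable
    moreover have ss: "sets (lborel \<Otimes>\<^sub>M clock t) = sets borel2" by (intro sets_pair_measure_cong) auto
    ultimately show "(\<lambda>(v, \<tau>). k v * gain (G \<tau>) v) \<in> borel_measurable (lborel \<Otimes>\<^sub>M clock t)"
      unfolding split_def by (subst measurable_cong_sets[OF ss refl])
  qed
  also have "\<dots> = (\<integral>\<^sup>+\<tau>. (\<integral>\<^sup>+\<theta>. (\<integral>\<^sup>+x. (\<integral>\<^sup>+y. k (x * cos \<theta> + y * sin \<theta>) * (G \<tau> x * G \<tau> y) \<partial>lborel) \<partial>lborel) \<partial>angle) \<partial>clock t)"
    by (intro nn_integral_cong nn_integral_gain k Gm)
  finally show ?thesis .
qed

text \<open>The loss term is g v itself, because g has mass 1 and the angle is averaged.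
  Integrability at v permits splitting the collision integral into gain and loss, and makes the gain
  finite.\<close>

lemma kac_operator_eq_gain:
  assumes g: "prob_density_fun g" and i: "kac_integrable g v"
  shows "gain (\<lambda>u. ennreal (g u)) v = ennreal (kac_operator g v + g v)" "0 \<le> kac_operator g v + g v"
proof -
  have g0: "\<And>u. 0 \<le> g u" and gi: "integrable lborel g" and g1: "(\<integral>w. g w \<partial>lborel) = 1" using g by (auto simp: prob_density_fun_def)
  have [measurable]: "g \<in> borel_measurable borel" using gi by (auto dest: borel_measurable_integrable)
  define I where "I = (\<lambda>\<theta>::real. indicator {0..2*pi} \<theta> :: real)"
  have [measurable]: "I \<in> borel_measurable borel" unfolding I_def by measurable
  define P where "P = (\<lambda>\<theta> w. g (v * cos \<theta> - w * sin \<theta>) * g (v * sin \<theta> + w * cos \<theta>))"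
  have Pm[measurable]: "(\<lambda>z. P (fst z) (snd z)) \<in> borel_measurable borel2" unfolding P_def by measurable
  have P0: "0 \<le> P \<theta> w" for \<theta> w using g0 by (simp add: P_def)
  have i1: "integrable (lborel \<Otimes>\<^sub>M lborel) (\<lambda>z. I (fst z) * (P (fst z) (snd z) - g v * g (snd z)))"
  proof -
    have "(\<lambda>z. indicator ({0..2*pi} \<times> UNIV) z *\<^sub>R (case z of (\<theta>, w) \<Rightarrow> kac_integrand g v \<theta> w)) = (\<lambda>z. I (fst z) * (P (fst z) (snd z) - g v * g (snd z)))"
      by (auto simp: fun_eq_iff I_def P_def kac_integrand_def indicator_def)
    then show ?thesis using i by (simp add: kac_integrable_def set_integrable_def)
  qed
  have Ii: "integrable lborel I" unfolding I_def by (intro integrable_real_indicator) auto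
  have i2: "integrable (lborel \<Otimes>\<^sub>M lborel) (\<lambda>z. I (fst z) * (g v * g (snd z)))"
  proof (rule lborel_pair.Fubini_integrable)
    have "(\<lambda>x. \<integral>y. norm (I (fst (x, y)) * (g v * g (snd (x, y)))) \<partial>lborel) = (\<lambda>x. \<bar>I x\<bar> * \<bar>g v\<bar>)"
      using g0 g1 by (simp add: abs_mult)
    then show "integrable lborel (\<lambda>x. \<integral>y. norm (I (fst (x, y)) * (g v * g (snd (x, y)))) \<partial>lborel)"
      using integrable_abs[OF Ii] by simp
  qed (use gi in auto)
  have i3: "integrable (lborel \<Otimes>\<^sub>M lborel) (\<lambda>z. I (fst z) * P (fst z) (snd z))"
    using Bochner_Integration.integrable_add[OF i1 i2] by (simp add: algebra_simps)
  have "kac_operator g v = 1 / (2*pi) * (LBINT \<theta>:{0..2*pi}. (LBINT w. kac_integrand g v \<theta> w))"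
    unfolding kac_operator_def zero_ereal_def by (subst interval_integral_Icc) auto
  also have "(LBINT \<theta>:{0..2*pi}. (LBINT w. kac_integrand g v \<theta> w)) = (\<integral>\<theta>. (\<integral>w. I \<theta> * (P \<theta> w - g v * g w) \<partial>lborel) \<partial>lborel)"
    unfolding set_lebesgue_integral_def by (simp add: kac_integrand_def[abs_def] I_def P_def)
  also have "\<dots> = (\<integral>z. I (fst z) * (P (fst z) (snd z) - g v * g (snd z)) \<partial>(lborel \<Otimes>\<^sub>M lborel))"
    using lborel_pair.integral_fst'[OF i1] by simp
  also have "\<dots> = (\<integral>z. I (fst z) * P (fst z) (snd z) \<partial>(lborel \<Otimes>\<^sub>M lborel)) - (\<integral>z. I (fst z) * (g v * g (snd z)) \<partial>(lborel \<Otimes>\<^sub>M lborel))"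
    using Bochner_Integration.integral_diff[OF i3 i2] by (simp add: algebra_simps)
  also have "(\<integral>z. I (fst z) * (g v * g (snd z)) \<partial>(lborel \<Otimes>\<^sub>M lborel)) = (\<integral>\<theta>. I \<theta> * g v \<partial>lborel)"
    using lborel_pair.integral_fst'[OF i2] g1 by simp
  also have "\<dots> = 2 * pi * g v" by (simp add: I_def)
  finally have op: "kac_operator g v + g v = 1 / (2*pi) * (\<integral>z. I (fst z) * P (fst z) (snd z) \<partial>(lborel \<Otimes>\<^sub>M lborel))"
    by (simp add: field_simps)
  have nn: "0 \<le> (\<integral>z. I (fst z) * P (fst z) (snd z) \<partial>(lborel \<Otimes>\<^sub>M lborel))"
    by (intro integral_nonneg_AE AE_I2) (auto simp: P0 I_def)
  then show "0 \<le> kac_operator g v + g v" unfolding op by simp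
  have m: "(\<lambda>\<theta>. \<integral>\<^sup>+w. ennreal (P \<theta> w) \<partial>lborel) \<in> borel_measurable borel"
    by (rule lborel.borel_measurable_nn_integral) (simp add: split_def)
  have "gain (\<lambda>u. ennreal (g u)) v = (\<integral>\<^sup>+\<theta>. (\<integral>\<^sup>+w. ennreal (P \<theta> w) \<partial>lborel) \<partial>angle)"
    unfolding gain_def P_def using g0 by (simp add: ennreal_mult)
  also have "\<dots> = (\<integral>\<^sup>+\<theta>. (\<integral>\<^sup>+w. ennreal (P \<theta> w) \<partial>lborel) * indicator {0..2*pi} \<theta> \<partial>lborel) * ennreal (1 / (2*pi))"
    by (rule nn_integral_angle[OF m])
  also have "(\<integral>\<^sup>+\<theta>. (\<integral>\<^sup>+w. ennreal (P \<theta> w) \<partial>lborel) * indicator {0..2*pi} \<theta> \<partial>lborel) = (\<integral>\<^sup>+\<theta>. (\<integral>\<^sup>+w. ennreal (I \<theta> * P \<theta> w) \<partial>lborel) \<partial>lborel)"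
    by (intro nn_integral_cong) (auto simp: I_def split: split_indicator)
  also have "\<dots> = (\<integral>\<^sup>+z. ennreal (I (fst z) * P (fst z) (snd z)) \<partial>(lborel \<Otimes>\<^sub>M lborel))"
  proof -
    have "(\<lambda>z. ennreal (I (fst z) * P (fst z) (snd z))) \<in> borel_measurable (lborel \<Otimes>\<^sub>M lborel)" by measurable
    from lborel.nn_integral_fst[OF this] show ?thesis by simp
  qed
  also have "\<dots> = ennreal (\<integral>z. I (fst z) * P (fst z) (snd z) \<partial>(lborel \<Otimes>\<^sub>M lborel))"
    using i3 by (intro nn_integral_eq_integral) (auto simp: P0 I_def)
  finally show "gain (\<lambda>u. ennreal (g u)) v = ennreal (kac_operator g v + g v)"
    unfolding op using nn by (simp add: ennreal_mult[symmetric] mult.commute)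
qed

text \<open>A solution is not assumed to be jointly measurable. Replacing t by grid points slightly
  to its right involves only countably many times, and right continuity carries measurability to the
  limit.\<close>

lemma measurable_right_continuous:
  fixes F :: "real \<Rightarrow> real \<Rightarrow> real"
  assumes m: "\<And>t. t \<ge> 0 \<Longrightarrow> F t \<in> borel_measurable borel"
    and c: "\<And>t v. t \<ge> 0 \<Longrightarrow> ((\<lambda>s. F s v) \<longlongrightarrow> F t v) (at_right t)"
  shows "(\<lambda>z. F (max 0 (fst z)) (snd z)) \<in> borel_measurable borel2"
proof -
  \<comment> \<open>The added 1 puts the grid point strictly to the right of t, also when t itself
    lies on the grid.\<close>
  define a where "a = (\<lambda>n t. (of_int \<lfloor>real (Suc n) * max 0 t\<rfloor> + 1) / real (Suc n))"
  show ?thesis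
  proof (rule borel_measurable_LIMSEQ_real)
    fix z :: "real \<times> real"
    define t where "t = max 0 (fst z)"
    have t0: "t \<ge> 0" by (simp add: t_def)
    have gt: "a n (fst z) > t" for n
      unfolding a_def t_def[symmetric] by (simp add: field_simps) linarith
    have le: "a n (fst z) \<le> t + 1 / real (Suc n)" for n
    proof -
      have "a n (fst z) \<le> (real (Suc n) * t + 1) / real (Suc n)"
        unfolding a_def t_def[symmetric] by (intro divide_right_mono add_right_mono of_int_floor_le) auto
      then show ?thesis by (simp add: add_divide_distrib del: of_nat_Suc)
    qed
    have "(\<lambda>n. a n (fst z)) \<longlonglongrightarrow> t"
    proof (rule tendsto_sandwich[OF _ _ tendsto_const])
      have "(\<lambda>n. t + 1 / real (Suc n)) \<longlonglongrightarrow> t + 0" by (intro tendsto_intros LIMSEQ_Suc[OF lim_1_over_n])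
      then show "(\<lambda>n. t + 1 / real (Suc n)) \<longlonglongrightarrow> t" by simp
    qed (use gt le in \<open>auto intro: less_imp_le always_eventually\<close>)
    then have "filterlim (\<lambda>n. a n (fst z)) (at_right t) sequentially"
      unfolding filterlim_at using gt by (auto simp: less_imp_neq intro!: always_eventually)
    then have "(\<lambda>n. F (a n (fst z)) (snd z)) \<longlonglongrightarrow> F t (snd z)"
      by (rule filterlim_compose[OF c[OF t0]])
    then show "(\<lambda>n. F (a n (fst z)) (snd z)) \<longlonglongrightarrow> F (max 0 (fst z)) (snd z)" by (simp add: t_def)
  next
    fix n
    have "(\<lambda>z. (\<lambda>i z. F (max 0 ((of_int i + 1) / real (Suc n))) (snd z)) \<lfloor>real (Suc n) * max 0 (fst z)\<rfloor> z) \<in> borel_measurable borel2"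
    proof (rule measurable_compose_countable[where f="\<lambda>i z. F (max 0 ((of_int i + 1) / real (Suc n))) (snd z)" and g="\<lambda>z. \<lfloor>real (Suc n) * max 0 (fst z)\<rfloor>"])
      show "(\<lambda>z. F (max 0 ((of_int i + 1) / real (Suc n))) (snd z)) \<in> borel_measurable borel2" for i :: int
        using m[of "max 0 ((of_int i + 1) / real (Suc n))"] by (intro measurable_compose[OF measurable_snd]) auto
    qed measurable
    moreover have "max 0 ((of_int \<lfloor>real (Suc n) * max 0 t\<rfloor> + 1) / real (Suc n)) = (of_int \<lfloor>real (Suc n) * max 0 t\<rfloor> + 1) / real (Suc n)" for t
      by (intro max_absorb2 divide_nonneg_nonneg add_nonneg_nonneg) auto
    ultimately show "(\<lambda>z. F (a n (fst z)) (snd z)) \<in> borel_measurable borel2"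
      unfolding a_def by simp
  qed
qed

text \<open>For v outside the common null set, e^t f(v,t) has derivative e^t times the gain, so its
  increments are integrals of a nonnegative function. F replaces f by 0 on that null set, which
  makes it right continuous in t for every v and hence jointly measurable; for negative t it is
  extended constantly.\<close>

theorem solution_mild:
  assumes f0: "prob_density_fun f0" and sol: "kac_solution f0 f"
  obtains F :: "real \<Rightarrow> real \<Rightarrow> real" where
    "(\<lambda>z. F (fst z) (snd z)) \<in> borel_measurable borel2"
    "\<And>t. prob_density_fun (F t)"
    "\<And>t. t \<ge> 0 \<Longrightarrow> AE v in lborel. F t v = f v t"
    "\<And>t. t \<ge> 0 \<Longrightarrow> AE v in lborel. ennreal (F t v) = ennreal (exp (- t) * f0 v) + mild (\<lambda>\<tau> v. ennreal (F \<tau> v)) t v"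
proof -
  have pf: "prob_density_fun (\<lambda>v. f v t)" if "t \<ge> 0" for t using sol that by (simp add: kac_solution_def)
  define ok where "ok = (\<lambda>v. f v 0 = f0 v \<and> ((\<lambda>t. f v t) \<longlongrightarrow> f0 v) (at_right 0) \<and>
        (\<forall>t>0. kac_integrable (\<lambda>u. f u t) v \<and> ((\<lambda>s. f v s) has_real_derivative kac_operator (\<lambda>u. f u t) v) (at t)))"
  have "AE v in lborel. ok v"
    using sol by (simp add: kac_solution_def ok_def)
  then obtain N where N': "\<And>v. v \<in> space lborel - N \<Longrightarrow> ok v" and Nn: "N \<in> null_sets lborel"
    using AE_E3 by metis
  have N: "f v 0 = f0 v \<and> ((\<lambda>t. f v t) \<longlongrightarrow> f0 v) (at_right 0) \<and>
        (\<forall>t>0. kac_integrable (\<lambda>u. f u t) v \<and> ((\<lambda>s. f v s) has_real_derivative kac_operator (\<lambda>u. f u t) v) (at t))"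
    if "v \<notin> N" for v using N'[of v] that by (simp add: ok_def)
  have [measurable]: "N \<in> sets borel" using Nn by auto
  have AEN: "AE v in lborel. v \<notin> N" using Nn by (rule AE_not_in)
  define F where "F = (\<lambda>t v. if v \<in> N then 0 else f v (max 0 t))"
  have fm: "(\<lambda>v. f v t) \<in> borel_measurable borel" if "t \<ge> 0" for t
    using pf[OF that] by (auto simp: prob_density_fun_def dest: borel_measurable_integrable)
  have Fae: "AE v in lborel. F t v = f v t" if "t \<ge> 0" for t
    using AEN by eventually_elim (use that in \<open>auto simp: F_def\<close>)
  have Fmt: "F t \<in> borel_measurable borel" for t
    unfolding F_def using fm[of "max 0 t"] by measurable
  have Fp: "prob_density_fun (F t)" for t
  proof -
    have F_max: "F t = F (max 0 t)" by (auto simp: F_def fun_eq_iff max_def)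
    have "AE v in lborel. F (max 0 t) v = f v (max 0 t)" by (intro Fae) simp
    then have "integrable lborel (F (max 0 t)) \<longleftrightarrow> integrable lborel (\<lambda>v. f v (max 0 t))"
      using Fmt fm[of "max 0 t"] by (intro integrable_cong_AE) auto
    moreover have "(\<integral>v. F (max 0 t) v \<partial>lborel) = (\<integral>v. f v (max 0 t) \<partial>lborel)"
      using Fmt fm[of "max 0 t"] \<open>AE v in lborel. F (max 0 t) v = f v (max 0 t)\<close> by (intro integral_cong_AE) auto
    moreover have "\<forall>v. 0 \<le> F t v" using pf[of "max 0 t"] by (auto simp: F_def prob_density_fun_def)
    ultimately show ?thesis using pf[of "max 0 t"] unfolding F_max by (simp add: prob_density_fun_def)
  qed
  have Fmeas: "(\<lambda>z. F (fst z) (snd z)) \<in> borel_measurable borel2"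
  proof -
    have "((\<lambda>s. F s v) \<longlongrightarrow> F t v) (at_right t)" if t: "t \<ge> 0" for t v
    proof (cases "v \<in> N")
      case False
      have "((\<lambda>s. f v s) \<longlongrightarrow> f v t) (at_right t)"
      proof (cases "t = 0")
        case True then show ?thesis using N[OF False] by simp
      next
        case False': False
        then have "((\<lambda>s. f v s) has_real_derivative kac_operator (\<lambda>u. f u t) v) (at t)" using N[OF False] t by simp
        then have "isCont (\<lambda>s. f v s) t" by (rule DERIV_isCont)
        then show ?thesis unfolding isCont_def by (rule filterlim_mono) (auto simp: at_le)
      qed
      moreover have "eventually (\<lambda>s. f v s = F s v) (at_right t)"
        unfolding eventually_at_filter using False t by (intro always_eventually) (auto simp: F_def)
      ultimately have "((\<lambda>s. F s v) \<longlongrightarrow> f v t) (at_right t)" by (rule Lim_transform_eventually)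
      then show ?thesis using False t by (simp add: F_def)
    qed (simp add: F_def)
    then have "(\<lambda>z. F (max 0 (fst z)) (snd z)) \<in> borel_measurable borel2"
      by (intro measurable_right_continuous Fmt)
    moreover have "F (max 0 t) = F t" for t by (auto simp: F_def fun_eq_iff max_def)
    ultimately show ?thesis by simp
  qed
  define G where "G = (\<lambda>\<tau> v. ennreal (F \<tau> v))"
  have Gm: "(\<lambda>z. G (fst z) (snd z)) \<in> borel_measurable borel2"
    unfolding G_def using Fmeas by measurable
  have gm: "(\<lambda>\<tau>. gain (G \<tau>) v) \<in> borel_measurable borel" for v
    using measurable_compose[OF _ measurable_gain[OF Gm], of "\<lambda>\<tau>. (\<tau>, v)" borel] by simp
  have eq: "ennreal (F t v) = ennreal (exp (- t) * f0 v) + mild G t v" if v: "v \<notin> N" and t: "t \<ge> 0" for v t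
  proof -
    note Nv = N[OF v]
    define Q where "Q = (\<lambda>\<tau>. kac_operator (\<lambda>u. f u \<tau>) v + f v \<tau>)"
    have gQ: "gain (G \<tau>) v = ennreal (Q \<tau>)" and Q0: "0 \<le> Q \<tau>" if "\<tau> > 0" for \<tau>
    proof -
      have "gain (G \<tau>) v = gain (\<lambda>u. ennreal (f u \<tau>)) v"
        using Fae[of \<tau>] that by (intro gain_cong_AE) (auto simp: G_def elim: eventually_mono)
      then show "gain (G \<tau>) v = ennreal (Q \<tau>)"
        using kac_operator_eq_gain(1)[of "\<lambda>u. f u \<tau>" v] pf[of \<tau>] Nv that by (simp add: Q_def)
      show "0 \<le> Q \<tau>" using kac_operator_eq_gain(2)[of "\<lambda>u. f u \<tau>" v] pf[of \<tau>] Nv that by (simp add: Q_def)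
    qed
    define Q' where "Q' = (\<lambda>\<tau>. if \<tau> > 0 then exp \<tau> * Q \<tau> else 0)"
    \<comment> \<open>The gauge integral delivers the integrability of the derivative, and
      nonnegativity of \<open>Q'\<close> then turns it into a Lebesgue integral. At \<tau> = 0 only
      continuity is available, hence the version for interior derivatives.\<close>
    have "(Q' has_integral (exp t * f v t - exp 0 * f v 0)) {0..t}"
    proof (rule fundamental_theorem_of_calculus_interior[OF t])
      fix \<tau> assume \<tau>: "\<tau> \<in> {0<..<t}"
      have "((\<lambda>\<tau>. exp \<tau> * f v \<tau>) has_real_derivative exp \<tau> * f v \<tau> + kac_operator (\<lambda>u. f u \<tau>) v * exp \<tau>) (at \<tau>)"
        using Nv \<tau> by (intro DERIV_mult' [THEN DERIV_cong] DERIV_exp) auto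
      then show "((\<lambda>\<tau>. exp \<tau> * f v \<tau>) has_vector_derivative Q' \<tau>) (at \<tau>)"
        using \<tau> unfolding has_real_derivative_iff_has_vector_derivative by (simp add: Q'_def Q_def algebra_simps)
    next
      have "continuous (at \<tau> within {0..t}) (\<lambda>\<tau>. f v \<tau>)" if "\<tau> \<in> {0..t}" for \<tau>
      proof (cases "\<tau> = 0")
        case True
        have "((\<lambda>t. f v t) \<longlongrightarrow> f v 0) (at_right 0)" using Nv by simp
        then have "((\<lambda>t. f v t) \<longlongrightarrow> f v 0) (at 0 within {0..t})"
        proof (rule filterlim_mono)
          show "at 0 within {0..t} \<le> at_right 0"
            unfolding at_within_def by (intro inf_mono order_refl) auto
        qed simp
        then show ?thesis using True by (simp add: continuous_within)
      next
        case False
        then have "((\<lambda>s. f v s) has_real_derivative kac_operator (\<lambda>u. f u \<tau>) v) (at \<tau>)" using Nv that by simp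
        then have "isCont (\<lambda>s. f v s) \<tau>" by (rule DERIV_isCont)
        then show ?thesis by (rule continuous_at_imp_continuous_at_within)
      qed
      then show "continuous_on {0..t} (\<lambda>\<tau>. exp \<tau> * f v \<tau>)"
        by (intro continuous_intros) (auto simp: continuous_on_eq_continuous_within)
    qed
    then have "(\<integral>\<^sup>+\<tau>. ennreal (Q' \<tau>) * indicator {0..t} \<tau> \<partial>lborel) = ennreal (exp t * f v t - exp 0 * f v 0)"
      using Q0 by (intro nn_integral_has_integral_lebesgue') (auto simp: Q'_def)
    then have I: "(\<integral>\<^sup>+\<tau>. ennreal (Q' \<tau>) * indicator {0..t} \<tau> \<partial>lborel) = ennreal (exp t * f v t - f0 v)" using Nv by simp
    have Q'0: "0 \<le> Q' \<tau>" for \<tau> using Q0 by (simp add: Q'_def)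
    have "mild G t v = (\<integral>\<^sup>+\<tau>. gain (G \<tau>) v * ennreal (exp (\<tau> - t)) * indicator {0..t} \<tau> \<partial>lborel)"
      unfolding mild_def by (rule nn_integral_clock[OF gm])
    also have "\<dots> = (\<integral>\<^sup>+\<tau>. ennreal (exp (- t)) * (gain (G \<tau>) v * ennreal (exp \<tau>) * indicator {0..t} \<tau>) \<partial>lborel)"
      by (intro nn_integral_cong) (simp add: exp_diff exp_minus divide_inverse ennreal_mult mult_ac)
    also have "\<dots> = ennreal (exp (- t)) * (\<integral>\<^sup>+\<tau>. gain (G \<tau>) v * ennreal (exp \<tau>) * indicator {0..t} \<tau> \<partial>lborel)"
      using gm by (intro nn_integral_cmult) auto
    also have "(\<integral>\<^sup>+\<tau>. gain (G \<tau>) v * ennreal (exp \<tau>) * indicator {0..t} \<tau> \<partial>lborel) = (\<integral>\<^sup>+\<tau>. ennreal (Q' \<tau>) * indicator {0..t} \<tau> \<partial>lborel)"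
    proof (rule nn_integral_cong_AE)
      show "AE \<tau> in lborel. gain (G \<tau>) v * ennreal (exp \<tau>) * indicator {0..t} \<tau> = ennreal (Q' \<tau>) * indicator {0..t} \<tau>"
        using AE_lborel_singleton[of 0]
      proof eventually_elim
        case (elim \<tau>)
        then show ?case using gQ[of \<tau>] Q0[of \<tau>]
          by (auto simp: Q'_def ennreal_mult[symmetric] mult.commute split: split_indicator)
      qed
    qed
    also have "\<dots> = ennreal (exp t * f v t - f0 v)" by (rule I)
    finally have mild: "mild G t v = ennreal (exp (- t)) * ennreal (exp t * f v t - f0 v)" .
    \<comment> \<open>Were this increment negative, \<open>ennreal\<close> would have truncated it
      to 0.\<close>
    have d: "0 \<le> exp t * f v t - f0 v"
    proof -
      have "(Q' has_integral (exp t * f v t - f0 v)) {0..t}" using \<open>(Q' has_integral (exp t * f v t - exp 0 * f v 0)) {0..t}\<close> Nv by simp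
      then show ?thesis by (rule has_integral_nonneg) (use Q'0 in auto)
    qed
    have "0 \<le> f0 v" using f0 by (simp add: prob_density_fun_def)
    then have "ennreal (exp (- t) * f0 v) + mild G t v = ennreal (exp (- t) * f0 v + exp (- t) * (exp t * f v t - f0 v))"
      unfolding mild using d by (subst ennreal_plus) (simp_all add: ennreal_mult)
    also have "exp (- t) * f0 v + exp (- t) * (exp t * f v t - f0 v) = f v t"
      by (simp add: right_diff_distrib exp_minus)
    finally have "ennreal (exp (- t) * f0 v) + mild G t v = ennreal (f v t)" .
    then show ?thesis using v t by (simp add: F_def)
  qed
  show ?thesis
  proof (rule that[OF Fmeas Fp Fae])
    show "AE v in lborel. ennreal (F t v) = ennreal (exp (- t) * f0 v) + mild (\<lambda>\<tau> v. ennreal (F \<tau> v)) t v" if "t \<ge> 0" for t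
      using AEN by eventually_elim (use eq that in \<open>auto simp: G_def\<close>)
  qed
qed

section \<open>Transforms of extended real densities\<close>

definition law :: "(real \<Rightarrow> ennreal) \<Rightarrow> real measure" where "law H = density lborel H"

lemma sets_law [simp, measurable_cong]: "sets (law H) = sets borel" and space_law [simp]: "space (law H) = UNIV"
  by (simp_all add: law_def)

definition mass :: "(real \<Rightarrow> ennreal) \<Rightarrow> real" where "mass H = enn2real (\<integral>\<^sup>+v. H v \<partial>lborel)"

text \<open>The shift by \<open>1\<close> keeps the integrand nonnegative for \<open>|K| \<le> 1\<close>, so that Tonelli's theorem
  applies to the nonnegative extended real density \<open>H\<close>.\<close>

definition transform :: "(real \<Rightarrow> real) \<Rightarrow> (real \<Rightarrow> ennreal) \<Rightarrow> real" where
  "transform K H = enn2real (\<integral>\<^sup>+v. ennreal (1 + K v) * H v \<partial>lborel) - mass H"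

lemma finite_law: "H \<in> borel_measurable borel \<Longrightarrow> (\<integral>\<^sup>+v. H v \<partial>lborel) \<le> 1 \<Longrightarrow> finite_measure (law H)"
  by (intro finite_measureI) (auto simp: law_def emeasure_density top_unique)

lemma nn_integral_law:
  assumes [measurable]: "H \<in> borel_measurable borel" "k \<in> borel_measurable borel"
  shows "(\<integral>\<^sup>+v. k v \<partial>law H) = (\<integral>\<^sup>+v. k v * H v \<partial>lborel)"
  unfolding law_def by (subst nn_integral_density) (auto simp: mult.commute)

lemma integrable_law:
  fixes K :: "real \<Rightarrow> real"
  assumes H: "H \<in> borel_measurable borel" "(\<integral>\<^sup>+v. H v \<partial>lborel) \<le> 1" and K: "K \<in> borel_measurable borel" "\<And>v. \<bar>K v\<bar> \<le> B"
  shows "integrable (law H) K"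
proof -
  interpret finite_measure "law H" by (rule finite_law[OF H])
  show ?thesis using K by (intro integrable_const_bound[where B=B]) auto
qed

lemma mass_eq: "H \<in> borel_measurable borel \<Longrightarrow> (\<integral>\<^sup>+v. H v \<partial>lborel) \<le> 1 \<Longrightarrow> mass H = measure (law H) UNIV"
  by (simp add: mass_def measure_def law_def emeasure_density)

lemma nn_integral_shifted:
  assumes H: "H \<in> borel_measurable borel" "(\<integral>\<^sup>+v. H v \<partial>lborel) \<le> 1" and K: "K \<in> borel_measurable borel" "\<And>v. \<bar>K v\<bar> \<le> 1"
  shows "(\<integral>\<^sup>+v. ennreal (1 + K v) * H v \<partial>lborel) = ennreal (mass H + (\<integral>v. K v \<partial>law H))"
    and "transform K H = (\<integral>v. K v \<partial>law H)"
proof -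
  interpret finite_measure "law H" by (rule finite_law[OF H])
  note [measurable] = K(1)
  have Ki: "integrable (law H) K" by (rule integrable_law[OF H K])
  have p: "0 \<le> 1 + K v" for v using K(2)[of v] by linarith
  have "(\<integral>\<^sup>+v. ennreal (1 + K v) * H v \<partial>lborel) = (\<integral>\<^sup>+v. ennreal (1 + K v) \<partial>law H)"
    by (rule nn_integral_law[symmetric]) (use H in auto)
  also have "\<dots> = ennreal (\<integral>v. 1 + K v \<partial>law H)"
    using Ki p by (intro nn_integral_eq_integral) auto
  also have "(\<integral>v. 1 + K v \<partial>law H) = mass H + (\<integral>v. K v \<partial>law H)" using Ki by (simp add: mass_eq[OF H])
  finally show 1: "(\<integral>\<^sup>+v. ennreal (1 + K v) * H v \<partial>lborel) = ennreal (mass H + (\<integral>v. K v \<partial>law H))" .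
  have "0 \<le> mass H + (\<integral>v. K v \<partial>law H)"
    using integral_nonneg_AE[of "\<lambda>v. 1 + K v" "law H"] p Ki by (simp add: mass_eq[OF H])
  then show "transform K H = (\<integral>v. K v \<partial>law H)" by (simp add: transform_def 1)
qed

lemma mass_le_1: "(\<integral>\<^sup>+v. H v \<partial>lborel) \<le> 1 \<Longrightarrow> mass H \<le> 1"
  unfolding mass_def by (rule enn2real_leI) auto

lemma mass_nonneg [simp]: "0 \<le> mass H" by (simp add: mass_def)

lemma ennreal_mass: "(\<integral>\<^sup>+v. H v \<partial>lborel) \<le> 1 \<Longrightarrow> ennreal (mass H) = (\<integral>\<^sup>+v. H v \<partial>lborel)"
  unfolding mass_def by (rule ennreal_enn2real) (auto simp: top_unique intro: le_less_trans)

lemma abs_transform_le: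
  assumes H: "H \<in> borel_measurable borel" "(\<integral>\<^sup>+v. H v \<partial>lborel) \<le> 1" and K: "K \<in> borel_measurable borel" "\<And>v. \<bar>K v\<bar> \<le> 1"
  shows "\<bar>transform K H\<bar> \<le> mass H"
proof -
  interpret finite_measure "law H" by (rule finite_law[OF H])
  have Ki: "integrable (law H) K" by (rule integrable_law[OF H K])
  have "\<bar>transform K H\<bar> \<le> (\<integral>v. \<bar>K v\<bar> \<partial>law H)" unfolding nn_integral_shifted(2)[OF H K] by (rule integral_abs_bound)
  also have "\<dots> \<le> (\<integral>v. 1 \<partial>law H)" using Ki K by (intro integral_mono) auto
  finally show ?thesis by (simp add: mass_eq[OF H])
qed

abbreviation cosT :: "(real \<Rightarrow> ennreal) \<Rightarrow> real \<Rightarrow> real" where "cosT H \<xi> \<equiv> transform (\<lambda>v. cos (\<xi> * v)) H"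
abbreviation sinT :: "(real \<Rightarrow> ennreal) \<Rightarrow> real \<Rightarrow> real" where "sinT H \<xi> \<equiv> transform (\<lambda>v. sin (\<xi> * v)) H"

lemma cosT_eq: "H \<in> borel_measurable borel \<Longrightarrow> (\<integral>\<^sup>+v. H v \<partial>lborel) \<le> 1 \<Longrightarrow> cosT H \<xi> = (\<integral>v. cos (\<xi> * v) \<partial>law H)"
  and sinT_eq: "H \<in> borel_measurable borel \<Longrightarrow> (\<integral>\<^sup>+v. H v \<partial>lborel) \<le> 1 \<Longrightarrow> sinT H \<xi> = (\<integral>v. sin (\<xi> * v) \<partial>law H)"
  by (rule nn_integral_shifted(2); simp)+

lemma measurable_transform:
  fixes G :: "real \<Rightarrow> real \<Rightarrow> ennreal" and k :: "real \<Rightarrow> real"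
  assumes m: "(\<lambda>z. G (fst z) (snd z)) \<in> borel_measurable borel2" and [measurable]: "k \<in> borel_measurable borel"
  shows "(\<lambda>z. transform (\<lambda>v. k (snd z * v)) (G (fst z))) \<in> borel_measurable borel2"
proof -
  let ?B = "borel :: real measure"
  have ss: "sets (borel2 \<Otimes>\<^sub>M lborel) = sets (borel2 \<Otimes>\<^sub>M ?B)" by (intro sets_pair_measure_cong) auto
  have 1[measurable]: "(\<lambda>p. G (fst (fst p)) (snd p)) \<in> borel_measurable (borel2 \<Otimes>\<^sub>M ?B)"
    using measurable_compose[OF _ m, of "\<lambda>p. (fst (fst p), snd p)" "borel2 \<Otimes>\<^sub>M ?B"] by simp
  have "(\<lambda>z. \<integral>\<^sup>+v. ennreal (1 + k (snd z * v)) * G (fst z) v \<partial>lborel) \<in> borel_measurable borel2"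
    by (rule lborel.borel_measurable_nn_integral) (unfold split_def, subst measurable_cong_sets[OF ss refl], measurable)
  moreover have "(\<lambda>z. \<integral>\<^sup>+v. G (fst z) v \<partial>lborel) \<in> borel_measurable borel2"
    by (rule lborel.borel_measurable_nn_integral) (unfold split_def, subst measurable_cong_sets[OF ss refl], measurable)
  ultimately show ?thesis unfolding transform_def mass_def by measurable
qed

text \<open>Real and imaginary part of the product of the characteristic function values at \<xi> c
  and \<xi> s.\<close>

lemma integral_cos_add_law:
  assumes H: "H \<in> borel_measurable borel" "(\<integral>\<^sup>+v. H v \<partial>lborel) \<le> 1"
  shows "(\<integral>x. (\<integral>y. cos (\<xi> * (x * c + y * s)) \<partial>law H) \<partial>law H) = cosT H (\<xi> * c) * cosT H (\<xi> * s) - sinT H (\<xi> * c) * sinT H (\<xi> * s)"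
    and "(\<integral>x. (\<integral>y. sin (\<xi> * (x * c + y * s)) \<partial>law H) \<partial>law H) = sinT H (\<xi> * c) * cosT H (\<xi> * s) + cosT H (\<xi> * c) * sinT H (\<xi> * s)"
proof -
  have ci: "integrable (law H) (\<lambda>v. cos (a * v))" and si: "integrable (law H) (\<lambda>v. sin (a * v))" for a
    by (rule integrable_law[OF H, where B=1]; simp)+
  have e: "\<xi> * (x * c + y * s) = \<xi> * c * x + \<xi> * s * y" for x y by (simp add: algebra_simps)
  show "(\<integral>x. (\<integral>y. cos (\<xi> * (x * c + y * s)) \<partial>law H) \<partial>law H) = cosT H (\<xi> * c) * cosT H (\<xi> * s) - sinT H (\<xi> * c) * sinT H (\<xi> * s)"
    unfolding e cos_add cosT_eq[OF H] sinT_eq[OF H] using ci si by simp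
  show "(\<integral>x. (\<integral>y. sin (\<xi> * (x * c + y * s)) \<partial>law H) \<partial>law H) = sinT H (\<xi> * c) * cosT H (\<xi> * s) + cosT H (\<xi> * c) * sinT H (\<xi> * s)"
    unfolding e sin_add cosT_eq[OF H] sinT_eq[OF H] using ci si by simp
qed

lemma nn_integral_add_law:
  assumes H: "H \<in> borel_measurable borel" "(\<integral>\<^sup>+v. H v \<partial>lborel) \<le> 1" and K[measurable]: "K \<in> borel_measurable borel" and K1: "\<And>v. \<bar>K v\<bar> \<le> 1"
  shows "(\<integral>\<^sup>+x. (\<integral>\<^sup>+y. ennreal (1 + K (x * c + y * s)) * (H x * H y) \<partial>lborel) \<partial>lborel)
     = ennreal ((mass H)\<^sup>2 + (\<integral>x. (\<integral>y. K (x * c + y * s) \<partial>law H) \<partial>law H))"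
    "\<bar>\<integral>x. (\<integral>y. K (x * c + y * s) \<partial>law H) \<partial>law H\<bar> \<le> (mass H)\<^sup>2"
proof -
  interpret finite_measure "law H" by (rule finite_law[OF H])
  note [measurable] = H(1)
  have Ki: "integrable (law H) (\<lambda>y. K (x * c + y * s))" for x by (rule integrable_law[OF H, where B=1]) (auto intro: K1)
  define J where "J = (\<lambda>x. \<integral>y. K (x * c + y * s) \<partial>law H)"
  have [measurable]: "J \<in> borel_measurable borel" unfolding J_def by measurable
  have J: "\<bar>J x\<bar> \<le> mass H" for x
  proof -
    have "\<bar>J x\<bar> \<le> (\<integral>y. \<bar>K (x * c + y * s)\<bar> \<partial>law H)" unfolding J_def by (rule integral_abs_bound)
    also have "\<dots> \<le> (\<integral>y. 1 \<partial>law H)" using Ki K1 by (intro integral_mono) auto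
    finally show ?thesis by (simp add: mass_eq[OF H])
  qed
  have Ji: "integrable (law H) J" by (rule integrable_law[OF H, where B="mass H"]) (auto intro: J)
  have "\<bar>\<integral>x. J x \<partial>law H\<bar> \<le> (\<integral>x. \<bar>J x\<bar> \<partial>law H)" by (rule integral_abs_bound)
  also have "\<dots> \<le> (\<integral>x. mass H \<partial>law H)" using Ji J by (intro integral_mono) auto
  finally have b: "\<bar>\<integral>x. J x \<partial>law H\<bar> \<le> (mass H)\<^sup>2" by (simp add: mass_eq[OF H] power2_eq_square)
  then show "\<bar>\<integral>x. (\<integral>y. K (x * c + y * s) \<partial>law H) \<partial>law H\<bar> \<le> (mass H)\<^sup>2" by (simp add: J_def)
  have inner: "(\<integral>\<^sup>+y. ennreal (1 + K (x * c + y * s)) * (H x * H y) \<partial>lborel) = ennreal (mass H + J x) * H x" for x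
  proof -
    have "(\<integral>\<^sup>+y. ennreal (1 + K (x * c + y * s)) * (H x * H y) \<partial>lborel) = (\<integral>\<^sup>+y. H x * (ennreal (1 + K (x * c + y * s)) * H y) \<partial>lborel)"
      by (simp add: mult.left_commute)
    also have "\<dots> = H x * (\<integral>\<^sup>+y. ennreal (1 + K (x * c + y * s)) * H y \<partial>lborel)" by (rule nn_integral_cmult) simp
    also have "(\<integral>\<^sup>+y. ennreal (1 + K (x * c + y * s)) * H y \<partial>lborel) = ennreal (mass H + J x)"
      unfolding J_def using nn_integral_shifted(1)[OF H, of "\<lambda>y. K (x * c + y * s)"] K1 by simp
    finally show ?thesis by (simp add: mult.commute)
  qed
  have "(\<integral>\<^sup>+x. (\<integral>\<^sup>+y. ennreal (1 + K (x * c + y * s)) * (H x * H y) \<partial>lborel) \<partial>lborel) = (\<integral>\<^sup>+x. ennreal (mass H + J x) \<partial>law H)"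
    unfolding inner by (rule nn_integral_law[symmetric]) auto
  also have "\<dots> = ennreal (\<integral>x. mass H + J x \<partial>law H)"
  proof (rule nn_integral_eq_integral)
    have "0 \<le> mass H + J x" for x using J[of x] by linarith
    then show "AE x in law H. 0 \<le> mass H + J x" by simp
  qed (use Ji in auto)
  also have "(\<integral>x. mass H + J x \<partial>law H) = (mass H)\<^sup>2 + (\<integral>x. J x \<partial>law H)" using Ji by (simp add: mass_eq[OF H] power2_eq_square)
  finally show "(\<integral>\<^sup>+x. (\<integral>\<^sup>+y. ennreal (1 + K (x * c + y * s)) * (H x * H y) \<partial>lborel) \<partial>lborel)
     = ennreal ((mass H)\<^sup>2 + (\<integral>x. (\<integral>y. K (x * c + y * s) \<partial>law H) \<partial>law H))" by (simp add: J_def)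
qed

text \<open>Tonelli's theorem applies to the shifted kernel 1 + K; applied to K and to the zero
  kernel it gives two integrals over \<open>collision t\<close> whose difference is the transform.
  The shift contributes the square of the mass, one factor for each collision partner.\<close>

lemma mild_transform:
  fixes G :: "real \<Rightarrow> real \<Rightarrow> ennreal"
  assumes m: "(\<lambda>z. G (fst z) (snd z)) \<in> borel_measurable borel2" and le: "\<And>t. (\<integral>\<^sup>+v. G t v \<partial>lborel) \<le> 1"
    and K: "K \<in> borel_measurable borel" "\<And>v. \<bar>K v\<bar> \<le> 1"
    and A: "\<And>\<tau> \<theta>. (\<integral>x. (\<integral>y. K (x * cos \<theta> + y * sin \<theta>) \<partial>law (G \<tau>)) \<partial>law (G \<tau>)) = A (\<tau>, \<theta>)"
    and Am: "A \<in> borel_measurable borel2"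
  shows "transform K (mild G t) = (\<integral>z. A z \<partial>collision t)"
    and "(\<integral>\<^sup>+v. mild G t v \<partial>lborel) \<le> 1"
proof -
  have Gm: "G \<tau> \<in> borel_measurable borel" for \<tau>
    using measurable_compose[OF _ m, of "\<lambda>v. (\<tau>, v)" borel] by simp
  have mm: "(\<lambda>z. mass (G (fst z))) \<in> borel_measurable borel2"
  proof -
    let ?B = "borel :: real measure"
    have ss: "sets (borel2 \<Otimes>\<^sub>M lborel) = sets (borel2 \<Otimes>\<^sub>M ?B)" by (intro sets_pair_measure_cong) auto
    have 1[measurable]: "(\<lambda>p. G (fst (fst p)) (snd p)) \<in> borel_measurable (borel2 \<Otimes>\<^sub>M ?B)"
      using measurable_compose[OF _ m, of "\<lambda>p. (fst (fst p), snd p)" "borel2 \<Otimes>\<^sub>M ?B"] by simp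
    have "(\<lambda>z. \<integral>\<^sup>+v. G (fst z) v \<partial>lborel) \<in> borel_measurable borel2"
      by (rule lborel.borel_measurable_nn_integral) (unfold split_def, subst measurable_cong_sets[OF ss refl], measurable)
    then show ?thesis unfolding mass_def by measurable
  qed
  have general: "(\<integral>\<^sup>+v. ennreal (1 + k v) * mild G t v \<partial>lborel) = ennreal (\<integral>z. (mass (G (fst z)))\<^sup>2 + a z \<partial>collision t)"
    "0 \<le> (\<integral>z. (mass (G (fst z)))\<^sup>2 + a z \<partial>collision t)"
    "integrable (collision t) a"
    if k: "k \<in> borel_measurable borel" "\<And>v. \<bar>k v\<bar> \<le> 1" and a: "\<And>\<tau> \<theta>. (\<integral>x. (\<integral>y. k (x * cos \<theta> + y * sin \<theta>) \<partial>law (G \<tau>)) \<partial>law (G \<tau>)) = a (\<tau>, \<theta>)"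
      and am: "a \<in> borel_measurable borel2" for k :: "real \<Rightarrow> real" and a
  proof -
    note [measurable] = k(1) am mm
    have ab: "\<bar>a z\<bar> \<le> (mass (G (fst z)))\<^sup>2" for z
      using nn_integral_add_law(2)[OF Gm le k, of "fst z" "cos (snd z)" "sin (snd z)"] a[of "fst z" "snd z"] by simp
    have pos: "0 \<le> (mass (G (fst z)))\<^sup>2 + a z" for z using ab[of z] by linarith
    have m1: "(mass (G \<tau>))\<^sup>2 \<le> 1" for \<tau> using mass_le_1[OF le[of \<tau>]] by (simp add: power_le_one)
    have "(\<integral>\<^sup>+v. ennreal (1 + k v) * mild G t v \<partial>lborel)
      = (\<integral>\<^sup>+\<tau>. (\<integral>\<^sup>+\<theta>. (\<integral>\<^sup>+x. (\<integral>\<^sup>+y. ennreal (1 + k (x * cos \<theta> + y * sin \<theta>)) * (G \<tau> x * G \<tau> y) \<partial>lborel) \<partial>lborel) \<partial>angle) \<partial>clock t)"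
      by (rule nn_integral_mild[OF _ m]) simp
    also have "\<dots> = (\<integral>\<^sup>+\<tau>. (\<integral>\<^sup>+\<theta>. ennreal ((mass (G \<tau>))\<^sup>2 + a (\<tau>, \<theta>)) \<partial>angle) \<partial>clock t)"
      by (intro nn_integral_cong) (simp add: nn_integral_add_law(1)[OF Gm le k] a)
    also have "\<dots> = (\<integral>\<^sup>+z. ennreal ((mass (G (fst z)))\<^sup>2 + a z) \<partial>collision t)"
    proof -
      have ss: "sets (collision t) = sets borel2" by (intro sets_pair_measure_cong) auto
      have "(\<lambda>z. ennreal ((mass (G (fst z)))\<^sup>2 + a z)) \<in> borel_measurable (collision t)"
        by (subst measurable_cong_sets[OF ss refl]) measurable
      from angle.nn_integral_fst[OF this] show ?thesis by simp
    qed
    also have "\<dots> = ennreal (\<integral>z. (mass (G (fst z)))\<^sup>2 + a z \<partial>collision t)"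
    proof (rule nn_integral_eq_integral)
      have "\<bar>(mass (G (fst z)))\<^sup>2 + a z\<bar> \<le> 2" for z using ab[of z] m1[of "fst z"] by (simp add: abs_le_iff)
      then show "integrable (collision t) (\<lambda>z. (mass (G (fst z)))\<^sup>2 + a z)"
        by (intro integrable_collision_bounded[where K=2]) auto
      show "AE z in collision t. 0 \<le> (mass (G (fst z)))\<^sup>2 + a z" using pos by simp
    qed
    finally show "(\<integral>\<^sup>+v. ennreal (1 + k v) * mild G t v \<partial>lborel) = ennreal (\<integral>z. (mass (G (fst z)))\<^sup>2 + a z \<partial>collision t)" .
    show "0 \<le> (\<integral>z. (mass (G (fst z)))\<^sup>2 + a z \<partial>collision t)"
      using pos by (intro integral_nonneg_AE) simp
    show "integrable (collision t) a"
      using order_trans[OF ab m1] by (intro integrable_collision_bounded[where K=1]) auto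
  qed
  have m1: "(mass (G \<tau>))\<^sup>2 \<le> 1" for \<tau> using mass_le_1[OF le[of \<tau>]] by (simp add: power_le_one)
  have im: "integrable (collision t) (\<lambda>z. (mass (G (fst z)))\<^sup>2)"
    using m1 mm by (intro integrable_collision_bounded[where K=1]) auto
  have g0: "(\<integral>\<^sup>+v. mild G t v \<partial>lborel) = ennreal (\<integral>z. (mass (G (fst z)))\<^sup>2 \<partial>collision t)"
  proof -
    have "(\<integral>\<^sup>+v. ennreal (1 + 0) * mild G t v \<partial>lborel) = ennreal (\<integral>z. (mass (G (fst z)))\<^sup>2 + 0 \<partial>collision t)"
      by (rule general(1)[where k="\<lambda>_. 0" and a="\<lambda>_. 0"]) simp_all
    then show ?thesis by (simp only: add_0_right ennreal_1 mult_1_left)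
  qed
  have n0: "0 \<le> (\<integral>z. (mass (G (fst z)))\<^sup>2 \<partial>collision t)" by (intro integral_nonneg_AE) auto
  note gK = general[OF K A Am]
  have "transform K (mild G t) = (\<integral>z. (mass (G (fst z)))\<^sup>2 + A z \<partial>collision t) - (\<integral>z. (mass (G (fst z)))\<^sup>2 \<partial>collision t)"
    unfolding transform_def mass_def[of "mild G t"] gK(1) g0 using gK(2) n0 by simp
  also have "\<dots> = (\<integral>z. A z \<partial>collision t)" using im gK(3) by simp
  finally show "transform K (mild G t) = (\<integral>z. A z \<partial>collision t)" .
  have "(\<integral>z. (mass (G (fst z)))\<^sup>2 \<partial>collision t) \<le> 1"
  proof (cases "t \<ge> 0")
    case True
    have "(\<integral>z. (mass (G (fst z)))\<^sup>2 \<partial>collision t) \<le> (\<integral>z. 1 \<partial>collision t)"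
      using im m1 by (intro integral_mono) auto
    also have "\<dots> \<le> 1" using measure_collision[OF True] by (simp add: space_pair_measure)
    finally show ?thesis .
  next
    case False
    have "AE z in collision t. False" using AE_collision[of t] False by (auto elim: eventually_mono)
    then have "(\<integral>z. (mass (G (fst z)))\<^sup>2 \<partial>collision t) = 0" by (intro integral_eq_zero_AE) (auto elim: eventually_mono)
    then show ?thesis by simp
  qed
  then show "(\<integral>\<^sup>+v. mild G t v \<partial>lborel) \<le> 1" unfolding g0 by simp
qed

text \<open>The terms with sine transforms have mean zero over the angle by the quarter turn
  symmetry. So the law is symmetric after one collision, and the cosine transforms evolve among
  themselves whatever the odd part of the datum is.\<close>

lemma mild_cosT_sinT:
  fixes G :: "real \<Rightarrow> real \<Rightarrow> ennreal"
  assumes m: "(\<lambda>z. G (fst z) (snd z)) \<in> borel_measurable borel2" and le: "\<And>t. (\<integral>\<^sup>+v. G t v \<partial>lborel) \<le> 1"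
  shows "cosT (mild G t) \<xi> = duhamel (\<lambda>t. cosT (G t)) t \<xi>" and "sinT (mild G t) \<xi> = 0"
proof -
  have Gm: "G \<tau> \<in> borel_measurable borel" for \<tau>
    using measurable_compose[OF _ m, of "\<lambda>v. (\<tau>, v)" borel] by simp
  have cm: "(\<lambda>z. cosT (G (fst z)) (snd z)) \<in> borel_measurable borel2" and sm: "(\<lambda>z. sinT (G (fst z)) (snd z)) \<in> borel_measurable borel2"
    using measurable_transform[OF m, of cos] measurable_transform[OF m, of sin] by simp_all
  have c1: "\<bar>cosT (G \<tau>) x\<bar> \<le> 1" and s1: "\<bar>sinT (G \<tau>) x\<bar> \<le> 1" for \<tau> x
    by (rule order_trans[OF abs_transform_le[OF Gm le] mass_le_1[OF le]]; simp)+
  have cmt: "cosT (G \<tau>) \<in> borel_measurable borel" and smt: "sinT (G \<tau>) \<in> borel_measurable borel" for \<tau>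
    using measurable_compose[OF _ cm, of "\<lambda>x. (\<tau>, x)" borel] measurable_compose[OF _ sm, of "\<lambda>x. (\<tau>, x)" borel] by simp_all
  have ceven: "cosT (G \<tau>) (- x) = cosT (G \<tau>) x" and sodd: "sinT (G \<tau>) (- x) = - sinT (G \<tau>) x" for \<tau> x
    unfolding cosT_eq[OF Gm le] sinT_eq[OF Gm le] by simp_all
  have cm': "(\<lambda>z. cosT (G (fst z)) (\<xi> * cos (snd z))) \<in> borel_measurable borel2" "(\<lambda>z. cosT (G (fst z)) (\<xi> * sin (snd z))) \<in> borel_measurable borel2"
    using measurable_compose[OF _ cm, of "\<lambda>z. (fst z, \<xi> * cos (snd z))" borel2] measurable_compose[OF _ cm, of "\<lambda>z. (fst z, \<xi> * sin (snd z))" borel2] by simp_all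
  have sm': "(\<lambda>z. sinT (G (fst z)) (\<xi> * cos (snd z))) \<in> borel_measurable borel2" "(\<lambda>z. sinT (G (fst z)) (\<xi> * sin (snd z))) \<in> borel_measurable borel2"
    using measurable_compose[OF _ sm, of "\<lambda>z. (fst z, \<xi> * cos (snd z))" borel2] measurable_compose[OF _ sm, of "\<lambda>z. (fst z, \<xi> * sin (snd z))" borel2] by simp_all
  have zero: "(\<integral>z. a z \<partial>collision t) = 0"
    if "integrable (collision t) a" "\<And>\<tau>. (\<integral>\<theta>. a (\<tau>, \<theta>) \<partial>angle) = 0" for a :: "real \<times> real \<Rightarrow> real"
    using collision.integral_fst'[OF that(1)] that(2) by simp
  have b2: "\<bar>x * y\<bar> \<le> 1" if "\<bar>x\<bar> \<le> 1" "\<bar>y\<bar> \<le> 1" for x y :: real using that by (simp add: abs_mult mult_le_one)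
  note [measurable] = cm' sm'
  have i: "integrable (collision t) (\<lambda>z. cosT (G (fst z)) (\<xi> * cos (snd z)) * cosT (G (fst z)) (\<xi> * sin (snd z)))"
    "integrable (collision t) (\<lambda>z. sinT (G (fst z)) (\<xi> * cos (snd z)) * sinT (G (fst z)) (\<xi> * sin (snd z)))"
    "integrable (collision t) (\<lambda>z. sinT (G (fst z)) (\<xi> * cos (snd z)) * cosT (G (fst z)) (\<xi> * sin (snd z)))"
    "integrable (collision t) (\<lambda>z. cosT (G (fst z)) (\<xi> * cos (snd z)) * sinT (G (fst z)) (\<xi> * sin (snd z)))"
    by (rule integrable_collision_bounded[where K=1], measurable, rule b2, (rule c1 s1)+)+
  have "cosT (mild G t) \<xi> = (\<integral>z. cosT (G (fst z)) (\<xi> * cos (snd z)) * cosT (G (fst z)) (\<xi> * sin (snd z)) - sinT (G (fst z)) (\<xi> * cos (snd z)) * sinT (G (fst z)) (\<xi> * sin (snd z)) \<partial>collision t)"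
    by (rule mild_transform(1)[OF m le]) (auto simp: integral_cos_add_law[OF Gm le])
  also have "\<dots> = duhamel (\<lambda>t. cosT (G t)) t \<xi> - (\<integral>z. sinT (G (fst z)) (\<xi> * cos (snd z)) * sinT (G (fst z)) (\<xi> * sin (snd z)) \<partial>collision t)"
    unfolding duhamel_def by (rule Bochner_Integration.integral_diff[OF i(1,2)])
  also have "(\<integral>z. sinT (G (fst z)) (\<xi> * cos (snd z)) * sinT (G (fst z)) (\<xi> * sin (snd z)) \<partial>collision t) = 0"
    by (rule zero[OF i(2)]) (simp add: integral_angle_sin_sin[OF smt sodd])
  finally show "cosT (mild G t) \<xi> = duhamel (\<lambda>t. cosT (G t)) t \<xi>" by simp
  have "sinT (mild G t) \<xi> = (\<integral>z. sinT (G (fst z)) (\<xi> * cos (snd z)) * cosT (G (fst z)) (\<xi> * sin (snd z)) + cosT (G (fst z)) (\<xi> * cos (snd z)) * sinT (G (fst z)) (\<xi> * sin (snd z)) \<partial>collision t)"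
    by (rule mild_transform(1)[OF m le]) (auto simp: integral_cos_add_law[OF Gm le])
  also have "\<dots> = (\<integral>z. sinT (G (fst z)) (\<xi> * cos (snd z)) * cosT (G (fst z)) (\<xi> * sin (snd z)) \<partial>collision t) + (\<integral>z. cosT (G (fst z)) (\<xi> * cos (snd z)) * sinT (G (fst z)) (\<xi> * sin (snd z)) \<partial>collision t)"
    by (rule Bochner_Integration.integral_add[OF i(3,4)])
  also have "(\<integral>z. sinT (G (fst z)) (\<xi> * cos (snd z)) * cosT (G (fst z)) (\<xi> * sin (snd z)) \<partial>collision t) = 0"
    by (rule zero[OF i(3)]) (simp add: integral_angle_sin_cos(1)[OF smt cmt sodd ceven])
  also have "(\<integral>z. cosT (G (fst z)) (\<xi> * cos (snd z)) * sinT (G (fst z)) (\<xi> * sin (snd z)) \<partial>collision t) = 0"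
    by (rule zero[OF i(4)]) (simp add: integral_angle_sin_cos(2)[OF smt cmt sodd ceven])
  finally show "sinT (mild G t) \<xi> = 0" by simp
qed

lemma transform_eq_integral:
  assumes H: "H \<in> borel_measurable borel" "(\<integral>\<^sup>+v. H v \<partial>lborel) \<le> 1" and K[measurable]: "K \<in> borel_measurable borel" and K1: "\<And>v. \<bar>K v\<bar> \<le> 1"
    and g[measurable]: "g \<in> borel_measurable borel" and g0: "\<And>v. 0 \<le> g v" and ae: "AE v in lborel. H v = ennreal (g v)"
  shows "transform K H = (\<integral>v. K v * g v \<partial>lborel)"
proof -
  have "law H = density lborel (\<lambda>v. ennreal (g v))"
    unfolding law_def using H(1) ae by (intro density_cong) auto
  then have "transform K H = (\<integral>v. K v \<partial>density lborel (\<lambda>v. ennreal (g v)))"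
    using nn_integral_shifted(2)[OF H K K1] by simp
  also have "\<dots> = (\<integral>v. g v *\<^sub>R K v \<partial>lborel)"
    using g0 by (intro integral_density) auto
  finally show ?thesis by (simp add: mult.commute)
qed

text \<open>Pointwise the increment of the cosine is at most 2 |S| \<le> z + S^2 / z with S = sin
  ((x - y) v / 2) and z = |x - y|. As S^2 is (1 - cos ((x - y) v)) / 2, the integral is again
  expressed by the cosine transform, and a density of unknown moments is covered.\<close>

lemma cos_transform_incr:
  assumes f: "prob_density_fun f" and xy: "x \<noteq> y"
  shows "\<bar>cos_transform f x - cos_transform f y\<bar> \<le> \<bar>x - y\<bar> + (1 - cos_transform f (x - y)) / (2 * \<bar>x - y\<bar>)"
proof -
  have fi: "integrable lborel f" "(\<integral>v. f v \<partial>lborel) = 1" "\<And>v. 0 \<le> f v" using f by (auto simp: prob_density_fun_def)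
  note ci = integrable_cos_mult[OF fi(1)]
  define z where "z = \<bar>x - y\<bar>"
  have z: "z > 0" using xy by (simp add: z_def)
  have pt: "\<bar>cos (x * v) - cos (y * v)\<bar> \<le> z + (1 - cos ((x - y) * v)) / (2 * z)" for v
  proof -
    define S where "S = sin ((x - y) * v / 2)"
    have "cos (x * v) - cos (y * v) = 2 * sin ((x * v + y * v) / 2) * sin ((y * v - x * v) / 2)"
      by (rule cos_diff_cos)
    then have "\<bar>cos (x * v) - cos (y * v)\<bar> = 2 * \<bar>sin ((x * v + y * v) / 2)\<bar> * \<bar>sin ((y * v - x * v) / 2)\<bar>"
      by (simp add: abs_mult)
    also have "\<bar>sin ((y * v - x * v) / 2)\<bar> = \<bar>S\<bar>"
    proof -
      have "(y * v - x * v) / 2 = - ((x - y) * v / 2)" by (simp add: field_simps)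
      then show ?thesis by (simp only: S_def sin_minus abs_minus_cancel)
    qed
    also have "2 * \<bar>sin ((x * v + y * v) / 2)\<bar> * \<bar>S\<bar> \<le> 2 * 1 * \<bar>S\<bar>" by (intro mult_right_mono mult_left_mono) auto
    also have "\<dots> \<le> z + S\<^sup>2 / z"
    proof -
      have "0 \<le> (z - \<bar>S\<bar>)\<^sup>2" by simp
      then have "2 * \<bar>S\<bar> * z \<le> z * z + S\<^sup>2" by (simp add: power2_diff power2_eq_square[of z] algebra_simps)
      then show ?thesis using z by (simp add: field_simps)
    qed
    also have "S\<^sup>2 / z = (1 - cos ((x - y) * v)) / (2 * z)"
      using cos_double_sin[of "(x - y) * v / 2"] z by (simp add: S_def)
    finally show ?thesis .
  qed
  have "\<bar>cos_transform f x - cos_transform f y\<bar> = \<bar>\<integral>v. (cos (x * v) - cos (y * v)) * f v \<partial>lborel\<bar>"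
    unfolding cos_transform_def left_diff_distrib using ci by simp
  also have "\<dots> \<le> (\<integral>v. \<bar>(cos (x * v) - cos (y * v)) * f v\<bar> \<partial>lborel)" by (rule integral_abs_bound)
  also have "\<dots> \<le> (\<integral>v. z * f v + (f v - cos ((x - y) * v) * f v) / (2 * z) \<partial>lborel)"
  proof (rule integral_mono)
    have "integrable lborel (\<lambda>v. (cos (x * v) - cos (y * v)) * f v)" using ci by (simp add: left_diff_distrib)
    then show "integrable lborel (\<lambda>v. \<bar>(cos (x * v) - cos (y * v)) * f v\<bar>)" by (rule integrable_abs)
    show "integrable lborel (\<lambda>v. z * f v + (f v - cos ((x - y) * v) * f v) / (2 * z))" using fi ci by simp
    show "\<bar>(cos (x * v) - cos (y * v)) * f v\<bar> \<le> z * f v + (f v - cos ((x - y) * v) * f v) / (2 * z)" for v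
    proof -
      have "\<bar>(cos (x * v) - cos (y * v)) * f v\<bar> = \<bar>cos (x * v) - cos (y * v)\<bar> * f v" using fi(3)[of v] by (simp add: abs_mult)
      also have "\<dots> \<le> (z + (1 - cos ((x - y) * v)) / (2 * z)) * f v" by (rule mult_right_mono[OF pt fi(3)])
      also have "\<dots> = z * f v + (f v - cos ((x - y) * v) * f v) / (2 * z)" by (simp add: algebra_simps diff_divide_distrib)
      finally show ?thesis .
    qed
  qed
  also have "\<dots> = z + (1 - cos_transform f (x - y)) / (2 * z)"
    using fi ci unfolding cos_transform_def by simp
  finally show ?thesis by (simp add: z_def)
qed

section \<open>Convergence to equilibrium\<close>

locale kac_mild =
  fixes f0 :: "real \<Rightarrow> real" and F :: "real \<Rightarrow> real \<Rightarrow> real"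
  assumes f0: "prob_density_fun f0"
    and F_meas: "(\<lambda>z. F (fst z) (snd z)) \<in> borel_measurable borel2"
    and F_prob: "\<And>t. prob_density_fun (F t)"
    and F_0: "AE v in lborel. F 0 v = f0 v"
    and F_eq: "\<And>t. t \<ge> 0 \<Longrightarrow> AE v in lborel. ennreal (F t v) = ennreal (exp (- t) * f0 v) + mild (\<lambda>\<tau> v. ennreal (F \<tau> v)) t v"
begin

text \<open>\<open>G d t\<close> is the part of the solution in which every branch of the collision history up to
  time \<open>t\<close> has at least \<open>d\<close> collisions; its transform is \<open>iter \<psi> d t\<close>.\<close>

primrec G :: "nat \<Rightarrow> real \<Rightarrow> real \<Rightarrow> ennreal" where
  "G 0 = (\<lambda>t v. ennreal (F t v))"
| "G (Suc d) = mild (G d)"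

lemma F_nonneg: "0 \<le> F t v" and F_integrable: "integrable lborel (F t)" and F_integral: "(\<integral>v. F t v \<partial>lborel) = 1"
  using F_prob[of t] by (auto simp: prob_density_fun_def)

lemma F_measurable [measurable]: "F t \<in> borel_measurable borel"
  using F_integrable by (auto dest: borel_measurable_integrable)

lemma F_nn_integral: "(\<integral>\<^sup>+v. ennreal (F t v) \<partial>lborel) = 1"
  using F_integrable F_nonneg F_integral by (subst nn_integral_eq_integral) auto

lemma G_meas: "(\<lambda>z. G d (fst z) (snd z)) \<in> borel_measurable borel2"
proof (induction d)
  case 0 show ?case using F_meas by simp
next
  case (Suc d) then show ?case unfolding G.simps by (rule measurable_mild)
qed

lemma G_measurable [measurable]: "G d t \<in> borel_measurable borel"
  using measurable_compose[OF _ G_meas[of d], of "\<lambda>v. (t, v)" borel] by simp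

lemma G_le: "(\<integral>\<^sup>+v. G d t v \<partial>lborel) \<le> 1"
proof (induction d arbitrary: t)
  case 0 show ?case by (simp add: F_nn_integral)
next
  case (Suc d)
  show ?case unfolding G.simps
    by (rule mild_transform(2)[OF G_meas Suc.IH, where K="\<lambda>_. 0" and A="\<lambda>_. 0"]) auto
qed

definition \<psi> :: "real \<Rightarrow> real \<Rightarrow> real" where "\<psi> t = cos_transform (F t)"

lemma cosT_F: "cosT (G 0 t) \<xi> = \<psi> t \<xi>"
  unfolding cos_transform_def \<psi>_def
  by (rule transform_eq_integral[OF G_measurable G_le]) (auto simp: F_nonneg)

lemma cos_transform_F_0: "\<psi> 0 \<xi> = cos_transform f0 \<xi>"
proof -
  have [measurable]: "f0 \<in> borel_measurable borel" using f0 by (auto simp: prob_density_fun_def dest: borel_measurable_integrable)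
  show ?thesis unfolding cos_transform_def \<psi>_def by (rule integral_cong_AE) (use F_0 in \<open>auto elim: eventually_mono\<close>)
qed

text \<open>The mild equation is an identity of extended reals. It is integrated against the
  nonnegative 1 + cos and, with \<open>j\<close> equal to 0, against 1; subtracting the mass balance
  from the first result leaves the equation for the transforms.\<close>

lemma \<psi>_eq:
  assumes t: "t \<ge> 0" shows "\<psi> t \<xi> = exp (- t) * \<psi> 0 \<xi> + duhamel \<psi> t \<xi>"
proof -
  have [measurable]: "f0 \<in> borel_measurable borel" and f0n: "\<And>v. 0 \<le> f0 v" using f0 by (auto simp: prob_density_fun_def dest: borel_measurable_integrable)
  have f0_1: "(\<integral>\<^sup>+v. ennreal (f0 v) \<partial>lborel) = 1" using f0 by (subst nn_integral_eq_integral) (auto simp: prob_density_fun_def)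
  define k where "k = (\<lambda>v. cos (\<xi> * v))"
  have k: "k \<in> borel_measurable borel" "\<And>v. \<bar>k v\<bar> \<le> 1" by (auto simp: k_def)
  note [measurable] = k(1)
  have kp: "0 \<le> 1 + k v" for v using k(2)[of v] by linarith
  define m T where "m = mass (G 1 t)" and "T = cosT (G 1 t) \<xi>"
  have T: "T = transform k (G 1 t)" by (simp add: T_def k_def)
  have G1: "(\<integral>\<^sup>+v. ennreal (1 + k v) * G 1 t v \<partial>lborel) = ennreal (m + T)" "0 \<le> m + T"
    using nn_integral_shifted[OF G_measurable G_le k, of 1 t] abs_transform_le[OF G_measurable G_le k, of 1 t] by (auto simp: m_def T)
  have split: "(\<integral>\<^sup>+v. ennreal (1 + j v) * ennreal (F t v) \<partial>lborel) = ennreal (exp (- t)) * (\<integral>\<^sup>+v. ennreal (1 + j v) * ennreal (f0 v) \<partial>lborel) + (\<integral>\<^sup>+v. ennreal (1 + j v) * G 1 t v \<partial>lborel)"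
    if [measurable]: "j \<in> borel_measurable borel" for j :: "real \<Rightarrow> real"
  proof -
    have "(\<integral>\<^sup>+v. ennreal (1 + j v) * ennreal (F t v) \<partial>lborel) = (\<integral>\<^sup>+v. ennreal (exp (- t)) * (ennreal (1 + j v) * ennreal (f0 v)) + ennreal (1 + j v) * G 1 t v \<partial>lborel)"
      using F_eq[OF t] by (intro nn_integral_cong_AE) (auto elim!: eventually_mono simp: distrib_left ennreal_mult f0n mult_ac)
    also have "\<dots> = (\<integral>\<^sup>+v. ennreal (exp (- t)) * (ennreal (1 + j v) * ennreal (f0 v)) \<partial>lborel) + (\<integral>\<^sup>+v. ennreal (1 + j v) * G 1 t v \<partial>lborel)"
      by (rule nn_integral_add) (measurable, use G_measurable[of 1 t] in measurable)
    also have "(\<integral>\<^sup>+v. ennreal (exp (- t)) * (ennreal (1 + j v) * ennreal (f0 v)) \<partial>lborel) = ennreal (exp (- t)) * (\<integral>\<^sup>+v. ennreal (1 + j v) * ennreal (f0 v) \<partial>lborel)"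
      by (rule nn_integral_cmult) measurable
    finally show ?thesis .
  qed
  have dens: "(\<integral>\<^sup>+v. ennreal (1 + k v) * ennreal (g v) \<partial>lborel) = ennreal (1 + cos_transform g \<xi>)" if g: "prob_density_fun g" for g
  proof -
    have gm: "g \<in> borel_measurable borel" and g0: "\<And>v. 0 \<le> g v" and gi: "integrable lborel g" "(\<integral>v. g v \<partial>lborel) = 1"
      using g by (auto simp: prob_density_fun_def dest: borel_measurable_integrable)
    have "(\<integral>\<^sup>+v. ennreal (1 + k v) * ennreal (g v) \<partial>lborel) = (\<integral>\<^sup>+v. ennreal (g v + cos (\<xi> * v) * g v) \<partial>lborel)"
      using g0 kp by (intro nn_integral_cong) (simp add: ennreal_mult[symmetric] k_def distrib_right)
    also have "\<dots> = ennreal (\<integral>v. g v + cos (\<xi> * v) * g v \<partial>lborel)"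
    proof (rule nn_integral_eq_integral)
      show "AE v in lborel. 0 \<le> g v + cos (\<xi> * v) * g v"
        using mult_nonneg_nonneg[OF kp g0] by (simp add: k_def distrib_right)
    qed (use gi integrable_cos_mult[OF gi(1), of \<xi>] in auto)
    also have "(\<integral>v. g v + cos (\<xi> * v) * g v \<partial>lborel) = 1 + cos_transform g \<xi>"
      using gi integrable_cos_mult[OF gi(1), of \<xi>] by (simp add: cos_transform_def)
    finally show ?thesis .
  qed
  have np: "0 \<le> 1 + cos_transform g \<xi>" if "prob_density_fun g" for g
    using abs_cos_transform_le_1[OF that, of \<xi>] by linarith
  have "ennreal (1 + \<psi> t \<xi>) = ennreal (exp (- t)) * ennreal (1 + cos_transform f0 \<xi>) + ennreal (m + T)"
    using split[OF k(1)] unfolding dens[OF F_prob] dens[OF f0] G1(1) by (simp add: \<psi>_def)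
  also have "\<dots> = ennreal (exp (- t) * (1 + cos_transform f0 \<xi>) + (m + T))"
    using np[OF f0] G1(2) by (simp add: ennreal_mult ennreal_plus)
  finally have 1: "1 + \<psi> t \<xi> = exp (- t) * (1 + cos_transform f0 \<xi>) + (m + T)"
    using np[OF F_prob, of t] np[OF f0] G1(2) by (subst (asm) ennreal_inj) (auto simp: \<psi>_def)
  have "ennreal 1 = ennreal (exp (- t)) + ennreal m"
    using split[of "\<lambda>_. 0"] F_nn_integral[of t] f0_1 ennreal_mass[OF G_le, of 1 t] by (simp add: m_def)
  also have "\<dots> = ennreal (exp (- t) + m)" by (simp add: m_def ennreal_plus)
  finally have 2: "1 = exp (- t) + m" by (subst (asm) ennreal_inj) (auto simp: m_def)
  have "T = duhamel (\<lambda>t. cosT (G 0 t)) t \<xi>"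
    unfolding T_def One_nat_def G.simps(2) by (rule mild_cosT_sinT(1)[OF G_meas G_le])
  also have "(\<lambda>t. cosT (G 0 t)) = \<psi>" by (intro ext) (rule cosT_F)
  finally have 3: "T = duhamel \<psi> t \<xi>" .
  have "1 + \<psi> t \<xi> = exp (- t) * \<psi> 0 \<xi> + (exp (- t) + m) + T" unfolding 1 cos_transform_F_0 by (simp add: algebra_simps)
  then show ?thesis using 2 3 by simp
qed

text \<open>The first comparison is the mild equation with its nonnegative initial term dropped;
  monotonicity of \<open>mild\<close> passes it on.\<close>

lemma G_decreasing: "t \<ge> 0 \<Longrightarrow> AE v in lborel. G (Suc d) t v \<le> G d t v"
proof (induction d arbitrary: t)
  case 0
  show ?case using F_eq[OF 0] by eventually_elim simp
next
  case (Suc d)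
  have "mild (G (Suc d)) t v \<le> mild (G d) t v" for v by (rule mild_mono_AE) (rule Suc.IH)
  then show ?case by (simp only: G.simps) simp
qed

lemma G_le_F: "t \<ge> 0 \<Longrightarrow> AE v in lborel. G d t v \<le> ennreal (F t v)"
proof (induction d)
  case (Suc d)
  show ?case using Suc.IH[OF Suc.prems] G_decreasing[OF Suc.prems, of d] by eventually_elim (rule order_trans)
qed simp

text \<open>The mass of \<open>G (Suc d) t\<close> is \<open>g 0\<close>, so the missing mass is controlled by the same Fourier
  estimate as the difference itself.\<close>

lemma L1_estimate:
  assumes N: "prob_density_fun N" and t: "t \<ge> 0"
    and M: "\<And>\<xi>. char (distr_of N) \<xi> = complex_of_real (M \<xi>)" "M 0 = 1"
    and gd: "\<And>\<xi>. cosT (G (Suc d) t) \<xi> = g \<xi>"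
    and L1: "\<And>F1. prob_density_fun F1 \<Longrightarrow> char_close F1 N E \<Longrightarrow> (LBINT x. \<bar>F1 x - N x\<bar>) \<le> B"
    and g1: "\<And>\<xi>. \<bar>(g \<xi> - M \<xi>) + (1 - g 0) * M \<xi>\<bar> \<le> E * W (-1) \<xi>"
    and g2: "\<And>\<xi> \<eta>. \<bar>\<eta>\<bar> \<le> 1 \<Longrightarrow> \<bar>((g (\<xi> + \<eta>) - M (\<xi> + \<eta>)) + (1 - g 0) * M (\<xi> + \<eta>)) - ((g \<xi> - M \<xi>) + (1 - g 0) * M \<xi>)\<bar> \<le> \<bar>\<eta>\<bar> * (E * W (-3/8) \<xi>)"
  shows "(LBINT v. \<bar>F t v - N v\<bar>) \<le> B + 2 * (1 - g 0)"
proof -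
  define H where "H = G (Suc d) t"
  have H: "H \<in> borel_measurable borel" "(\<integral>\<^sup>+v. H v \<partial>lborel) \<le> 1" unfolding H_def by (rule G_measurable G_le)+
  note [measurable] = H(1)
  define m where "m = mass H"
  have Nn: "\<And>v. 0 \<le> N v" and Ni: "integrable lborel N" "(\<integral>v. N v \<partial>lborel) = 1" using N by (auto simp: prob_density_fun_def)
  have [measurable]: "N \<in> borel_measurable borel" using Ni by (auto dest: borel_measurable_integrable)
  define k where "k = (\<lambda>v. enn2real (H v))"
  have km[measurable]: "k \<in> borel_measurable borel" unfolding k_def by measurable
  have k0: "0 \<le> k v" for v by (simp add: k_def)
  have HF: "AE v in lborel. H v \<le> ennreal (F t v)" unfolding H_def by (rule G_le_F[OF t])
  have Hk: "AE v in lborel. H v = ennreal (k v)"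
    using HF by eventually_elim (auto simp: k_def intro!: ennreal_enn2real[symmetric] intro: le_less_trans)
  have kF: "AE v in lborel. k v \<le> F t v"
    using HF by eventually_elim (auto simp: k_def intro!: enn2real_leI F_nonneg)
  have m1: "m \<le> 1" and m0: "0 \<le> m" using mass_le_1[OF H(2)] by (auto simp: m_def)
  have kn: "(\<integral>\<^sup>+v. ennreal (k v) \<partial>lborel) = ennreal m"
    unfolding m_def ennreal_mass[OF H(2)] using Hk by (intro nn_integral_cong_AE) (auto elim: eventually_mono)
  have ki: "integrable lborel k" using kn k0 by (intro integrableI_nonneg) auto
  have kI: "(\<integral>v. k v \<partial>lborel) = m"
    using nn_integral_eq_integral[OF ki] k0 kn m0 by (simp add: integral_nonneg_AE)
  have tr: "transform K H = (\<integral>v. K v * k v \<partial>lborel)" if "K \<in> borel_measurable borel" "\<And>v. \<bar>K v\<bar> \<le> 1" for K :: "real \<Rightarrow> real"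
    by (rule transform_eq_integral[OF H that km k0 Hk])
  have gm: "g 0 = m"
    using tr[of "\<lambda>_. 1"] gd[of 0] kI by (simp add: H_def)
  \<comment> \<open>The missing mass is filled up with equilibrium to obtain a probability density,
    as required by the inversion theorem. In the transform this adds (1 - g 0) M, which is the
    correction in the hypotheses on g.\<close>
  define F1 where "F1 = (\<lambda>v. k v + (1 - m) * N v)"
  have F1: "prob_density_fun F1"
    unfolding prob_density_fun_def F1_def using k0 m1 Nn ki Ni kI by auto
  have charF1: "char (distr_of F1) \<xi> = complex_of_real (g \<xi> + (1 - m) * M \<xi>)" for \<xi>
  proof -
    have "cos_transform N \<xi> = M \<xi>" using Re_char_density[OF N, of \<xi>] M(1) by simp
    moreover have "(\<integral>v. cos (\<xi> * v) * k v \<partial>lborel) = g \<xi>" using tr[of "\<lambda>v. cos (\<xi> * v)"] gd by (simp add: H_def)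
    ultimately have "cos_transform F1 \<xi> = g \<xi> + (1 - m) * M \<xi>"
      using integrable_cos_mult[OF ki, of \<xi>] integrable_cos_mult[OF Ni(1), of \<xi>]
      by (simp add: cos_transform_def F1_def distrib_left mult.left_commute[of _ "1 - m"])
    moreover have "(\<integral>v. sin (\<xi> * v) * N v \<partial>lborel) = 0" using Im_char_density[OF N, of \<xi>] M(1) by simp
    \<comment> \<open>Here the index \<open>Suc d\<close> matters: the sine transform vanishes after
      at least one collision.\<close>
    moreover have "(\<integral>v. sin (\<xi> * v) * k v \<partial>lborel) = 0"
      using tr[of "\<lambda>v. sin (\<xi> * v)"] mild_cosT_sinT(2)[OF G_meas[of d] G_le, of \<xi> t] by (simp add: H_def)
    ultimately have "(\<integral>v. sin (\<xi> * v) * F1 v \<partial>lborel) = 0"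
      using integrable_sin_mult[OF ki, of \<xi>] integrable_sin_mult[OF Ni(1), of \<xi>]
      by (simp add: F1_def distrib_left mult.left_commute[of _ "1 - m"])
    with \<open>cos_transform F1 \<xi> = _\<close> show ?thesis
      by (simp only: complex_eq_iff Re_char_density[OF F1] Im_char_density[OF F1] Re_complex_of_real Im_complex_of_real)
  qed
  have w: "char (distr_of F1) \<xi> - char (distr_of N) \<xi> = complex_of_real ((g \<xi> - M \<xi>) + (1 - g 0) * M \<xi>)" for \<xi>
    unfolding charF1 M(1) gm by (simp add: algebra_simps)
  have "(LBINT x. \<bar>F1 x - N x\<bar>) \<le> B"
    using g1 g2 by (intro L1 F1) (simp only: char_close_def w of_real_diff[symmetric] norm_of_real, blast)
  \<comment> \<open>Triangle inequality through k and F1. Since k \<le> F almost everywhere, the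
    first and the last summand each integrate to the missing mass 1 - m.\<close>
  moreover have "(LBINT v. \<bar>F t v - N v\<bar>) \<le> (LBINT v. (F t v - k v) + \<bar>F1 v - N v\<bar> + (1 - m) * N v)"
  proof (rule integral_mono_AE')
    have "integrable lborel F1" using F1 by (simp add: prob_density_fun_def)
    then show "integrable lborel (\<lambda>v. (F t v - k v) + \<bar>F1 v - N v\<bar> + (1 - m) * N v)" using F_integrable ki Ni by simp
    show "AE v in lborel. \<bar>F t v - N v\<bar> \<le> (F t v - k v) + \<bar>F1 v - N v\<bar> + (1 - m) * N v"
      using kF
    proof eventually_elim
      case (elim v)
      have "0 \<le> (1 - m) * N v" using m1 Nn by simp
      moreover have "F1 v = k v + (1 - m) * N v" by (simp add: F1_def)
      ultimately show ?case using elim by linarith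
    qed
    show "AE v in lborel. 0 \<le> (F t v - k v) + \<bar>F1 v - N v\<bar> + (1 - m) * N v"
      using kF
    proof eventually_elim
      case (elim v)
      have "0 \<le> (1 - m) * N v" using m1 Nn by simp
      then show ?case using elim by linarith
    qed
  qed
  moreover have "(LBINT v. (F t v - k v) + \<bar>F1 v - N v\<bar> + (1 - m) * N v) = (1 - m) + (LBINT v. \<bar>F1 v - N v\<bar>) + (1 - m)"
  proof -
    have "integrable lborel F1" using F1 by (simp add: prob_density_fun_def)
    then show ?thesis using F_integrable ki Ni kI F_integral by simp
  qed
  moreover have "a \<le> B \<Longrightarrow> x \<le> y \<Longrightarrow> y = (1 - m) + a + (1 - m) \<Longrightarrow> x \<le> B + 2 * (1 - m)" for a x y :: real
    by simp
  ultimately show ?thesis unfolding gm by blast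
qed

end

text \<open>The constant is built from the datum before a solution is chosen: all solutions have
  admissible transforms for the same q, s, \<sigma>, D.\<close>

theorem theorem2p3:
  fixes f0 :: "real \<Rightarrow> real" and \<sigma> :: real and chi :: nat and \<delta> p :: real
  assumes "prob_density_fun f0"
    and "\<sigma> = sqrt (LBINT v. v\<^sup>2 * f0 v)"
    and "chi > 2" and "0 \<le> \<delta>" and "\<delta> < 2"
    and "integrable lborel (\<lambda>v. \<bar>v\<bar> powr (2 * real chi + \<delta>) * f0 v)"
    and "\<forall>m\<in>{2..chi}. cumulant (distr_of (symmetrization f0)) (2 * m) = 0"
    and "p > 0"
    and "(\<lambda>\<xi>. char (distr_of f0) \<xi>) \<in> o[at_infinity](\<lambda>\<xi>. complex_of_real (\<bar>\<xi>\<bar> powr (- p)))"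
  shows "\<exists>C>0. \<forall>f. kac_solution f0 f \<longrightarrow>
           (\<forall>t\<ge>0. (LBINT v. \<bar>f v t - normal_density 0 \<sigma> v\<bar>)
                    \<le> C * exp (- (1 - 2 * kac_alpha (2 * real chi + \<delta>)) * t))"
proof -
  interpret I: kac_initial f0 \<sigma> \<delta> chi
    using assms by unfold_locales auto
  obtain q where q: "q > 0" "q \<le> 1/4" "\<And>\<xi>. \<bar>cos_transform f0 \<xi>\<bar> \<le> W (- q) \<xi>"
    using cos_transform_decay[OF assms(1,8,9)] by blast
  obtain D where D: "D \<ge> 0" "\<And>x y m. \<bar>x\<bar> \<le> m \<Longrightarrow> \<bar>y\<bar> \<le> m \<Longrightarrow>
     \<bar>(cos_transform f0 x - exp (- (\<sigma>\<^sup>2 * x\<^sup>2 / 2))) - (cos_transform f0 y - exp (- (\<sigma>\<^sup>2 * y\<^sup>2 / 2)))\<bar> \<le> D * \<bar>x - y\<bar> * m powr (I.s - 1)"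
    using I.initial_lip by blast
  interpret K: kac_fourier q I.s \<sigma> D
    using q D I.sigma_pos assms(3,4) by unfold_locales (auto simp: I.s_def)
  obtain d C where dC: "d \<ge> 1" "C \<ge> 0" "\<And>\<psi> t \<xi>. K.admissible \<psi> \<Longrightarrow> t \<ge> 0 \<Longrightarrow> \<bar>K.iter \<psi> d t \<xi> - K.M \<xi>\<bar> \<le> exp (- K.r * t) * C * W (-1) \<xi>"
    "\<And>\<psi> t \<xi> \<eta>. K.admissible \<psi> \<Longrightarrow> t \<ge> 0 \<Longrightarrow> \<bar>\<eta>\<bar> \<le> 1 \<Longrightarrow> \<bar>(K.iter \<psi> d t (\<xi> + \<eta>) - K.M (\<xi> + \<eta>)) - (K.iter \<psi> d t \<xi> - K.M \<xi>)\<bar> \<le> \<bar>\<eta>\<bar> * (exp (- K.r * t) * C * W (-3/8) \<xi>)"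
    using K.iter_approx by metis
  \<comment> \<open>\<open>L1_estimate\<close> speaks of at least one collision.\<close>
  obtain d' where d': "d = Suc d'" using dC(1) by (cases d) auto
  obtain C1 where C1: "C1 \<ge> 0" "\<And>\<xi>. K.M \<xi> \<le> C1 * W (-1) \<xi>" using K.M_decay[of 1] by auto
  obtain C2 where C2: "C2 \<ge> 0" "\<And>x \<eta>. \<bar>\<eta>\<bar> \<le> 1 \<Longrightarrow> \<bar>K.M (x + \<eta>) - K.M x\<bar> \<le> \<bar>\<eta>\<bar> * (C2 * W (-3/8) x)"
    using K.M_diff_decay by blast
  obtain K1 where K1: "K1 > 0" "\<And>F N E. prob_density_fun F \<Longrightarrow> prob_density_fun N \<Longrightarrow> E > 0 \<Longrightarrow>
     char_close F N E \<Longrightarrow> (LBINT x. \<bar>F x - N x\<bar>) \<le> K1 * E"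
    by (rule L1_bound) blast
  \<comment> \<open>The summands in the bracket account for the difference itself, for the filled up
    mass times M, and for the increment of the latter. The final 1 makes the scale E = e C0
    positive, as \<open>L1_bound\<close> demands.\<close>
  define C0 where "C0 = C * (1 + C1 + C2) + 1"
  have C0: "C0 > 0" using dC(2) C1 C2 by (auto simp: C0_def intro!: add_nonneg_pos mult_nonneg_nonneg)
  have rate: "- (1 - 2 * kac_alpha (2 * real chi + \<delta>)) = - K.r"
    unfolding K.r_def unfolding I.s_def kac_alpha_eq by simp
  show ?thesis unfolding rate
  \<comment> \<open>\<open>K1 * C0\<close> bounds the distance of the filled up part to the
    Gaussian, and 2 C covers twice the missing mass.\<close>
  proof (intro exI[of _ "K1 * C0 + 2 * C"] conjI allI impI)
    show "K1 * C0 + 2 * C > 0" using K1(1) C0 dC(2) by (simp add: add_pos_nonneg)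
    fix f t assume sol: "kac_solution f0 f" and t: "(t::real) \<ge> 0"
    obtain F where F: "(\<lambda>z. F (fst z) (snd z)) \<in> borel_measurable borel2" "\<And>t. prob_density_fun (F t)"
      "\<And>t. t \<ge> 0 \<Longrightarrow> AE v in lborel. F t v = f v t"
      "\<And>t. t \<ge> 0 \<Longrightarrow> AE v in lborel. ennreal (F t v) = ennreal (exp (- t) * f0 v) + mild (\<lambda>\<tau> v. ennreal (F \<tau> v)) t v"
      using solution_mild[OF assms(1) sol] by blast
    have "AE v in lborel. f v 0 = f0 v" using sol by (auto simp: kac_solution_def)
    then have F0: "AE v in lborel. F 0 v = f0 v" using F(3)[OF order_refl] by eventually_elim simp
    interpret S: kac_mild f0 F
      by unfold_locales (use assms(1) F F0 in auto)
    have S0: "S.\<psi> 0 = cos_transform f0" by (rule ext) (rule S.cos_transform_F_0)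
    have adm: "K.admissible S.\<psi>"
      unfolding K.admissible_def
    proof (intro conjI allI impI)
      show "(\<lambda>z. S.\<psi> (fst z) (snd z)) \<in> borel_measurable borel2"
        using measurable_transform[OF S.G_meas[of 0], of cos] unfolding S.cosT_F by simp
      show "\<bar>S.\<psi> t \<xi>\<bar> \<le> 1" for t \<xi> unfolding S.\<psi>_def by (rule abs_cos_transform_le_1[OF F(2)])
      show "S.\<psi> t \<xi> = exp (- t) * S.\<psi> 0 \<xi> + duhamel S.\<psi> t \<xi>" if "0 \<le> t" for t \<xi> by (rule S.\<psi>_eq[OF that])
      show "\<bar>S.\<psi> t x - S.\<psi> t y\<bar> \<le> \<bar>x - y\<bar> + (1 - S.\<psi> t (x - y)) / (2 * \<bar>x - y\<bar>)" if "x \<noteq> y" for t x y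
        unfolding S.\<psi>_def by (rule cos_transform_incr[OF F(2) that])
      show "S.\<psi> 0 0 = 1" unfolding S0 by (rule cos_transform_0[OF assms(1)])
      show "\<bar>S.\<psi> 0 \<xi>\<bar> \<le> W (- q) \<xi>" for \<xi> unfolding S0 by (rule q(3))
      show "1 - S.\<psi> 0 \<xi> \<le> \<sigma>\<^sup>2 * \<xi>\<^sup>2 / 2" for \<xi> unfolding S0 by (rule I.initial_quadratic)
      show "\<bar>(S.\<psi> 0 x - K.M x) - (S.\<psi> 0 y - K.M y)\<bar> \<le> D * \<bar>x - y\<bar> * m powr (I.s - 1)" if "\<bar>x\<bar> \<le> m" "\<bar>y\<bar> \<le> m" for x y m
        unfolding S0 K.M_def by (rule D(2)[OF that])
    qed
    have tr: "(\<lambda>t. cosT (S.G n t)) = K.iter S.\<psi> n" for n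
    proof (induction n)
      case 0 show ?case unfolding S.cosT_F by simp
    next
      case (Suc n)
      have "cosT (S.G (Suc n) t) \<xi> = duhamel (\<lambda>t. cosT (S.G n t)) t \<xi>" for t \<xi>
        unfolding S.G.simps by (rule mild_cosT_sinT(1)[OF S.G_meas S.G_le])
      then show ?case unfolding Suc K.iter.simps by (simp add: fun_eq_iff)
    qed
    define g where "g = K.iter S.\<psi> d t"
    define e where "e = exp (- K.r * t)"
    have e: "e > 0" by (simp add: e_def)
    have u: "\<bar>g \<xi> - K.M \<xi>\<bar> \<le> e * C * W (-1) \<xi>" for \<xi> unfolding g_def e_def by (rule dC(3)[OF adm t])
    have du: "\<bar>(g (\<xi> + \<eta>) - K.M (\<xi> + \<eta>)) - (g \<xi> - K.M \<xi>)\<bar> \<le> \<bar>\<eta>\<bar> * (e * C * W (-3/8) \<xi>)" if "\<bar>\<eta>\<bar> \<le> 1" for \<xi> \<eta>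
      unfolding g_def e_def by (rule dC(4)[OF adm t that])
    \<comment> \<open>At \<xi> = 0, where M and W are 1, the estimate of the difference is an
      estimate of the missing mass.\<close>
    have g0: "\<bar>1 - g 0\<bar> \<le> e * C" using u[of 0] by (simp add: K.M_0 W_def abs_minus_commute)
    have eC: "0 \<le> e * C" using e dC(2) by simp
    have "(LBINT v. \<bar>F t v - normal_density 0 \<sigma> v\<bar>) \<le> K1 * (e * C0) + 2 * (1 - g 0)"
    proof (rule S.L1_estimate[OF prob_density_normal[OF I.sigma_pos] t, where M=K.M and d=d' and E="e * C0"])
      show "char (distr_of (normal_density 0 \<sigma>)) \<xi> = complex_of_real (K.M \<xi>)" for \<xi>
        unfolding K.M_def by (rule char_normal[OF I.sigma_pos])
      show "K.M 0 = 1" by (rule K.M_0)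
      show "cosT (S.G (Suc d') t) \<xi> = g \<xi>" for \<xi> using fun_cong[OF fun_cong[OF tr[of d], of t], of \<xi>] by (simp add: g_def d')
      show "(LBINT x. \<bar>F1 x - normal_density 0 \<sigma> x\<bar>) \<le> K1 * (e * C0)"
        if "prob_density_fun F1" "char_close F1 (normal_density 0 \<sigma>) (e * C0)" for F1
        using e C0 by (intro K1(2)[OF that(1) prob_density_normal[OF I.sigma_pos] _ that(2)]) auto
    next
      fix \<xi>
      have "\<bar>(g \<xi> - K.M \<xi>) + (1 - g 0) * K.M \<xi>\<bar> \<le> \<bar>g \<xi> - K.M \<xi>\<bar> + \<bar>1 - g 0\<bar> * K.M \<xi>"
        using abs_triangle_ineq[of "g \<xi> - K.M \<xi>" "(1 - g 0) * K.M \<xi>"] K.M_pos[of \<xi>] by (simp add: abs_mult)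
      also have "\<dots> \<le> e * C * W (-1) \<xi> + e * C * (C1 * W (-1) \<xi>)"
        using K.M_pos[of \<xi>] eC by (intro add_mono mult_mono u g0 C1) auto
      also have "\<dots> = e * (C * (1 + C1)) * W (-1) \<xi>" by (simp add: algebra_simps)
      also have "\<dots> \<le> e * C0 * W (-1) \<xi>"
        using e dC(2) C1 C2 by (intro mult_right_mono mult_left_mono) (auto simp: C0_def distrib_left)
      finally show "\<bar>(g \<xi> - K.M \<xi>) + (1 - g 0) * K.M \<xi>\<bar> \<le> e * C0 * W (-1) \<xi>" .
      fix \<eta> :: real assume h: "\<bar>\<eta>\<bar> \<le> 1"
      have "((g (\<xi> + \<eta>) - K.M (\<xi> + \<eta>)) + (1 - g 0) * K.M (\<xi> + \<eta>)) - ((g \<xi> - K.M \<xi>) + (1 - g 0) * K.M \<xi>)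
        = ((g (\<xi> + \<eta>) - K.M (\<xi> + \<eta>)) - (g \<xi> - K.M \<xi>)) + (1 - g 0) * (K.M (\<xi> + \<eta>) - K.M \<xi>)" by (simp add: algebra_simps)
      also have "\<bar>\<dots>\<bar> \<le> \<bar>(g (\<xi> + \<eta>) - K.M (\<xi> + \<eta>)) - (g \<xi> - K.M \<xi>)\<bar> + \<bar>1 - g 0\<bar> * \<bar>K.M (\<xi> + \<eta>) - K.M \<xi>\<bar>"
        by (rule order_trans[OF abs_triangle_ineq]) (simp add: abs_mult)
      also have "\<dots> \<le> \<bar>\<eta>\<bar> * (e * C * W (-3/8) \<xi>) + e * C * (\<bar>\<eta>\<bar> * (C2 * W (-3/8) \<xi>))"
        using eC by (intro add_mono mult_mono du g0 C2 h) auto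
      also have "\<dots> = \<bar>\<eta>\<bar> * (e * (C * (1 + C2)) * W (-3/8) \<xi>)" by (simp add: algebra_simps)
      also have "\<dots> \<le> \<bar>\<eta>\<bar> * (e * C0 * W (-3/8) \<xi>)"
        using e dC(2) C1 C2 by (intro mult_right_mono mult_left_mono) (auto simp: C0_def distrib_left)
      finally show "\<bar>((g (\<xi> + \<eta>) - K.M (\<xi> + \<eta>)) + (1 - g 0) * K.M (\<xi> + \<eta>)) - ((g \<xi> - K.M \<xi>) + (1 - g 0) * K.M \<xi>)\<bar> \<le> \<bar>\<eta>\<bar> * (e * C0 * W (-3/8) \<xi>)" .
    qed
    moreover have "(LBINT v. \<bar>f v t - normal_density 0 \<sigma> v\<bar>) = (LBINT v. \<bar>F t v - normal_density 0 \<sigma> v\<bar>)"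
    proof (rule integral_cong_AE)
      have "prob_density_fun (\<lambda>v. f v t)" using sol t by (simp add: kac_solution_def)
      then have [measurable]: "(\<lambda>v. f v t) \<in> borel_measurable borel" by (auto simp: prob_density_fun_def dest: borel_measurable_integrable)
      show "(\<lambda>v. \<bar>f v t - normal_density 0 \<sigma> v\<bar>) \<in> borel_measurable lborel" by measurable
      show "AE v in lborel. \<bar>f v t - normal_density 0 \<sigma> v\<bar> = \<bar>F t v - normal_density 0 \<sigma> v\<bar>"
        using F(3)[OF t] by eventually_elim simp
    qed measurable
    moreover have "2 * (1 - g 0) \<le> 2 * (e * C)" using abs_le_D1[OF g0] by (intro mult_left_mono) auto
    ultimately show "(LBINT v. \<bar>f v t - normal_density 0 \<sigma> v\<bar>) \<le> (K1 * C0 + 2 * C) * exp (- K.r * t)"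
      unfolding e_def[symmetric] by (simp add: algebra_simps)
  qed
qed

end
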